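(* Let $v\in BV(\Omega_1,w)$ be nonnegative. Then $T(v)\in BV(\Omega_1,w)$ and $$\|\nabla v\|_{BV,w}\ \ge\ \|\nabla T(v)\|_{BV,w}.$$
   Context: Points of $\mathbb R^N$ ($N\ge2$) are written $x=(x',y)$ with $x'=(x_1,\dots,x_{N-1})$, $y=x_N$. Let $\Omega'\subset\mathbb R^{N-1}$ be a bounded domain with Lipschitz boundary, $\alpha,\alpha_1\in(0,+\infty]$, $I=(0,\alpha)$, $I_1=(0,\alpha_1)$, $\Omega=\Omega'\times I$, $\Omega_1=\Omega'\times I_1$. Closures are taken in Euclidean space. Weight: $w\in C(\overline{I_1})$, $w(y)>0$ for all $y\in I_1$, $W(y):=\int_0^y w(t)\,dt$ for $y\in\overline{I_1}$, and $\alpha=\lim_{y\to\alpha_1}W(y)$. The function $f(z):=w(W^{-1}(z))$ is assumed to belong to $C(\overline I)$ (with continuous extension to $z=\alpha$ if $\alpha<+\infty=\alpha_1$) and to satisfy: $f(z_2-z_1)\le f(z_1)+f(z_2)$ whenever $z_1,z_2\in\overline I$, $z_1\le z_2$; and, if $\alpha<+\infty$, also $f(z)=f(\alpha-z)$ for all $z\in\overline I$. Rearrangement: for a measurable $M\subset I$ of finite measure put $M^*:=(0,|M|)$. For a nonnegative measurable function $v$ on $\Omega_1$ set $u(x',z):=v(x',W^{-1}(z))$ for $(x',z)\in\Omega$, let $$u^*(x',z):=\sup\{c>0:\ z\in\{u(x',\cdot)>c\}^*\}\quad(\sup\emptyset=0),$$ and define the $w$-rearrangement in direction $y$ by $T(v)(x',y):=u^*(x',W(y))$,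 $(x',y)\in\Omega_1$. This is defined for every $x'$ such that $|\{z\in I:u(x',z)>c\}|<+\infty$ for all $c>0$, which for nonnegative $v\in L^1(\Omega_1,w)$ is the case for a.e. $x'\in\Omega'$. Spaces: $L^1(\Omega_1,w)$ is the space of measurable $v:\Omega_1\to\mathbb R$ with $\|v\|_{1,w}:=\int_{\Omega_1}|v|\,w\,dx<+\infty$ (with $w=w(y)$). For $v\in L^1(\Omega_1,w)$, $$\|\nabla v\|_{BV,w}:=\sup\left\{\int_{\Omega_1}v\,\mathrm{div}\,\varphi\,dx:\ \varphi\in C^1_0(\Omega_1,\mathbb R^N),\ |\varphi|\le w\right\},$$ where $C^1_0$ means $C^1$ with compact support. $BV(\Omega_1,w)$ is the set of $v\in L^1(\Omega_1,w)$ with $\|v\|_{1,w}+\|\nabla v\|_{BV,w}<+\infty$. *)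

theory Defs
  imports "HOL-Analysis.Analysis"
begin

text \<open>
  A point \<open>x = (x', y)\<close> of \<open>\<real>\<^sup>N\<close>, \<open>N \<ge> 2\<close>, is an element of \<open>(real ^ 'n) \<times> real\<close> with
  \<open>CARD('n) = N - 1\<close>; norm, inner product and Lebesgue measure of the product type are the Euclidean
  ones. The intervals \<open>(0, \<alpha>)\<close> with \<open>\<alpha> \<in> (0, \<infinity>]\<close> are \<open>einterval 0 \<alpha>\<close>, which is a set of reals.
  Functions on a set are total functions whose values elsewhere play no role.
\<close>

text \<open>
  Near each boundary point the set is the strict epigraph, in some unit direction \<open>e\<close>, of a
  Lipschitz function \<open>g\<close> on the hyperplane orthogonal to \<open>e\<close>.
\<close>
definition lipschitz_boundary :: "'a::euclidean_space set \<Rightarrow> bool" where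
  "lipschitz_boundary S \<longleftrightarrow>
    (\<forall>p\<in>frontier S. \<exists>e r g L. norm e = 1 \<and> r > 0 \<and> L-lipschitz_on {z. z \<bullet> e = 0} g \<and>
       S \<inter> ball p r = {x \<in> ball p r. g (x - (x \<bullet> e) *\<^sub>R e) < x \<bullet> e})"

definition bounded_lipschitz_domain :: "'a::euclidean_space set \<Rightarrow> bool" where
  "bounded_lipschitz_domain S \<longleftrightarrow>
     open S \<and> connected S \<and> S \<noteq> {} \<and> bounded S \<and> lipschitz_boundary S"

definition weight_primitive :: "(real \<Rightarrow> real) \<Rightarrow> real \<Rightarrow> real" where
  "weight_primitive w y = integral {0..y} w"

definition weight_primitive_inv :: "ereal \<Rightarrow> (real \<Rightarrow> real) \<Rightarrow> real \<Rightarrow> real" where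
  "weight_primitive_inv \<alpha>1 w = the_inv_into (closure (einterval 0 \<alpha>1)) (weight_primitive w)"

definition set_rearrangement :: "real set \<Rightarrow> real set" where
  "set_rearrangement M = {0<..<measure lebesgue M}"

text \<open>
  The rearrangement \<open>u\<^sup>*\<close> in the last variable, on \<open>(0, \<alpha>)\<close>. It is meaningful only for those \<open>x'\<close>
  whose superlevel sets are all measurable of finite measure; for the remaining \<open>x'\<close>, a null set
  in the case of integrable functions, it is set to \<open>0\<close>. The supremum of the empty set of levels is \<open>0\<close>.
\<close>
definition rearrangement :: "ereal \<Rightarrow> ('a \<times> real \<Rightarrow> real) \<Rightarrow> 'a \<times> real \<Rightarrow> real" where
  "rearrangement \<alpha> u = (\<lambda>(x', z).
     let superlevel = (\<lambda>c. {s \<in> einterval 0 \<alpha>. u (x', s) > c});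
         levels = {c. c > 0 \<and> z \<in> set_rearrangement (superlevel c)}
     in if (\<forall>c>0. superlevel c \<in> lmeasurable) \<and> levels \<noteq> {} then Sup levels else 0)"

definition w_rearrangement ::
    "ereal \<Rightarrow> ereal \<Rightarrow> (real \<Rightarrow> real) \<Rightarrow> ('a \<times> real \<Rightarrow> real) \<Rightarrow> 'a \<times> real \<Rightarrow> real" where
  "w_rearrangement \<alpha> \<alpha>1 w v = (\<lambda>(x', y).
     rearrangement \<alpha> (\<lambda>(x', z). v (x', weight_primitive_inv \<alpha>1 w z)) (x', weight_primitive w y))"

definition L1_norm_w ::
    "('a::euclidean_space \<times> real) set \<Rightarrow> (real \<Rightarrow> real) \<Rightarrow> ('a \<times> real \<Rightarrow> real) \<Rightarrow> ereal" where
  "L1_norm_w S w v = enn2ereal (\<integral>\<^sup>+ x. ennreal (\<bar>v x\<bar> * w (snd x)) \<partial>lebesgue_on S)"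

definition L1_w ::
    "('a::euclidean_space \<times> real) set \<Rightarrow> (real \<Rightarrow> real) \<Rightarrow> ('a \<times> real \<Rightarrow> real) set" where
  "L1_w S w = {v \<in> borel_measurable (lebesgue_on S). L1_norm_w S w v < \<infinity>}"

text \<open>
  \<open>C\<^sup>1\<close> vector fields with compact support in the open set \<open>S\<close>, extended by \<open>0\<close> to the whole space.
\<close>
definition C1_compact_support :: "'a::euclidean_space set \<Rightarrow> ('a \<Rightarrow> 'a) set" where
  "C1_compact_support S = {\<phi>.
     (\<exists>\<phi>' :: 'a \<Rightarrow> 'a \<Rightarrow>\<^sub>L 'a.
        (\<forall>x. (\<phi> has_derivative blinfun_apply (\<phi>' x)) (at x)) \<and> continuous_on UNIV \<phi>') \<and>
     compact (closure {x. \<phi> x \<noteq> 0}) \<and> closure {x. \<phi> x \<noteq> 0} \<subseteq> S}"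

definition divergence :: "('a::euclidean_space \<Rightarrow> 'a) \<Rightarrow> 'a \<Rightarrow> real" where
  "divergence \<phi> x = (\<Sum>b\<in>Basis. frechet_derivative \<phi> (at x) b \<bullet> b)"

definition BV_seminorm_w ::
    "('a::euclidean_space \<times> real) set \<Rightarrow> (real \<Rightarrow> real) \<Rightarrow> ('a \<times> real \<Rightarrow> real) \<Rightarrow> ereal" where
  "BV_seminorm_w S w v =
     (SUP \<phi> \<in> {\<phi> \<in> C1_compact_support S. \<forall>x\<in>S. norm (\<phi> x) \<le> w (snd x)}.
        ereal (\<integral>x. v x * divergence \<phi> x \<partial>lebesgue_on S))"

definition BV_w ::
    "('a::euclidean_space \<times> real) set \<Rightarrow> (real \<Rightarrow> real) \<Rightarrow> ('a \<times> real \<Rightarrow> real) set" where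
  "BV_w S w = {v \<in> L1_w S w. L1_norm_w S w v + BV_seminorm_w S w v < \<infinity>}"

end

theory Submission
  imports Defs
begin

text \<open>
  Everything is done in the variable \<open>y\<close>, with the measure \<open>mu = w dy\<close> on \<open>I1\<close>, whose distribution function is
  \<open>W\<close>. For a nonnegative \<open>v\<close> and a level \<open>c > 0\<close> let \<open>m(x, c)\<close> be the \<open>mu\<close>-measure of \<open>{y. v(x, y) > c}\<close>
  (\<open>lev v\<close> below). A point \<open>(x, y)\<close> has \<open>T v(x, y) > c\<close> exactly if \<open>W y < m(x, c)\<close>, so \<open>T v\<close> is determined by \<open>m\<close>,
  and the variations of \<open>v\<close> and of \<open>T v\<close> are compared by means of the functional
  \<open>J(\<Phi>) = \<integral> (m hdiv \<Phi> + \<Phi>_N f(m)) d(x, c)\<close>, where \<open>\<Phi>\<close> is a \<open>C1\<close> field on \<open>\<Omega>' \<times> (0, \<infinity>)\<close> with \<open>|\<Phi>| \<le> 1\<close>,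
  \<open>\<Phi>_N \<ge> 0\<close> is its last component and \<open>hdiv\<close> is the divergence in \<open>x\<close> only.

  First, \<open>J(\<Phi>)\<close> is at most the variation of \<open>v\<close> (\<open>level_inequality\<close>). If \<open>v\<close> is smooth, write
  \<open>\<Phi> = (a, b)\<close> and test \<open>v\<close> with the field \<open>w(y) (a(x, v), - b(x, v) sgn(v_y))\<close>, whose norm is at most \<open>w\<close>.
  The horizontal part becomes \<open>\<integral> m hdiv \<Phi>\<close>, by the divergence theorem on the subgraph of \<open>v(\<cdot>, y)\<close> and integration over
  \<open>y\<close>. The vertical part is \<open>\<integral> w b(x, v) |v_y|\<close>; by the one-dimensional coarea formula it is
  the integral over \<open>c\<close> of \<open>b(x, c)\<close> times the weighted number of boundary points of \<open>{v(x, \<cdot>) > c}\<close>, and this weighted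
  number is at least \<open>f(m(x, c))\<close>. The last statement is a one-dimensional isoperimetric inequality
  (\<open>grid_isoperimetric\<close>): among the subsets of \<open>I1\<close> of measure \<open>s\<close> the initial interval has the least weighted
  boundary \<open>f(s)\<close>. It follows from \<open>f(z2 - z1) \<le> f(z1) + f(z2)\<close> and the symmetry of \<open>f\<close> by adding one interval after
  the other.

  Second, the variation of \<open>T v\<close> is at most the supremum of \<open>J\<close> (\<open>rearranged_test_bound\<close>). Let \<open>\<phi>\<close> be a
  test field with \<open>|\<phi>| \<le> w\<close> and let \<open>Y\<close> be the inverse of \<open>W\<close>. By Fubini,
  \<open>\<integral> T v div \<phi> = \<integral> (Q(x, m) + \<phi>_N(x, Y m)) d(x, c)\<close> with \<open>Q(x, s) = \<integral>_{W t < s} hdiv \<phi>(x, t) dt\<close>. For smooth \<open>m\<close>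
  the divergence theorem on the subgraph of \<open>Y m\<close>, with \<open>Y' = 1 / w(Y)\<close>, turns \<open>\<integral> Q(x, m)\<close> into
  \<open>\<integral> m hdiv \<Phi>\<close> for \<open>\<Phi>(x, c) = (\<phi>', |\<phi>_N|)(x, Y m) / w(Y m)\<close>. Since \<open>f(m) = w(Y m)\<close>, the second
  term is at most \<open>\<Phi>_N f(m)\<close>, so the whole is at most \<open>J(\<Phi>)\<close>.

  In general, neither \<open>v\<close> nor \<open>m\<close> is differentiable, but it is enough to mollify the
  test fields. A bounded measurable field \<open>g\<close> with compact support becomes a \<open>C1\<close> field \<open>\<eta> * g\<close>, and
  \<open>\<integral> v div(\<eta> * g) = - \<integral> \<nabla>(\<eta> * v) \<cdot> g\<close>. Hence the smooth function \<open>\<eta> * v\<close> may be tested with every measurable field,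
  such as the one with a sign above, and its variation is controlled by that of \<open>v\<close>. The coarea formula is replaced by
  sampling the smooth function on a fine grid in \<open>y\<close>, so that all superlevel sets are finite unions of grid cells.
  As the empty set and \<open>I1\<close> have no boundary in \<open>I1\<close> while \<open>f(0)\<close> and \<open>f(\<alpha>)\<close> may be positive, \<open>f\<close> is
  replaced by a uniformly continuous \<open>\<theta> \<le> f\<close> that vanishes at \<open>0\<close> and at \<open>\<alpha>\<close>. If \<open>\<alpha> = \<infinity>\<close>, then \<open>v\<close> is
  first cut off at large \<open>y\<close>.
\<close>

section \<open>Mollification on Euclidean spaces\<close>

lemma lborel_distr_reflect:
  fixes c :: "'a::euclidean_space"
  shows "distr lborel borel (\<lambda>x. c - x) = lborel"
  using lborel_affine[of "-1" c] by (simp add: density_1 one_ennreal_def[symmetric])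

lemma lborel_distr_translate:
  fixes c :: "'a::euclidean_space"
  shows "distr lborel borel (\<lambda>x. x + c) = lborel"
  using lborel_distr_plus[of c] by (subst add.commute) auto

lemma integral_lborel_translate:
  fixes c :: "'a::euclidean_space" and f :: "'a \<Rightarrow> 'b::{banach,second_countable_topology}"
  assumes "f \<in> borel_measurable borel"
  shows "(\<integral>x. f (x + c) \<partial>lborel) = (\<integral>x. f x \<partial>lborel)"
  using integral_distr[of "\<lambda>x. x + c" lborel borel f] assms
  by (simp add: lborel_distr_translate)

lemma integral_lborel_reflect:
  fixes c :: "'a::euclidean_space" and f :: "'a \<Rightarrow> 'b::{banach,second_countable_topology}"
  assumes "f \<in> borel_measurable borel"
  shows "(\<integral>x. f (c - x) \<partial>lborel) = (\<integral>x. f x \<partial>lborel)"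
  using integral_distr[of "\<lambda>x. c - x" lborel borel f] assms
  by (simp add: lborel_distr_reflect)

lemma integrable_lborel_translate:
  fixes c :: "'a::euclidean_space" and f :: "'a \<Rightarrow> 'b::{banach,second_countable_topology}"
  assumes "integrable lborel f"
  shows "integrable lborel (\<lambda>x. f (x + c))"
  using integrable_distr_eq[of "\<lambda>x. x + c" lborel borel f] assms
    borel_measurable_integrable[OF assms]
  by (simp add: lborel_distr_translate)

lemma integrable_lborel_reflect:
  fixes c :: "'a::euclidean_space" and f :: "'a \<Rightarrow> 'b::{banach,second_countable_topology}"
  assumes "integrable lborel f"
  shows "integrable lborel (\<lambda>x. f (c - x))"
  using integrable_distr_eq[of "\<lambda>x. c - x" lborel borel f] assms
    borel_measurable_integrable[OF assms]
  by (simp add: lborel_distr_reflect)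

lemma norm_integral_bound:
  fixes f :: "'a \<Rightarrow> 'b::{banach,second_countable_topology}"
  assumes "integrable M f" "integrable M g" "\<And>x. norm (f x) \<le> g x"
  shows "norm (\<integral>x. f x \<partial>M) \<le> (\<integral>x. g x \<partial>M)"
  by (rule order_trans[OF integral_norm_bound integral_mono[OF integrable_norm[OF assms(1)] assms(2,3)]])

lemma uniformly_continuous_compact_support:
  fixes f :: "'a::euclidean_space \<Rightarrow> 'b::real_normed_vector"
  assumes f: "continuous_on UNIV f" and K: "compact K" and z: "\<And>x. x \<notin> K \<Longrightarrow> f x = 0"
  shows "uniformly_continuous_on UNIV f"
unfolding uniformly_continuous_on_def
proof (intro allI impI)
  fix e :: real assume e: "e > 0"
  obtain B where B: "B > 0" "\<And>x. x \<in> K \<Longrightarrow> norm x \<le> B"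
    using compact_imp_bounded[OF K] bounded_pos by metis
  have "uniformly_continuous_on (cball 0 (B+1)) f"
    by (rule compact_uniformly_continuous) (auto intro: continuous_on_subset[OF f])
  then obtain d where d: "d > 0" "\<And>x y. x \<in> cball 0 (B+1) \<Longrightarrow> y \<in> cball 0 (B+1) \<Longrightarrow> dist y x < d \<Longrightarrow> dist (f y) (f x) < e"
    using e unfolding uniformly_continuous_on_def by meson
  show "\<exists>d>0. \<forall>x\<in>UNIV. \<forall>x'\<in>UNIV. dist x' x < d \<longrightarrow> dist (f x') (f x) < e"
  proof (intro exI[of _ "min d 1"] conjI ballI impI)
    show "min d 1 > 0" using d by auto
    fix x y :: 'a assume xy: "dist y x < min d 1"
    show "dist (f y) (f x) < e"
    proof (cases "x \<in> K \<or> y \<in> K")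
      case True
      have "norm x \<le> B + 1 \<and> norm y \<le> B + 1"
        using True B xy norm_triangle_ineq2[of x y] norm_triangle_ineq2[of y x]
        by (smt (verit) dist_norm norm_minus_commute min_less_iff_conj)
      then show ?thesis using d(2)[of x y] xy by auto
    next
      case False then show ?thesis using z e by simp
    qed
  qed
qed

lemma bounded_compact_support:
  fixes f :: "'a::euclidean_space \<Rightarrow> 'b::real_normed_vector"
  assumes f: "continuous_on UNIV f" and K: "compact K" and z: "\<And>x. x \<notin> K \<Longrightarrow> f x = 0"
  obtains B where "B \<ge> 0" "\<And>x. norm (f x) \<le> B"
proof -
  have "bounded (f ` K)" by (intro compact_imp_bounded compact_continuous_image K continuous_on_subset[OF f]) auto
  then obtain B where B: "B > 0" "\<And>x. x \<in> K \<Longrightarrow> norm (f x) \<le> B" unfolding bounded_pos by auto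
  have "norm (f x) \<le> B" for x using B z by (cases "x \<in> K") auto
  then show ?thesis using that[of B] B by auto
qed

lemma integrable_compact_support:
  fixes f :: "'a::euclidean_space \<Rightarrow> 'b::{banach,second_countable_topology}"
  assumes f: "f \<in> borel_measurable borel" and K: "bounded K" and z: "\<And>x. x \<notin> K \<Longrightarrow> f x = 0"
   and B: "\<And>x. norm (f x) \<le> B"
  shows "integrable lborel f"
proof -
  obtain a b where ab: "K \<subseteq> cbox a b" using bounded_subset_cbox_symmetric[OF K] by metis
  have "integrable lborel (\<lambda>x. indicator (cbox a b) x *\<^sub>R B)"
    by (intro integrable_real_indicator integrable_scaleR_left)
      (auto simp: emeasure_lborel_cbox_eq)
  then show ?thesis
    by (rule Bochner_Integration.integrable_bound)
       (use f in simp, intro AE_I2, use B z ab in \<open>fastforce simp: indicator_def intro: order_trans[OF _ abs_ge_self]\<close>)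
qed

text \<open>
  The square makes the truncated paraboloid \<open>C1\<close>. One continuous derivative is all that test fields need, and this kernel
  has a gradient in closed form.
\<close>

definition bump :: "real \<Rightarrow> 'a::euclidean_space \<Rightarrow> real" where
  "bump d x = (max 0 (d\<^sup>2 - x \<bullet> x))\<^sup>2"

definition mollifier :: "real \<Rightarrow> 'a::euclidean_space \<Rightarrow> real" where
  "mollifier d x = bump d x / (\<integral>y. bump d (y::'a) \<partial>lborel)"

definition mollifier_grad :: "real \<Rightarrow> 'a::euclidean_space \<Rightarrow> 'a" where
  "mollifier_grad d x = (- 4 * max 0 (d\<^sup>2 - x \<bullet> x) / (\<integral>y. bump d (y::'a) \<partial>lborel)) *\<^sub>R x"

definition mollify :: "real \<Rightarrow> ('a::euclidean_space \<Rightarrow> 'b::euclidean_space) \<Rightarrow> 'a \<Rightarrow> 'b" where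
  "mollify d g x = (\<integral>t. mollifier d (x - t) *\<^sub>R g t \<partial>lborel)"

lemma continuous_bump: "continuous_on UNIV (bump d)"
  unfolding bump_def by (intro continuous_intros)

lemma bump_nonneg: "bump d x \<ge> 0" by (simp add: bump_def)

lemma square_norm_ge: "d > 0 \<Longrightarrow> d \<le> norm x \<Longrightarrow> d\<^sup>2 - x \<bullet> x \<le> (0::real)"
  by (metis diff_ge_0_iff_ge diff_le_0_iff_le dot_square_norm less_imp_le power_mono)

lemma bump_zero: "d > 0 \<Longrightarrow> norm x \<ge> d \<Longrightarrow> bump d x = 0"
  using square_norm_ge[of d x] by (simp add: bump_def max_def)

lemma integrable_bump: "d > 0 \<Longrightarrow> integrable lborel (bump d :: 'a::euclidean_space \<Rightarrow> real)"
proof -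
  assume d: "d > 0"
  obtain B where "\<And>x::'a. norm (bump d x) \<le> B"
    using bounded_compact_support[OF continuous_bump, of "cball 0 d" d] bump_zero[OF d]
    by (metis compact_cball dist_0_norm linorder_not_less mem_cball order_less_imp_le)
  then show ?thesis
    using d by (intro integrable_compact_support[where K="cball 0 d" and B=B])
      (auto simp: bump_zero intro!: borel_measurable_continuous_onI continuous_bump)
qed

lemma integral_bump_pos:
  assumes d: "d > 0" shows "(\<integral>y. bump d (y::'a::euclidean_space) \<partial>lborel) > 0"
proof -
  have "(\<integral>y. bump d (y::'a) \<partial>lborel) \<noteq> 0"
  proof
    assume "(\<integral>y. bump d (y::'a) \<partial>lborel) = 0"
    then have "AE y in lborel. bump d (y::'a) = 0"
      using integral_nonneg_eq_0_iff_AE[OF integrable_bump[OF d]] bump_nonneg by auto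
    then have "AE y in lborel. (y::'a) \<notin> ball 0 d"
    proof eventually_elim
      fix y :: 'a assume y: "bump d y = 0"
      show "y \<notin> ball 0 d"
      proof
        assume "y \<in> ball 0 d"
        then have "norm y < d" by simp
        then have "d\<^sup>2 - y \<bullet> y > 0" using power_strict_mono[of "norm y" d 2] by (simp add: dot_square_norm)
        then show False using y by (simp add: bump_def)
      qed
    qed
    then have "emeasure lborel (ball 0 d :: 'a set) = 0"
      by (subst (asm) AE_iff_measurable[where N="ball 0 d"]) auto
    moreover have "emeasure lborel (ball 0 d :: 'a set) > 0"
      using d by (simp add: emeasure_ball unit_ball_vol_pos ennreal_zero_less_mult_iff)
    ultimately show False by simp
  qed
  moreover have "(\<integral>y. bump d (y::'a) \<partial>lborel) \<ge> 0" by (intro integral_nonneg_AE) (auto simp: bump_nonneg)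
  ultimately show ?thesis by linarith
qed

lemma DERIV_max_square: "((\<lambda>s. (max 0 s)\<^sup>2) has_real_derivative (2 * max 0 s)) (at s)" for s :: real
proof -
  consider "s > 0" | "s < 0" | "s = 0" by linarith
  then show ?thesis
  proof cases
    case 1
    have "((\<lambda>s. s\<^sup>2) has_real_derivative (2 * max 0 s)) (at s)"
      using 1 by (auto intro!: derivative_eq_intros)
    moreover have "eventually (\<lambda>t. (max 0 t)\<^sup>2 = t\<^sup>2) (nhds s)"
      using eventually_nhds_in_open[of "{0<..}" s] 1 by (auto elim: eventually_mono)
    ultimately show ?thesis using DERIV_cong_ev[OF refl _ refl] by fast
  next
    case 2
    have "((\<lambda>s. 0) has_real_derivative (2 * max 0 s)) (at s)"
      using 2 by (auto intro!: derivative_eq_intros)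
    moreover have "eventually (\<lambda>t. (max 0 t)\<^sup>2 = 0) (nhds s)"
      using eventually_nhds_in_open[of "{..<0}" s] 2 by (auto elim: eventually_mono)
    ultimately show ?thesis using DERIV_cong_ev[OF refl _ refl] by fast
  next
    case 3
    have "((\<lambda>h. (max 0 h)\<^sup>2 / h) \<longlongrightarrow> 0) (at (0::real))"
    proof (rule tendsto_0_le[where f="\<lambda>h. h" and K=1])
      show "((\<lambda>h. h) \<longlongrightarrow> 0) (at (0::real))" by (rule tendsto_ident_at)
      show "eventually (\<lambda>h. norm ((max 0 h)\<^sup>2 / h) \<le> norm h * 1) (at (0::real))"
        by (intro always_eventually allI) (auto simp: max_def power2_eq_square)
    qed
    then show ?thesis using 3 by (simp add: DERIV_def)
  qed
qed

context fixes d :: real assumes d: "d > 0" begin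

lemma mollifier_nonneg: "mollifier d (x::'a::euclidean_space) \<ge> 0"
  using integral_bump_pos[OF d, where 'a='a] bump_nonneg[of d x] by (simp add: mollifier_def)

lemma mollifier_zero: "norm x \<ge> d \<Longrightarrow> mollifier d x = 0"
  by (simp add: mollifier_def bump_zero[OF d])

lemma mollifier_grad_zero: "norm x \<ge> d \<Longrightarrow> mollifier_grad d x = 0"
  using square_norm_ge[OF d, of x] by (simp add: mollifier_grad_def)

lemma continuous_mollifier: "continuous_on UNIV (mollifier d :: 'a::euclidean_space \<Rightarrow> real)"
  unfolding mollifier_def using integral_bump_pos[OF d, where 'a='a]
  by (intro continuous_intros continuous_bump) auto

lemma continuous_mollifier_grad: "continuous_on UNIV (mollifier_grad d :: 'a::euclidean_space \<Rightarrow> 'a)"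
  unfolding mollifier_grad_def using integral_bump_pos[OF d, where 'a='a]
  by (intro continuous_intros) auto

lemma mollifier_even: "mollifier d (- x) = mollifier d x"
  by (simp add: mollifier_def bump_def)

lemma mollifier_grad_odd: "mollifier_grad d (- x) = - mollifier_grad d x"
  by (simp add: mollifier_grad_def)

lemma integrable_mollifier: "integrable lborel (mollifier d :: 'a::euclidean_space \<Rightarrow> real)"
  unfolding mollifier_def by (intro Bochner_Integration.integrable_divide impI integrable_bump[OF d])

lemma integral_mollifier: "(\<integral>x. mollifier d (x::'a::euclidean_space) \<partial>lborel) = 1"
  unfolding mollifier_def using integral_bump_pos[OF d, where 'a='a] by simp

lemma has_derivative_mollifier:
  "(mollifier d has_derivative (\<lambda>h. mollifier_grad d x \<bullet> h)) (at (x::'a::euclidean_space))"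
proof -
  have 1: "((\<lambda>x. d\<^sup>2 - x \<bullet> x) has_derivative (\<lambda>h. - 2 * (x \<bullet> h))) (at x)"
    by (auto intro!: derivative_eq_intros simp: inner_commute)
  have "((\<lambda>x. (max 0 (d\<^sup>2 - x \<bullet> x))\<^sup>2) has_derivative (\<lambda>h. 2 * max 0 (d\<^sup>2 - x \<bullet> x) * (- 2 * (x \<bullet> h)))) (at x)"
    using has_derivative_compose[OF 1 DERIV_max_square[unfolded has_field_derivative_def]] by simp
  from has_derivative_mult_right[OF this, of "1 / (\<integral>y. bump d (y::'a) \<partial>lborel)"]
  have "((\<lambda>x. (max 0 (d\<^sup>2 - x \<bullet> x))\<^sup>2 / (\<integral>y. bump d (y::'a) \<partial>lborel)) has_derivative
     (\<lambda>h. 2 * max 0 (d\<^sup>2 - x \<bullet> x) * (- 2 * (x \<bullet> h)) / (\<integral>y. bump d (y::'a) \<partial>lborel))) (at x)"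
    by simp
  then show ?thesis
    by (simp add: mollifier_def[abs_def] bump_def[abs_def] mollifier_grad_def mult.assoc)
qed

lemma mollifier_grad_bound:
  obtains B where "B \<ge> 0" "\<And>x::'a::euclidean_space. norm (mollifier_grad d x) \<le> B"
  using bounded_compact_support[OF continuous_mollifier_grad, of "cball 0 d"] mollifier_grad_zero
  by (metis compact_cball dist_0_norm linorder_not_less mem_cball order_less_imp_le)

lemma mollifier_bound:
  obtains B where "B \<ge> 0" "\<And>x::'a::euclidean_space. norm (mollifier d x) \<le> B"
  using bounded_compact_support[OF continuous_mollifier, of "cball 0 d"] mollifier_zero
  by (metis compact_cball dist_0_norm linorder_not_less mem_cball order_less_imp_le)

lemma uniformly_continuous_mollifier_grad:
  "uniformly_continuous_on UNIV (mollifier_grad d :: 'a::euclidean_space \<Rightarrow> 'a)"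
  by (rule uniformly_continuous_compact_support[where K="cball 0 d"])
    (auto simp: continuous_mollifier_grad mollifier_grad_zero)

lemma measurable_mollifier [measurable]: "(mollifier d :: 'a::euclidean_space \<Rightarrow> real) \<in> borel_measurable borel"
  by (intro borel_measurable_continuous_onI continuous_mollifier)

lemma measurable_mollifier_grad [measurable]: "(mollifier_grad d :: 'a::euclidean_space \<Rightarrow> 'a) \<in> borel_measurable borel"
  by (intro borel_measurable_continuous_onI continuous_mollifier_grad)

end


text \<open>
  The first-order remainder is uniform in the base point, since the gradient is uniformly continuous. This allows
  differentiation under the integral against a function that is only integrable.
\<close>

lemma mollifier_linearization:
  assumes d: "d > 0" and e: "e > 0"
  obtains s where "s > 0" "\<And>(z::'a::euclidean_space) h. norm h < s \<Longrightarrow>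
     \<bar>mollifier d (z + h) - mollifier d z - mollifier_grad d z \<bullet> h\<bar> \<le> e * norm h"
proof -
  obtain s where s: "s > 0" "\<And>x y::'a. dist y x < s \<Longrightarrow> dist (mollifier_grad d y) (mollifier_grad d x) < e"
    using uniformly_continuous_mollifier_grad[OF d] e unfolding uniformly_continuous_on_def by blast
  show ?thesis
  proof (rule that[OF s(1)])
    fix z h :: 'a assume h: "norm h < s"
    have "norm (mollifier d (z + h) - mollifier d z - mollifier_grad d z \<bullet> ((z + h) - z)) \<le> norm ((z + h) - z) * e"
    proof (rule differentiable_bound_linearization[where S="ball z s" and f'="\<lambda>x h. mollifier_grad d x \<bullet> h"])
      show "\<And>t. t \<in> {0..1} \<Longrightarrow> z + t *\<^sub>R (z + h - z) \<in> ball z s"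
      proof -
        fix t :: real assume t: "t \<in> {0..1}"
        have "t * norm h \<le> 1 * norm h" by (rule mult_right_mono) (use t in auto)
        then show "z + t *\<^sub>R (z + h - z) \<in> ball z s" using t h by (simp add: dist_norm)
      qed
      show "\<And>x. x \<in> ball z s \<Longrightarrow> (mollifier d has_derivative (\<bullet>) (mollifier_grad d x)) (at x within ball z s)"
        using has_derivative_mollifier[OF d] has_derivative_at_withinI by blast
      show "onorm ((\<bullet>) (mollifier_grad d x) - (\<bullet>) (mollifier_grad d z)) \<le> e" if "x \<in> ball z s" for x
        unfolding fun_diff_def
      proof (rule onorm_le)
        fix i :: 'a
        have "norm (mollifier_grad d x \<bullet> i - mollifier_grad d z \<bullet> i) = \<bar>(mollifier_grad d x - mollifier_grad d z) \<bullet> i\<bar>"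
          by (simp add: inner_diff_left)
        also have "\<dots> \<le> norm (mollifier_grad d x - mollifier_grad d z) * norm i"
          by (rule Cauchy_Schwarz_ineq2)
        also have "\<dots> \<le> e * norm i"
          using s(2)[of x z] that by (intro mult_right_mono) (auto simp: dist_norm norm_minus_commute)
        finally show "norm (mollifier_grad d x \<bullet> i - mollifier_grad d z \<bullet> i) \<le> e * norm i" .
      qed
      show "z \<in> ball z s" using s by simp
    qed
    then show "\<bar>mollifier d (z + h) - mollifier d z - mollifier_grad d z \<bullet> h\<bar> \<le> e * norm h"
      by (simp add: mult.commute)
  qed
qed

lemma integrable_mollify_integrand:
  fixes g :: "'a::euclidean_space \<Rightarrow> 'b::euclidean_space"
  assumes d: "d > 0" and g: "integrable lborel g"
  shows "integrable lborel (\<lambda>t. mollifier d (x - t) *\<^sub>R g t)"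
proof -
  obtain B where B: "\<And>x::'a. norm (mollifier d x) \<le> B" using mollifier_bound[OF d] by metis
  note [measurable] = measurable_mollifier[OF d] borel_measurable_integrable[OF g]
  show ?thesis
    by (rule Bochner_Integration.integrable_bound[where f="\<lambda>t. B *\<^sub>R g t"])
      (use g B in \<open>auto intro!: AE_I2 mult_right_mono intro: order_trans[OF _ abs_ge_self]\<close>)
qed

lemma integrable_mollify_grad_integrand:
  fixes g :: "'a::euclidean_space \<Rightarrow> 'b::euclidean_space"
  assumes d: "d > 0" and g: "integrable lborel g"
  shows "integrable lborel (\<lambda>t. (mollifier_grad d (x - t) \<bullet> h) *\<^sub>R g t)"
proof -
  obtain B where B: "B \<ge> 0" "\<And>x::'a. norm (mollifier_grad d x) \<le> B" using mollifier_grad_bound[OF d] by metis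
  note [measurable] = measurable_mollifier_grad[OF d] borel_measurable_integrable[OF g]
  show ?thesis
  proof (rule Bochner_Integration.integrable_bound[where f="\<lambda>t. (B * norm h) *\<^sub>R g t"])
    show "AE t in lborel. norm ((mollifier_grad d (x - t) \<bullet> h) *\<^sub>R g t) \<le> norm ((B * norm h) *\<^sub>R g t)"
    proof (intro AE_I2)
      fix t
      have "\<bar>mollifier_grad d (x - t) \<bullet> h\<bar> \<le> B * norm h"
        by (rule order_trans[OF Cauchy_Schwarz_ineq2]) (use B in \<open>auto intro!: mult_right_mono\<close>)
      then show "norm ((mollifier_grad d (x - t) \<bullet> h) *\<^sub>R g t) \<le> norm ((B * norm h) *\<^sub>R g t)"
        using B by (auto intro!: mult_right_mono)
    qed
  qed (use g in auto)
qed

lemma has_derivative_mollify: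
  fixes g :: "'a::euclidean_space \<Rightarrow> 'b::euclidean_space"
  assumes d: "d > 0" and g: "integrable lborel g"
  shows "(mollify d g has_derivative (\<lambda>h. \<integral>t. (mollifier_grad d (x - t) \<bullet> h) *\<^sub>R g t \<partial>lborel)) (at x)"
  unfolding has_derivative_at_alt
proof (intro conjI allI impI)
  let ?D = "\<lambda>h. \<integral>t. (mollifier_grad d (x - t) \<bullet> h) *\<^sub>R g t \<partial>lborel"
  note int = integrable_mollify_integrand[OF d g] integrable_mollify_grad_integrand[OF d g]
  have "linear ?D"
  proof (rule linearI)
    fix a b show "?D (a + b) = ?D a + ?D b"
      by (simp add: inner_add_right scaleR_add_left int Bochner_Integration.integral_add)
  next
    fix r b show "?D (r *\<^sub>R b) = r *\<^sub>R ?D b"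
      by (simp flip: scaleR_scaleR)
  qed
  then show "bounded_linear ?D" by (rule linear_conv_bounded_linear[THEN iffD1])
  fix e :: real assume e: "e > 0"
  define G where "G = (\<integral>t. norm (g t) \<partial>lborel)"
  have G: "G \<ge> 0" by (simp add: G_def)
  obtain s where s: "s > 0" "\<And>(z::'a) h. norm h < s \<Longrightarrow>
     \<bar>mollifier d (z + h) - mollifier d z - mollifier_grad d z \<bullet> h\<bar> \<le> e / (G + 1) * norm h"
    using mollifier_linearization[OF d, of "e / (G + 1)"] e G by (metis add_nonneg_pos divide_pos_pos zero_less_one)
  show "\<exists>s>0. \<forall>y. norm (y - x) < s \<longrightarrow> norm (mollify d g y - mollify d g x - ?D (y - x)) \<le> e * norm (y - x)"
  proof (intro exI[of _ s] conjI allI impI s(1))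
    fix y assume y: "norm (y - x) < s"
    have "mollify d g y - mollify d g x - ?D (y - x) =
      (\<integral>t. (mollifier d (y - t) - mollifier d (x - t) - mollifier_grad d (x - t) \<bullet> (y - x)) *\<^sub>R g t \<partial>lborel)"
      unfolding mollify_def scaleR_diff_left by (simp add: int Bochner_Integration.integral_diff)
    also have "norm \<dots> \<le> (\<integral>t. (e / (G + 1) * norm (y - x)) * norm (g t) \<partial>lborel)"
    proof (rule norm_integral_bound)
      show "integrable lborel (\<lambda>t. (mollifier d (y - t) - mollifier d (x - t) - mollifier_grad d (x - t) \<bullet> (y - x)) *\<^sub>R g t)"
        unfolding scaleR_diff_left by (intro Bochner_Integration.integrable_diff int)
      show "integrable lborel (\<lambda>t. (e / (G + 1) * norm (y - x)) * norm (g t))" using g by simp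
      fix t
      have "\<bar>mollifier d (y - t) - mollifier d (x - t) - mollifier_grad d (x - t) \<bullet> (y - x)\<bar> \<le> e / (G + 1) * norm (y - x)"
        using s(2)[of "y - x" "x - t"] y by simp
      then show "norm ((mollifier d (y - t) - mollifier d (x - t) - mollifier_grad d (x - t) \<bullet> (y - x)) *\<^sub>R g t)
         \<le> (e / (G + 1) * norm (y - x)) * norm (g t)"
        unfolding norm_scaleR real_norm_def by (rule mult_right_mono) auto
    qed
    also have "\<dots> = e * norm (y - x) * (G / (G + 1))" by (simp add: G_def)
    also have "\<dots> \<le> e * norm (y - x) * 1" using e G by (intro mult_left_mono) auto
    finally show "norm (mollify d g y - mollify d g x - ?D (y - x)) \<le> e * norm (y - x)" by simp
  qed
qed

lemma continuous_mollify_derivative: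
  fixes g :: "'a::euclidean_space \<Rightarrow> 'b::euclidean_space"
  assumes d: "d > 0" and g: "integrable lborel g"
  shows "continuous_on UNIV (\<lambda>x. \<integral>t. (mollifier_grad d (x - t) \<bullet> h) *\<^sub>R g t \<partial>lborel)"
  unfolding continuous_on_iff
proof (intro ballI allI impI)
  note int = integrable_mollify_grad_integrand[OF d g]
  define G where "G = (\<integral>t. norm (g t) \<partial>lborel)"
  have G: "G \<ge> 0" by (simp add: G_def)
  fix x :: 'a and e :: real assume e: "e > 0"
  define e' where "e' = e / ((norm h + 1) * (G + 1))"
  have pos: "(norm h + 1) * (G + 1) > 0" using G by (simp add: add_nonneg_pos)
  have e': "e' > 0" using e pos by (simp add: e'_def)
  obtain s where s: "s > 0" "\<And>x y::'a. dist y x < s \<Longrightarrow> dist (mollifier_grad d y) (mollifier_grad d x) < e'"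
    using uniformly_continuous_mollifier_grad[OF d] e' unfolding uniformly_continuous_on_def by blast
  show "\<exists>s>0. \<forall>y\<in>UNIV. dist y x < s \<longrightarrow>
    dist (\<integral>t. (mollifier_grad d (y - t) \<bullet> h) *\<^sub>R g t \<partial>lborel) (\<integral>t. (mollifier_grad d (x - t) \<bullet> h) *\<^sub>R g t \<partial>lborel) < e"
  proof (intro exI[of _ s] conjI ballI impI s(1))
    fix y assume y: "dist y x < s"
    have "(\<integral>t. (mollifier_grad d (y - t) \<bullet> h) *\<^sub>R g t \<partial>lborel) - (\<integral>t. (mollifier_grad d (x - t) \<bullet> h) *\<^sub>R g t \<partial>lborel)
      = (\<integral>t. (mollifier_grad d (y - t) \<bullet> h - mollifier_grad d (x - t) \<bullet> h) *\<^sub>R g t \<partial>lborel)"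
      by (simp add: scaleR_diff_left int Bochner_Integration.integral_diff)
    also have "norm \<dots> \<le> (\<integral>t. (e' * norm h) * norm (g t) \<partial>lborel)"
    proof (rule norm_integral_bound)
      show "integrable lborel (\<lambda>t. (mollifier_grad d (y - t) \<bullet> h - mollifier_grad d (x - t) \<bullet> h) *\<^sub>R g t)"
        unfolding scaleR_diff_left by (intro Bochner_Integration.integrable_diff int)
      show "integrable lborel (\<lambda>t. (e' * norm h) * norm (g t))" using g by simp
      fix t
      have "\<bar>mollifier_grad d (y - t) \<bullet> h - mollifier_grad d (x - t) \<bullet> h\<bar> \<le> norm (mollifier_grad d (y - t) - mollifier_grad d (x - t)) * norm h"
        by (metis Cauchy_Schwarz_ineq2 inner_diff_left)
      also have "\<dots> \<le> e' * norm h"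
        using s(2)[of "y - t" "x - t"] y by (intro mult_right_mono) (auto simp: dist_norm)
      finally show "norm ((mollifier_grad d (y - t) \<bullet> h - mollifier_grad d (x - t) \<bullet> h) *\<^sub>R g t) \<le> (e' * norm h) * norm (g t)"
        unfolding norm_scaleR real_norm_def by (rule mult_right_mono) auto
    qed
    also have "\<dots> = e' * (norm h * G)" by (simp add: G_def)
    also have "\<dots> < e' * ((norm h + 1) * (G + 1))"
    proof (rule mult_strict_left_mono[OF _ e'])
      have "norm h * G \<le> (norm h + 1) * G" using G by (intro mult_right_mono) auto
      also have "\<dots> < (norm h + 1) * (G + 1)" by (intro mult_strict_left_mono) (auto simp: add_nonneg_pos)
      finally show "norm h * G < (norm h + 1) * (G + 1)" .
    qed
    also have "\<dots> = e" unfolding e'_def by (subst times_divide_eq_left, rule nonzero_mult_div_cancel_right) (metis less_irrefl pos)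
    finally show "dist (\<integral>t. (mollifier_grad d (y - t) \<bullet> h) *\<^sub>R g t \<partial>lborel) (\<integral>t. (mollifier_grad d (x - t) \<bullet> h) *\<^sub>R g t \<partial>lborel) < e"
      by (simp add: dist_norm)
  qed
qed

lemma continuous_mollify:
  fixes g :: "'a::euclidean_space \<Rightarrow> 'b::euclidean_space"
  assumes d: "d > 0" and g: "integrable lborel g"
  shows "continuous_on UNIV (mollify d g)"
  by (intro has_derivative_continuous_on[where f'="\<lambda>x h. \<integral>t. (mollifier_grad d (x - t) \<bullet> h) *\<^sub>R g t \<partial>lborel"])
    (use has_derivative_mollify[OF d g] in auto)

lemma norm_mollify_le:
  fixes g :: "'a::euclidean_space \<Rightarrow> 'b::euclidean_space"
  assumes d: "d > 0" and M: "\<And>t. dist x t < d \<Longrightarrow> norm (g t) \<le> M"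
    and M0: "0 \<le> M"
  shows "norm (mollify d g x) \<le> M"
proof (cases "integrable lborel (\<lambda>t. mollifier d (x - t) *\<^sub>R g t)")
  case True
  have "norm (mollify d g x) \<le> (\<integral>t. mollifier d (x - t) * M \<partial>lborel)"
    unfolding mollify_def
  proof (rule norm_integral_bound[OF True])
    show "integrable lborel (\<lambda>t. mollifier d (x - t) * M)"
      by (intro integrable_mult_left impI integrable_lborel_reflect integrable_mollifier d)
    fix t
    show "norm (mollifier d (x - t) *\<^sub>R g t) \<le> mollifier d (x - t) * M"
      using M[of t] mollifier_zero[OF d, of "x - t"] mollifier_nonneg[OF d, of "x - t"]
      by (cases "dist x t < d") (auto simp: dist_norm intro!: mult_left_mono)
  qed
  also have "\<dots> = M"
    by (simp add: integral_lborel_reflect[where f="mollifier d"] integral_mollifier d measurable_mollifier)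
  finally show ?thesis .
next
  case False
  then show ?thesis using M0 by (simp add: mollify_def not_integrable_integral_eq)
qed

lemma mollify_eq_0:
  fixes g :: "'a::euclidean_space \<Rightarrow> 'b::euclidean_space"
  assumes "d > 0" "\<And>t. dist x t < d \<Longrightarrow> g t = 0"
  shows "mollify d g x = 0"
  using norm_mollify_le[of d x g 0] assms by simp

lemma integrable_product_mult:
  fixes f :: "'a::euclidean_space \<Rightarrow> real" and g :: "'b::euclidean_space \<Rightarrow> real"
  assumes f: "integrable lborel f" and g: "integrable lborel g"
  shows "integrable (lborel \<Otimes>\<^sub>M lborel) (\<lambda>z. f (fst z) * g (snd z))"
proof (rule lborel_pair.Fubini_integrable)
  note [measurable] = borel_measurable_integrable[OF f] borel_measurable_integrable[OF g]
  show "(\<lambda>z. f (fst z) * g (snd z)) \<in> borel_measurable (lborel \<Otimes>\<^sub>M lborel)" by measurable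
  show "integrable lborel (\<lambda>x. \<integral>y. norm (f (fst (x, y)) * g (snd (x, y))) \<partial>lborel)"
    using f by (simp add: abs_mult)
  show "AE x in lborel. integrable lborel (\<lambda>y. f (fst (x, y)) * g (snd (x, y)))"
    using g by simp
qed

lemma mollify_symmetric:
  fixes f g :: "'a::euclidean_space \<Rightarrow> real"
  assumes d: "d > 0" and f: "integrable lborel f" and g: "integrable lborel g"
  shows "(\<integral>x. f x * mollify d g x \<partial>lborel) = (\<integral>t. mollify d f t * g t \<partial>lborel)"
proof -
  obtain B where B: "\<And>x::'a. norm (mollifier d x) \<le> B" "B \<ge> 0" using mollifier_bound[OF d] by metis
  note [measurable] = measurable_mollifier[OF d] borel_measurable_integrable[OF f] borel_measurable_integrable[OF g]
  have int: "integrable (lborel \<Otimes>\<^sub>M lborel) (\<lambda>(x, t). f x * (mollifier d (x - t) * g t))"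
  proof (rule Bochner_Integration.integrable_bound[where f="\<lambda>(x,t). B * (f x * g t)"])
    show "integrable (lborel \<Otimes>\<^sub>M lborel) (\<lambda>(x,t). B * (f x * g t))"
      using integrable_product_mult[OF f g] by (simp add: split_def)
    show "AE z in lborel \<Otimes>\<^sub>M lborel. norm (case z of (x, t) \<Rightarrow> f x * (mollifier d (x - t) * g t)) \<le> norm (case z of (x, t) \<Rightarrow> B * (f x * g t))"
    proof (intro AE_I2, clarify)
      fix x t
      have "\<bar>mollifier d (x - t)\<bar> * (\<bar>f x\<bar> * \<bar>g t\<bar>) \<le> B * (\<bar>f x\<bar> * \<bar>g t\<bar>)"
        using B(1)[of "x - t"] by (intro mult_right_mono) auto
      then show "norm (f x * (mollifier d (x - t) * g t)) \<le> norm (B * (f x * g t))"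
        using B(2) by (simp add: abs_mult mult_ac)
    qed
  qed simp
  have "(\<integral>x. f x * mollify d g x \<partial>lborel) = (\<integral>x. (\<integral>t. f x * (mollifier d (x - t) * g t) \<partial>lborel) \<partial>lborel)"
    by (simp add: mollify_def)
  also have "\<dots> = (\<integral>t. (\<integral>x. f x * (mollifier d (x - t) * g t) \<partial>lborel) \<partial>lborel)"
    using lborel_pair.Fubini_integral[OF int] by simp
  also have "\<dots> = (\<integral>t. mollify d f t * g t \<partial>lborel)"
  proof (intro Bochner_Integration.integral_cong refl)
    fix t
    have "f x * (mollifier d (x - t) * g t) = (mollifier d (t - x) * f x) * g t" for x
      using mollifier_even[OF d, of "t - x"] by simp
    then show "(\<integral>x. f x * (mollifier d (x - t) * g t) \<partial>lborel) = mollify d f t * g t"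
      unfolding mollify_def by (simp only: integral_mult_left_zero real_scaleR_def)
  qed
  finally show ?thesis .
qed

text \<open>
  Integration by parts moved to the kernel: the left side is \<open>\<integral> f div(\<eta> * g)\<close>, the right side
  \<open>- \<integral> \<nabla>(\<eta> * f) \<cdot> g\<close>. It is Fubini's theorem together with the oddness of the kernel gradient, and holds for fields
  \<open>g\<close> without any smoothness.
\<close>

lemma mollify_grad_duality:
  fixes f :: "'a::euclidean_space \<Rightarrow> real" and g :: "'a \<Rightarrow> 'a"
  assumes d: "d > 0" and f: "integrable lborel f" and g: "integrable lborel g"
  shows "(\<integral>x. f x * (\<integral>t. mollifier_grad d (x - t) \<bullet> g t \<partial>lborel) \<partial>lborel)
    = - (\<integral>t. (\<integral>x. f x *\<^sub>R mollifier_grad d (t - x) \<partial>lborel) \<bullet> g t \<partial>lborel)"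
proof -
  obtain B where B: "\<And>x::'a. norm (mollifier_grad d x) \<le> B" "B \<ge> 0" using mollifier_grad_bound[OF d] by metis
  note [measurable] = measurable_mollifier_grad[OF d] borel_measurable_integrable[OF f] borel_measurable_integrable[OF g]
  have int: "integrable (lborel \<Otimes>\<^sub>M lborel) (\<lambda>(x, t). f x * (mollifier_grad d (x - t) \<bullet> g t))"
  proof (rule Bochner_Integration.integrable_bound[where f="\<lambda>(x,t). B * (f x * norm (g t))"])
    show "integrable (lborel \<Otimes>\<^sub>M lborel) (\<lambda>(x,t). B * (f x * norm (g t)))"
      using integrable_product_mult[OF f integrable_norm[OF g]] by (simp add: split_def)
    show "AE z in lborel \<Otimes>\<^sub>M lborel. norm (case z of (x, t) \<Rightarrow> f x * (mollifier_grad d (x - t) \<bullet> g t)) \<le> norm (case z of (x, t) \<Rightarrow> B * (f x * norm (g t)))"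
    proof (intro AE_I2, clarify)
      fix x t
      have "\<bar>mollifier_grad d (x - t) \<bullet> g t\<bar> \<le> norm (mollifier_grad d (x - t)) * norm (g t)"
        by (rule Cauchy_Schwarz_ineq2)
      also have "\<dots> \<le> B * norm (g t)" by (intro mult_right_mono B) auto
      finally have "\<bar>f x\<bar> * \<bar>mollifier_grad d (x - t) \<bullet> g t\<bar> \<le> \<bar>f x\<bar> * (B * norm (g t))"
        by (intro mult_left_mono) auto
      then show "norm (f x * (mollifier_grad d (x - t) \<bullet> g t)) \<le> norm (B * (f x * norm (g t)))"
        using B(2) by (simp add: abs_mult mult_ac)
    qed
  qed simp
  have "(\<integral>x. f x * (\<integral>t. mollifier_grad d (x - t) \<bullet> g t \<partial>lborel) \<partial>lborel) = (\<integral>x. (\<integral>t. f x * (mollifier_grad d (x - t) \<bullet> g t) \<partial>lborel) \<partial>lborel)"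
    by simp
  also have "\<dots> = (\<integral>t. (\<integral>x. f x * (mollifier_grad d (x - t) \<bullet> g t) \<partial>lborel) \<partial>lborel)"
    using lborel_pair.Fubini_integral[OF int] by simp
  also have "\<dots> = (\<integral>t. - ((\<integral>x. f x *\<^sub>R mollifier_grad d (t - x) \<partial>lborel) \<bullet> g t) \<partial>lborel)"
  proof (intro Bochner_Integration.integral_cong refl)
    fix t
    have i: "integrable lborel (\<lambda>x. f x *\<^sub>R mollifier_grad d (t - x))"
      by (rule Bochner_Integration.integrable_bound[where f="\<lambda>x. B *\<^sub>R f x"])
         (use f B in \<open>auto simp: abs_mult mult.commute[of _ "norm (mollifier_grad d _)"] intro!: AE_I2 mult_right_mono\<close>)
    have "f x * (mollifier_grad d (x - t) \<bullet> g t) = - ((f x *\<^sub>R mollifier_grad d (t - x)) \<bullet> g t)" for x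
      using mollifier_grad_odd[OF d, of "t - x"] by simp
    then show "(\<integral>x. f x * (mollifier_grad d (x - t) \<bullet> g t) \<partial>lborel) = - ((\<integral>x. f x *\<^sub>R mollifier_grad d (t - x) \<partial>lborel) \<bullet> g t)"
      using integral_inner_left[OF i, of "g t"] by simp
  qed
  finally show ?thesis by simp
qed

text \<open>
  Let \<open>U\<close> be an open set that contains \<open>A\<close> and has little more measure. Every \<open>x \<in> A\<close> satisfies \<open>x + h \<in> U\<close> for all
  small \<open>h\<close>, so by dominated convergence a small translation moves little of \<open>A\<close> out of \<open>U\<close>.
\<close>

lemma translation_continuous_L1_set:
  fixes A :: "'a::euclidean_space set"
  assumes A: "A \<in> sets borel" and fin: "emeasure lborel A < \<infinity>"
  shows "((\<lambda>h. \<integral>x. \<bar>indicator A (x + h) - indicator A x :: real\<bar> \<partial>lborel) \<longlongrightarrow> 0) (at 0)"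
  unfolding tendsto_at_iff_sequentially comp_def
proof (intro allI impI)
  fix X :: "nat \<Rightarrow> 'a" assume X: "X \<longlonglongrightarrow> 0"
  note [measurable] = A
  let ?F = "\<lambda>h. \<integral>x. \<bar>indicator A (x + h) - indicator A x :: real\<bar> \<partial>lborel"
  have iA: "integrable lborel (indicator A :: 'a \<Rightarrow> real)" using fin A by simp
  have iAh: "integrable lborel (\<lambda>x. indicator A (x + h) :: real)" for h
    using integrable_lborel_translate[OF iA, of h] by simp
  show "(\<lambda>n. ?F (X n)) \<longlonglongrightarrow> 0"
  proof (rule LIMSEQ_I)
    fix r :: real assume r: "r > 0"
    obtain U where U: "open U" "A \<subseteq> U" "emeasure lborel (U - A) < ennreal (r / 4)"
      using outer_regular_lborel[OF A, of "r / 4"] r by auto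
    have [measurable]: "U \<in> sets borel" using U by simp
    have iUA: "integrable lborel (indicator (U - A) :: 'a \<Rightarrow> real)"
      by (rule integrable_real_indicator) (use order_less_trans[OF U(3) ennreal_less_top] in auto)
    have iUAh: "integrable lborel (\<lambda>x. indicator (U - A) (x + h) :: real)" for h
      using integrable_lborel_translate[OF iUA, of h] by simp
    have mUA: "measure lborel (U - A) < r / 4"
    proof -
      have "ennreal (measure lborel (U - A)) < ennreal (r / 4)"
        using U(3) order_less_trans[OF U(3) ennreal_less_top] by (subst emeasure_eq_ennreal_measure[symmetric]) auto
      then show ?thesis by (simp add: ennreal_less_iff)
    qed
    have prod: "integrable lborel (\<lambda>x. indicator A x * indicator B (x + h) :: real)" if [measurable]: "B \<in> sets borel" for B h
      by (rule Bochner_Integration.integrable_bound[OF iA]) (auto simp: indicator_def)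
    have lim: "(\<lambda>n. \<integral>x. indicator A x * indicator U (x + X n) \<partial>lborel) \<longlonglongrightarrow> (\<integral>x. (indicator A x :: real) \<partial>lborel)"
    proof (rule integral_dominated_convergence[where w="indicator A"])
      show "AE x in lborel. (\<lambda>n. indicator A x * indicator U (x + X n) :: real) \<longlonglongrightarrow> indicator A x"
      proof (intro AE_I2)
        fix x
        show "(\<lambda>n. indicator A x * indicator U (x + X n) :: real) \<longlonglongrightarrow> indicator A x"
        proof (cases "x \<in> A")
          case True
          have "(\<lambda>n. x + X n) \<longlonglongrightarrow> x + 0" by (intro tendsto_intros X)
          then have "eventually (\<lambda>n. x + X n \<in> U) sequentially"
            using topological_tendstoD[of "\<lambda>n. x + X n" x sequentially U] U True by auto
          then have "eventually (\<lambda>n. indicator A x * indicator U (x + X n) = (indicator A x :: real)) sequentially"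
            by eventually_elim simp
          then show ?thesis by (rule tendsto_eventually)
        qed simp
      qed
    qed (use iA in \<open>auto simp: indicator_def\<close>)
    obtain N where N: "\<And>n. n \<ge> N \<Longrightarrow> \<bar>(\<integral>x. indicator A x * indicator U (x + X n) \<partial>lborel) - (\<integral>x. (indicator A x :: real) \<partial>lborel)\<bar> < r / 4"
      using LIMSEQ_D[OF lim, of "r / 4"] r by auto
    show "\<exists>N. \<forall>n\<ge>N. norm (?F (X n) - 0) < r"
    proof (intro exI[of _ N] allI impI)
      fix n assume n: "n \<ge> N"
      let ?h = "X n"
      have "?F ?h \<le> (\<integral>x. indicator A (x + ?h) + indicator A x - 2 * (indicator A x * indicator U (x + ?h)) + 2 * indicator (U - A) (x + ?h) \<partial>lborel)"
      proof (rule integral_mono)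
        show "integrable lborel (\<lambda>x. \<bar>indicator A (x + ?h) - indicator A x :: real\<bar>)"
          by (intro integrable_abs Bochner_Integration.integrable_diff iA iAh)
        show "integrable lborel (\<lambda>x. indicator A (x + ?h) + indicator A x - 2 * (indicator A x * indicator U (x + ?h)) + 2 * indicator (U - A) (x + ?h) :: real)"
          by (intro Bochner_Integration.integrable_diff Bochner_Integration.integrable_add integrable_mult_right impI iA iAh iUAh prod) measurable
      qed (use U in \<open>auto simp: indicator_def\<close>)
      also have "\<dots> = measure lborel A + measure lborel A - 2 * (\<integral>x. indicator A x * indicator U (x + ?h) \<partial>lborel) + 2 * measure lborel (U - A)"
        using iA iAh iUAh prod A
        by (simp add: integral_lborel_translate[where f="indicator _ :: _ \<Rightarrow> real"])
      also have "\<dots> < r"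
        using N[OF n] mUA A by (simp add: abs_if split: if_splits)
      finally show "norm (?F ?h - 0) < r" by simp
    qed
  qed
qed

lemma translation_continuous_L1:
  fixes g :: "'a::euclidean_space \<Rightarrow> 'b::euclidean_space"
  assumes "integrable lborel g"
  shows "((\<lambda>h. \<integral>x. norm (g (x + h) - g x) \<partial>lborel) \<longlongrightarrow> 0) (at 0)"
  using assms
proof (induct rule: integrable_induct)
  case (base A c)
  have "((\<lambda>h. (\<integral>x. \<bar>indicator A (x + h) - indicator A x :: real\<bar> \<partial>lborel) * norm c) \<longlongrightarrow> 0 * norm c) (at 0)"
    by (intro tendsto_intros translation_continuous_L1_set) (use base in auto)
  moreover have "norm (indicator A (x + h) *\<^sub>R c - indicator A x *\<^sub>R c) = \<bar>indicator A (x + h) - indicator A x\<bar> * norm c" for x h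
    by (simp flip: scaleR_diff_left)
  ultimately show ?case by simp
next
  case (add f g)
  have "((\<lambda>h. (\<integral>x. norm (f (x + h) - f x) \<partial>lborel) + (\<integral>x. norm (g (x + h) - g x) \<partial>lborel)) \<longlongrightarrow> 0 + 0) (at 0)"
    by (intro tendsto_intros add)
  then have lim: "((\<lambda>h. (\<integral>x. norm (f (x + h) - f x) \<partial>lborel) + (\<integral>x. norm (g (x + h) - g x) \<partial>lborel)) \<longlongrightarrow> 0) (at 0)" by simp
  show ?case
  proof (rule tendsto_sandwich[OF _ _ tendsto_const lim])
    show "\<forall>\<^sub>F h in at 0. (\<integral>x. norm (f (x + h) + g (x + h) - (f x + g x)) \<partial>lborel) \<le> (\<integral>x. norm (f (x + h) - f x) \<partial>lborel) + (\<integral>x. norm (g (x + h) - g x) \<partial>lborel)"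
    proof (intro always_eventually allI)
      fix h
      have i: "integrable lborel (\<lambda>x. f (x + h) - f x)" "integrable lborel (\<lambda>x. g (x + h) - g x)"
        by (intro Bochner_Integration.integrable_diff integrable_lborel_translate add)+
      have "(\<integral>x. norm (f (x + h) + g (x + h) - (f x + g x)) \<partial>lborel) \<le> (\<integral>x. norm (f (x + h) - f x) + norm (g (x + h) - g x) \<partial>lborel)"
      proof (rule integral_mono)
        have "integrable lborel (\<lambda>x. (f (x + h) - f x) + (g (x + h) - g x))" by (intro Bochner_Integration.integrable_add i)
        then show "integrable lborel (\<lambda>x. norm (f (x + h) + g (x + h) - (f x + g x)))"
          by (intro integrable_norm) (simp add: algebra_simps)
        show "integrable lborel (\<lambda>x. norm (f (x + h) - f x) + norm (g (x + h) - g x))"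
          by (intro Bochner_Integration.integrable_add integrable_norm i)
        show "\<And>x. norm (f (x + h) + g (x + h) - (f x + g x)) \<le> norm (f (x + h) - f x) + norm (g (x + h) - g x)"
          by (metis add_diff_add norm_triangle_ineq)
      qed
      also have "\<dots> = (\<integral>x. norm (f (x + h) - f x) \<partial>lborel) + (\<integral>x. norm (g (x + h) - g x) \<partial>lborel)"
        by (intro Bochner_Integration.integral_add integrable_norm i)
      finally show "(\<integral>x. norm (f (x + h) + g (x + h) - (f x + g x)) \<partial>lborel) \<le> (\<integral>x. norm (f (x + h) - f x) \<partial>lborel) + (\<integral>x. norm (g (x + h) - g x) \<partial>lborel)" .
    qed
  qed (auto intro!: always_eventually)
next
  case (lim f s)
  have dct: "(\<lambda>i. \<integral>x. norm (s i x - f x) \<partial>lborel) \<longlonglongrightarrow> (\<integral>x. 0 \<partial>(lborel :: 'a measure))"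
  proof (rule integral_dominated_convergence[where w="\<lambda>x. 3 * norm (f x)"])
    show "AE x in lborel. (\<lambda>i. norm (s i x - f x)) \<longlonglongrightarrow> 0"
      by (intro AE_I2) (use lim LIM_zero tendsto_norm_zero in fastforce)
    show "\<And>i. AE x in lborel. norm (norm (s i x - f x)) \<le> 3 * norm (f x)"
    proof (intro AE_I2)
      fix i x show "norm (norm (s i x - f x)) \<le> 3 * norm (f x)"
        using lim(4)[of x i] norm_triangle_ineq4[of "s i x" "f x"] by simp
    qed
  qed (use lim borel_measurable_integrable[OF lim(1)] borel_measurable_integrable[OF lim(5)] in auto)
  show ?case
  proof (rule tendstoI)
    fix e :: real assume e: "e > 0"
    obtain i where i: "(\<integral>x. norm (s i x - f x) \<partial>lborel) < e / 3"
      using order_tendstoD(2)[OF dct, of "e/3"] e by (auto simp: eventually_sequentially)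
    have "\<forall>\<^sub>F h in at 0. (\<integral>x. norm (s i (x + h) - s i x) \<partial>lborel) < e / 3"
      using order_tendstoD(2)[OF lim(2)[of i], of "e/3"] e by auto
    then show "\<forall>\<^sub>F h in at 0. dist (\<integral>x. norm (f (x + h) - f x) \<partial>lborel) 0 < e"
    proof eventually_elim
      fix h assume h: "(\<integral>x. norm (s i (x + h) - s i x) \<partial>lborel) < e / 3"
      have int: "integrable lborel (\<lambda>x. s i x - f x)" using lim by auto
      have inth: "integrable lborel (\<lambda>x. s i (x + h) - f (x + h))" using integrable_lborel_translate[OF int] .
      have ints: "integrable lborel (\<lambda>x. s i (x + h) - s i x)"
        by (intro Bochner_Integration.integrable_diff integrable_lborel_translate lim)
      have intf: "integrable lborel (\<lambda>x. f (x + h) - f x)"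
        by (intro Bochner_Integration.integrable_diff integrable_lborel_translate lim)
      have "(\<integral>x. norm (f (x + h) - f x) \<partial>lborel) \<le>
        (\<integral>x. norm (s i (x + h) - f (x + h)) + norm (s i (x + h) - s i x) + norm (s i x - f x) \<partial>lborel)"
      proof (rule integral_mono)
        fix x
        have "f (x + h) - f x = - (s i (x + h) - f (x + h)) + (s i (x + h) - s i x) + (s i x - f x)" by simp
        then show "norm (f (x + h) - f x) \<le> norm (s i (x + h) - f (x + h)) + norm (s i (x + h) - s i x) + norm (s i x - f x)"
          using norm_triangle_ineq[of "- (s i (x + h) - f (x + h)) + (s i (x + h) - s i x)" "s i x - f x"]
            norm_triangle_ineq[of "- (s i (x + h) - f (x + h))" "s i (x + h) - s i x"]
          by (simp add: norm_minus_commute)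
      qed (use int inth ints intf in auto)
      also have "\<dots> = (\<integral>x. norm (s i (x + h) - f (x + h)) \<partial>lborel) + (\<integral>x. norm (s i (x + h) - s i x) \<partial>lborel) + (\<integral>x. norm (s i x - f x) \<partial>lborel)"
        using int inth ints by simp
      also have "(\<integral>x. norm (s i (x + h) - f (x + h)) \<partial>lborel) = (\<integral>x. norm (s i x - f x) \<partial>lborel)"
        by (rule integral_lborel_translate[where f="\<lambda>x. norm (s i x - f x)"])
          (use borel_measurable_integrable[OF int] in simp)
      finally show "dist (\<integral>x. norm (f (x + h) - f x) \<partial>lborel) 0 < e" using i h by simp
    qed
  qed
qed

text \<open>
  A mollified function is an average of translates, so its \<open>L1\<close> distance to the function is at most the average of the
  \<open>L1\<close> distances of the translates.
\<close>

lemma nn_integral_mollify_diff_le: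
  fixes g :: "'a::euclidean_space \<Rightarrow> 'b::euclidean_space"
  assumes d: "d > 0" and g: "integrable lborel g"
    and e: "\<And>h. norm h < d \<Longrightarrow> (\<integral>x. norm (g (x + h) - g x) \<partial>lborel) \<le> e"
  shows "(\<integral>\<^sup>+x. ennreal (norm (mollify d g x - g x)) \<partial>lborel) \<le> ennreal e"
proof -
  note [measurable] = measurable_mollifier[OF d] borel_measurable_integrable[OF g]
  have le: "ennreal (norm (mollify d g x - g x)) \<le> (\<integral>\<^sup>+h. ennreal (mollifier d h * norm (g (x - h) - g x)) \<partial>lborel)" for x
  proof -
    have i1: "integrable lborel (\<lambda>t. mollifier d (x - t) *\<^sub>R g t)" by (rule integrable_mollify_integrand[OF d g])
    have i2: "integrable lborel (\<lambda>t. mollifier d (x - t) *\<^sub>R g x)"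
      by (intro integrable_scaleR_left impI integrable_lborel_reflect integrable_mollifier d)
    have "mollify d g x - g x = (\<integral>t. mollifier d (x - t) *\<^sub>R g t - mollifier d (x - t) *\<^sub>R g x \<partial>lborel)"
      using i1 i2 by (simp add: mollify_def integral_lborel_reflect[where f="mollifier d"] integral_mollifier[OF d] integrable_lborel_reflect integrable_mollifier[OF d])
    also have "\<dots> = (\<integral>t. mollifier d (x - t) *\<^sub>R (g t - g x) \<partial>lborel)" by (simp add: scaleR_diff_right)
    also have "\<dots> = (\<integral>h. mollifier d h *\<^sub>R (g (x - h) - g x) \<partial>lborel)"
      using integral_lborel_reflect[where f="\<lambda>h. mollifier d h *\<^sub>R (g (x - h) - g x)" and c=x] by simp
    finally have eq: "mollify d g x - g x = (\<integral>h. mollifier d h *\<^sub>R (g (x - h) - g x) \<partial>lborel)" .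
    have "integrable lborel (\<lambda>t. mollifier d (x - t) *\<^sub>R (g t - g x))"
      using Bochner_Integration.integrable_diff[OF i1 i2] by (simp add: scaleR_diff_right)
    from integrable_lborel_reflect[OF this, of x]
    have "integrable lborel (\<lambda>h. mollifier d h *\<^sub>R (g (x - h) - g x))" by simp
    from integral_norm_bound_ennreal[OF this] show ?thesis
      unfolding eq by (simp add: mollifier_nonneg[OF d])
  qed
  have "(\<integral>\<^sup>+x. ennreal (norm (mollify d g x - g x)) \<partial>lborel) \<le>
     (\<integral>\<^sup>+x. \<integral>\<^sup>+h. ennreal (mollifier d h * norm (g (x - h) - g x)) \<partial>lborel \<partial>lborel)"
    by (intro nn_integral_mono le)
  also have "\<dots> = (\<integral>\<^sup>+h. \<integral>\<^sup>+x. ennreal (mollifier d h * norm (g (x - h) - g x)) \<partial>lborel \<partial>lborel)"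
    by (rule lborel_pair.Fubini') measurable
  also have "\<dots> \<le> (\<integral>\<^sup>+h. ennreal (mollifier d (h::'a)) * ennreal e \<partial>lborel)"
  proof (intro nn_integral_mono)
    fix h :: 'a
    have i: "integrable lborel (\<lambda>x. norm (g (x + (-h)) - g x))"
      using g integrable_lborel_translate[OF g, of "-h"] by (intro integrable_norm Bochner_Integration.integrable_diff)
    have "(\<integral>\<^sup>+x. ennreal (mollifier d h * norm (g (x - h) - g x)) \<partial>lborel) = ennreal (mollifier d h) * (\<integral>\<^sup>+x. ennreal (norm (g (x + (-h)) - g x)) \<partial>lborel)"
      by (subst nn_integral_cmult[symmetric]) (auto simp: ennreal_mult mollifier_nonneg[OF d])
    also have "(\<integral>\<^sup>+x. ennreal (norm (g (x + (-h)) - g x)) \<partial>lborel) = ennreal (\<integral>x. norm (g (x + (-h)) - g x) \<partial>lborel)"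
      by (rule nn_integral_eq_integral[OF i]) auto
    also have "ennreal (mollifier d h) * ennreal (\<integral>x. norm (g (x + (-h)) - g x) \<partial>lborel) \<le> ennreal (mollifier d h) * ennreal e"
    proof (cases "norm h < d")
      case True
      then show ?thesis using e[of "-h"] by (intro mult_left_mono ennreal_leI) auto
    next
      case False then show ?thesis using mollifier_zero[OF d, of h] by simp
    qed
    finally show "(\<integral>\<^sup>+x. ennreal (mollifier d h * norm (g (x - h) - g x)) \<partial>lborel) \<le> ennreal (mollifier d h) * ennreal e" .
  qed
  also have "\<dots> = ennreal e"
    using nn_integral_eq_integral[OF integrable_mollifier[OF d, where 'a='a]]
    by (simp add: nn_integral_multc integral_mollifier[OF d] mollifier_nonneg[OF d])
  finally show ?thesis .
qed

lemma integrable_mollify: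
  fixes g :: "'a::euclidean_space \<Rightarrow> 'b::euclidean_space"
  assumes d: "d > 0" and g: "integrable lborel g"
  shows "integrable lborel (mollify d g)"
proof -
  have gh: "integrable lborel (\<lambda>x. g (x + h))" for h by (rule integrable_lborel_translate[OF g])
  have "(\<integral>x. norm (g (x + h) - g x) \<partial>lborel) \<le> 2 * (\<integral>x. norm (g x) \<partial>lborel)" for h
  proof -
    have "(\<integral>x. norm (g (x + h) - g x) \<partial>lborel) \<le> (\<integral>x. norm (g (x + h)) + norm (g x) \<partial>lborel)"
      using g gh by (intro integral_mono norm_triangle_ineq4) auto
    also have "\<dots> = (\<integral>x. norm (g x) \<partial>lborel) + (\<integral>x. norm (g x) \<partial>lborel)"
      using g gh integral_lborel_translate[of "\<lambda>x. norm (g x)" h] borel_measurable_integrable[OF g] by simp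
    finally show ?thesis by simp
  qed
  from nn_integral_mollify_diff_le[OF d g this]
  have "(\<integral>\<^sup>+x. ennreal (norm (mollify d g x - g x)) \<partial>lborel) < \<infinity>"
    using ennreal_less_top order_le_less_trans by fastforce
  moreover have "(\<lambda>x. mollify d g x - g x) \<in> borel_measurable lborel"
    using borel_measurable_continuous_onI[OF continuous_mollify[OF d g]] borel_measurable_integrable[OF g] by simp
  ultimately have "integrable lborel (\<lambda>x. mollify d g x - g x)"
    by (intro integrableI_bounded) auto
  from Bochner_Integration.integrable_add[OF this g] show ?thesis by simp
qed

lemma mollify_tendsto_L1:
  fixes g :: "'a::euclidean_space \<Rightarrow> 'b::euclidean_space"
  assumes g: "integrable lborel g"
  shows "((\<lambda>d. \<integral>x. norm (mollify d g x - g x) \<partial>lborel) \<longlongrightarrow> 0) (at_right 0)"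
proof (rule tendstoI)
  fix e :: real assume e: "e > 0"
  have "\<forall>\<^sub>F h in at 0. dist (\<integral>x. norm (g (x + h) - g x) \<partial>lborel) 0 < e / 2"
    using tendstoD[OF translation_continuous_L1[OF g], of "e/2"] e by auto
  then obtain s where s: "s > 0" "\<And>h. h \<noteq> 0 \<Longrightarrow> norm h < s \<Longrightarrow> (\<integral>x. norm (g (x + h) - g x) \<partial>lborel) < e / 2"
    unfolding eventually_at by (auto simp: dist_norm)
  have s': "(\<integral>x. norm (g (x + h) - g x) \<partial>lborel) \<le> e / 2" if "norm h < s" for h
    using s(2)[of h] that e by (cases "h = 0") auto
  show "\<forall>\<^sub>F d in at_right 0. dist (\<integral>x. norm (mollify d g x - g x) \<partial>lborel) 0 < e"
    using eventually_at_right_less[of 0] eventually_at_right_real[OF s(1)]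
  proof eventually_elim
    fix d :: real assume d: "0 < d" and ds: "d \<in> {0<..<s}"
    have "ennreal (\<integral>x. norm (mollify d g x - g x) \<partial>lborel) = (\<integral>\<^sup>+x. ennreal (norm (mollify d g x - g x)) \<partial>lborel)"
      using integrable_mollify[OF d g] g by (intro nn_integral_eq_integral[symmetric]) auto
    also have "\<dots> \<le> ennreal (e / 2)"
      by (rule nn_integral_mollify_diff_le[OF d g]) (use s' ds in auto)
    finally show "dist (\<integral>x. norm (mollify d g x - g x) \<partial>lborel) 0 < e"
      using e by (simp add: ennreal_le_iff)
  qed
qed

definition mollify_gradient :: "real \<Rightarrow> ('a::euclidean_space \<Rightarrow> real) \<Rightarrow> 'a \<Rightarrow> 'a" where
  "mollify_gradient d f x = (\<integral>t. f t *\<^sub>R mollifier_grad d (x - t) \<partial>lborel)"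

lemma integrable_mollify_gradient:
  fixes f :: "'a::euclidean_space \<Rightarrow> real"
  assumes d: "d > 0" and f: "integrable lborel f"
  shows "integrable lborel (\<lambda>t. f t *\<^sub>R mollifier_grad d (x - t))"
proof -
  obtain B where B: "B \<ge> 0" "\<And>x::'a. norm (mollifier_grad d x) \<le> B" using mollifier_grad_bound[OF d] by metis
  note [measurable] = measurable_mollifier_grad[OF d] borel_measurable_integrable[OF f]
  show ?thesis
  proof (rule Bochner_Integration.integrable_bound[where f="\<lambda>t. B * f t"])
    show "AE t in lborel. norm (f t *\<^sub>R mollifier_grad d (x - t)) \<le> norm (B * f t)"
    proof (intro AE_I2)
      fix t
      have "\<bar>f t\<bar> * norm (mollifier_grad d (x - t)) \<le> \<bar>f t\<bar> * B" using B by (intro mult_left_mono) auto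
      then show "norm (f t *\<^sub>R mollifier_grad d (x - t)) \<le> norm (B * f t)" using B(1) by (simp add: abs_mult mult.commute)
    qed
  qed (use f in auto)
qed

lemma has_derivative_mollify_real:
  fixes f :: "'a::euclidean_space \<Rightarrow> real"
  assumes d: "d > 0" and f: "integrable lborel f"
  shows "(mollify d f has_derivative (\<lambda>h. mollify_gradient d f x \<bullet> h)) (at x)"
proof -
  have "(\<integral>t. (mollifier_grad d (x - t) \<bullet> h) *\<^sub>R f t \<partial>lborel) = mollify_gradient d f x \<bullet> h" for h
    unfolding mollify_gradient_def
    using integral_inner_left[OF integrable_mollify_gradient[OF d f, of x], of h] by (simp add: mult.commute)
  then show ?thesis using has_derivative_mollify[OF d f, of x] by simp
qed

lemma continuous_mollify_gradient:
  fixes f :: "'a::euclidean_space \<Rightarrow> real"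
  assumes d: "d > 0" and f: "integrable lborel f"
  shows "continuous_on UNIV (mollify_gradient d f)"
proof -
  have "continuous_on UNIV (\<lambda>x. mollify_gradient d f x \<bullet> h)" for h
  proof -
    have "(\<integral>t. (mollifier_grad d (x - t) \<bullet> h) *\<^sub>R f t \<partial>lborel) = mollify_gradient d f x \<bullet> h" for x
      unfolding mollify_gradient_def
      using integral_inner_left[OF integrable_mollify_gradient[OF d f, of x], of h] by (simp add: mult.commute)
    then show ?thesis using continuous_mollify_derivative[OF d f, of h] by simp
  qed
  then show ?thesis by (intro continuous_on_componentwise[THEN iffD2]) auto
qed

section \<open>Compactly supported \<open>C1\<close> fields and the divergence theorem on subgraphs\<close>

text \<open>
  The part of the divergence that differentiates in the directions of the first factor.
\<close>

definition hdivergence :: "('a::euclidean_space \<times> real \<Rightarrow> 'a \<times> real) \<Rightarrow> 'a \<times> real \<Rightarrow> real" where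
  "hdivergence \<phi> p = (\<Sum>i\<in>Basis. frechet_derivative \<phi> (at p) (i, 0) \<bullet> (i, 0))"

lemma C1_compact_support_has_derivative:
  assumes "\<phi> \<in> C1_compact_support S"
  shows "(\<phi> has_derivative frechet_derivative \<phi> (at x)) (at x)"
proof -
  obtain D where "(\<phi> has_derivative blinfun_apply (D x)) (at x)"
    using assms unfolding C1_compact_support_def by auto
  then show ?thesis by (metis frechet_derivative_at)
qed

lemma C1_compact_support_continuous:
  assumes "\<phi> \<in> C1_compact_support S"
  shows "continuous_on UNIV \<phi>"
  by (rule has_derivative_continuous_on[where f'="\<lambda>x. frechet_derivative \<phi> (at x)"])
    (simp add: C1_compact_support_has_derivative[OF assms])

lemma C1_compact_support_continuous_derivative:
  assumes "\<phi> \<in> C1_compact_support S"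
  shows "continuous_on UNIV (\<lambda>x. frechet_derivative \<phi> (at x) h)"
proof -
  obtain D where D: "\<And>x. (\<phi> has_derivative blinfun_apply (D x)) (at x)" "continuous_on UNIV D"
    using assms unfolding C1_compact_support_def by auto
  have "frechet_derivative \<phi> (at x) = blinfun_apply (D x)" for x
    using frechet_derivative_at[OF D(1)] by simp
  then show ?thesis by (simp add: D(2) bounded_linear.continuous_on[OF blinfun.bounded_linear_left])
qed

lemma C1_compact_support_obtain:
  assumes "\<phi> \<in> C1_compact_support S"
  obtains K where "compact K" "K \<subseteq> S" "\<And>x. x \<notin> K \<Longrightarrow> \<phi> x = 0"
    "\<And>x h. x \<notin> K \<Longrightarrow> frechet_derivative \<phi> (at x) h = 0"
proof (rule that)
  let ?K = "closure {x. \<phi> x \<noteq> 0}"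
  show "compact ?K" "?K \<subseteq> S" using assms by (auto simp: C1_compact_support_def)
  show 0: "\<phi> x = 0" if "x \<notin> ?K" for x using that closure_subset[of "{x. \<phi> x \<noteq> 0}"] by auto
  show "frechet_derivative \<phi> (at x) h = 0" if "x \<notin> ?K" for x h
  proof -
    have "((\<lambda>x. 0) has_derivative (\<lambda>h. 0)) (at x)" by simp
    then have "(\<phi> has_derivative (\<lambda>h. 0)) (at x)"
    proof (rule has_derivative_transform_within_open)
      show "open (- ?K)" by auto
      show "x \<in> - ?K" using that by blast
      show "0 = \<phi> y" if "y \<in> - ?K" for y using 0[of y] that by (metis ComplD)
    qed
    then show ?thesis using frechet_derivative_at by metis
  qed
qed

lemma C1_compact_supportI:
  fixes \<phi> :: "'a::euclidean_space \<Rightarrow> 'a"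
  assumes D: "\<And>x. (\<phi> has_derivative D x) (at x)" and cont: "\<And>b. b \<in> Basis \<Longrightarrow> continuous_on UNIV (\<lambda>x. D x b)"
    and K: "compact K" "K \<subseteq> S" "\<And>x. x \<notin> K \<Longrightarrow> \<phi> x = 0"
  shows "\<phi> \<in> C1_compact_support S"
proof -
  have ap: "blinfun_apply (Blinfun (D x)) = D x" for x
    using bounded_linear_Blinfun_apply[OF has_derivative_bounded_linear[OF D]] .
  have "continuous_on UNIV (\<lambda>x. Blinfun (D x))"
    by (rule continuous_on_blinfun_componentwise) (simp add: ap cont)
  moreover have "\<And>x. (\<phi> has_derivative blinfun_apply (Blinfun (D x))) (at x)" using D ap by simp
  moreover have "closure {x. \<phi> x \<noteq> 0} \<subseteq> K"
    by (rule closure_minimal) (use K compact_imp_closed in auto)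
  moreover have "compact (closure {x. \<phi> x \<noteq> 0})"
    using \<open>closure {x. \<phi> x \<noteq> 0} \<subseteq> K\<close> K(1) by (metis closed_Int_compact closed_closure inf.absorb_iff1)
  ultimately show ?thesis using K(2) unfolding C1_compact_support_def
    by (auto intro!: exI[of _ "\<lambda>x. Blinfun (D x)"])
qed

text \<open>
  This is the source of all test fields: the support grows by at most \<open>d\<close>, and measurability and integrability of \<open>g\<close>
  suffice.
\<close>

lemma mollify_C1_compact_support:
  fixes g :: "'a::euclidean_space \<Rightarrow> 'a"
  assumes d: "d > 0" and g: "integrable lborel g" and K: "compact K" "\<And>x. x \<notin> K \<Longrightarrow> g x = 0"
    and S: "\<And>x y. x \<in> K \<Longrightarrow> dist x y \<le> d \<Longrightarrow> y \<in> S"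
  shows "mollify d g \<in> C1_compact_support S"
proof (rule C1_compact_supportI[OF has_derivative_mollify[OF d g]])
  let ?K = "{x + y |x y. x \<in> K \<and> y \<in> cball 0 d}"
  show "compact ?K" by (intro compact_sums K compact_cball)
  show "?K \<subseteq> S" using S by (auto simp: dist_norm)
  show "mollify d g x = 0" if "x \<notin> ?K" for x
  proof (rule mollify_eq_0[OF d])
    fix t assume t: "dist x t < d"
    show "g t = 0"
    proof (rule K(2), rule notI)
      assume "t \<in> K"
      moreover have "x = t + (x - t)" "x - t \<in> cball 0 d" using t by (auto simp: dist_norm norm_minus_commute)
      ultimately show False using that by blast
    qed
  qed
qed (intro continuous_mollify_derivative[OF d g])

lemma frechet_derivative_mollify:
  fixes g :: "'a::euclidean_space \<Rightarrow> 'b::euclidean_space"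
  assumes d: "d > 0" and g: "integrable lborel g"
  shows "frechet_derivative (mollify d g) (at x) h \<bullet> b = (\<integral>t. mollifier_grad d (x - t) \<bullet> ((g t \<bullet> b) *\<^sub>R h) \<partial>lborel)"
proof -
  have "frechet_derivative (mollify d g) (at x) h = (\<integral>t. (mollifier_grad d (x - t) \<bullet> h) *\<^sub>R g t \<partial>lborel)"
    using frechet_derivative_at[OF has_derivative_mollify[OF d g], of x] by metis
  then show ?thesis
    using integral_inner_left[OF integrable_mollify_grad_integrand[OF d g, of x h], of b]
    by (simp add: mult.commute)
qed

lemma integrable_mollify_grad_inner:
  fixes g :: "'a::euclidean_space \<Rightarrow> 'b::euclidean_space"
  assumes d: "d > 0" and g: "integrable lborel g"
  shows "integrable lborel (\<lambda>t. mollifier_grad d (x - t) \<bullet> ((g t \<bullet> b) *\<^sub>R h))"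
proof -
  have "integrable lborel (\<lambda>t. ((mollifier_grad d (x - t) \<bullet> h) *\<^sub>R g t) \<bullet> b)"
    by (intro integrable_inner_left impI integrable_mollify_grad_integrand[OF d g])
  then show ?thesis by (simp add: mult.commute)
qed

lemma divergence_mollify:
  fixes g :: "'a::euclidean_space \<Rightarrow> 'a"
  assumes d: "d > 0" and g: "integrable lborel g"
  shows "divergence (mollify d g) x = (\<integral>t. mollifier_grad d (x - t) \<bullet> g t \<partial>lborel)"
proof -
  have "divergence (mollify d g) x = (\<Sum>b\<in>Basis. \<integral>t. mollifier_grad d (x - t) \<bullet> ((g t \<bullet> b) *\<^sub>R b) \<partial>lborel)"
    unfolding divergence_def frechet_derivative_mollify[OF d g] ..
  also have "\<dots> = (\<integral>t. (\<Sum>b\<in>Basis. mollifier_grad d (x - t) \<bullet> ((g t \<bullet> b) *\<^sub>R b)) \<partial>lborel)"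
    by (rule Bochner_Integration.integral_sum[symmetric]) (rule integrable_mollify_grad_inner[OF d g])
  also have "(\<lambda>t. \<Sum>b\<in>Basis. mollifier_grad d (x - t) \<bullet> ((g t \<bullet> b) *\<^sub>R b)) = (\<lambda>t. mollifier_grad d (x - t) \<bullet> g t)"
    unfolding inner_sum_right[symmetric] euclidean_representation ..
  finally show ?thesis .
qed

lemma hdivergence_mollify:
  fixes g :: "'a::euclidean_space \<times> real \<Rightarrow> 'a \<times> real"
  assumes d: "d > 0" and g: "integrable lborel g"
  shows "hdivergence (mollify d g) x = (\<integral>t. mollifier_grad d (x - t) \<bullet> (fst (g t), 0) \<partial>lborel)"
proof -
  let ?F = "\<lambda>i t. mollifier_grad d (x - t) \<bullet> ((g t \<bullet> (i, 0)) *\<^sub>R (i, 0))"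
  have e: "(\<Sum>i\<in>Basis. ?F i t) = mollifier_grad d (x - t) \<bullet> (fst (g t), 0)" for t
  proof -
    have "(\<Sum>i\<in>Basis. ?F i t) = (\<Sum>i\<in>Basis. (fst (mollifier_grad d (x - t)) \<bullet> i) * (fst (g t) \<bullet> i))"
      by (rule sum.cong) (simp_all add: inner_prod_def)
    then show ?thesis
      using euclidean_inner[of "fst (mollifier_grad d (x - t))" "fst (g t)"] by (simp add: inner_prod_def)
  qed
  have "hdivergence (mollify d g) x = (\<Sum>i\<in>Basis. \<integral>t. ?F i t \<partial>lborel)"
    unfolding hdivergence_def by (rule sum.cong[OF refl]) (rule frechet_derivative_mollify[OF d g])
  also have "\<dots> = (\<integral>t. (\<Sum>i\<in>Basis. ?F i t) \<partial>lborel)"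
    by (rule Bochner_Integration.integral_sum[of Basis lborel ?F, symmetric]) (rule integrable_mollify_grad_inner[OF d g])
  finally show ?thesis using e by simp
qed

lemma divergence_eq_hdivergence:
  "divergence \<phi> p = hdivergence \<phi> p + frechet_derivative \<phi> (at p) (0, 1) \<bullet> (0, 1)"
proof -
  let ?f = "\<lambda>b. frechet_derivative \<phi> (at p) b \<bullet> b"
  have "sum ?f Basis = sum ?f ((\<lambda>u. (u, 0)) ` Basis) + sum ?f (Pair 0 ` Basis)"
    unfolding Basis_prod_def by (rule sum.union_disjoint) (auto dest: nonzero_Basis)
  also have "sum ?f ((\<lambda>u. (u, 0)) ` Basis) = hdivergence \<phi> p"
    unfolding hdivergence_def by (subst sum.reindex) (simp_all add: inj_on_def)
  also have "sum ?f (Pair 0 ` Basis) = ?f (0, 1)"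
    by simp
  finally show ?thesis unfolding divergence_def .
qed

lemma continuous_hdivergence:
  assumes "\<phi> \<in> C1_compact_support S"
  shows "continuous_on UNIV (hdivergence \<phi>)"
  unfolding hdivergence_def
  by (intro continuous_on_sum continuous_on_inner[OF C1_compact_support_continuous_derivative[OF assms] continuous_on_const])

text \<open>
  The integral of \<open>F\<close> is invariant under translation in the direction \<open>e\<close>, so its derivative vanishes. Only the derivative
  along \<open>e\<close> is used, which suits functions composed with a graph.
\<close>

lemma integral_directional_derivative_eq_0:
  fixes F D :: "'a::euclidean_space \<Rightarrow> real"
  assumes F: "continuous_on UNIV F" and D: "continuous_on UNIV D"
    and der: "\<And>x. ((\<lambda>t. F (x + t *\<^sub>R e)) has_real_derivative D x) (at 0)"
    and K: "compact K" "\<And>x. x \<notin> K \<Longrightarrow> F x = 0" "\<And>x. x \<notin> K \<Longrightarrow> D x = 0"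
  shows "(\<integral>x. D x \<partial>lborel) = 0"
proof -
  have Fm[measurable]: "F \<in> borel_measurable borel" and Dm[measurable]: "D \<in> borel_measurable borel"
    using F D by (auto intro: borel_measurable_continuous_onI)
  obtain B where B: "B \<ge> 0" "\<And>x. norm (D x) \<le> B" using bounded_compact_support[OF D K(1,3)] by metis
  obtain A where A: "\<And>x. norm (F x) \<le> A" using bounded_compact_support[OF F K(1,2)] by metis
  have intF: "integrable lborel F" by (rule integrable_compact_support[OF Fm compact_imp_bounded[OF K(1)] K(2) A])
  define t where "t n = 1 / real (Suc n)" for n
  have t: "0 < t n" "t n \<le> 1" for n by (auto simp: t_def)
  have tlim: "t \<longlonglongrightarrow> 0" unfolding t_def using LIMSEQ_inverse_real_of_nat by (simp add: inverse_eq_divide)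
  let ?K = "{x + y |x y. x \<in> K \<and> y \<in> cball 0 (norm e)}"
  have Kc: "compact ?K" by (intro compact_sums K compact_cball)
  have der': "((\<lambda>t. F (x + t *\<^sub>R e)) has_real_derivative D (x + s *\<^sub>R e)) (at s)" for x s
  proof -
    have "((\<lambda>u. F ((x + s *\<^sub>R e) + u *\<^sub>R e)) has_real_derivative D (x + s *\<^sub>R e)) (at (s - s))" using der by simp
    then have "((\<lambda>t. F ((x + s *\<^sub>R e) + (t - s) *\<^sub>R e)) has_real_derivative D (x + s *\<^sub>R e) * 1) (at s)"
      by (rule DERIV_chain2) (auto intro!: derivative_eq_intros)
    then show ?thesis by (simp add: algebra_simps)
  qed
  have bound: "norm ((F (x + t n *\<^sub>R e) - F x) / t n) \<le> B * indicator ?K x" for x n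
  proof (cases "x \<in> ?K")
    case True
    obtain s where "F (x + t n *\<^sub>R e) - F (x + 0 *\<^sub>R e) = (t n - 0) * D (x + s *\<^sub>R e)"
      using MVT2[OF t(1)[of n], of "\<lambda>t. F (x + t *\<^sub>R e)" "\<lambda>s. D (x + s *\<^sub>R e)"] der' by blast
    then show ?thesis using True B(2)[of "x + s *\<^sub>R e"] t(1)[of n] by (simp add: abs_mult)
  next
    case False
    have "y \<notin> K" if "norm (x - y) \<le> norm e" for y
    proof
      assume "y \<in> K"
      then have "y + (x - y) \<in> ?K" using that by fastforce
      then show False using False by simp
    qed
    from this[of x] this[of "x + t n *\<^sub>R e"] have "x \<notin> K" "x + t n *\<^sub>R e \<notin> K"
      using t[of n] mult_right_mono[of "t n" 1 "norm e"] by auto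
    then show ?thesis using K B(1) by simp
  qed
  have "(\<lambda>n. \<integral>x. (F (x + t n *\<^sub>R e) - F x) / t n \<partial>lborel) \<longlonglongrightarrow> (\<integral>x. D x \<partial>lborel)"
  proof (rule integral_dominated_convergence[where w="\<lambda>x. B * indicator ?K x"])
    show "integrable lborel (\<lambda>x. B * indicator ?K x)"
      by (intro integrable_mult_right impI integrable_real_indicator)
       (use borel_closed[OF compact_imp_closed[OF Kc]] emeasure_bounded_finite[OF compact_imp_bounded[OF Kc]] in simp_all)
    show "AE x in lborel. (\<lambda>n. (F (x + t n *\<^sub>R e) - F x) / t n) \<longlonglongrightarrow> D x"
    proof (intro AE_I2)
      fix x
      have "((\<lambda>h. (F (x + h *\<^sub>R e) - F x) / h) \<longlongrightarrow> D x) (at 0)" using der[of x] by (simp add: DERIV_def)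
      then show "(\<lambda>n. (F (x + t n *\<^sub>R e) - F x) / t n) \<longlonglongrightarrow> D x"
      proof (rule filterlim_compose)
        show "filterlim t (at 0) sequentially"
          unfolding filterlim_at using tlim t(1) by (auto intro!: always_eventually simp: less_imp_neq[symmetric])
      qed
    qed
  qed (use bound in auto)
  moreover have "(\<integral>x. (F (x + t n *\<^sub>R e) - F x) / t n \<partial>lborel) = 0" for n
    by (simp add: intF integrable_lborel_translate[OF intF] integral_lborel_translate[OF Fm])
  ultimately have "(\<lambda>n::nat. 0) \<longlonglongrightarrow> (\<integral>x. D x \<partial>lborel)" by (simp only:)
  then show ?thesis by (simp add: LIMSEQ_const_iff)
qed

lemma integral_derivative_lessThan:
  fixes g g' :: "real \<Rightarrow> real"
  assumes g: "\<And>c. (g has_real_derivative g' c) (at c)" and g': "continuous_on UNIV g'"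
    and K: "bounded K" "\<And>c. c \<notin> K \<Longrightarrow> g c = 0" "\<And>c. c \<notin> K \<Longrightarrow> g' c = 0"
  shows "(\<integral>c. indicator {..<s} c * g' c \<partial>lborel) = g s"
proof -
  obtain b where b: "\<And>c. c \<in> K \<Longrightarrow> \<bar>c\<bar> \<le> b" "b > 0" using K(1) bounded_pos by (metis real_norm_def)
  define a where "a = min (- b - 1) (s - 1)"
  have a: "a \<le> s" "\<And>c. c \<le> a \<Longrightarrow> c \<notin> K" using b by (fastforce simp: a_def)+
  have *: "has_bochner_integral lborel (\<lambda>x. g' x * indicator {a .. s} x) (g s - g a)"
    by (rule has_bochner_integral_FTC_Icc_real[OF a(1) g]) (use g' in \<open>auto simp: continuous_on_eq_continuous_at\<close>)
  have "(\<integral>c. indicator {..<s} c * g' c \<partial>lborel) = (\<integral>x. g' x * indicator {a .. s} x \<partial>lborel)"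
  proof (rule integral_cong_AE)
    have [measurable]: "g' \<in> borel_measurable borel" using g' by (rule borel_measurable_continuous_onI)
    show "(\<lambda>c. indicator {..<s} c * g' c) \<in> borel_measurable lborel" "(\<lambda>x. g' x * indicator {a .. s} x) \<in> borel_measurable lborel"
      by measurable
    show "AE x in lborel. indicator {..<s} x * g' x = g' x * indicator {a..s} x"
      using AE_lborel_singleton[of s]
    proof eventually_elim
      fix x assume "x \<noteq> s"
      then show "indicator {..<s} x * g' x = g' x * indicator {a..s} x"
        using a(2)[of x] K(3)[of x] by (cases "x \<ge> a") (auto simp: indicator_def)
    qed
  qed
  also have "\<dots> = g s - g a" using * by (rule has_bochner_integral_integral_eq)
  also have "g a = 0" using a K by auto
  finally show ?thesis by simp
qed

lemma vertical_derivative: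
  fixes \<Phi> :: "'a::euclidean_space \<times> real \<Rightarrow> 'a \<times> real"
  assumes "\<Phi> \<in> C1_compact_support S"
  shows "((\<lambda>c. \<Phi> (x, c) \<bullet> p) has_real_derivative (frechet_derivative \<Phi> (at (x, c)) (0, 1) \<bullet> p)) (at c)"
proof -
  let ?D = "frechet_derivative \<Phi> (at (x, c))"
  have lin: "linear ?D"
    using C1_compact_support_has_derivative[OF assms] has_derivative_linear by blast
  have "((\<lambda>c. (x, c)) has_derivative (\<lambda>t. (0, t))) (at c)" by (auto intro!: derivative_eq_intros)
  from has_derivative_compose[OF this C1_compact_support_has_derivative[OF assms]]
  have "((\<lambda>c. \<Phi> (x, c) \<bullet> p) has_derivative (\<lambda>t. ?D (0, t) \<bullet> p)) (at c)"
    by (rule has_derivative_inner_left)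
  moreover have "(\<lambda>t. ?D (0, t) \<bullet> p) = (*) (?D (0, 1) \<bullet> p)"
  proof
    fix t show "?D (0, t) \<bullet> p = (?D (0, 1) \<bullet> p) * t"
      using linear_scale[OF lin, of t "(0, 1)"] by simp
  qed
  ultimately show ?thesis unfolding has_field_derivative_def by metis
qed

lemma integral_vertical_derivative:
  fixes \<Phi> :: "'a::euclidean_space \<times> real \<Rightarrow> 'a \<times> real"
  assumes \<Phi>: "\<Phi> \<in> C1_compact_support S"
  shows "(\<integral>c. indicator {..<s} c * (frechet_derivative \<Phi> (at (x, c)) (0, 1) \<bullet> p) \<partial>lborel) = \<Phi> (x, s) \<bullet> p"
proof -
  obtain K where K: "compact K" "K \<subseteq> S" "\<And>x. x \<notin> K \<Longrightarrow> \<Phi> x = 0"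
    "\<And>x h. x \<notin> K \<Longrightarrow> frechet_derivative \<Phi> (at x) h = 0"
    by (rule C1_compact_support_obtain[OF \<Phi>]) (rule that)
  show ?thesis
  proof (rule integral_derivative_lessThan[where K="snd ` K" and g="\<lambda>c. \<Phi> (x, c) \<bullet> p"])
    show "bounded (snd ` K)" using K(1) by (intro compact_imp_bounded compact_continuous_image) (auto intro: continuous_intros)
    show "continuous_on UNIV (\<lambda>c. frechet_derivative \<Phi> (at (x, c)) (0, 1) \<bullet> p)"
      by (intro continuous_intros continuous_on_compose2[OF C1_compact_support_continuous_derivative[OF \<Phi>]]) auto
    show "\<Phi> (x, c) \<bullet> p = 0" if "c \<notin> snd ` K" for c using that K(3)[of "(x, c)"] by force
    show "frechet_derivative \<Phi> (at (x, c)) (0, 1) \<bullet> p = 0" if "c \<notin> snd ` K" for c using that K(4)[of "(x, c)"] by force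
  qed (rule vertical_derivative[OF \<Phi>])
qed

lemma borel_measurable_fst [measurable]:
  "(fst :: 'a::second_countable_topology \<times> 'b::second_countable_topology \<Rightarrow> 'a) \<in> borel \<rightarrow>\<^sub>M borel"
  by (metis borel_prod measurable_fst)

lemma borel_measurable_snd [measurable]:
  "(snd :: 'a::second_countable_topology \<times> 'b::second_countable_topology \<Rightarrow> 'b) \<in> borel \<rightarrow>\<^sub>M borel"
  by (metis borel_prod measurable_snd)

lemma borel_measurable_Pair' [measurable (raw)]:
  fixes f :: "'c \<Rightarrow> 'a::second_countable_topology" and g :: "'c \<Rightarrow> 'b::second_countable_topology"
  assumes "f \<in> M \<rightarrow>\<^sub>M borel" "g \<in> M \<rightarrow>\<^sub>M borel"
  shows "(\<lambda>x. (f x, g x)) \<in> M \<rightarrow>\<^sub>M borel"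
  using measurable_Pair[OF assms] by (simp add: borel_prod)

text \<open>
  The left side is the flux of the horizontal part of \<open>\<Phi>\<close> through the graph of \<open>h\<close>. The field is shifted down along the
  graph: for fixed \<open>\<tau>\<close> the function \<open>x \<mapsto> \<Phi>(x, h x - \<tau>)\<close> has compact support, so the integrals of its
  derivatives vanish; integrating over \<open>\<tau> > 0\<close> sweeps out the subgraph, and the part of the derivative that comes from
  \<open>\<nabla>h\<close> is a vertical derivative, which integrates to the value on the graph.
\<close>

lemma subgraph_divergence:
  fixes \<Phi> :: "'a::euclidean_space \<times> real \<Rightarrow> 'a \<times> real" and h :: "'a \<Rightarrow> real" and H :: "'a \<Rightarrow> 'a"
  assumes \<Phi>: "\<Phi> \<in> C1_compact_support S"
    and h: "\<And>x. (h has_derivative (\<lambda>d. H x \<bullet> d)) (at x)" and H: "continuous_on UNIV H"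
  shows "(\<integral>x. fst (\<Phi> (x, h x)) \<bullet> H x \<partial>lborel)
     = - (\<integral>x. (\<integral>c. indicator {..<h x} c * hdivergence \<Phi> (x, c) \<partial>lborel) \<partial>lborel)"
    and "integrable lborel (\<lambda>x. fst (\<Phi> (x, h x)) \<bullet> H x)"
    and "integrable lborel (\<lambda>x. \<integral>c. indicator {..<h x} c * hdivergence \<Phi> (x, c) \<partial>lborel)"
proof -
  let ?D = "\<lambda>p. frechet_derivative \<Phi> (at p)"
  obtain K where K: "compact K" "K \<subseteq> S" "\<And>x. x \<notin> K \<Longrightarrow> \<Phi> x = 0"
    "\<And>x h. x \<notin> K \<Longrightarrow> ?D x h = 0"
    by (rule C1_compact_support_obtain[OF \<Phi>]) (rule that)
  have lin: "linear (?D p)" for p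
    using C1_compact_support_has_derivative[OF \<Phi>] has_derivative_linear by blast
  have contD: "continuous_on UNIV (\<lambda>x. ?D x h)" for h
    by (rule C1_compact_support_continuous_derivative[OF \<Phi>])
  have cont\<Phi>: "continuous_on UNIV \<Phi>" by (rule C1_compact_support_continuous[OF \<Phi>])
  have conth: "continuous_on UNIV h"
    by (rule has_derivative_continuous_on[where f'="\<lambda>x d. H x \<bullet> d"]) (simp add: h)
  have K1: "compact (fst ` K)" and K2: "compact (snd ` K)"
    using K(1) by (auto intro!: compact_continuous_image continuous_intros)
  have "bounded (snd ` K)" "bounded (h ` (fst ` K))"
    using K2 K1 conth by (auto intro!: compact_imp_bounded compact_continuous_image continuous_on_subset[OF conth])
  then obtain b1 b2 where b: "\<And>p. p \<in> K \<Longrightarrow> \<bar>snd p\<bar> \<le> b1" "\<And>x. x \<in> fst ` K \<Longrightarrow> \<bar>h x\<bar> \<le> b2"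
    unfolding bounded_iff by (metis (no_types, lifting) imageI real_norm_def)
  \<comment> \<open>the derivative of \<open>\<Phi> (x, h x - \<tau>) \<bullet> (i, 0)\<close> in direction \<open>i\<close>\<close>
  define G where "G i = (\<lambda>(x, \<tau>). ?D (x, h x - \<tau>) (i, 0) \<bullet> (i, 0) + (H x \<bullet> i) * (?D (x, h x - \<tau>) (0, 1) \<bullet> (i, 0)))" for i
  have contG: "continuous_on UNIV (G i)" for i
    unfolding G_def split_def
    by (intro continuous_on_add continuous_on_mult continuous_on_inner continuous_on_const
       continuous_on_compose2[OF contD] continuous_on_Pair continuous_on_fst continuous_on_snd continuous_on_id
       continuous_on_diff continuous_on_compose2[OF conth] continuous_on_compose2[OF H]) auto
  have G0: "G i (x, \<tau>) = 0" if "x \<notin> fst ` K \<or> \<bar>\<tau>\<bar> > b1 + b2" for i x \<tau>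
  proof -
    have "(x, h x - \<tau>) \<notin> K"
    proof
      assume k: "(x, h x - \<tau>) \<in> K"
      then have "x \<in> fst ` K" by force
      moreover have "\<bar>h x - \<tau>\<bar> \<le> b1" using b(1)[OF k] by simp
      ultimately show False using b(2)[of x] that by auto
    qed
    then show ?thesis by (simp add: G_def K(4))
  qed
  have measG[measurable]: "G i \<in> borel_measurable borel" for i
    by (intro borel_measurable_continuous_onI contG)
  have compKG: "compact (fst ` K \<times> {- (b1 + b2) .. b1 + b2})" using K1 by (intro compact_Times) auto
  have G0': "G i p = 0" if "p \<notin> fst ` K \<times> {- (b1 + b2) .. b1 + b2}" for i p
  proof -
    have "fst p \<notin> fst ` K \<or> \<bar>snd p\<bar> > b1 + b2" using that by (cases p) (auto simp: abs_if split: if_splits)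
    from G0[OF this] show ?thesis by simp
  qed
  have intG: "integrable (lborel \<Otimes>\<^sub>M lborel) (\<lambda>(x, \<tau>). indicator {0<..} \<tau> * G i (x, \<tau>))" for i
  proof -
    obtain B where B: "\<And>p. norm (G i p) \<le> B"
      using bounded_compact_support[OF contG compKG G0'] by metis
    have "integrable lborel (\<lambda>p. indicator {0<..} (snd p) * G i p)"
    proof (rule integrable_compact_support[where B=B])
      show "bounded (fst ` K \<times> {- (b1 + b2) .. b1 + b2})" using compKG by (rule compact_imp_bounded)
      show "norm (indicator {0<..} (snd p) * G i p) \<le> B" for p
        using B[of p] norm_ge_zero[of "G i p"] by (auto simp: indicator_def simp del: norm_ge_zero)
      show "(\<lambda>p. indicator {0<..} (snd p) * G i p) \<in> borel_measurable borel" by measurable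
    qed (use G0' in \<open>auto\<close>)
    then show ?thesis by (simp add: lborel_prod split_def)
  qed
  have zero: "(\<integral>x. G i (x, \<tau>) \<partial>lborel) = 0" for i \<tau>
  proof (rule integral_directional_derivative_eq_0[where F="\<lambda>x. \<Phi> (x, h x - \<tau>) \<bullet> (i, 0)" and e=i and K="fst ` K"])
    show "continuous_on UNIV (\<lambda>x. \<Phi> (x, h x - \<tau>) \<bullet> (i, 0))"
      by (intro continuous_on_inner continuous_on_const continuous_on_compose2[OF cont\<Phi>] continuous_on_Pair
        continuous_on_id continuous_on_diff conth) auto
    show "continuous_on UNIV (\<lambda>x. G i (x, \<tau>))"
      by (intro continuous_on_compose2[OF contG] continuous_on_Pair continuous_on_id continuous_on_const) auto
    show "\<Phi> (x, h x - \<tau>) \<bullet> (i, 0) = 0" if "x \<notin> fst ` K" for x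
      using that K(3)[of "(x, h x - \<tau>)"] by force
    show "G i (x, \<tau>) = 0" if "x \<notin> fst ` K" for x using that G0 by blast
    show "((\<lambda>t. \<Phi> (x + t *\<^sub>R i, h (x + t *\<^sub>R i) - \<tau>) \<bullet> (i, 0)) has_real_derivative G i (x, \<tau>)) (at 0)" for x
    proof -
      have 1: "((\<lambda>t. x + t *\<^sub>R i) has_derivative (\<lambda>t. t *\<^sub>R i)) (at 0)"
        by (auto intro!: derivative_eq_intros)
      have 2: "((\<lambda>t. h (x + t *\<^sub>R i)) has_derivative (\<lambda>t. H x \<bullet> (t *\<^sub>R i))) (at 0)"
        using has_derivative_compose[OF 1, of h "\<lambda>d. H x \<bullet> d"] h[of x] by simp
      have 3: "((\<lambda>t. (x + t *\<^sub>R i, h (x + t *\<^sub>R i) - \<tau>)) has_derivative (\<lambda>t. (t *\<^sub>R i, H x \<bullet> (t *\<^sub>R i)))) (at 0)"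
        by (intro has_derivative_Pair 1) (use has_derivative_diff[OF 2 has_derivative_const[of \<tau>]] in simp)
      have "((\<lambda>t. \<Phi> (x + t *\<^sub>R i, h (x + t *\<^sub>R i) - \<tau>)) has_derivative (\<lambda>t. ?D (x, h x - \<tau>) (t *\<^sub>R i, H x \<bullet> (t *\<^sub>R i)))) (at 0)"
        using has_derivative_compose[OF 3, of \<Phi> "?D (x, h x - \<tau>)"] C1_compact_support_has_derivative[OF \<Phi>] by simp
      then have "((\<lambda>t. \<Phi> (x + t *\<^sub>R i, h (x + t *\<^sub>R i) - \<tau>) \<bullet> (i, 0)) has_derivative
          (\<lambda>t. ?D (x, h x - \<tau>) (t *\<^sub>R i, H x \<bullet> (t *\<^sub>R i)) \<bullet> (i, 0))) (at 0)"
        by (rule has_derivative_inner_left)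
      moreover have "(\<lambda>t. ?D (x, h x - \<tau>) (t *\<^sub>R i, H x \<bullet> (t *\<^sub>R i)) \<bullet> (i, 0)) = (*) (G i (x, \<tau>))"
      proof
        fix t
        have "(t *\<^sub>R i, H x \<bullet> (t *\<^sub>R i)) = t *\<^sub>R ((i, 0) + (H x \<bullet> i) *\<^sub>R (0, 1))" by (simp add: algebra_simps)
        then have "?D (x, h x - \<tau>) (t *\<^sub>R i, H x \<bullet> (t *\<^sub>R i)) = t *\<^sub>R (?D (x, h x - \<tau>) (i, 0) + (H x \<bullet> i) *\<^sub>R ?D (x, h x - \<tau>) (0, 1))"
          using lin[of "(x, h x - \<tau>)"] by (simp only: linear_scale linear_add)
        then show "?D (x, h x - \<tau>) (t *\<^sub>R i, H x \<bullet> (t *\<^sub>R i)) \<bullet> (i, 0) = G i (x, \<tau>) * t"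
          by (simp add: G_def inner_add_left algebra_simps)
      qed
      ultimately show ?thesis unfolding has_field_derivative_def by metis
    qed
  qed (use K1 in auto)
  define A where "A i x = (\<integral>c. indicator {..<h x} c * (?D (x, c) (i, 0) \<bullet> (i, 0)) \<partial>lborel)" for i x
  define B where "B i x = (fst (\<Phi> (x, h x)) \<bullet> i) * (H x \<bullet> i)" for i x
  have int1: "integrable lborel (\<lambda>c. indicator {..<s} c * (?D (x, c) d \<bullet> (i, 0)))" for x d i s
  proof -
    have c: "continuous_on UNIV (\<lambda>c. ?D (x, c) d \<bullet> (i, 0))"
      by (intro continuous_on_inner continuous_on_const continuous_on_compose2[OF contD] continuous_on_Pair continuous_on_id) auto
    have z: "?D (x, c) d \<bullet> (i, 0) = 0" if "c \<notin> snd ` K" for c using that K(4)[of "(x, c)" d] by force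
    obtain b where b: "\<And>c. norm (?D (x, c) d \<bullet> (i, 0)) \<le> b"
      using bounded_compact_support[OF c K2 z] by metis
    have "integrable lborel (\<lambda>c. ?D (x, c) d \<bullet> (i, 0))"
      by (rule integrable_compact_support[OF borel_measurable_continuous_onI[OF c] compact_imp_bounded[OF K2] z b])
    from integrable_real_mult_indicator[of "{..<s}", OF _ this] show ?thesis by (simp add: mult.commute)
  qed
  have inner: "(\<integral>\<tau>. indicator {0<..} \<tau> * G i (x, \<tau>) \<partial>lborel) = A i x + B i x" for i x
  proof -
    have "(\<integral>\<tau>. indicator {0<..} \<tau> * G i (x, \<tau>) \<partial>lborel) = (\<integral>c. indicator {0<..} (h x - c) * G i (x, h x - c) \<partial>lborel)"
      by (rule integral_lborel_reflect[symmetric]) measurable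
    also have "\<dots> = (\<integral>c. indicator {..<h x} c * (?D (x, c) (i, 0) \<bullet> (i, 0))
        + (H x \<bullet> i) * (indicator {..<h x} c * (?D (x, c) (0, 1) \<bullet> (i, 0))) \<partial>lborel)"
      by (intro Bochner_Integration.integral_cong refl) (simp add: G_def indicator_def)
    also have "\<dots> = A i x + (H x \<bullet> i) * (\<integral>c. indicator {..<h x} c * (?D (x, c) (0, 1) \<bullet> (i, 0)) \<partial>lborel)"
      unfolding A_def by (subst Bochner_Integration.integral_add) (auto intro: int1)
    also have "(\<integral>c. indicator {..<h x} c * (?D (x, c) (0, 1) \<bullet> (i, 0)) \<partial>lborel) = \<Phi> (x, h x) \<bullet> (i, 0)"
      by (rule integral_vertical_derivative[OF \<Phi>])
    finally show ?thesis by (simp add: B_def inner_prod_def)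
  qed
  have intAB: "integrable lborel (\<lambda>x. A i x + B i x)" for i
    using lborel_pair.integrable_fst'[OF intG[of i]] by (simp add: inner)
  have intB: "integrable lborel (B i)" for i
  proof -
    have c: "continuous_on UNIV (B i)" unfolding B_def
      by (intro continuous_on_mult continuous_on_inner continuous_on_fst continuous_on_const
        continuous_on_compose2[OF cont\<Phi>] continuous_on_Pair continuous_on_id conth H) auto
    have z: "B i x = 0" if "x \<notin> fst ` K" for x
    proof -
      have "\<Phi> (x, h x) = 0" using that K(3)[of "(x, h x)"] by force
      then show ?thesis by (simp add: B_def)
    qed
    obtain b where b: "\<And>x. norm (B i x) \<le> b"
      using bounded_compact_support[OF c K1 z] by metis
    show ?thesis
      by (rule integrable_compact_support[OF borel_measurable_continuous_onI[OF c] compact_imp_bounded[OF K1] z b])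
  qed
  have intA: "integrable lborel (A i)" for i
    using Bochner_Integration.integrable_diff[OF intAB intB, of i i] by simp
  have AB0: "(\<integral>x. A i x \<partial>lborel) + (\<integral>x. B i x \<partial>lborel) = 0" for i
  proof -
    have "(\<integral>x. A i x \<partial>lborel) + (\<integral>x. B i x \<partial>lborel) = (\<integral>x. (\<integral>\<tau>. indicator {0<..} \<tau> * G i (x, \<tau>) \<partial>lborel) \<partial>lborel)"
      unfolding inner using intA intB by (simp add: Bochner_Integration.integral_add)
    also have "\<dots> = (\<integral>\<tau>. (\<integral>x. indicator {0<..} \<tau> * G i (x, \<tau>) \<partial>lborel) \<partial>lborel)"
      using lborel_pair.Fubini_integral[OF intG[of i]] by simp
    also have "\<dots> = 0" using zero by simp
    finally show ?thesis .
  qed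
  have sumA: "(\<Sum>i\<in>Basis. A i x) = (\<integral>c. indicator {..<h x} c * hdivergence \<Phi> (x, c) \<partial>lborel)" for x
    unfolding A_def hdivergence_def sum_distrib_left
    by (rule Bochner_Integration.integral_sum[symmetric]) (rule int1)
  have sumB: "(\<Sum>i\<in>Basis. B i x) = fst (\<Phi> (x, h x)) \<bullet> H x" for x
    unfolding B_def by (rule euclidean_inner[symmetric])
  have "integrable lborel (\<lambda>x. \<Sum>i\<in>Basis. B i x)" "integrable lborel (\<lambda>x. \<Sum>i\<in>Basis. A i x)"
    by (intro Bochner_Integration.integrable_sum intA intB)+
  then show "integrable lborel (\<lambda>x. fst (\<Phi> (x, h x)) \<bullet> H x)"
    and "integrable lborel (\<lambda>x. \<integral>c. indicator {..<h x} c * hdivergence \<Phi> (x, c) \<partial>lborel)"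
    by (simp_all add: sumA sumB)
  have "(\<integral>x. fst (\<Phi> (x, h x)) \<bullet> H x \<partial>lborel) = (\<Sum>i\<in>Basis. \<integral>x. B i x \<partial>lborel)"
    unfolding sumB[symmetric] by (rule Bochner_Integration.integral_sum) (rule intB)
  also have "\<dots> = (\<Sum>i\<in>Basis. - (\<integral>x. A i x \<partial>lborel))"
    by (rule sum.cong) (use AB0 in \<open>auto simp: add_eq_0_iff\<close>)
  also have "\<dots> = - (\<integral>x. (\<Sum>i\<in>Basis. A i x) \<partial>lborel)"
    unfolding sum_negf by (subst Bochner_Integration.integral_sum) (auto intro: intA)
  finally show "(\<integral>x. fst (\<Phi> (x, h x)) \<bullet> H x \<partial>lborel)
     = - (\<integral>x. (\<integral>c. indicator {..<h x} c * hdivergence \<Phi> (x, c) \<partial>lborel) \<partial>lborel)"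
    unfolding sumA .
qed

section \<open>The weight and its primitive\<close>

locale weight =
  fixes \<alpha> \<alpha>1 :: ereal and w f :: "real \<Rightarrow> real"
  assumes alpha_pos: "0 < \<alpha>" and alpha1_pos: "0 < \<alpha>1"
    and w_continuous: "continuous_on (closure (einterval 0 \<alpha>1)) w"
    and w_pos: "\<And>y. y \<in> einterval 0 \<alpha>1 \<Longrightarrow> w y > 0"
    and W_tendsto: "((ereal \<circ> weight_primitive w \<circ> real_of_ereal) \<longlongrightarrow> \<alpha>) (at_left \<alpha>1)"
    and f_continuous: "continuous_on (closure (einterval 0 \<alpha>)) f"
    and f_W_inv: "\<And>z. z \<in> weight_primitive w ` closure (einterval 0 \<alpha>1) \<Longrightarrow> f z = w (weight_primitive_inv \<alpha>1 w z)"
    and f_diff_le: "\<And>z1 z2. \<lbrakk>z1 \<in> closure (einterval 0 \<alpha>); z2 \<in> closure (einterval 0 \<alpha>); z1 \<le> z2\<rbrakk> \<Longrightarrow> f (z2 - z1) \<le> f z1 + f z2"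
    and f_symmetric: "\<And>z. \<lbrakk>\<alpha> < \<infinity>; z \<in> closure (einterval 0 \<alpha>)\<rbrakk> \<Longrightarrow> f z = f (real_of_ereal \<alpha> - z)"
begin

abbreviation "I1 \<equiv> einterval 0 \<alpha>1"
abbreviation "W \<equiv> weight_primitive w"

lemma mem_I1: "y \<in> I1 \<longleftrightarrow> 0 < y \<and> ereal y < \<alpha>1"
  by (simp add: einterval_def zero_ereal_def)

lemma ereal_le_less: "a \<le> b \<Longrightarrow> ereal b < x \<Longrightarrow> ereal a < x"
  by (meson ereal_less_eq(3) order_le_less_trans)

lemma I1_subset_closure: "y \<in> I1 \<Longrightarrow> y \<in> closure I1"
  using closure_subset by blast

lemma I1_downward: "b \<in> I1 \<Longrightarrow> 0 < a \<Longrightarrow> a \<le> b \<Longrightarrow> a \<in> I1"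
  unfolding mem_I1 by (meson ereal_less_eq(3) order_le_less_trans)

lemma open_I1: "open I1" by simp

lemma I1_above: assumes "y \<in> I1" obtains y' where "y < y'" "y' \<in> I1"
proof -
  obtain e where "e > 0" "ball y e \<subseteq> I1" using open_I1 assms open_contains_ball by blast
  then have "y + e / 2 \<in> I1" by (auto simp: dist_norm)
  then show ?thesis using that[of "y + e / 2"] \<open>e > 0\<close> by auto
qed

lemma closure_I1: "closure I1 = {y. 0 \<le> y \<and> ereal y \<le> \<alpha>1}"
proof
  have "closed {y. 0 \<le> y \<and> ereal y \<le> \<alpha>1}"
    by (intro closed_Collect_conj closed_Collect_le continuous_intros)
  then show "closure I1 \<subseteq> {y. 0 \<le> y \<and> ereal y \<le> \<alpha>1}"
    by (intro closure_minimal) (auto simp: mem_I1)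
  show "{y. 0 \<le> y \<and> ereal y \<le> \<alpha>1} \<subseteq> closure I1"
  proof
    fix y assume y: "y \<in> {y. 0 \<le> y \<and> ereal y \<le> \<alpha>1}"
    show "y \<in> closure I1"
    proof (cases "y = 0")
      case True
      obtain b where b: "0 < ereal b" "ereal b < \<alpha>1" using ereal_dense2[OF alpha1_pos] by auto
      have "{0<..<b} \<subseteq> I1"
      proof
        fix x assume "x \<in> {0<..<b}"
        then show "x \<in> I1" using ereal_le_less[of x b] b(2) by (simp add: mem_I1)
      qed
      then have "closure {0<..<b} \<subseteq> closure I1" by (rule closure_mono)
      then show ?thesis using b True by auto
    next
      case False
      have "{0<..<y} \<subseteq> I1"
      proof
        fix x assume x: "x \<in> {0<..<y}"
        then have "ereal x < ereal y" by simp
        then show "x \<in> I1" using x y less_le_trans[of "ereal x" "ereal y" \<alpha>1] by (simp add: mem_I1)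
      qed
      then have "closure {0<..<y} \<subseteq> closure I1" by (rule closure_mono)
      then show ?thesis using y False by auto
    qed
  qed
qed

lemma Icc_closure: "b \<in> closure I1 \<Longrightarrow> {0..b} \<subseteq> closure I1"
  unfolding closure_I1 by (auto, metis ereal_less_eq(3) order_trans)

lemma w_continuous_Icc: "b \<in> closure I1 \<Longrightarrow> continuous_on {0..b} w"
  using continuous_on_subset[OF w_continuous Icc_closure] .

lemma w_continuous_I1: "continuous_on I1 w"
  using continuous_on_subset[OF w_continuous closure_subset] .

lemma W_0 [simp]: "W 0 = 0" by (simp add: weight_primitive_def)

lemma W_continuous_Icc: "b \<in> closure I1 \<Longrightarrow> continuous_on {0..b} W"
  unfolding weight_primitive_def[abs_def]
  by (intro indefinite_integral_continuous_1 integrable_continuous_interval w_continuous_Icc)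

lemma DERIV_W: assumes "y \<in> I1" shows "(W has_real_derivative w y) (at y)"
proof -
  obtain b where b: "y < b" "b \<in> I1" using I1_above[OF assms] .
  have "((\<lambda>x. integral {0..x} w) has_real_derivative w y) (at y within {0..b})"
    using assms b closure_subset[of I1] by (intro integral_has_real_derivative w_continuous_Icc) (auto simp: mem_I1)
  then show ?thesis
    using assms b at_within_interior[of y "{0..b}"] by (simp add: weight_primitive_def[abs_def] mem_I1)
qed

lemma W_strict_mono: assumes "0 \<le> a" "a < b" "b \<in> closure I1" shows "W a < W b"
proof -
  have sub: "x \<in> I1" if "a < x" "x < b" for x
    using assms that less_le_trans[of "ereal x" "ereal b" \<alpha>1] by (simp add: closure_I1 mem_I1)
  have "continuous_on {a..b} W"
    using assms by (intro continuous_on_subset[OF W_continuous_Icc[OF assms(3)]]) auto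
  from MVT[OF assms(2) this]
  obtain l z where "a < z" "z < b" "DERIV W z :> l" "W b - W a = (b - a) * l"
    using DERIV_W sub real_differentiable_def by metis
  moreover have "l = w z" using DERIV_unique[OF \<open>DERIV W z :> l\<close> DERIV_W[OF sub]] calculation by auto
  moreover have "(b - a) * w z > 0" using w_pos[OF sub] calculation assms by auto
  ultimately show ?thesis by auto
qed

lemma W_pos: "y \<in> I1 \<Longrightarrow> 0 < W y"
  using W_strict_mono[of 0 y] closure_subset[of I1] by (auto simp: mem_I1)

lemma W_mono_I1: "a \<in> I1 \<Longrightarrow> b \<in> I1 \<Longrightarrow> a \<le> b \<Longrightarrow> W a \<le> W b"
  using W_strict_mono[of a b] I1_subset_closure[of b] by (cases "a = b") (auto simp: mem_I1)

lemma W_less_iff: "a \<in> I1 \<Longrightarrow> b \<in> I1 \<Longrightarrow> W a < W b \<longleftrightarrow> a < b"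
proof -
  assume ab: "a \<in> I1" "b \<in> I1"
  then have "0 \<le> a" by (simp add: mem_I1)
  then show ?thesis
    using W_strict_mono[of a b] W_mono_I1[of b a] I1_subset_closure[of b] ab by (metis linorder_not_less)
qed

lemma eventually_at_left_alpha1: assumes "y \<in> I1"
  shows "eventually (\<lambda>e. real_of_ereal e \<in> I1 \<and> real_of_ereal e > y) (at_left \<alpha>1)"
proof -
  have "ereal y < \<alpha>1" using assms by (simp add: mem_I1)
  then have "eventually (\<lambda>e. e \<in> {ereal y<..<\<alpha>1}) (at_left \<alpha>1)"
    unfolding eventually_at_left[OF \<open>ereal y < \<alpha>1\<close>] by auto
  then show ?thesis
  proof eventually_elim
    fix e assume e: "e \<in> {ereal y<..<\<alpha>1}"
    then obtain r where "e = ereal r" by (cases e) auto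
    then show "real_of_ereal e \<in> I1 \<and> real_of_ereal e > y" using e assms by (auto simp: mem_I1)
  qed
qed

lemma at_left_alpha1_nontrivial: "at_left \<alpha>1 \<noteq> bot"
proof -
  have "\<not> eventually (\<lambda>_. False) (at_left \<alpha>1)"
    unfolding eventually_at_left[OF alpha1_pos] using dense by blast
  then show ?thesis using eventually_bot by metis
qed

lemma I1_nonempty: obtains y where "y \<in> I1"
proof -
  obtain y where "0 < ereal y" "ereal y < \<alpha>1" using ereal_dense2[OF alpha1_pos] by auto
  then show ?thesis using that[of y] by (simp add: mem_I1)
qed

lemma W_less_alpha: assumes "y \<in> I1" shows "ereal (W y) < \<alpha>"
proof -
  obtain y' where y': "y < y'" "y' \<in> I1" using I1_above[OF assms] .
  have "ereal (W y') \<le> \<alpha>"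
  proof (rule tendsto_lowerbound[OF W_tendsto _ at_left_alpha1_nontrivial])
    show "\<forall>\<^sub>F e in at_left \<alpha>1. ereal (W y') \<le> (ereal \<circ> W \<circ> real_of_ereal) e"
      using eventually_at_left_alpha1[OF y'(2)]
      by eventually_elim (use y' in \<open>auto intro: W_mono_I1\<close>)
  qed
  moreover have "W y < W y'" using W_less_iff[of y y'] assms y' by simp
  ultimately show ?thesis by (metis ereal_less(2) less_ereal.simps(1) less_le_trans)
qed

lemma W_approaches_alpha: assumes "ereal s < \<alpha>" "y \<in> I1" obtains R where "R \<in> I1" "s < W R" "y < R"
proof -
  have "eventually (\<lambda>e. ereal s < (ereal \<circ> W \<circ> real_of_ereal) e) (at_left \<alpha>1)"
    using order_tendstoD(1)[OF W_tendsto assms(1)] .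
  with eventually_at_left_alpha1[OF assms(2)]
  have "eventually (\<lambda>e. (real_of_ereal e \<in> I1 \<and> real_of_ereal e > y) \<and> ereal s < (ereal \<circ> W \<circ> real_of_ereal) e) (at_left \<alpha>1)"
    by (rule eventually_conj)
  then obtain e where "(real_of_ereal e \<in> I1 \<and> real_of_ereal e > y) \<and> ereal s < (ereal \<circ> W \<circ> real_of_ereal) e"
    using eventually_happens[OF _ ] at_left_alpha1_nontrivial by blast
  then show ?thesis using that by auto
qed

lemma W_inj: "inj_on W (closure I1)"
proof (rule linorder_inj_onI')
  fix a b assume "a \<in> closure I1" "b \<in> closure I1" "a < b"
  then show "W a \<noteq> W b" using W_strict_mono[of a b] by (simp add: closure_I1)
qed

lemma W_inv: "y \<in> I1 \<Longrightarrow> weight_primitive_inv \<alpha>1 w (W y) = y"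
  unfolding weight_primitive_inv_def by (rule the_inv_into_f_f[OF W_inj I1_subset_closure])

lemma f_W: assumes "y \<in> I1" shows "f (W y) = w y"
  using f_W_inv[of "W y"] W_inv[OF assms] I1_subset_closure[OF assms] by simp

text \<open>
  A continuous weight on a bounded closed interval has a finite integral.
\<close>

lemma alpha1_infinite: assumes "\<alpha> = \<infinity>" shows "\<alpha>1 = \<infinity>"
proof (cases \<alpha>1)
  case (real r)
  have r: "r \<in> closure I1" unfolding closure_I1 using real alpha1_pos by simp
  have "\<alpha> \<le> ereal (W r)"
  proof (rule tendsto_upperbound[OF W_tendsto _ at_left_alpha1_nontrivial])
    obtain y where y: "y \<in> I1" using I1_nonempty .
    show "\<forall>\<^sub>F e in at_left \<alpha>1. (ereal \<circ> W \<circ> real_of_ereal) e \<le> ereal (W r)"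
      using eventually_at_left_alpha1[OF y]
    proof eventually_elim
      fix e assume e: "real_of_ereal e \<in> I1 \<and> y < real_of_ereal e"
      then have "0 < real_of_ereal e" "ereal (real_of_ereal e) < \<alpha>1" unfolding mem_I1 by blast+
      then have "0 \<le> real_of_ereal e" "real_of_ereal e < r" unfolding real by simp_all
      then have "W (real_of_ereal e) < W r" using W_strict_mono r by blast
      then show "(ereal \<circ> W \<circ> real_of_ereal) e \<le> ereal (W r)" by simp
    qed
  qed
  then show ?thesis using assms by simp
qed (use alpha1_pos in auto)

lemma W_surj: assumes "0 < z" "ereal z < \<alpha>" obtains y where "y \<in> I1" "W y = z"
proof -
  obtain y0 where "y0 \<in> I1" using I1_nonempty .
  then obtain R where R: "R \<in> I1" "z < W R" using W_approaches_alpha assms by metis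
  have Rc: "R \<in> closure I1" using R closure_subset by auto
  obtain y where y: "0 \<le> y" "y \<le> R" "W y = z"
    using IVT'[of W 0 z R] W_continuous_Icc[OF Rc] R assms by (auto simp: mem_I1)
  then have "y \<noteq> 0" using assms by auto
  then show ?thesis using that[of y] y I1_downward[OF R(1), of y] by auto
qed

lemma f_pos: assumes "0 < z" "ereal z < \<alpha>" shows "f z > 0"
  using W_surj[OF assms] f_W w_pos by metis

lemma mem_closure_I: assumes "0 < z" "ereal z < \<alpha>" shows "z \<in> closure (einterval 0 \<alpha>)"
  by (rule subsetD[OF closure_subset]) (use assms in \<open>simp add: einterval_def zero_ereal_def\<close>)

section \<open>The one-dimensional isoperimetric inequality\<close>

text \<open>
  Cells \<open>[z i, z (i + 1))\<close> with \<open>e i\<close> form a set; \<open>S j\<close> is its measure below \<open>z j\<close> and \<open>P j\<close> the sum of \<open>f\<close> over its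
  boundary points up to \<open>z j\<close>. The invariant compares \<open>P j\<close> with \<open>f\<close> at the measure of the set while the current cell is
  outside, and at the measure of the complement while it is inside. At a change of state the two measures are exchanged by
  \<open>s \<mapsto> z - s\<close>, at the cost \<open>f z\<close> of the new boundary point, which is the hypothesis \<open>f (z - s) \<le> f s + f z\<close>.
\<close>

lemma grid_isoperimetric_aux:
  fixes z :: "nat \<Rightarrow> real" and e :: "nat \<Rightarrow> bool"
  assumes z: "z 0 = 0" "\<And>i. i < n \<Longrightarrow> z i < z (Suc i)" "\<And>i. i \<le> n \<Longrightarrow> ereal (z i) < \<alpha>"
  defines "S \<equiv> \<lambda>j. \<Sum>i<j. if e i then z (Suc i) - z i else 0"
    and "P \<equiv> \<lambda>j. \<Sum>i<j. if e i \<noteq> e (Suc i) then f (z (Suc i)) else 0"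
  assumes j: "j \<le> n"
  shows "0 \<le> P j \<and> 0 \<le> S j \<and> S j \<le> z j \<and> (\<not> e j \<longrightarrow> S j = 0 \<or> f (S j) \<le> P j) \<and> (e j \<longrightarrow> S j = z j \<or> f (z j - S j) \<le> P j)"
  using j
proof (induction j)
  case 0 show ?case by (simp add: S_def P_def z)
next
  case (Suc j)
  let ?z = "z (Suc j)"
  have IH: "0 \<le> P j" "0 \<le> S j" "S j \<le> z j" "\<not> e j \<Longrightarrow> S j = 0 \<or> f (S j) \<le> P j" "e j \<Longrightarrow> S j = z j \<or> f (z j - S j) \<le> P j"
    using Suc by auto
  have zz: "z j < ?z" "ereal ?z < \<alpha>" using z Suc by auto
  have z0: "0 \<le> z j" using IH by linarith
  then have fz: "0 < f ?z" using f_pos[of ?z] zz by auto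
  have zc: "?z \<in> closure (einterval 0 \<alpha>)" using mem_closure_I zz z0 by auto
  have S: "S (Suc j) = S j + (if e j then ?z - z j else 0)" by (simp add: S_def)
  have P: "P (Suc j) = P j + (if e j \<noteq> e (Suc j) then f ?z else 0)" by (simp add: P_def)
  have key: "f (?z - s) \<le> P j + f ?z" if s: "0 \<le> s" "s \<le> z j" "s = 0 \<or> f s \<le> P j" for s
  proof (cases "s = 0")
    case True then show ?thesis using IH(1) by simp
  next
    case False
    have "ereal s < \<alpha>" using s zz by (metis ereal_less_eq(3) less_ereal.simps(1) order_le_less_trans order_less_trans)
    then have "f (?z - s) \<le> f s + f ?z"
      using False s zz by (intro f_diff_le zc mem_closure_I) auto
    then show ?thesis using s False by auto
  qed
  show ?case
  proof (cases "e j")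
    case True
    have "f (S (Suc j)) \<le> P (Suc j)" if "\<not> e (Suc j)"
      using key[of "z j - S j"] IH True that by (auto simp: S P algebra_simps)
    then show ?thesis using IH True fz zz by (auto simp: S P algebra_simps)
  next
    case False
    have "f (?z - S j) \<le> P (Suc j)" if "e (Suc j)"
      using key[of "S j"] IH False that by (auto simp: P)
    then show ?thesis using IH False fz zz by (auto simp: S P)
  qed
qed

text \<open>
  If the last cell belongs to the set, the set extends to \<open>\<alpha>\<close>, and the invariant speaks about its complement in
  \<open>(0, \<alpha>)\<close>; the symmetry \<open>f z = f (\<alpha> - z)\<close> leads back to the set itself. The function \<open>\<theta>\<close> takes care of the sets of
  measure \<open>0\<close> and \<open>\<alpha>\<close>, which have no boundary points.
\<close>

lemma grid_isoperimetric:
  fixes z :: "nat \<Rightarrow> real" and e :: "nat \<Rightarrow> bool" and \<theta> :: "real \<Rightarrow> real"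
  assumes z: "z 0 = 0" "\<And>i. i < n \<Longrightarrow> z i < z (Suc i)" "\<And>i. i \<le> n \<Longrightarrow> ereal (z i) < \<alpha>"
    and \<theta>0: "\<theta> 0 = 0" and \<theta>\<alpha>: "\<alpha> < \<infinity> \<Longrightarrow> \<theta> (real_of_ereal \<alpha>) = 0"
    and \<theta>f: "\<And>s. 0 < s \<Longrightarrow> ereal s < \<alpha> \<Longrightarrow> \<theta> s \<le> f s"
    and inf: "\<alpha> = \<infinity> \<Longrightarrow> \<not> e n"
  shows "\<theta> ((\<Sum>i<n. if e i then z (Suc i) - z i else 0) + (if e n then real_of_ereal \<alpha> - z n else 0))
     \<le> (\<Sum>i<n. if e i \<noteq> e (Suc i) then f (z (Suc i)) else 0)"
proof -
  define S where "S = (\<Sum>i<n. if e i then z (Suc i) - z i else 0)"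
  define P where "P = (\<Sum>i<n. if e i \<noteq> e (Suc i) then f (z (Suc i)) else 0)"
  have A: "0 \<le> P" "0 \<le> S" "S \<le> z n" "\<not> e n \<Longrightarrow> S = 0 \<or> f S \<le> P" "e n \<Longrightarrow> S = z n \<or> f (z n - S) \<le> P"
    using grid_isoperimetric_aux[of z n n e, OF z order_refl] unfolding S_def P_def by auto
  have Sa: "ereal S < \<alpha>" using A(3) z(3)[of n] by (metis ereal_less_eq(3) order_le_less_trans order_refl)
  show ?thesis
  proof (cases "e n")
    case False
    have "\<theta> S \<le> P" using A False \<theta>0 \<theta>f[of S] Sa by (cases "S = 0") auto
    then show ?thesis using False by (simp add: S_def P_def)
  next
    case True
    then have "\<alpha> < \<infinity>" using inf by auto
    then obtain a where a: "\<alpha> = ereal a" using alpha_pos by (cases \<alpha>) auto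
    have za: "z n < a" using z(3)[of n] a by simp
    have "\<theta> (S + (a - z n)) \<le> P"
    proof (cases "S = z n")
      case True then show ?thesis using \<theta>\<alpha> a A by simp
    next
      case False
      have t: "0 < z n - S" "z n - S < a" using A False za by auto
      have "\<theta> (S + (a - z n)) \<le> f (a - (z n - S))"
        using \<theta>f[of "a - (z n - S)"] t a by (simp add: algebra_simps)
      also have "\<dots> = f (z n - S)" using f_symmetric[of "z n - S"] mem_closure_I[of "z n - S"] t a by simp
      also have "\<dots> \<le> P" using A True False by auto
      finally show ?thesis .
    qed
    then show ?thesis using True a by (simp add: S_def P_def)
  qed
qed


definition wbar :: "real \<Rightarrow> real" where "wbar y = (if y \<in> I1 then w y else 0)"

text \<open>
  The image of this measure under \<open>W\<close> is Lebesgue measure on \<open>(0, \<alpha>)\<close>.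
\<close>

definition mu :: "real measure" where "mu = density lborel (\<lambda>y. ennreal (wbar y))"

lemma wbar_nonneg: "0 \<le> wbar y"
  using w_pos[of y] by (auto simp: wbar_def less_imp_le)

lemma measurable_wbar [measurable]: "wbar \<in> borel_measurable borel"
proof -
  have "(\<lambda>y. if y \<in> I1 then w y else 0) \<in> borel_measurable borel"
    by (rule borel_measurable_continuous_on_if) (use w_continuous_I1 in \<open>auto intro: continuous_on_const\<close>)
  then show ?thesis by (simp add: wbar_def[abs_def])
qed

lemma sets_mu [simp, measurable_cong]: "sets mu = sets borel" by (simp add: mu_def)
lemma space_mu [simp]: "space mu = UNIV" by (simp add: mu_def)

lemma emeasure_mu: "A \<in> sets borel \<Longrightarrow> emeasure mu A = (\<integral>\<^sup>+y. ennreal (wbar y) * indicator A y \<partial>lborel)"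
  unfolding mu_def by (rule emeasure_density) auto

lemma emeasure_mu_Icc: assumes "a \<in> I1" "b \<in> I1" "a \<le> b" shows "emeasure mu {a..b} = ennreal (W b - W a)"
proof -
  have "(\<integral>\<^sup>+y. ennreal (wbar y) * indicator {a..b} y \<partial>lborel) = ennreal (W b - W a)"
  proof (rule nn_integral_FTC_Icc)
    show "DERIV W x :> wbar x" if "x \<in> {a..b}" for x
    proof -
      have "x \<in> I1" using I1_downward[OF assms(2), of x] assms that by (auto simp: mem_I1)
      then show ?thesis using DERIV_W[of x] by (simp add: wbar_def)
    qed
  qed (use assms wbar_nonneg in auto)
  then show ?thesis by (simp add: emeasure_mu)
qed

lemma emeasure_mu_singleton [simp]: "emeasure mu {a} = 0"
proof -
  have "AE y in lborel. ennreal (wbar y) * indicator {a} y = 0"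
    using AE_lborel_singleton[of a] by eventually_elim auto
  then show ?thesis by (simp add: emeasure_mu nn_integral_0_iff_AE)
qed

lemma emeasure_mu_Ico: assumes "a \<in> I1" "b \<in> I1" "a \<le> b" shows "emeasure mu {a..<b} = ennreal (W b - W a)"
proof -
  have "{a..b} = {a..<b} \<union> {b}" using assms by auto
  then have "emeasure mu {a..b} = emeasure mu {a..<b} + emeasure mu {b}"
    by (simp only:) (rule plus_emeasure[symmetric], auto)
  then show ?thesis using emeasure_mu_Icc[OF assms] by simp
qed

lemma emeasure_mu_lessThan: assumes "b \<in> I1" shows "emeasure mu {..<b} = ennreal (W b)"
proof -
  have bc: "b \<in> closure I1" "0 < b" using assms I1_subset_closure by (auto simp: mem_I1)
  define a where "a i = b / real (Suc (Suc i))" for i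
  have a: "0 < a i" "a i < b" "a (Suc i) \<le> a i" for i
    using bc by (auto simp: a_def field_simps add_pos_nonneg)
  have aI: "a i \<in> I1" for i using a I1_downward[OF assms] less_imp_le by blast
  have "(\<lambda>i. b * inverse (real (Suc (Suc i)))) \<longlonglongrightarrow> b * 0"
    by (intro tendsto_intros LIMSEQ_Suc[OF LIMSEQ_inverse_real_of_nat])
  then have alim: "a \<longlonglongrightarrow> 0" by (simp add: a_def[abs_def] divide_inverse)
  have "(\<lambda>i. emeasure mu {a i..<b}) \<longlonglongrightarrow> emeasure mu (\<Union>i. {a i..<b})"
    by (intro Lim_emeasure_incseq incseq_SucI) (use a(3) in \<open>auto intro: order_trans\<close>)
  moreover have "emeasure mu (\<Union>i. {a i..<b}) = emeasure mu {..<b}"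
  proof -
    have "y \<in> (\<Union>i. {a i..<b})" if y: "0 < y" "y < b" for y
    proof -
      obtain i where "a i < y" using order_tendstoD(2)[OF alim y(1)] eventually_sequentially by auto
      then show ?thesis using y by (auto intro: less_imp_le)
    qed
    then have "ennreal (wbar y) * indicator (\<Union>i. {a i..<b}) y = ennreal (wbar y) * indicator {..<b} y" for y
      by (cases "0 < y") (auto simp: wbar_def mem_I1 indicator_def)
    then show ?thesis by (simp add: emeasure_mu)
  qed
  ultimately have lim1: "(\<lambda>i. ennreal (W b - W (a i))) \<longlonglongrightarrow> emeasure mu {..<b}"
    using emeasure_mu_Ico[OF aI assms less_imp_le[OF a(2)]] by simp
  have "continuous_on {0..b} W" by (rule W_continuous_Icc[OF bc(1)])
  then have "(\<lambda>i. W (a i)) \<longlonglongrightarrow> W 0"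
    by (rule continuous_on_tendsto_compose[OF _ alim]) (use a bc in \<open>auto intro!: always_eventually simp: less_imp_le\<close>)
  then have "(\<lambda>i. W (a i)) \<longlonglongrightarrow> 0" by simp
  from tendsto_ennrealI[OF tendsto_diff[OF tendsto_const this]]
  have "(\<lambda>i. ennreal (W b - W (a i))) \<longlonglongrightarrow> ennreal (W b - 0)" .
  with lim1 show ?thesis using LIMSEQ_unique by fastforce
qed

lemma emeasure_mu_atLeast:
  assumes a: "a \<in> I1" and A: "\<alpha> = ereal A" shows "emeasure mu {a..} = ennreal (A - W a)"
proof -
  obtain u l where ul: "I1 = (\<Union>i. {l i .. u i})" "incseq u" "\<And>i. ereal (u i) < \<alpha>1" "\<And>i. 0 < ereal (l i)"
      "\<And>i. l i < u i" "(\<lambda>i. ereal (u i)) \<longlonglongrightarrow> \<alpha>1"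
  proof (rule einterval_Icc_approximation[OF alpha1_pos])
    fix u l :: "nat \<Rightarrow> real"
    assume "I1 = (\<Union>i. {l i .. u i})" "incseq u" "decseq l" "\<And>i. l i < u i"
      "\<And>i. 0 < ereal (l i)" "\<And>i. ereal (u i) < \<alpha>1" "(\<lambda>i. ereal (l i)) \<longlonglongrightarrow> 0" "(\<lambda>i. ereal (u i)) \<longlonglongrightarrow> \<alpha>1"
    then show thesis using that[of l u] by blast
  qed
  have uI: "u i \<in> I1" for i
  proof -
    have "0 < l i" using ul(4)[of i] by simp
    then show ?thesis using ul(3,5)[of i] by (simp add: mem_I1)
  qed
  have "a \<in> (\<Union>i. {l i .. u i})" using a ul(1) by simp
  then obtain N where N: "a \<le> u N" by auto
  have un: "a \<le> u (i + N)" for i using N incseqD[OF ul(2), of N "i + N"] by auto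
  have "(\<lambda>i. emeasure mu {a..u (i + N)}) \<longlonglongrightarrow> emeasure mu (\<Union>i. {a..u (i + N)})"
  proof (rule Lim_emeasure_incseq)
    show "incseq (\<lambda>i. {a..u (i + N)})"
    proof (rule incseq_SucI)
      fix i show "{a..u (i + N)} \<subseteq> {a..u (Suc i + N)}"
        using incseqD[OF ul(2), of "i + N" "Suc i + N"] by auto
    qed
  qed auto
  moreover have "emeasure mu (\<Union>i. {a..u (i + N)}) = emeasure mu {a..}"
  proof -
    have "I1 \<inter> {a..} \<subseteq> (\<Union>i. {a..u (i + N)})"
    proof
      fix y assume y: "y \<in> I1 \<inter> {a..}"
      then have "y \<in> (\<Union>i. {l i .. u i})" using ul(1) by blast
      then obtain i where "y \<le> u i" by auto
      then have "y \<le> u (i + N)" using incseqD[OF ul(2), of i "i + N"] by auto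
      then show "y \<in> (\<Union>i. {a..u (i + N)})" using y by auto
    qed
    then have "ennreal (wbar y) * indicator (\<Union>i. {a..u (i + N)}) y = ennreal (wbar y) * indicator {a..} y" for y
      by (auto simp: wbar_def indicator_def)
    then show ?thesis by (simp add: emeasure_mu)
  qed
  ultimately have lim1: "(\<lambda>i. ennreal (W (u (i + N)) - W a)) \<longlonglongrightarrow> emeasure mu {a..}"
    using emeasure_mu_Icc[OF a uI un] by simp
  have "filterlim (\<lambda>i. ereal (u i)) (at_left \<alpha>1) sequentially"
    unfolding filterlim_at using ul by (auto intro!: always_eventually simp: less_imp_neq)
  from filterlim_compose[OF W_tendsto this]
  have "(\<lambda>i. W (u i)) \<longlonglongrightarrow> A" by (simp add: A)
  then have "(\<lambda>i. W (u (i + N))) \<longlonglongrightarrow> A" by (rule LIMSEQ_ignore_initial_segment)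
  then have "(\<lambda>i. ennreal (W (u (i + N)) - W a)) \<longlonglongrightarrow> ennreal (A - W a)"
    by (intro tendsto_intros)
  with lim1 show ?thesis using LIMSEQ_unique by blast
qed

end

text \<open>
  The grid point below \<open>t\<close>, except that everything to the left of \<open>y 1\<close> belongs to the point \<open>y 0\<close> and everything to the
  right of \<open>y n\<close> to \<open>y n\<close>: a function sampled at \<open>y (grid_index y n t)\<close> is constant near both ends of \<open>I1\<close>.
\<close>

definition grid_index :: "(nat \<Rightarrow> real) \<Rightarrow> nat \<Rightarrow> real \<Rightarrow> nat" where
  "grid_index y n t = card {i \<in> {1..n}. y i \<le> t}"

lemma grid_index_le: "grid_index y n t \<le> n"
proof -
  have "card {i \<in> {1..n}. y i \<le> t} \<le> card {1..n}" by (rule card_mono) auto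
  then show ?thesis unfolding grid_index_def by simp
qed

lemma le_grid_index_iff:
  assumes y: "\<And>i. i < n \<Longrightarrow> y i < y (Suc i)" and j: "1 \<le> j" "j \<le> n"
  shows "j \<le> grid_index y n t \<longleftrightarrow> y j \<le> t"
proof -
  have mono: "y i \<le> y k" if "i \<le> k" "k \<le> n" for i k
    using that
  proof (induction k)
    case (Suc k) then show ?case using y[of k] by (cases "i = Suc k") auto
  qed auto
  let ?S = "{i \<in> {1..n}. y i \<le> t}"
  have sub: "{1..k} \<subseteq> ?S" if "k \<in> ?S" for k using that mono by force
  have "k \<le> card ?S" if "k \<in> ?S" for k
    using card_mono[OF _ sub[OF that]] by auto
  then have "?S \<subseteq> {1..card ?S}" by auto
  then have "?S = {1..card ?S}" by (intro card_subset_eq) auto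
  then show ?thesis using j unfolding grid_index_def by (metis (no_types, lifting) atLeastAtMost_iff mem_Collect_eq)
qed

lemma measurable_grid_index [measurable]: "grid_index y n \<in> borel \<rightarrow>\<^sub>M count_space UNIV"
proof -
  have "grid_index y n t = (\<Sum>i\<in>{1..n}. if y i \<le> t then 1 else 0)" for t
    unfolding grid_index_def by (simp add: sum.If_cases Int_def)
  then show ?thesis by (simp add: fun_eq_iff[symmetric] del: sum.cl_ivl_Suc) (subst ext, assumption, measurable)
qed

context weight begin

lemma emeasure_mu_grid:
  fixes y :: "nat \<Rightarrow> real" and e :: "nat \<Rightarrow> bool"
  assumes n: "n \<ge> 1" and yI: "\<And>i. i \<le> n \<Longrightarrow> y i \<in> I1" and ym: "\<And>i. i < n \<Longrightarrow> y i < y (Suc i)"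
    and inf: "\<alpha> = \<infinity> \<Longrightarrow> \<not> e n"
  defines "z \<equiv> \<lambda>i. if i = 0 then 0 else W (y i)"
  shows "emeasure mu {t. e (grid_index y n t)} =
     ennreal ((\<Sum>i<n. if e i then z (Suc i) - z i else 0) + (if e n then real_of_ereal \<alpha> - z n else 0))"
proof -
  define C where "C i = {t. grid_index y n t = i}" for i
  have [measurable]: "C i \<in> sets borel" for i unfolding C_def by measurable
  let ?I = "{i. i \<le> n \<and> e i}"
  have zm: "z i < z (Suc i)" if "i < n" for i
    using that W_pos[OF yI[of "Suc i"]] W_less_iff[OF yI[of i] yI[of "Suc i"]] ym[of i] by (auto simp: z_def)
  have "{t. e (grid_index y n t)} = (\<Union>i\<in>?I. C i)"
    using grid_index_le by (auto simp: C_def)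
  then have "emeasure mu {t. e (grid_index y n t)} = (\<Sum>i\<in>?I. emeasure mu (C i))"
    by (simp only:) (rule sum_emeasure[symmetric], auto simp: C_def disjoint_family_on_def)
  also have "\<dots> = (\<Sum>i\<in>{..n}. if e i then emeasure mu (C i) else 0)"
    by (subst sum.inter_filter[symmetric]) (auto intro!: sum.cong)
  also have "\<dots> = (\<Sum>i<n. if e i then emeasure mu (C i) else 0) + (if e n then emeasure mu (C n) else 0)"
    by (simp add: lessThan_Suc_atMost[symmetric])
  also have "(\<Sum>i<n. if e i then emeasure mu (C i) else 0) = (\<Sum>i<n. ennreal (if e i then z (Suc i) - z i else 0))"
  proof (rule sum.cong[OF refl])
    fix i assume i: "i \<in> {..<n}"
    have "emeasure mu (C i) = ennreal (z (Suc i) - z i)"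
    proof (cases "i = 0")
      case True
      have "C i = {t. \<not> 1 \<le> grid_index y n t}" using True by (auto simp: C_def)
      also have "\<dots> = {..<y 1}" 
        by (rule set_eqI) (use le_grid_index_iff[of n y 1, OF ym order_refl n] in auto)
      finally have "C i = {..<y 1}" .
      then show ?thesis using True n emeasure_mu_lessThan[OF yI[of 1]] by (simp add: z_def)
    next
      case False
      have i': "1 \<le> i" "i \<le> n" "1 \<le> Suc i" "Suc i \<le> n" using False i by auto
      have "C i = {t. i \<le> grid_index y n t \<and> \<not> Suc i \<le> grid_index y n t}" by (auto simp: C_def)
      also have "\<dots> = {y i..<y (Suc i)}"

        by (rule set_eqI)
          (use le_grid_index_iff[of n y i, OF ym i'(1,2)] le_grid_index_iff[of n y "Suc i", OF ym i'(3,4)] in auto)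
      finally have "C i = {y i..<y (Suc i)}" .
      then show ?thesis using False i emeasure_mu_Ico[OF yI[of i] yI[of "Suc i"]] ym[of i] by (simp add: z_def)
    qed
    then show "(if e i then emeasure mu (C i) else 0) = ennreal (if e i then z (Suc i) - z i else 0)" by simp
  qed
  also have "\<dots> = ennreal (\<Sum>i<n. if e i then z (Suc i) - z i else 0)"
    by (rule sum_ennreal) (use zm in \<open>auto intro: less_imp_le\<close>)
  also have tail: "(if e n then emeasure mu (C n) else 0) = ennreal (if e n then real_of_ereal \<alpha> - z n else 0)"
  proof (cases "e n")
    case True
    then have "\<alpha> \<noteq> \<infinity>" using inf by auto
    then obtain a where a: "\<alpha> = ereal a" using alpha_pos by (cases \<alpha>) auto
    have "C n = {t. n \<le> grid_index y n t}" using grid_index_le[of y n] by (auto simp: C_def antisym)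
    also have "\<dots> = {y n..}" 
      by (rule set_eqI) (use le_grid_index_iff[of n y n, OF ym n order_refl] in auto)
    finally have "C n = {y n..}" .
    then show ?thesis using True a n emeasure_mu_atLeast[OF yI[of n] a] by (simp add: z_def)
  qed simp
  finally show ?thesis
  proof (subst ennreal_plus)
    show "0 \<le> (\<Sum>i<n. if e i then z (Suc i) - z i else 0)" by (intro sum_nonneg) (use zm in \<open>auto intro: less_imp_le\<close>)
    show "0 \<le> (if e n then real_of_ereal \<alpha> - z n else 0)"
      using inf W_less_alpha[OF yI[of n]] n alpha_pos by (cases \<alpha>) (auto simp: z_def)
  qed simp
qed

end

text \<open>
  The levels that separate \<open>s\<close> from \<open>s'\<close> form an interval.
\<close>

lemma integral_crossing:
  fixes b B :: "real \<Rightarrow> real"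
  assumes B: "\<And>s. (B has_real_derivative b s) (at s)" and b: "continuous_on UNIV b" "\<And>c. 0 \<le> b c"
  shows "has_bochner_integral lborel (\<lambda>c. b c * (if (c < s) \<noteq> (c < s') then 1 else 0)) \<bar>B s' - B s\<bar>"
proof -
  have *: "has_bochner_integral lborel (\<lambda>c. b c * (if (c < s) \<noteq> (c < s') then 1 else 0)) \<bar>B s' - B s\<bar>"
    if "s \<le> s'" for s s'
  proof -
    have 1: "has_bochner_integral lborel (\<lambda>x. b x * indicator {s .. s'} x) (B s' - B s)"
      by (rule has_bochner_integral_FTC_Icc_real[OF that B]) (use b in \<open>auto simp: continuous_on_eq_continuous_at\<close>)
    have "0 \<le> (\<integral>x. b x * indicator {s .. s'} x \<partial>lborel)"
      using b(2) by (intro integral_nonneg_AE AE_I2) simp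
    then have "0 \<le> B s' - B s" using has_bochner_integral_integral_eq[OF 1] by simp
    moreover have "has_bochner_integral lborel (\<lambda>c. b c * (if (c < s) \<noteq> (c < s') then 1 else 0)) (B s' - B s)"
    proof (subst has_bochner_integral_cong_AE)
      have [measurable]: "b \<in> borel_measurable borel" by (rule borel_measurable_continuous_onI[OF b(1)])
      show "(\<lambda>c. b c * (if (c < s) \<noteq> (c < s') then 1 else 0)) \<in> borel_measurable lborel"
        "(\<lambda>x. b x * indicator {s .. s'} x) \<in> borel_measurable lborel" by measurable
      show "AE c in lborel. b c * (if (c < s) \<noteq> (c < s') then 1 else 0) = b c * indicator {s..s'} c"
        using AE_lborel_singleton[of s'] by eventually_elim (use that in \<open>auto simp: indicator_def\<close>)
    qed (rule 1)
    ultimately show ?thesis by simp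
  qed
  show ?thesis
  proof (cases "s \<le> s'")
    case True then show ?thesis by (rule *)
  next
    case False
    then have "s' \<le> s" by simp
    from *[OF this] show ?thesis by (simp add: abs_minus_commute eq_commute)
  qed
qed

lemma sum_integral_grid:
  fixes y :: "nat \<Rightarrow> real" and g :: "real \<Rightarrow> real"
  assumes y: "\<And>i. i < n \<Longrightarrow> y i \<le> y (Suc i)" and g: "continuous_on {y 0..y n} g"
  shows "(\<Sum>i<n. integral {y i..y (Suc i)} g) = integral {y 0..y n} g \<and> y 0 \<le> y n"
  using assms
proof (induction n)
  case (Suc n)
  have le: "y n \<le> y (Suc n)" using Suc by auto
  have "continuous_on {y 0..y n} g" by (rule continuous_on_subset[OF Suc.prems(2)]) (use le in auto)
  then have IH: "(\<Sum>i<n. integral {y i..y (Suc i)} g) = integral {y 0..y n} g" "y 0 \<le> y n" using Suc by auto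
  have "integral {y 0..y n} g + integral {y n..y (Suc n)} g = integral {y 0..y (Suc n)} g"
    by (rule Henstock_Kurzweil_Integration.integral_combine) (use IH le Suc.prems(2) in \<open>auto intro: integrable_continuous_real\<close>)
  then show ?case using IH le by simp
qed auto

context weight begin

text \<open>
  A discrete coarea inequality. Between two grid points the integral of \<open>b(h) |h'|\<close> is at least the \<open>b\<close>-mass of the levels
  that separate the two values of \<open>h\<close>; exchanging the sum over the cells with the integral over the levels leaves, for each
  level, the weighted boundary of a union of cells, to which \<open>grid_isoperimetric\<close> applies. The factor \<open>\<kappa>\<close> accounts
  for the oscillation of \<open>w\<close> in a cell.
\<close>

lemma total_variation_ge_level_perimeter:
  fixes h h' b \<theta> :: "real \<Rightarrow> real" and y :: "nat \<Rightarrow> real"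
  assumes n: "n \<ge> 1" and yI: "\<And>i. i \<le> n \<Longrightarrow> y i \<in> I1" and ym: "\<And>i. i < n \<Longrightarrow> y i < y (Suc i)"
    and h: "\<And>t. (h has_real_derivative h' t) (at t)" and h': "continuous_on UNIV h'"
    and b: "continuous_on UNIV b" "\<And>c. 0 \<le> b c" "\<And>c. c \<le> 0 \<Longrightarrow> b c = 0"
    and \<theta>0: "\<theta> 0 = 0" and \<theta>\<alpha>: "\<alpha> < \<infinity> \<Longrightarrow> \<theta> (real_of_ereal \<alpha>) = 0"
    and \<theta>f: "\<And>s. 0 < s \<Longrightarrow> ereal s < \<alpha> \<Longrightarrow> \<theta> s \<le> f s"
    and \<kappa>: "0 \<le> \<kappa>" "\<And>i t. i < n \<Longrightarrow> t \<in> {y i..y (Suc i)} \<Longrightarrow> \<kappa> * w (y (Suc i)) \<le> w t"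
    and inf: "\<alpha> = \<infinity> \<Longrightarrow> h (y n) \<le> 0"
  shows "\<kappa> * (\<integral>c. b c * \<theta> (measure mu {t. c < h (y (grid_index y n t))}) \<partial>lborel)
    \<le> integral {y 0..y n} (\<lambda>t. w t * (b (h t) * \<bar>h' t\<bar>))"
proof -
  obtain B where B: "\<And>s. (B has_real_derivative b s) (at s)"
    using einterval_antiderivative[of "-\<infinity>" \<infinity> b] b(1)
    by (auto simp: continuous_on_eq_continuous_at has_real_derivative_iff_has_vector_derivative)
  \<comment> \<open>state of the cells at level \<open>c\<close>, and the weighted boundary of their union\<close>
  define e where "e c i \<longleftrightarrow> c < h (y i)" for c :: real and i
  define P where "P c = (\<Sum>i<n. (if e c i \<noteq> e c (Suc i) then w (y (Suc i)) else 0))" for c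
  define z where "z i = (if i = 0 then 0 else W (y i))" for i
  have zm: "z i < z (Suc i)" if "i < n" for i
    using that W_pos[OF yI[of "Suc i"]] W_less_iff[OF yI[of i] yI[of "Suc i"]] ym[of i] by (auto simp: z_def)
  have z\<alpha>: "ereal (z i) < \<alpha>" if "i \<le> n" for i
    using that W_less_alpha[OF yI[of i]] alpha_pos by (auto simp: z_def zero_ereal_def[symmetric])
  have P: "has_bochner_integral lborel (\<lambda>c. b c * P c) (\<Sum>i<n. w (y (Suc i)) * \<bar>B (h (y (Suc i))) - B (h (y i))\<bar>)"
  proof -
    have "has_bochner_integral lborel (\<lambda>c. \<Sum>i<n. w (y (Suc i)) * (b c * (if (c < h (y i)) \<noteq> (c < h (y (Suc i))) then 1 else 0)))
       (\<Sum>i<n. w (y (Suc i)) * \<bar>B (h (y (Suc i))) - B (h (y i))\<bar>)"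
      by (intro has_bochner_integral_sum has_bochner_integral_mult_right integral_crossing[OF B b(1,2)])
    moreover have "(\<Sum>i<n. w (y (Suc i)) * (b c * (if (c < h (y i)) \<noteq> (c < h (y (Suc i))) then 1 else 0))) = b c * P c" for c
      unfolding P_def e_def sum_distrib_left by (rule sum.cong) auto
    ultimately show ?thesis by simp
  qed
  have le: "b c * \<theta> (measure mu {t. c < h (y (grid_index y n t))}) \<le> b c * P c" for c
  proof (cases "c \<le> 0")
    case True then show ?thesis using b by simp
  next
    case False
    have inf': "\<alpha> = \<infinity> \<Longrightarrow> \<not> e c n" using inf False by (auto simp: e_def)
    let ?M = "(\<Sum>i<n. if e c i then z (Suc i) - z i else 0) + (if e c n then real_of_ereal \<alpha> - z n else 0)"
    have "0 \<le> ?M"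
    proof (rule add_nonneg_nonneg)
      show "0 \<le> (\<Sum>i<n. if e c i then z (Suc i) - z i else 0)" by (intro sum_nonneg) (use zm in \<open>auto intro: less_imp_le\<close>)
      show "0 \<le> (if e c n then real_of_ereal \<alpha> - z n else 0)"
        using inf' z\<alpha>[of n] alpha_pos by (cases \<alpha>) auto
    qed
    moreover have "emeasure mu {t. e c (grid_index y n t)} = ennreal ?M"
      unfolding z_def by (rule emeasure_mu_grid[of n y "e c", OF n yI ym inf'])
    ultimately have "measure mu {t. c < h (y (grid_index y n t))} = ?M"
      by (simp add: measure_def e_def)
    moreover have "\<theta> ?M \<le> (\<Sum>i<n. if e c i \<noteq> e c (Suc i) then f (z (Suc i)) else 0)"
      by (rule grid_isoperimetric[of z n \<theta> "e c", OF _ zm z\<alpha> \<theta>0 \<theta>\<alpha> \<theta>f inf']) (auto simp: z_def)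
    moreover have "\<dots> = P c"
      unfolding P_def by (intro sum.cong refl if_cong) (use f_W[OF yI] in \<open>auto simp: z_def\<close>)
    ultimately show ?thesis using b(2)[of c] by (simp add: mult_left_mono)
  qed
  have conth: "continuous_on UNIV h" using h by (auto intro!: continuous_at_imp_continuous_on DERIV_isCont)
  have contg: "continuous_on S (\<lambda>t. b (h t) * \<bar>h' t\<bar>)" for S
    by (intro continuous_on_mult continuous_on_rabs continuous_on_compose2[OF b(1)] continuous_on_subset[OF conth] continuous_on_subset[OF h']) auto
  have y0n: "y 0 \<le> y n" and mono: "\<And>i. i \<le> n \<Longrightarrow> y 0 \<le> y i \<and> y i \<le> y n"
  proof -
    have m: "y i \<le> y k" if "i \<le> k" "k \<le> n" for i k
      using that
    proof (induction k)
      case (Suc k) then show ?case using ym[of k] by (cases "i = Suc k") auto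
    qed auto
    show "y 0 \<le> y n" "\<And>i. i \<le> n \<Longrightarrow> y 0 \<le> y i \<and> y i \<le> y n" using m by auto
  qed
  have contw: "continuous_on {y 0..y n} w"
    using w_continuous_I1 by (rule continuous_on_subset)
      (use I1_downward[OF yI[of n]] yI[of 0] in \<open>auto simp: mem_I1\<close>)
  have contwg: "continuous_on {y 0..y n} (\<lambda>t. w t * (b (h t) * \<bar>h' t\<bar>))"
    by (intro continuous_on_mult contw contg)
  \<comment> \<open>on one cell: fundamental theorem of calculus for \<open>B \<circ> h\<close>, where \<open>B\<close> is a primitive of \<open>b\<close>\<close>
  have piece: "\<kappa> * (w (y (Suc i)) * \<bar>B (h (y (Suc i))) - B (h (y i))\<bar>) \<le> integral {y i..y (Suc i)} (\<lambda>t. w t * (b (h t) * \<bar>h' t\<bar>))"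
    if i: "i < n" for i
  proof -
    have sub: "{y i..y (Suc i)} \<subseteq> {y 0..y n}" using mono[of i] mono[of "Suc i"] i by auto
    have "((\<lambda>t. b (h t) * h' t) has_integral (B (h (y (Suc i))) - B (h (y i)))) {y i..y (Suc i)}"
    proof (rule fundamental_theorem_of_calculus)
      show "y i \<le> y (Suc i)" using ym[OF i] by simp
      fix t
      have "((\<lambda>t. B (h t)) has_real_derivative b (h t) * h' t) (at t within {y i..y (Suc i)})"
        by (rule DERIV_chain2[OF B has_field_derivative_at_within[OF h]])
      then show "((\<lambda>t. B (h t)) has_vector_derivative b (h t) * h' t) (at t within {y i..y (Suc i)})"
        by (simp add: has_real_derivative_iff_has_vector_derivative)
    qed
    then have "\<bar>B (h (y (Suc i))) - B (h (y i))\<bar> = norm (integral {y i..y (Suc i)} (\<lambda>t. b (h t) * h' t))"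
      by (simp add: integral_unique)
    also have "\<dots> \<le> integral {y i..y (Suc i)} (\<lambda>t. b (h t) * \<bar>h' t\<bar>)"
    proof (rule Henstock_Kurzweil_Integration.integral_norm_bound_integral)
      show "(\<lambda>t. b (h t) * h' t) integrable_on {y i..y (Suc i)}"
        by (intro integrable_continuous_real continuous_on_mult continuous_on_compose2[OF b(1)]
           continuous_on_subset[OF conth] continuous_on_subset[OF h']) auto
      show "(\<lambda>t. b (h t) * \<bar>h' t\<bar>) integrable_on {y i..y (Suc i)}"
        by (intro integrable_continuous_real contg)
    qed (use b(2) in \<open>auto simp: abs_mult\<close>)
    finally have "\<bar>B (h (y (Suc i))) - B (h (y i))\<bar> \<le> integral {y i..y (Suc i)} (\<lambda>t. b (h t) * \<bar>h' t\<bar>)" .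
    then have "(\<kappa> * w (y (Suc i))) * \<bar>B (h (y (Suc i))) - B (h (y i))\<bar> \<le> (\<kappa> * w (y (Suc i))) * integral {y i..y (Suc i)} (\<lambda>t. b (h t) * \<bar>h' t\<bar>)"
      using \<kappa>(1) w_pos[OF yI[of "Suc i"]] i by (intro mult_left_mono) auto
    also have "\<dots> = integral {y i..y (Suc i)} (\<lambda>t. (\<kappa> * w (y (Suc i))) * (b (h t) * \<bar>h' t\<bar>))" by simp
    also have "\<dots> \<le> integral {y i..y (Suc i)} (\<lambda>t. w t * (b (h t) * \<bar>h' t\<bar>))"
    proof (rule integral_le)
      show "(\<lambda>t. \<kappa> * w (y (Suc i)) * (b (h t) * \<bar>h' t\<bar>)) integrable_on {y i..y (Suc i)}"
        by (intro integrable_continuous_real continuous_on_mult continuous_on_const contg)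
      show "(\<lambda>t. w t * (b (h t) * \<bar>h' t\<bar>)) integrable_on {y i..y (Suc i)}"
        by (intro integrable_continuous_real continuous_on_subset[OF contwg sub])
    qed (use \<kappa>(2)[OF i] b(2) in \<open>auto intro!: mult_right_mono\<close>)
    finally show ?thesis by (simp add: mult.assoc)
  qed
  have "\<kappa> * (\<integral>c. b c * P c \<partial>lborel) = \<kappa> * (\<Sum>i<n. w (y (Suc i)) * \<bar>B (h (y (Suc i))) - B (h (y i))\<bar>)"
    using P by (simp add: has_bochner_integral_integral_eq)
  also have "\<dots> \<le> (\<Sum>i<n. integral {y i..y (Suc i)} (\<lambda>t. w t * (b (h t) * \<bar>h' t\<bar>)))"
    unfolding sum_distrib_left by (rule sum_mono) (use piece in auto)
  also have "\<dots> = integral {y 0..y n} (\<lambda>t. w t * (b (h t) * \<bar>h' t\<bar>))"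
    using sum_integral_grid[of n y, OF _ contwg] ym less_imp_le by blast
  finally have main: "\<kappa> * (\<integral>c. b c * P c \<partial>lborel) \<le> integral {y 0..y n} (\<lambda>t. w t * (b (h t) * \<bar>h' t\<bar>))" .
  show ?thesis
  proof (cases "integrable lborel (\<lambda>c. b c * \<theta> (measure mu {t. c < h (y (grid_index y n t))}))")
    case True
    have "(\<integral>c. b c * \<theta> (measure mu {t. c < h (y (grid_index y n t))}) \<partial>lborel) \<le> (\<integral>c. b c * P c \<partial>lborel)"
      by (rule integral_mono[OF True _ le]) (use P in \<open>simp add: has_bochner_integral_iff\<close>)
    then show ?thesis using main \<kappa>(1) mult_left_mono order_trans by blast
  next
    \<comment> \<open>the integral of a function that is not integrable is \<open>0\<close>\<close>
    case False
    then have "(\<integral>c. b c * \<theta> (measure mu {t. c < h (y (grid_index y n t))}) \<partial>lborel) = 0"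
      by (rule not_integrable_integral_eq)
    moreover have "0 \<le> (\<integral>c. b c * P c \<partial>lborel)"
    proof (intro integral_nonneg_AE AE_I2)
      fix c
      have "0 \<le> P c" unfolding P_def by (intro sum_nonneg) (use w_pos[OF yI] in \<open>auto intro: less_imp_le\<close>)
      then show "0 \<le> b c * P c" using b(2) by simp
    qed
    ultimately show ?thesis using order_trans[OF mult_nonneg_nonneg[OF \<kappa>(1)] main] by simp
  qed
qed

end

section \<open>Measures of superlevel sets\<close>

text \<open>
  Where \<open>|mk - m| < d\<close> the integrands differ by at most \<open>e\<close>; elsewhere they differ by at most \<open>2 B\<close>, hence by at most
  \<open>(2 B / d) |mk - m|\<close>, whose integral tends to \<open>0\<close>.
\<close>

lemma tendsto_integral_compose_L1:
  fixes G :: "'p::euclidean_space \<Rightarrow> real \<Rightarrow> real" and m :: "'p \<Rightarrow> real" and mk :: "nat \<Rightarrow> 'p \<Rightarrow> real"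
  assumes D: "D \<in> sets borel" "bounded D"
    and uc: "\<And>e. e > 0 \<Longrightarrow> \<exists>d>0. \<forall>p\<in>D. \<forall>s s'. \<bar>s - s'\<bar> < d \<longrightarrow> \<bar>G p s - G p s'\<bar> \<le> e"
    and B: "\<And>p s. \<bar>G p s\<bar> \<le> B" and G0: "\<And>p s. p \<notin> D \<Longrightarrow> G p s = 0"
    and meas: "\<And>k. (\<lambda>p. G p (mk k p)) \<in> borel_measurable borel" "(\<lambda>p. G p (m p)) \<in> borel_measurable borel"
      "\<And>k. mk k \<in> borel_measurable borel" "m \<in> borel_measurable borel"
    and lim: "(\<lambda>k. \<integral>\<^sup>+p. indicator D p * ennreal \<bar>mk k p - m p\<bar> \<partial>lborel) \<longlonglongrightarrow> 0"
  shows "(\<lambda>k. \<integral>p. G p (mk k p) \<partial>lborel) \<longlonglongrightarrow> (\<integral>p. G p (m p) \<partial>lborel)"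
proof -
  note [measurable] = meas D(1)
  have Bn: "0 \<le> B" using B[of undefined undefined] by linarith
  have int: "integrable lborel (\<lambda>p. G p (mk k p))" "integrable lborel (\<lambda>p. G p (m p))" for k
    by (rule integrable_compact_support[OF _ D(2), where B=B], use B G0 meas in auto)+
  define \<mu> where "\<mu> = measure lborel D"
  have Dfin: "emeasure lborel D < \<infinity>" using emeasure_bounded_finite[OF D(2)] .
  show ?thesis
  proof (rule LIMSEQ_I)
    fix r :: real assume r: "r > 0"
    define e where "e = r / (2 * (\<mu> + 1))"
    have mu0: "0 \<le> \<mu>" by (simp add: \<mu>_def)
    have e: "e > 0" using r mu0 by (simp add: e_def)
    obtain d where d: "d > 0" "\<And>p s s'. p \<in> D \<Longrightarrow> \<bar>s - s'\<bar> < d \<Longrightarrow> \<bar>G p s - G p s'\<bar> \<le> e"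
      using uc[OF e] by blast
    define L where "L = 2 * B / d"
    have L: "0 \<le> L" using Bn d by (simp add: L_def)
    have pw: "\<bar>G p s - G p s'\<bar> \<le> e + L * \<bar>s - s'\<bar>" if "p \<in> D" for p s s'
    proof (cases "\<bar>s - s'\<bar> < d")
      case True
      then show ?thesis using d(2)[OF that True] L by (smt (verit) mult_nonneg_nonneg abs_ge_zero)
    next
      case False
      have "\<bar>G p s - G p s'\<bar> \<le> 2 * B" using B[of p s] B[of p s'] by linarith
      also have "\<dots> \<le> L * \<bar>s - s'\<bar>"
        using False d Bn mult_left_mono[of d "\<bar>s - s'\<bar>" "L"] L by (simp add: L_def)
      finally show ?thesis using e by linarith
    qed
    have "eventually (\<lambda>k. (\<integral>\<^sup>+p. indicator D p * ennreal \<bar>mk k p - m p\<bar> \<partial>lborel) < ennreal (r / (2 * (L + 1)))) sequentially"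
      by (rule order_tendstoD(2)[OF lim]) (use r L in auto)
    then obtain N where N: "\<And>k. k \<ge> N \<Longrightarrow> (\<integral>\<^sup>+p. indicator D p * ennreal \<bar>mk k p - m p\<bar> \<partial>lborel) < ennreal (r / (2 * (L + 1)))"
      by (auto simp: eventually_sequentially)
    show "\<exists>N. \<forall>k\<ge>N. norm ((\<integral>p. G p (mk k p) \<partial>lborel) - (\<integral>p. G p (m p) \<partial>lborel)) < r"
    proof (intro exI[of _ N] allI impI)
      fix k assume k: "k \<ge> N"
      let ?J = "\<integral>\<^sup>+p. indicator D p * ennreal \<bar>mk k p - m p\<bar> \<partial>lborel"
      have J: "?J < ennreal (r / (2 * (L + 1)))" using N[OF k] .
      have "ennreal (norm ((\<integral>p. G p (mk k p) \<partial>lborel) - (\<integral>p. G p (m p) \<partial>lborel)))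
         = ennreal (norm (\<integral>p. G p (mk k p) - G p (m p) \<partial>lborel))"
        using int by simp
      also have "\<dots> \<le> (\<integral>\<^sup>+p. ennreal (norm (G p (mk k p) - G p (m p))) \<partial>lborel)"
        by (rule integral_norm_bound_ennreal) (use int in simp)
      also have "\<dots> \<le> (\<integral>\<^sup>+p. ennreal e * indicator D p + ennreal L * (indicator D p * ennreal \<bar>mk k p - m p\<bar>) \<partial>lborel)"
      proof (rule nn_integral_mono)
        fix p
        show "ennreal (norm (G p (mk k p) - G p (m p))) \<le> ennreal e * indicator D p + ennreal L * (indicator D p * ennreal \<bar>mk k p - m p\<bar>)"
        proof (cases "p \<in> D")
          case True
          have "ennreal (norm (G p (mk k p) - G p (m p))) \<le> ennreal (e + L * \<bar>mk k p - m p\<bar>)"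
            using pw[OF True] by (intro ennreal_leI) simp
          also have "\<dots> = ennreal e + ennreal L * ennreal \<bar>mk k p - m p\<bar>"
            using e L by (simp add: ennreal_mult[symmetric])
          finally show ?thesis using True by simp
        next
          case False then show ?thesis using G0 by simp
        qed
      qed
      also have "\<dots> = ennreal e * emeasure lborel D + ennreal L * ?J"
        by (simp add: nn_integral_add nn_integral_cmult)
      also have "ennreal e * emeasure lborel D = ennreal (e * \<mu>)"
        using Dfin e by (simp add: \<mu>_def emeasure_eq_ennreal_measure ennreal_mult)
      also have "ennreal (e * \<mu>) + ennreal L * ?J \<le> ennreal (e * \<mu>) + ennreal L * ennreal (r / (2 * (L + 1)))"
        using J by (intro add_left_mono mult_left_mono) auto
      also have "\<dots> = ennreal (e * \<mu> + L * (r / (2 * (L + 1))))"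
        using L e mu0 r by (simp add: ennreal_mult[symmetric] ennreal_plus[symmetric] del: ennreal_plus)
      finally have "norm ((\<integral>p. G p (mk k p) \<partial>lborel) - (\<integral>p. G p (m p) \<partial>lborel)) \<le> e * \<mu> + L * (r / (2 * (L + 1)))"
        by (subst (asm) ennreal_le_iff) (use L e mu0 r in auto)
      also have "\<dots> < r"
      proof -
        have "e * \<mu> = r / 2 * (\<mu> / (\<mu> + 1))" by (simp add: e_def)
        also have "\<dots> < r / 2 * 1" using r mu0 by (intro mult_strict_left_mono) auto
        finally have 1: "e * \<mu> < r / 2" by simp
        have "L * (r / (2 * (L + 1))) = r / 2 * (L / (L + 1))" by simp
        also have "\<dots> \<le> r / 2 * 1" using r L by (intro mult_left_mono) auto
        finally have "L * (r / (2 * (L + 1))) \<le> r / 2" by simp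
        then show ?thesis using 1 by linarith
      qed
      finally show "norm ((\<integral>p. G p (mk k p) \<partial>lborel) - (\<integral>p. G p (m p) \<partial>lborel)) < r" .
    qed
  qed
qed

lemma nn_integral_crossing_le:
  fixes a b C :: real
  shows "(\<integral>\<^sup>+c. indicator {0<..<C} c * (if (c < a) \<noteq> (c < b) then 1 else 0) \<partial>lborel) \<le> ennreal \<bar>a - b\<bar>"
    and "(\<integral>\<^sup>+c. indicator {0<..<C} c * (if (c < a) \<noteq> (c < b) then 1 else 0) \<partial>lborel) \<le> ennreal C"
proof -
  have "(\<integral>\<^sup>+c. indicator {0<..<C} c * (if (c < a) \<noteq> (c < b) then 1 else 0) \<partial>lborel) \<le> (\<integral>\<^sup>+c. indicator {min a b..max a b} c \<partial>lborel)"
    by (intro nn_integral_mono) (auto simp: indicator_def)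
  also have "\<dots> = ennreal \<bar>a - b\<bar>" by (simp add: max_def min_def)
  finally show "(\<integral>\<^sup>+c. indicator {0<..<C} c * (if (c < a) \<noteq> (c < b) then 1 else 0) \<partial>lborel) \<le> ennreal \<bar>a - b\<bar>" .
  have "(\<integral>\<^sup>+c. indicator {0<..<C} c * (if (c < a) \<noteq> (c < b) then 1 else 0) \<partial>lborel) \<le> (\<integral>\<^sup>+c. indicator {0<..<C} c \<partial>lborel)"
    by (intro nn_integral_mono) (auto simp: indicator_def)
  also have "\<dots> \<le> ennreal C" by (cases "0 \<le> C") auto
  finally show "(\<integral>\<^sup>+c. indicator {0<..<C} c * (if (c < a) \<noteq> (c < b) then 1 else 0) \<partial>lborel) \<le> ennreal C" .
qed

lemma measure_diff_le_symmetric_difference: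
  assumes "A \<in> sets M" "B \<in> sets M"
  shows "ennreal \<bar>measure M A - measure M B\<bar> \<le> emeasure M ((A - B) \<union> (B - A))"
proof (cases "emeasure M ((A - B) \<union> (B - A)) = \<infinity>")
  case False
  have *: "emeasure M A \<le> emeasure M B + emeasure M ((A - B) \<union> (B - A))" if "A \<in> sets M" "B \<in> sets M" for A B
  proof -
    have "emeasure M A \<le> emeasure M (B \<union> ((A - B) \<union> (B - A)))" by (rule emeasure_mono) (use that in auto)
    also have "\<dots> \<le> emeasure M B + emeasure M ((A - B) \<union> (B - A))" by (rule emeasure_subadditive) (use that in auto)
    finally show ?thesis .
  qed
  have AB: "emeasure M A \<le> emeasure M B + emeasure M ((A - B) \<union> (B - A))"
    and BA: "emeasure M B \<le> emeasure M A + emeasure M ((A - B) \<union> (B - A))"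
    using *[OF assms] *[OF assms(2,1)] by (simp_all add: Un_commute)
  show ?thesis
  proof (cases "emeasure M A = \<infinity>")
    case True
    then have "emeasure M B = \<infinity>" using AB False by (simp add: top_unique)
    then show ?thesis using True by (simp add: measure_def)
  next
    case Afin: False
    then have Bfin: "emeasure M B \<noteq> \<infinity>" using BA False by (auto simp: top_unique)
    let ?S = "(A - B) \<union> (B - A)"
    have "ennreal (measure M A) \<le> ennreal (measure M B) + ennreal (measure M ?S)"
      "ennreal (measure M B) \<le> ennreal (measure M A) + ennreal (measure M ?S)"
      using AB BA Afin Bfin False by (simp_all add: emeasure_eq_ennreal_measure)
    then have "measure M A \<le> measure M B + measure M ?S" "measure M B \<le> measure M A + measure M ?S"
      by (simp_all add: ennreal_plus[symmetric] ennreal_le_iff del: ennreal_plus)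
    then have "\<bar>measure M A - measure M B\<bar> \<le> measure M ?S" by linarith
    then show ?thesis using False by (simp add: emeasure_eq_ennreal_measure ennreal_leI)
  qed
qed simp

context weight begin

text \<open>
  The function \<open>m\<close> of the introduction. It is set to \<open>0\<close> at levels \<open>c \<le> 0\<close>, for which the superlevel set may have infinite
  measure; it is then integrable over the whole space as soon as \<open>v\<close> has a finite weighted integral.
\<close>

definition lev :: "('a::euclidean_space \<times> real \<Rightarrow> real) \<Rightarrow> 'a \<times> real \<Rightarrow> real" where
  "lev u p = (if 0 < snd p then measure mu {y. snd p < u (fst p, y)} else 0)"

lemma lev_nonneg: "0 \<le> lev u p" by (simp add: lev_def)

lemma measurable_level_set:
  fixes u :: "'a::euclidean_space \<times> real \<Rightarrow> real"
  assumes [measurable]: "u \<in> borel_measurable borel"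
  shows "{y. c < u (x, y)} \<in> sets borel"
  by measurable

lemma measurable_lev [measurable]:
  fixes u :: "'a::euclidean_space \<times> real \<Rightarrow> real"
  assumes u[measurable]: "u \<in> borel_measurable borel"
  shows "lev u \<in> borel_measurable borel"
proof -
  have eq: "emeasure mu {y. snd p < u (fst p, y)} = (\<integral>\<^sup>+y. ennreal (wbar y) * indicator {y. snd p < u (fst p, y)} y \<partial>lborel)" for p
    by (rule emeasure_mu) (rule measurable_level_set[OF u])
  have [measurable]: "(\<lambda>p. \<integral>\<^sup>+y. ennreal (wbar y) * indicator {y. snd p < u (fst p, y)} y \<partial>lborel) \<in> borel_measurable borel"
    by (rule lborel.borel_measurable_nn_integral) (simp add: indicator_def split_def, measurable)
  show ?thesis unfolding lev_def[abs_def] measure_def eq by measurable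
qed

text \<open>
  Two functions that are close in \<open>L1\<close> have superlevel sets that are close in measure for most levels: the levels that
  separate \<open>u1(x, t)\<close> from \<open>u2(x, t)\<close> form an interval of length \<open>|u1(x, t) - u2(x, t)|\<close>. The bound \<open>g\<close> is left open because
  large differences near the ends of \<open>I1\<close> are better estimated by the number \<open>C\<close> of all levels in question.
\<close>

lemma nn_integral_lev_diff_le:
  fixes u1 u2 :: "'a::euclidean_space \<times> real \<Rightarrow> real" and g :: "'a \<times> real \<Rightarrow> ennreal"
  assumes [measurable]: "u1 \<in> borel_measurable borel" "u2 \<in> borel_measurable borel"
    and S[measurable]: "S \<in> sets borel" and g[measurable]: "g \<in> borel_measurable borel"
    and le: "\<And>x t. x \<in> S \<Longrightarrow> t \<in> I1 \<Longrightarrow>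
      (\<integral>\<^sup>+c. indicator {0<..<C} c * (if (c < u1 (x, t)) \<noteq> (c < u2 (x, t)) then 1 else 0) \<partial>lborel) \<le> g (x, t)"
  shows "(\<integral>\<^sup>+p. indicator (S \<times> {0<..<C}) p * ennreal \<bar>lev u1 p - lev u2 p\<bar> \<partial>lborel)
     \<le> (\<integral>\<^sup>+x. indicator S x * (\<integral>\<^sup>+t. g (x, t) * ennreal (wbar t) \<partial>lborel) \<partial>lborel)"
proof -
  have [measurable]: "S \<times> {0<..<C} \<in> sets borel" by (intro borel_Times) auto
  let ?\<chi> = "\<lambda>x t c. (if (c < u1 (x, t)) \<noteq> (c < u2 (x, t)) then 1 else 0) :: ennreal"
  have pw: "ennreal \<bar>lev u1 (x, c) - lev u2 (x, c)\<bar> \<le> (\<integral>\<^sup>+t. ennreal (wbar t) * ?\<chi> x t c \<partial>lborel)" if "0 < c" for x c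
  proof -
    let ?A = "{y. c < u1 (x, y)}" and ?B = "{y. c < u2 (x, y)}"
    have "ennreal \<bar>lev u1 (x, c) - lev u2 (x, c)\<bar> = ennreal \<bar>measure mu ?A - measure mu ?B\<bar>"
      using that by (simp add: lev_def)
    also have "\<dots> \<le> emeasure mu ((?A - ?B) \<union> (?B - ?A))"
      by (rule measure_diff_le_symmetric_difference) simp_all
    also have "\<dots> = (\<integral>\<^sup>+t. ennreal (wbar t) * indicator ((?A - ?B) \<union> (?B - ?A)) t \<partial>lborel)"
      by (rule emeasure_mu) simp
    also have "\<dots> = (\<integral>\<^sup>+t. ennreal (wbar t) * ?\<chi> x t c \<partial>lborel)"
      by (rule nn_integral_cong) (auto simp: indicator_def)
    finally show ?thesis .
  qed
  have "(\<integral>\<^sup>+p. indicator (S \<times> {0<..<C}) p * ennreal \<bar>lev u1 p - lev u2 p\<bar> \<partial>lborel)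
     = (\<integral>\<^sup>+p. indicator (S \<times> {0<..<C}) p * ennreal \<bar>lev u1 p - lev u2 p\<bar> \<partial>(lborel \<Otimes>\<^sub>M lborel))"
    by (simp add: lborel_prod)
  also have "\<dots> = (\<integral>\<^sup>+x. \<integral>\<^sup>+c. indicator (S \<times> {0<..<C}) (x, c) * ennreal \<bar>lev u1 (x, c) - lev u2 (x, c)\<bar> \<partial>lborel \<partial>lborel)"
    by (rule lborel.nn_integral_fst[symmetric]) (simp add: lborel_prod, measurable)
  also have "\<dots> \<le> (\<integral>\<^sup>+x. \<integral>\<^sup>+c. \<integral>\<^sup>+t. indicator S x * (indicator {0<..<C} c * (ennreal (wbar t) * ?\<chi> x t c)) \<partial>lborel \<partial>lborel \<partial>lborel)"
  proof (intro nn_integral_mono)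
    fix x c
    have "(\<integral>\<^sup>+t. indicator S x * (indicator {0<..<C} c * (ennreal (wbar t) * ?\<chi> x t c)) \<partial>lborel)
      = indicator S x * (indicator {0<..<C} c * (\<integral>\<^sup>+t. ennreal (wbar t) * ?\<chi> x t c \<partial>lborel))"
      by (simp add: nn_integral_cmult)
    then show "indicator (S \<times> {0<..<C}) (x, c) * ennreal \<bar>lev u1 (x, c) - lev u2 (x, c)\<bar>
       \<le> (\<integral>\<^sup>+t. indicator S x * (indicator {0<..<C} c * (ennreal (wbar t) * ?\<chi> x t c)) \<partial>lborel)"
      using pw[of c x] by (auto simp: indicator_def)
  qed
  also have "\<dots> = (\<integral>\<^sup>+x. \<integral>\<^sup>+t. \<integral>\<^sup>+c. indicator S x * (indicator {0<..<C} c * (ennreal (wbar t) * ?\<chi> x t c)) \<partial>lborel \<partial>lborel \<partial>lborel)"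
    by (intro nn_integral_cong lborel_pair.Fubini') measurable
  also have "\<dots> \<le> (\<integral>\<^sup>+x. \<integral>\<^sup>+t. indicator S x * (g (x, t) * ennreal (wbar t)) \<partial>lborel \<partial>lborel)"
  proof (intro nn_integral_mono)
    fix x t
    have "(\<integral>\<^sup>+c. indicator S x * (indicator {0<..<C} c * (ennreal (wbar t) * ?\<chi> x t c)) \<partial>lborel)
      = (\<integral>\<^sup>+c. (indicator S x * ennreal (wbar t)) * (indicator {0<..<C} c * ?\<chi> x t c) \<partial>lborel)"
      by (simp add: mult_ac)
    also have "\<dots> = (indicator S x * ennreal (wbar t)) * (\<integral>\<^sup>+c. indicator {0<..<C} c * ?\<chi> x t c \<partial>lborel)"
      by (rule nn_integral_cmult) measurable
    also have "\<dots> \<le> (indicator S x * ennreal (wbar t)) * g (x, t)"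
    proof (cases "x \<in> S \<and> t \<in> I1")
      case True then show ?thesis using le[of x t] by (intro mult_left_mono) auto
    next
      case False
      then have "indicator S x * ennreal (wbar t) = 0" by (auto simp: wbar_def)
      then show ?thesis by (simp only: mult_zero_left order_refl)
    qed
    finally show "(\<integral>\<^sup>+c. indicator S x * (indicator {0<..<C} c * (ennreal (wbar t) * ?\<chi> x t c)) \<partial>lborel) \<le> indicator S x * (g (x, t) * ennreal (wbar t))"
      by (simp add: mult_ac)
  qed
  also have "\<dots> = (\<integral>\<^sup>+x. indicator S x * (\<integral>\<^sup>+t. g (x, t) * ennreal (wbar t) \<partial>lborel) \<partial>lborel)"
    by (intro nn_integral_cong nn_integral_cmult) measurable
  finally show ?thesis .
qed

end

section \<open>The level inequality for a mollified function\<close>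

lemma abs_snd_diff_le_dist: "\<bar>snd p - snd q\<bar> \<le> dist p q" for p q :: "'a::metric_space \<times> real"
  using dist_snd_le[of p q] by (simp add: dist_real_def)

lemma sets_borel_Times [measurable]:
  fixes A :: "'a::second_countable_topology set" and B :: "'b::second_countable_topology set"
  shows "A \<in> sets borel \<Longrightarrow> B \<in> sets borel \<Longrightarrow> A \<times> B \<in> sets borel"
  by (rule borel_Times)

context weight begin

lemma Icc_subset_I1: "r \<in> I1 \<Longrightarrow> R \<in> I1 \<Longrightarrow> {r..R} \<subseteq> I1"
proof
  fix x assume "r \<in> I1" "R \<in> I1" "x \<in> {r..R}"
  then show "x \<in> I1" using I1_downward[of R x] mem_I1[of r] by auto
qed

lemma w_bounded_Icc: assumes "r \<in> I1" "R \<in> I1"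
  obtains B where "B > 0" "\<And>t. t \<in> {r..R} \<Longrightarrow> w t \<le> B"
proof -
  have "continuous_on {r..R} w" by (rule continuous_on_subset[OF w_continuous_I1 Icc_subset_I1[OF assms]])
  then have "bounded (w ` {r..R})" by (intro compact_imp_bounded compact_continuous_image) auto
  then obtain B where "B > 0" "\<And>t. t \<in> {r..R} \<Longrightarrow> \<bar>w t\<bar> \<le> B" unfolding bounded_pos by auto
  then show ?thesis using that[of B] by (meson abs_ge_self order_trans)
qed

text \<open>
  The field \<open>\<eta> * g\<close> is admissible up to the factor \<open>1 + e\<close>, since \<open>w\<close> varies little at distance \<open>d\<close>; by duality the mollified
  function may then be tested with the measurable field \<open>g\<close>. The function is truncated to \<open>{r'..R'}\<close>, because \<open>v\<close> need not
  be integrable near the ends of \<open>I1\<close>; the truncation is not seen by \<open>\<eta> * g\<close>, which is supported inside.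
\<close>

lemma mollified_test_bound:
  fixes v :: "'a::euclidean_space \<times> real \<Rightarrow> real" and g :: "'a \<times> real \<Rightarrow> 'a \<times> real"
  assumes C: "\<And>\<phi>. \<phi> \<in> C1_compact_support (\<Omega>' \<times> I1) \<Longrightarrow> (\<And>p. p \<in> \<Omega>' \<times> I1 \<Longrightarrow> norm (\<phi> p) \<le> w (snd p)) \<Longrightarrow>
       (\<integral>p. v p * divergence \<phi> p \<partial>lborel) \<le> C"
    and d: "d > 0" and e: "e \<ge> 0"
    and rR: "r' \<in> I1" "R' \<in> I1" "r' + d \<le> r" "R + d \<le> R'"
    and v1: "integrable lborel (\<lambda>p. if snd p \<in> {r'..R'} then v p else 0)"
    and K: "compact K" "\<And>x x'. x \<in> K \<Longrightarrow> dist x x' \<le> d \<Longrightarrow> x' \<in> \<Omega>'"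
    and w: "\<And>s t. t \<in> {r..R} \<Longrightarrow> \<bar>s - t\<bar> \<le> d \<Longrightarrow> w t \<le> (1 + e) * w s"
    and g: "g \<in> borel_measurable borel" "\<And>p. p \<notin> K \<times> {r..R} \<Longrightarrow> g p = 0"
      "\<And>p. p \<in> K \<times> {r..R} \<Longrightarrow> norm (g p) \<le> w (snd p)"
  shows "- (\<integral>p. mollify_gradient d (\<lambda>p. if snd p \<in> {r'..R'} then v p else 0) p \<bullet> g p \<partial>lborel) \<le> (1 + e) * C"
proof -
  let ?v1 = "\<lambda>p. if snd p \<in> {r'..R'} then v p else 0"
  define g' where "g' p = (1 / (1 + e)) *\<^sub>R g p" for p
  have rI: "r \<in> I1" "R \<in> I1" if "r \<le> R"
  proof -
    have "0 < r'" using rR(1) by (simp add: mem_I1)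
    then show "r \<in> I1" "R \<in> I1"
      using I1_downward[OF rR(2), of R] I1_downward[OF rR(2), of r] rR(3,4) d that by linarith+
  qed
  have KR: "compact (K \<times> {r..R})" using K(1) by (intro compact_Times) auto
  have intg: "integrable lborel g"
  proof (cases "r \<le> R")
    case True
    obtain B where B: "B > 0" "\<And>t. t \<in> {r..R} \<Longrightarrow> w t \<le> B" 
      by (rule w_bounded_Icc[OF rI[OF True]]) (rule that)
    have "norm (g p) \<le> B" for p
    proof (cases "p \<in> K \<times> {r..R}")
      case True
      then have "snd p \<in> {r..R}" by auto
      from g(3)[OF True] B(2)[OF this] show ?thesis by linarith
    next
      case False then show ?thesis using g(2) B(1) by simp
    qed
    then show ?thesis using integrable_compact_support[OF g(1) compact_imp_bounded[OF KR] g(2)] by blast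
  next
    case False
    then have "g = (\<lambda>p. 0)" using g(2) by auto
    then show ?thesis by simp
  qed
  have intg': "integrable lborel g'" unfolding g'_def using intg by simp
  have g'0: "g' p = 0" if "p \<notin> K \<times> {r..R}" for p using g(2)[OF that] by (simp add: g'_def)
  let ?\<phi> = "mollify d g'"
  have near: "x \<in> I1" if "t \<in> {r..R}" "\<bar>x - t\<bar> \<le> d" for x t
  proof -
    have "r' \<le> x" "x \<le> R'" using that rR by auto
    then show ?thesis using I1_downward[OF rR(2), of x] mem_I1[of r'] rR(1) by linarith
  qed
  have \<phi>: "?\<phi> \<in> C1_compact_support (\<Omega>' \<times> I1)"
  proof (rule mollify_C1_compact_support[OF d intg' KR g'0])
    fix p q assume p: "p \<in> K \<times> {r..R}" and pq: "dist p q \<le> d"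
    have "dist (fst p) (fst q) \<le> d" using dist_fst_le[of p q] pq by linarith
    then have "fst q \<in> \<Omega>'" using K(2) p by auto
    moreover have "snd q \<in> I1"
      using near[of "snd p" "snd q"] abs_snd_diff_le_dist[of q p] p pq by (auto simp: dist_commute)
    ultimately show "q \<in> \<Omega>' \<times> I1" by (cases q) auto
  qed
  have "norm (?\<phi> p) \<le> w (snd p)" if p: "p \<in> \<Omega>' \<times> I1" for p
  proof (rule norm_mollify_le[OF d])
    show w0: "0 \<le> w (snd p)" using w_pos[of "snd p"] p by auto
    fix t assume t: "dist p t < d"
    show "norm (g' t) \<le> w (snd p)"
    proof (cases "t \<in> K \<times> {r..R}")
      case True
      have "norm (g t) \<le> w (snd t)" by (rule g(3)[OF True])
      also have "\<dots> \<le> (1 + e) * w (snd p)"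
        using w[of "snd t" "snd p"] True t abs_snd_diff_le_dist[of p t] by auto
      finally show ?thesis using e by (simp add: g'_def field_simps)
    next
      case False then show ?thesis using g'0 w0 by simp
    qed
  qed
  then have "(\<integral>p. v p * divergence ?\<phi> p \<partial>lborel) \<le> C" by (rule C[OF \<phi>])
  moreover have "(\<integral>p. v p * divergence ?\<phi> p \<partial>lborel) = (\<integral>p. ?v1 p * (\<integral>t. mollifier_grad d (p - t) \<bullet> g' t \<partial>lborel) \<partial>lborel)"
  proof (rule Bochner_Integration.integral_cong[OF refl])
    fix p
    show "v p * divergence ?\<phi> p = ?v1 p * (\<integral>t. mollifier_grad d (p - t) \<bullet> g' t \<partial>lborel)"
    proof (cases "snd p \<in> {r'..R'}")
      case True then show ?thesis by (simp add: divergence_mollify[OF d intg'])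
    next
      case False
      have "mollifier_grad d (p - t) \<bullet> g' t = 0" for t
      proof (cases "t \<in> K \<times> {r..R}")
        case True
        then have "d \<le> \<bar>snd p - snd t\<bar>" using False rR by auto
        then have "d \<le> norm (p - t)" using abs_snd_diff_le_dist[of p t] by (simp add: dist_norm)
        then show ?thesis using mollifier_grad_zero[OF d, of "p - t"] by simp
      qed (simp add: g'0)
      then show ?thesis using False by (simp add: divergence_mollify[OF d intg'])
    qed
  qed
  moreover have "\<dots> = - (\<integral>t. mollify_gradient d ?v1 t \<bullet> g' t \<partial>lborel)"
    unfolding mollify_gradient_def by (rule mollify_grad_duality[OF d v1 intg'])
  moreover have "\<dots> = - (\<integral>t. mollify_gradient d ?v1 t \<bullet> g t \<partial>lborel) / (1 + e)"
    by (simp add: g'_def)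
  ultimately have "- (\<integral>t. mollify_gradient d ?v1 t \<bullet> g t \<partial>lborel) / (1 + e) \<le> C" by simp
  then show ?thesis using e by (simp add: field_simps)
qed

text \<open>
  The level inequality for a smooth function \<open>V\<close> on a strip \<open>{y 0..y n}\<close>, obtained from the field
  \<open>w (a(x, V), - b(x, V) sgn(V_y))\<close> where \<open>\<Phi> = (a, b)\<close>. It involves two versions of the levels: cut off outside the
  strip for the horizontal part, and sampled on the grid for the vertical part.
\<close>

lemma level_lower_bound:
  fixes V :: "'a::euclidean_space \<times> real \<Rightarrow> real" and \<Phi> :: "'a \<times> real \<Rightarrow> 'a \<times> real" and \<theta> :: "real \<Rightarrow> real"
    and y :: "nat \<Rightarrow> real"
  assumes V: "\<And>p. (V has_derivative (\<lambda>h. DV p \<bullet> h)) (at p)" and DV: "continuous_on UNIV DV"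
    and \<Phi>: "\<Phi> \<in> C1_compact_support (\<Omega>' \<times> {0<..})" "\<And>p. norm (\<Phi> p) \<le> 1" "\<And>p. 0 \<le> snd (\<Phi> p)"
    and K: "compact K" "\<And>p. fst p \<notin> K \<Longrightarrow> \<Phi> p = 0"
    and H: "\<And>g. g \<in> borel_measurable borel \<Longrightarrow> (\<And>p. p \<notin> K \<times> {y 0..y n} \<Longrightarrow> g p = 0) \<Longrightarrow>
       (\<And>p. p \<in> K \<times> {y 0..y n} \<Longrightarrow> norm (g p) \<le> w (snd p)) \<Longrightarrow> - (\<integral>p. DV p \<bullet> g p \<partial>lborel) \<le> C'"
    and n: "n \<ge> 1" and yI: "\<And>i. i \<le> n \<Longrightarrow> y i \<in> I1" and ym: "\<And>i. i < n \<Longrightarrow> y i < y (Suc i)"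
    and \<theta>0: "\<theta> 0 = 0" and \<theta>\<alpha>: "\<alpha> < \<infinity> \<Longrightarrow> \<theta> (real_of_ereal \<alpha>) = 0"
    and \<theta>f: "\<And>s. 0 < s \<Longrightarrow> ereal s < \<alpha> \<Longrightarrow> \<theta> s \<le> f s"
    and \<theta>c: "continuous_on UNIV \<theta>" "\<And>s. \<bar>\<theta> s\<bar> \<le> \<Theta>"
    and \<kappa>: "0 \<le> \<kappa>" "\<And>i t. i < n \<Longrightarrow> t \<in> {y i..y (Suc i)} \<Longrightarrow> \<kappa> * w (y (Suc i)) \<le> w t"
    and inf: "\<And>x. \<alpha> = \<infinity> \<Longrightarrow> V (x, y n) \<le> 0"
  shows "(\<integral>p. lev (\<lambda>p. if snd p \<in> {y 0..y n} then V p else 0) p * hdivergence \<Phi> p \<partial>lborel)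
     + \<kappa> * (\<integral>p. snd (\<Phi> p) * \<theta> (lev (\<lambda>p. V (fst p, y (grid_index y n (snd p)))) p) \<partial>lborel) \<le> C'"
proof -
  let ?r = "y 0" and ?R = "y n"
  let ?u1 = "\<lambda>p. if snd p \<in> {?r..?R} then V p else 0"
  let ?u2 = "\<lambda>p. V (fst p, y (grid_index y n (snd p)))"
  let ?S = "K \<times> {?r..?R}"
  obtain K0 where K0: "compact K0" "K0 \<subseteq> \<Omega>' \<times> {0<..}" "\<And>x. x \<notin> K0 \<Longrightarrow> \<Phi> x = 0"
    "\<And>x h. x \<notin> K0 \<Longrightarrow> frechet_derivative \<Phi> (at x) h = 0"
    by (rule C1_compact_support_obtain[OF \<Phi>(1)]) (rule that)
  have hd0: "hdivergence \<Phi> p = 0" if "p \<notin> K0" for p using K0(4)[OF that] by (simp add: hdivergence_def)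
  have K0pos: "0 < snd p" if "p \<in> K0" for p using K0(2) that by auto
  have cont\<Phi>: "continuous_on UNIV \<Phi>" by (rule C1_compact_support_continuous[OF \<Phi>(1)])
  have conthd: "continuous_on UNIV (hdivergence \<Phi>)" by (rule continuous_hdivergence[OF \<Phi>(1)])
  obtain Bh where Bh: "Bh \<ge> 0" "\<And>p. norm (hdivergence \<Phi> p) \<le> Bh"
    using bounded_compact_support[OF conthd K0(1) hd0] by metis
  have contV: "continuous_on UNIV V"
    by (rule has_derivative_continuous_on[where f'="\<lambda>p h. DV p \<bullet> h"]) (simp add: V)
  have [measurable]: "V \<in> borel_measurable borel" "DV \<in> borel_measurable borel" "\<Phi> \<in> borel_measurable borel"
    "hdivergence \<Phi> \<in> borel_measurable borel" "\<theta> \<in> borel_measurable borel" "K \<in> sets borel"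
    using contV DV cont\<Phi> conthd \<theta>c K(1) by (auto intro!: borel_measurable_continuous_onI borel_closed compact_imp_closed)
  have Kbd: "bounded ?S" using K(1) by (intro compact_imp_bounded compact_Times) auto
  have rI: "?r \<in> I1" "?R \<in> I1" using yI by auto
  have sub: "{?r..?R} \<subseteq> I1" by (rule Icc_subset_I1[OF rI])
  obtain Bw where Bw: "Bw > 0" "\<And>t. t \<in> {?r..?R} \<Longrightarrow> w t \<le> Bw" 
    by (rule w_bounded_Icc[OF rI]) (rule that)
  have wb: "wbar t = w t" "0 \<le> w t" "w t \<le> Bw" if "t \<in> {?r..?R}" for t
    using that sub Bw(2) w_pos[of t] by (auto simp: wbar_def less_imp_le)
  have "bounded (DV ` ?S)" using K(1)
    by (intro compact_imp_bounded compact_continuous_image compact_Times continuous_on_subset[OF DV]) auto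
  then obtain BD where BD: "BD > 0" "\<And>p. p \<in> ?S \<Longrightarrow> norm (DV p) \<le> BD" unfolding bounded_pos by auto
  \<comment> \<open>the horizontal and the vertical part of \<open>DV p \<bullet> g p\<close> for the field \<open>g\<close> defined next\<close>
  define T1 where "T1 p = indicator ?S p * (wbar (snd p) * (fst (\<Phi> (fst p, V p)) \<bullet> fst (DV p)))" for p
  define T2 where "T2 p = indicator ?S p * (wbar (snd p) * (snd (\<Phi> (fst p, V p)) * \<bar>snd (DV p)\<bar>))" for p
  define g where "g p = (indicator ?S p * wbar (snd p)) *\<^sub>R (fst (\<Phi> (fst p, V p)), - sgn (snd (DV p)) * snd (\<Phi> (fst p, V p)))" for p
  have nf: "norm (fst (\<Phi> p)) \<le> 1" "\<bar>snd (\<Phi> p)\<bar> \<le> 1" for p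
    using \<Phi>(2)[of p] norm_fst_le[of "fst (\<Phi> p)" "snd (\<Phi> p)"] norm_snd_le[of "snd (\<Phi> p)" "fst (\<Phi> p)"] by auto
  have nD: "norm (fst (DV p)) \<le> BD" "\<bar>snd (DV p)\<bar> \<le> BD" if "p \<in> ?S" for p
    using BD(2)[OF that] norm_fst_le[of "fst (DV p)" "snd (DV p)"] norm_snd_le[of "snd (DV p)" "fst (DV p)"] by auto
  have intT1: "integrable lborel T1"
  proof (rule integrable_compact_support[OF _ Kbd, where B="Bw * (1 * BD)"])
    show "T1 \<in> borel_measurable borel" unfolding T1_def by measurable
    show "norm (T1 p) \<le> Bw * (1 * BD)" for p
    proof (cases "p \<in> ?S")
      case True
      have "\<bar>fst (\<Phi> (fst p, V p)) \<bullet> fst (DV p)\<bar> \<le> norm (fst (\<Phi> (fst p, V p))) * norm (fst (DV p))"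
        by (rule Cauchy_Schwarz_ineq2)
      also have "\<dots> \<le> 1 * BD" by (intro mult_mono nf nD[OF True]) auto
      finally have "\<bar>wbar (snd p)\<bar> * \<bar>fst (\<Phi> (fst p, V p)) \<bullet> fst (DV p)\<bar> \<le> Bw * (1 * BD)"
        using wb[of "snd p"] True by (intro mult_mono) auto
      then show ?thesis using True by (simp add: T1_def abs_mult)
    next
      case False then show ?thesis using Bw(1) BD(1) by (simp add: T1_def)
    qed
  qed (simp add: T1_def)
  have intT2: "integrable lborel T2"
  proof (rule integrable_compact_support[OF _ Kbd, where B="Bw * (1 * BD)"])
    show "T2 \<in> borel_measurable borel" unfolding T2_def by measurable
    show "norm (T2 p) \<le> Bw * (1 * BD)" for p
    proof (cases "p \<in> ?S")
      case True
      have A: "\<bar>snd (\<Phi> (fst p, V p))\<bar> * \<bar>snd (DV p)\<bar> \<le> 1 * BD" by (intro mult_mono nf nD[OF True]) auto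
      have "\<bar>wbar (snd p)\<bar> * (\<bar>snd (\<Phi> (fst p, V p))\<bar> * \<bar>snd (DV p)\<bar>) \<le> Bw * (1 * BD)"
        by (rule mult_mono[OF _ A]) (use wb[of "snd p"] True Bw(1) in auto)
      then show ?thesis using True by (simp add: T2_def abs_mult)
    next
      case False then show ?thesis using Bw(1) BD(1) by (simp add: T2_def)
    qed
  qed (simp add: T2_def)
  have "- (\<integral>p. DV p \<bullet> g p \<partial>lborel) \<le> C'"
  proof (rule H)
    show "g \<in> borel_measurable borel" unfolding g_def by measurable
    show "norm (g p) \<le> w (snd p)" if "p \<in> ?S" for p
    proof -
      have "norm (fst (\<Phi> (fst p, V p)), - sgn (snd (DV p)) * snd (\<Phi> (fst p, V p))) \<le> norm (\<Phi> (fst p, V p))"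
        unfolding norm_Pair norm_prod_def[of "\<Phi> _"]
        by (intro real_sqrt_le_mono add_left_mono) (auto simp: power_mult_distrib sgn_real_def)
      also have "\<dots> \<le> 1" by (rule \<Phi>(2))
      finally have "\<bar>wbar (snd p)\<bar> * norm (fst (\<Phi> (fst p, V p)), - sgn (snd (DV p)) * snd (\<Phi> (fst p, V p))) \<le> w (snd p) * 1"
        using wb[of "snd p"] that by (intro mult_mono) auto
      then show ?thesis unfolding g_def norm_scaleR using that by simp
    qed
  qed (simp add: g_def zero_prod_def)
  moreover have "DV p \<bullet> g p = T1 p - T2 p" for p
    unfolding g_def T1_def T2_def
    by (simp add: inner_prod_def[of "DV p"] inner_commute[of "fst (DV p)"] abs_sgn[of "snd (DV p)"] algebra_simps)
  ultimately have main: "- (\<integral>p. T1 p \<partial>lborel) + (\<integral>p. T2 p \<partial>lborel) \<le> C'"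
    using intT1 intT2 by simp
  \<comment> \<open>divergence theorem on the subgraph of \<open>V(\<cdot>, t)\<close>, then Fubini in \<open>t\<close>\<close>
  have X1: "- (\<integral>p. T1 p \<partial>lborel) = (\<integral>p. lev ?u1 p * hdivergence \<Phi> p \<partial>lborel)"
  proof -
    define Z where "Z = (\<lambda>(t, q). indicator {?r..?R} t * wbar t * (if snd q < V (fst q, t) then hdivergence \<Phi> q else 0))"
    have Zm: "Z \<in> borel_measurable borel" unfolding Z_def split_def by measurable
    have intZ: "integrable (lborel \<Otimes>\<^sub>M lborel) Z"
    proof -
      have "integrable lborel Z"
      proof (rule integrable_compact_support[OF Zm, where B="Bw * Bh"])
        show "bounded ({?r..?R} \<times> K0)" using K0(1) by (intro compact_imp_bounded compact_Times) auto
        show "Z p = 0" if "p \<notin> {?r..?R} \<times> K0" for p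
        proof -
          have "fst p \<notin> {?r..?R} \<or> snd p \<notin> K0" using that by (cases p) auto
          then show ?thesis using hd0[of "snd p"] by (auto simp: Z_def split_def)
        qed
        show "norm (Z p) \<le> Bw * Bh" for p
        proof (cases "fst p \<in> {?r..?R}")
          case True
          have "\<bar>wbar (fst p)\<bar> * \<bar>hdivergence \<Phi> (snd p)\<bar> \<le> Bw * Bh"
            using wb[OF True] Bh(2)[of "snd p"] by (intro mult_mono) auto
          then show ?thesis using True Bw(1) Bh(1) by (auto simp: Z_def split_def abs_mult)
        next
          case False then show ?thesis using Bw(1) Bh(1) by (simp add: Z_def split_def)
        qed
      qed
      then show ?thesis by (simp add: lborel_prod)
    qed
    have slice: "(\<integral>x. T1 (x, t) \<partial>lborel) = - (\<integral>q. Z (t, q) \<partial>lborel)" for t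
    proof -
      have "(\<integral>x. T1 (x, t) \<partial>lborel) = (\<integral>x. (indicator {?r..?R} t * wbar t) * (fst (\<Phi> (x, V (x, t))) \<bullet> fst (DV (x, t))) \<partial>lborel)"
      proof (rule Bochner_Integration.integral_cong[OF refl])
        fix x
        show "T1 (x, t) = (indicator {?r..?R} t * wbar t) * (fst (\<Phi> (x, V (x, t))) \<bullet> fst (DV (x, t)))"
          using K(2)[of "(x, V (x, t))"] by (cases "x \<in> K") (auto simp: T1_def indicator_def)
      qed
      also have "\<dots> = (indicator {?r..?R} t * wbar t) * (\<integral>x. fst (\<Phi> (x, V (x, t))) \<bullet> fst (DV (x, t)) \<partial>lborel)" by simp
      also have "(\<integral>x. fst (\<Phi> (x, V (x, t))) \<bullet> fst (DV (x, t)) \<partial>lborel)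
          = - (\<integral>x. (\<integral>c. indicator {..<V (x, t)} c * hdivergence \<Phi> (x, c) \<partial>lborel) \<partial>lborel)"
      proof (rule subgraph_divergence(1)[OF \<Phi>(1)])
        show "continuous_on UNIV (\<lambda>x. fst (DV (x, t)))"
          by (intro continuous_on_fst continuous_on_compose2[OF DV] continuous_on_Pair continuous_on_id continuous_on_const) auto
        fix x :: 'a
        have "((\<lambda>x. (x, t)) has_derivative (\<lambda>d. (d, 0))) (at x)" by (auto intro!: derivative_eq_intros)
        from has_derivative_compose[OF this, of V "\<lambda>h. DV (x, t) \<bullet> h"]
        show "((\<lambda>x. V (x, t)) has_derivative (\<lambda>d. fst (DV (x, t)) \<bullet> d)) (at x)"
          using V[of "(x, t)"] by (simp add: inner_prod_def)
      qed
      also have "(\<integral>x. (\<integral>c. indicator {..<V (x, t)} c * hdivergence \<Phi> (x, c) \<partial>lborel) \<partial>lborel)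
          = (\<integral>q. (if snd q < V (fst q, t) then hdivergence \<Phi> q else 0) \<partial>lborel)"
      proof -
        have "integrable lborel (\<lambda>q. if snd q < V (fst q, t) then hdivergence \<Phi> q else 0)"
        proof (rule integrable_compact_support[where B=Bh])
          show "bounded K0" using K0(1) by (rule compact_imp_bounded)
          show "norm (if snd q < V (fst q, t) then hdivergence \<Phi> q else 0) \<le> Bh" for q using Bh by auto
        qed (use hd0 in auto)
        then have "integrable (lborel \<Otimes>\<^sub>M lborel) (\<lambda>q. if snd q < V (fst q, t) then hdivergence \<Phi> q else 0)"
          by (simp add: lborel_prod)
        from lborel_pair.integral_fst'[OF this]
        have "(\<integral>x. \<integral>c. (if c < V (x, t) then hdivergence \<Phi> (x, c) else 0) \<partial>lborel \<partial>lborel)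
            = (\<integral>q. (if snd q < V (fst q, t) then hdivergence \<Phi> q else 0) \<partial>lborel)"
          by (simp add: lborel_prod)
        moreover have "(if c < V (x, t) then hdivergence \<Phi> (x, c) else 0) = indicator {..<V (x, t)} c * hdivergence \<Phi> (x, c)" for x c
          by simp
        ultimately show ?thesis by (simp only:)
      qed
      finally show ?thesis by (simp add: Z_def)
    qed
    have "(\<integral>p. T1 p \<partial>lborel) = (\<integral>t. (\<integral>x. T1 (x, t) \<partial>lborel) \<partial>lborel)"
      using lborel_pair.integral_snd[of "\<lambda>x t. T1 (x, t)"] intT1 by (simp add: lborel_prod)
    also have "\<dots> = - (\<integral>t. (\<integral>q. Z (t, q) \<partial>lborel) \<partial>lborel)" unfolding slice by simp
    also have "(\<integral>t. (\<integral>q. Z (t, q) \<partial>lborel) \<partial>lborel) = (\<integral>q. (\<integral>t. Z (t, q) \<partial>lborel) \<partial>lborel)"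
      using lborel_pair.Fubini_integral[of "\<lambda>t q. Z (t, q)"] intZ by simp
    also have "(\<lambda>q. (\<integral>t. Z (t, q) \<partial>lborel)) = (\<lambda>q. lev ?u1 q * hdivergence \<Phi> q)"
    proof
      fix q
      show "(\<integral>t. Z (t, q) \<partial>lborel) = lev ?u1 q * hdivergence \<Phi> q"
      proof (cases "q \<in> K0")
        case False
        then have h0: "hdivergence \<Phi> q = 0" by (rule hd0)
        then have "Z (t, q) = 0" for t by (simp add: Z_def)
        then show ?thesis using h0 by simp
      next
        case True
        have pos: "0 < snd q" using K0pos[OF True] .
        let ?A = "{t. t \<in> {?r..?R} \<and> snd q < V (fst q, t)}"
        have [measurable]: "?A \<in> sets borel" by measurable
        have "{t. snd q < ?u1 (fst q, t)} = ?A" using pos by auto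
        then have "lev ?u1 q = enn2real (\<integral>\<^sup>+t. ennreal (wbar t) * indicator ?A t \<partial>lborel)"
          using pos emeasure_mu[of ?A] by (simp add: lev_def measure_def)
        also have "(\<integral>\<^sup>+t. ennreal (wbar t) * indicator ?A t \<partial>lborel) = (\<integral>\<^sup>+t. ennreal (wbar t * indicator ?A t) \<partial>lborel)"
          by (intro nn_integral_cong) (auto simp: indicator_def)
        also have "enn2real \<dots> = (\<integral>t. wbar t * indicator ?A t \<partial>lborel)"
          by (rule integral_eq_nn_integral[symmetric]) (auto simp: wbar_nonneg)
        finally have "lev ?u1 q * hdivergence \<Phi> q = (\<integral>t. (wbar t * indicator ?A t) * hdivergence \<Phi> q \<partial>lborel)" by simp
        moreover have "(wbar t * indicator ?A t) * hdivergence \<Phi> q = Z (t, q)" for t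
          by (auto simp: Z_def indicator_def)
        ultimately show ?thesis by (simp only:)
      qed
    qed
    finally show ?thesis by simp
  qed
  \<comment> \<open>the one-dimensional inequality on every vertical line\<close>
  have X2: "\<kappa> * (\<integral>p. snd (\<Phi> p) * \<theta> (lev ?u2 p) \<partial>lborel) \<le> (\<integral>p. T2 p \<partial>lborel)"
  proof -
    have u2m[measurable]: "?u2 \<in> borel_measurable borel" by measurable
    have intb: "integrable lborel (\<lambda>p. snd (\<Phi> p) * \<theta> (lev ?u2 p))"
    proof (rule integrable_compact_support[where B="1 * \<Theta>"])
      show "bounded K0" using K0(1) by (rule compact_imp_bounded)
      show "norm (snd (\<Phi> p) * \<theta> (lev ?u2 p)) \<le> 1 * \<Theta>" for p
        unfolding real_norm_def abs_mult by (intro mult_mono nf \<theta>c) auto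
    qed (use K0(3) in auto)
    then have intb': "integrable (lborel \<Otimes>\<^sub>M lborel) (\<lambda>p. snd (\<Phi> p) * \<theta> (lev ?u2 p))" by (simp add: lborel_prod)
    have intT2': "integrable (lborel \<Otimes>\<^sub>M lborel) T2" using intT2 by (simp add: lborel_prod)
    have "\<kappa> * (\<integral>p. snd (\<Phi> p) * \<theta> (lev ?u2 p) \<partial>lborel) = \<kappa> * (\<integral>x. \<integral>c. snd (\<Phi> (x, c)) * \<theta> (lev ?u2 (x, c)) \<partial>lborel \<partial>lborel)"
      using lborel_pair.integral_fst'[OF intb'] by (simp add: lborel_prod)
    also have "\<dots> = (\<integral>x. \<kappa> * (\<integral>c. snd (\<Phi> (x, c)) * \<theta> (lev ?u2 (x, c)) \<partial>lborel) \<partial>lborel)" by simp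
    also have "\<dots> \<le> (\<integral>x. \<integral>t. T2 (x, t) \<partial>lborel \<partial>lborel)"
    proof (rule integral_mono)
      show "integrable lborel (\<lambda>x. \<kappa> * (\<integral>c. snd (\<Phi> (x, c)) * \<theta> (lev ?u2 (x, c)) \<partial>lborel))"
        using lborel_pair.integrable_fst'[OF intb'] by simp
      show "integrable lborel (\<lambda>x. \<integral>t. T2 (x, t) \<partial>lborel)" using lborel_pair.integrable_fst'[OF intT2'] .
      fix x
      show "\<kappa> * (\<integral>c. snd (\<Phi> (x, c)) * \<theta> (lev ?u2 (x, c)) \<partial>lborel) \<le> (\<integral>t. T2 (x, t) \<partial>lborel)"
      proof (cases "x \<in> K")
        case False
        then have "\<Phi> (x, c) = 0" for c using K(2)[of "(x, c)"] by simp
        then show ?thesis using False by (simp add: T2_def)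
      next
        case True
        let ?b = "\<lambda>c. snd (\<Phi> (x, c))"
        have b0: "?b c = 0" if "c \<le> 0" for c using K0(3)[of "(x, c)"] K0pos[of "(x, c)"] that by force
        have eq: "snd (\<Phi> (x, c)) * \<theta> (lev ?u2 (x, c)) = ?b c * \<theta> (measure mu {t. c < V (x, y (grid_index y n t))})" for c
          using b0[of c] by (cases "0 < c") (auto simp: lev_def)
        have contg: "continuous_on {?r..?R} (\<lambda>t. w t * (?b (V (x, t)) * \<bar>snd (DV (x, t))\<bar>))"
          by (intro continuous_on_mult continuous_on_rabs continuous_on_snd continuous_on_subset[OF w_continuous_I1 sub]
            continuous_on_compose2[OF cont\<Phi>] continuous_on_compose2[OF contV] continuous_on_compose2[OF DV]
            continuous_on_Pair continuous_on_id continuous_on_const) auto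
        have "\<kappa> * (\<integral>c. ?b c * \<theta> (measure mu {t. c < V (x, y (grid_index y n t))}) \<partial>lborel)
           \<le> integral {?r..?R} (\<lambda>t. w t * (?b (V (x, t)) * \<bar>snd (DV (x, t))\<bar>))"
        proof (rule total_variation_ge_level_perimeter[of n y "\<lambda>t. V (x, t)", OF n yI ym])
          fix t :: real
          have "((\<lambda>t. (x, t)) has_derivative (\<lambda>d. (0, d))) (at t)" by (auto intro!: derivative_eq_intros)
          from has_derivative_compose[OF this, of V "\<lambda>h. DV (x, t) \<bullet> h"]
          have "((\<lambda>t. V (x, t)) has_derivative (\<lambda>d. snd (DV (x, t)) * d)) (at t)"
            using V[of "(x, t)"] by (simp add: inner_prod_def)
          then show "((\<lambda>t. V (x, t)) has_real_derivative snd (DV (x, t))) (at t)"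
            by (simp add: has_field_derivative_def)
        next
          show "continuous_on UNIV (\<lambda>t. snd (DV (x, t)))"
            by (intro continuous_on_snd continuous_on_compose2[OF DV] continuous_on_Pair continuous_on_id continuous_on_const) auto
          show "continuous_on UNIV ?b"
            by (intro continuous_on_snd continuous_on_compose2[OF cont\<Phi>] continuous_on_Pair continuous_on_id continuous_on_const) auto
        qed (use \<Phi>(3) b0 \<theta>0 \<theta>\<alpha> \<theta>f \<kappa> inf in auto)
        also have "\<dots> = (\<integral>t. indicator {?r..?R} t *\<^sub>R (w t * (?b (V (x, t)) * \<bar>snd (DV (x, t))\<bar>)) \<partial>lborel)"
          using set_borel_integral_eq_integral(2)[OF borel_integrable_atLeastAtMost'[OF contg]]
          unfolding set_lebesgue_integral_def by simp
        also have "\<dots> = (\<integral>t. T2 (x, t) \<partial>lborel)"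
          by (intro Bochner_Integration.integral_cong refl) (use True wb in \<open>auto simp: T2_def indicator_def\<close>)
        finally show ?thesis unfolding eq .
      qed
    qed
    also have "\<dots> = (\<integral>p. T2 p \<partial>lborel)"
      using lborel_pair.integral_fst'[OF intT2'] by (simp add: lborel_prod)
    finally show ?thesis .
  qed
  show ?thesis using main X1 X2 by simp
qed

end

section \<open>The level inequality\<close>

lemma uniform_grid:
  fixes r h :: real
  assumes h: "h > 0" and n: "n \<ge> 1"
  defines "y \<equiv> \<lambda>i. r + real i * h"
  shows "t \<ge> y n \<Longrightarrow> grid_index y n t = n"
    and "y 0 \<le> t \<Longrightarrow> t \<le> y n \<Longrightarrow> \<bar>t - y (grid_index y n t)\<bar> \<le> h"
    and "y 0 \<le> y (grid_index y n t)" "y (grid_index y n t) \<le> y n"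
proof -
  have ym: "y i < y (Suc i)" for i using h by (simp add: y_def algebra_simps)
  have iff: "j \<le> grid_index y n t \<longleftrightarrow> y j \<le> t" if "1 \<le> j" "j \<le> n" for j t
    by (rule le_grid_index_iff) (use ym that in auto)
  show "grid_index y n t = n" if "t \<ge> y n"
    using iff[of n t] that n grid_index_le[of y n t] by auto
  show "y 0 \<le> y (grid_index y n t)" using h by (simp add: y_def)
  show "y (grid_index y n t) \<le> y n" using h grid_index_le[of y n t] by (simp add: y_def mult_right_mono)
  show "\<bar>t - y (grid_index y n t)\<bar> \<le> h" if t: "y 0 \<le> t" "t \<le> y n"
  proof -
    let ?j = "grid_index y n t"
    have 1: "y ?j \<le> t" using iff[of ?j t] grid_index_le[of y n t] t by (cases "?j = 0") auto
    have 2: "t \<le> y ?j + h"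
    proof (cases "?j = n")
      case True then show ?thesis using t h by simp
    next
      case False
      then have "Suc ?j \<le> n" using grid_index_le[of y n t] by simp
      then have "\<not> y (Suc ?j) \<le> t" using iff[of "Suc ?j" t] by auto
      then show ?thesis by (simp add: y_def algebra_simps)
    qed
    show ?thesis using 1 2 h by simp
  qed
qed

context weight begin

text \<open>
  Near the lower end of \<open>I1\<close> there is little measure, so the truncation to \<open>{r..R}\<close> changes the levels little.
\<close>

lemma W_small: assumes "e > 0" obtains r where "r \<in> I1" "W r < e"
proof -
  obtain b where b: "b \<in> I1" using I1_nonempty .
  define a where "a i = b / real (Suc (Suc i))" for i
  have b0: "0 < b" using b by (simp add: mem_I1)
  have a: "0 < a i" "a i \<le> b" for i using b0 by (auto simp: a_def field_simps)
  have "(\<lambda>i. b * inverse (real (Suc (Suc i)))) \<longlonglongrightarrow> b * 0"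
    by (intro tendsto_intros LIMSEQ_Suc[OF LIMSEQ_inverse_real_of_nat])
  then have alim: "a \<longlonglongrightarrow> 0" by (simp add: a_def[abs_def] divide_inverse)
  have "continuous_on {0..b} W" by (rule W_continuous_Icc[OF I1_subset_closure[OF b]])
  then have "(\<lambda>i. W (a i)) \<longlonglongrightarrow> W 0"
    by (rule continuous_on_tendsto_compose[OF _ alim]) (use a b0 in \<open>auto intro!: always_eventually simp: less_imp_le\<close>)
  then obtain i where "W (a i) < e" using order_tendstoD(2)[of _ "W 0" sequentially e] assms by (auto simp: eventually_sequentially)
  then show ?thesis using that[of "a i"] I1_downward[OF b a] by auto
qed

text \<open>
  Layer cake: the integral of \<open>lev v\<close> over all levels is the weighted integral of \<open>v\<close>.
\<close>

lemma integrable_lev: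
  fixes v :: "'a::euclidean_space \<times> real \<Rightarrow> real"
  assumes v[measurable]: "v \<in> borel_measurable borel" and nn: "\<And>p. 0 \<le> v p"
    and int: "integrable lborel (\<lambda>p. v p * wbar (snd p))"
  shows "integrable lborel (lev v)" "(\<integral>\<^sup>+p. ennreal (lev v p) \<partial>lborel) \<le> (\<integral>\<^sup>+p. ennreal (v p * wbar (snd p)) \<partial>lborel)"
proof -
  have pw: "ennreal (lev v (x, c)) \<le> (\<integral>\<^sup>+t. ennreal (wbar t) * (if 0 < c \<and> c < v (x, t) then 1 else 0) \<partial>lborel)" for x c
  proof (cases "0 < c")
    case True
    have "ennreal (lev v (x, c)) \<le> emeasure mu {t. c < v (x, t)}"
      using True by (simp add: lev_def measure_def) (metis enn2real_top ennreal_0 ennreal_enn2real ennreal_top_neq_zero linorder_le_cases not_le order_refl top.not_eq_extremum zero_le)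
    also have "\<dots> = (\<integral>\<^sup>+t. ennreal (wbar t) * indicator {t. c < v (x, t)} t \<partial>lborel)"
      by (rule emeasure_mu) measurable
    also have "\<dots> = (\<integral>\<^sup>+t. ennreal (wbar t) * (if 0 < c \<and> c < v (x, t) then 1 else 0) \<partial>lborel)"
      using True by (intro nn_integral_cong) (auto simp: indicator_def)
    finally show ?thesis .
  qed (simp add: lev_def)
  have "(\<integral>\<^sup>+p. ennreal (lev v p) \<partial>lborel) = (\<integral>\<^sup>+x. \<integral>\<^sup>+c. ennreal (lev v (x, c)) \<partial>lborel \<partial>lborel)"
    by (subst lborel.nn_integral_fst) (simp_all add: lborel_prod)
  also have "\<dots> \<le> (\<integral>\<^sup>+x. \<integral>\<^sup>+c. \<integral>\<^sup>+t. ennreal (wbar t) * (if 0 < c \<and> c < v (x, t) then 1 else 0) \<partial>lborel \<partial>lborel \<partial>lborel)"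
    by (intro nn_integral_mono pw)
  also have "\<dots> = (\<integral>\<^sup>+x. \<integral>\<^sup>+t. \<integral>\<^sup>+c. ennreal (wbar t) * (if 0 < c \<and> c < v (x, t) then 1 else 0) \<partial>lborel \<partial>lborel \<partial>lborel)"
    by (intro nn_integral_cong lborel_pair.Fubini') measurable
  also have "\<dots> = (\<integral>\<^sup>+x. \<integral>\<^sup>+t. ennreal (v (x, t) * wbar t) \<partial>lborel \<partial>lborel)"
  proof (intro nn_integral_cong)
    fix x t
    have "(\<integral>\<^sup>+c. ennreal (wbar t) * (if 0 < c \<and> c < v (x, t) then 1 else 0) \<partial>lborel) = ennreal (wbar t) * (\<integral>\<^sup>+c. (if 0 < c \<and> c < v (x, t) then 1 else 0) \<partial>lborel)"
      by (rule nn_integral_cmult) measurable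
    also have "(\<integral>\<^sup>+c. (if 0 < c \<and> c < v (x, t) then 1 else 0) \<partial>lborel) = (\<integral>\<^sup>+c. indicator {0<..<v (x, t)} c \<partial>lborel)"
      by (intro nn_integral_cong) (auto simp: indicator_def)
    also have "\<dots> = ennreal (v (x, t))" using nn[of "(x, t)"] by simp
    finally show "(\<integral>\<^sup>+c. ennreal (wbar t) * (if 0 < c \<and> c < v (x, t) then 1 else 0) \<partial>lborel) = ennreal (v (x, t) * wbar t)"
      using nn[of "(x, t)"] wbar_nonneg[of t] by (simp add: ennreal_mult mult.commute)
  qed
  also have "\<dots> = (\<integral>\<^sup>+p. ennreal (v p * wbar (snd p)) \<partial>lborel)"
    using lborel.nn_integral_fst[of "\<lambda>p. ennreal (v p * wbar (snd p))" lborel] by (simp add: lborel_prod)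
  finally show le: "(\<integral>\<^sup>+p. ennreal (lev v p) \<partial>lborel) \<le> (\<integral>\<^sup>+p. ennreal (v p * wbar (snd p)) \<partial>lborel)" .
  also have "\<dots> < \<infinity>" using int nn wbar_nonneg by (simp add: integrable_iff_bounded)
  finally show "integrable lborel (lev v)" by (intro integrableI_bounded) (simp_all add: lev_nonneg)
qed

text \<open>
  The error budget for \<open>level_approximation\<close>. Below \<open>r\<close>, and above \<open>R\<close> if \<open>\<alpha>\<close> is finite, the crude bound \<open>C0\<close> is multiplied
  by a small measure; in between, \<open>D\<close> is the mollification error and \<open>\<eta>\<close> the sampling error.
\<close>

lemma level_approximation_bound:
  fixes V v1 :: "'a::euclidean_space \<times> real \<Rightarrow> real"
  assumes Vm[measurable]: "V \<in> borel_measurable borel" "v1 \<in> borel_measurable borel" and K: "compact K"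
    and rR: "r \<in> I1" "R \<in> I1" "r \<le> R" and Bw: "0 < Bw" "\<And>t. t \<in> {r..R} \<Longrightarrow> w t \<le> Bw"
    and C0: "0 \<le> C0" and \<eta>: "0 \<le> \<eta>" and \<tau>: "\<alpha> < \<infinity> \<Longrightarrow> real_of_ereal \<alpha> - W R \<le> \<tau>" "0 \<le> \<tau>"
    and L1: "(\<integral>\<^sup>+p. ennreal \<bar>V p - v1 p\<bar> \<partial>lborel) \<le> ennreal D" "0 \<le> D"
  defines "g \<equiv> \<lambda>p. (ennreal C0 * indicator {..<r} (snd p) + (if \<alpha> = \<infinity> then 0 else ennreal C0 * indicator {R..} (snd p)))
       + indicator {r..R} (snd p) * (ennreal \<bar>V p - v1 p\<bar> + ennreal \<eta>)"
  shows "(\<integral>\<^sup>+x. indicator K x * (\<integral>\<^sup>+t. g (x, t) * ennreal (wbar t) \<partial>lborel) \<partial>lborel)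
    \<le> ennreal (measure lborel K * (C0 * W r + C0 * \<tau> + Bw * \<eta> * (R - r)) + Bw * D)"
proof -
  define \<mu> where "\<mu> = measure lborel K"
  have Km[measurable]: "K \<in> sets borel" using K by (simp add: borel_closed compact_imp_closed)
  have K\<mu>: "emeasure lborel K = ennreal \<mu>"
    using emeasure_bounded_finite[OF compact_imp_bounded[OF K]] by (simp add: \<mu>_def emeasure_eq_ennreal_measure)
  have wbB: "wbar t \<le> Bw" if "t \<in> {r..R}" for t using that Bw(1) Bw(2)[of t] by (auto simp: wbar_def)
  have W0: "0 \<le> W r" using W_pos[OF rR(1)] by simp
  have gm[measurable]: "g \<in> borel_measurable borel" unfolding g_def by measurable
  have inner: "(\<integral>\<^sup>+t. g (x, t) * ennreal (wbar t) \<partial>lborel) \<le> ennreal (C0 * W r + C0 * \<tau> + Bw * \<eta> * (R - r)) + ennreal Bw * (\<integral>\<^sup>+t. ennreal \<bar>V (x, t) - v1 (x, t)\<bar> \<partial>lborel)" for x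
  proof -
    let ?a = "\<lambda>t. ennreal C0 * (ennreal (wbar t) * indicator {..<r} t)"
    let ?b = "\<lambda>t. (if \<alpha> = \<infinity> then 0 else ennreal C0) * (ennreal (wbar t) * indicator {R..} t)"
    let ?c = "\<lambda>t. ennreal Bw * ennreal \<bar>V (x, t) - v1 (x, t)\<bar>"
    let ?d = "\<lambda>t. ennreal (Bw * \<eta>) * indicator {r..R} t"
    have "(\<integral>\<^sup>+t. g (x, t) * ennreal (wbar t) \<partial>lborel) \<le> (\<integral>\<^sup>+t. ?a t + ?b t + ?c t + ?d t \<partial>lborel)"
    proof (rule nn_integral_mono)
      fix t
      have "indicator {r..R} t * (ennreal \<bar>V (x, t) - v1 (x, t)\<bar> + ennreal \<eta>) * ennreal (wbar t) \<le> ?c t + ?d t"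
      proof (cases "t \<in> {r..R}")
        case True
        have "(ennreal \<bar>V (x, t) - v1 (x, t)\<bar> + ennreal \<eta>) * ennreal (wbar t) \<le> (ennreal \<bar>V (x, t) - v1 (x, t)\<bar> + ennreal \<eta>) * ennreal Bw"
          by (intro mult_left_mono ennreal_leI wbB[OF True]) auto
        also have "\<dots> = ?c t + ennreal (Bw * \<eta>)"
          using Bw(1) \<eta> by (simp add: distrib_left ennreal_mult mult.commute[of _ "ennreal Bw"])
        finally show ?thesis using True by simp
      qed simp
      moreover have "(ennreal C0 * indicator {..<r} t + (if \<alpha> = \<infinity> then 0 else ennreal C0 * indicator {R..} t)) * ennreal (wbar t) = ?a t + ?b t"
        by (cases "\<alpha> = \<infinity>") (simp_all add: distrib_left distrib_right mult_ac)
      moreover have "g (x, t) * ennreal (wbar t) = (ennreal C0 * indicator {..<r} t + (if \<alpha> = \<infinity> then 0 else ennreal C0 * indicator {R..} t)) * ennreal (wbar t)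
         + indicator {r..R} t * (ennreal \<bar>V (x, t) - v1 (x, t)\<bar> + ennreal \<eta>) * ennreal (wbar t)"
        unfolding g_def snd_conv by (rule distrib_right)
      ultimately have "g (x, t) * ennreal (wbar t) \<le> (?a t + ?b t) + (?c t + ?d t)"
        by (simp only: add_left_mono)
      then show "g (x, t) * ennreal (wbar t) \<le> ?a t + ?b t + ?c t + ?d t" by (simp only: add.assoc)
    qed
    also have "\<dots> = (\<integral>\<^sup>+t. ?a t \<partial>lborel) + (\<integral>\<^sup>+t. ?b t \<partial>lborel) + (\<integral>\<^sup>+t. ?c t \<partial>lborel) + (\<integral>\<^sup>+t. ?d t \<partial>lborel)"
      by (simp add: nn_integral_add)
    also have "\<dots> \<le> ennreal (C0 * W r) + ennreal (C0 * \<tau>) + ennreal Bw * (\<integral>\<^sup>+t. ennreal \<bar>V (x, t) - v1 (x, t)\<bar> \<partial>lborel) + ennreal (Bw * \<eta> * (R - r))"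
    proof (intro add_mono)
      show "(\<integral>\<^sup>+t. ?a t \<partial>lborel) \<le> ennreal (C0 * W r)"
        using emeasure_mu[of "{..<r}"] emeasure_mu_lessThan[OF rR(1)] C0 W0 by (simp add: nn_integral_cmult ennreal_mult)
      show "(\<integral>\<^sup>+t. ?b t \<partial>lborel) \<le> ennreal (C0 * \<tau>)"
      proof (cases \<alpha>)
        case (real A)
        have "(\<integral>\<^sup>+t. ?b t \<partial>lborel) = ennreal C0 * ennreal (A - W R)"
          using emeasure_mu[of "{R..}"] emeasure_mu_atLeast[OF rR(2) real] real by (simp add: nn_integral_cmult)
        also have "\<dots> \<le> ennreal C0 * ennreal \<tau>" using \<tau> real by (intro mult_left_mono ennreal_leI) auto
        finally show ?thesis using C0 \<tau> by (simp add: ennreal_mult)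
      qed (use alpha_pos in auto)
      show "(\<integral>\<^sup>+t. ?c t \<partial>lborel) \<le> ennreal Bw * (\<integral>\<^sup>+t. ennreal \<bar>V (x, t) - v1 (x, t)\<bar> \<partial>lborel)"
        by (rule eq_refl, rule nn_integral_cmult) measurable
      show "(\<integral>\<^sup>+t. ?d t \<partial>lborel) \<le> ennreal (Bw * \<eta> * (R - r))"
        using Bw(1) \<eta> rR(3) by (simp add: nn_integral_cmult ennreal_mult)
    qed
    also have "\<dots> = ennreal (C0 * W r + C0 * \<tau> + Bw * \<eta> * (R - r)) + ennreal Bw * (\<integral>\<^sup>+t. ennreal \<bar>V (x, t) - v1 (x, t)\<bar> \<partial>lborel)"
      using C0 W0 \<tau> Bw \<eta> rR by (simp add: ennreal_plus add_ac)
    finally show ?thesis .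
  qed
  let ?A = "C0 * W r + C0 * \<tau> + Bw * \<eta> * (R - r)"
  have A0: "0 \<le> ?A" using C0 W0 \<tau> Bw \<eta> rR by simp
  have "(\<integral>\<^sup>+x. indicator K x * (\<integral>\<^sup>+t. g (x, t) * ennreal (wbar t) \<partial>lborel) \<partial>lborel)
    \<le> (\<integral>\<^sup>+x. ennreal ?A * indicator K x + ennreal Bw * (\<integral>\<^sup>+t. ennreal \<bar>V (x, t) - v1 (x, t)\<bar> \<partial>lborel) \<partial>lborel)"
    by (intro nn_integral_mono) (use inner in \<open>auto simp: indicator_def\<close>)
  also have "\<dots> = ennreal ?A * ennreal \<mu> + ennreal Bw * (\<integral>\<^sup>+x. \<integral>\<^sup>+t. ennreal \<bar>V (x, t) - v1 (x, t)\<bar> \<partial>lborel \<partial>lborel)"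
    by (simp add: nn_integral_add nn_integral_cmult K\<mu>)
  also have "(\<integral>\<^sup>+x. \<integral>\<^sup>+t. ennreal \<bar>V (x, t) - v1 (x, t)\<bar> \<partial>lborel \<partial>lborel) = (\<integral>\<^sup>+p. ennreal \<bar>V p - v1 p\<bar> \<partial>lborel)"
    using lborel.nn_integral_fst[of "\<lambda>p. ennreal \<bar>V p - v1 p\<bar>" lborel] by (simp add: lborel_prod)
  also have "ennreal ?A * ennreal \<mu> + ennreal Bw * (\<integral>\<^sup>+p. ennreal \<bar>V p - v1 p\<bar> \<partial>lborel) \<le> ennreal ?A * ennreal \<mu> + ennreal Bw * ennreal D"
    by (intro add_left_mono mult_left_mono L1) auto
  also have "\<dots> = ennreal (\<mu> * ?A + Bw * D)"
    using A0 Bw L1 by (simp add: ennreal_mult[symmetric] ennreal_plus[symmetric] \<mu>_def mult.commute del: ennreal_plus)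
  finally show ?thesis by (simp add: \<mu>_def)
qed


text \<open>
  Order of the choices: first the strip \<open>{r..R}\<close>, which carries almost all of the measure \<open>mu\<close> (if \<open>\<alpha> = \<infinity>\<close>, then \<open>R\<close>
  lies so high that the mollified function vanishes at \<open>R\<close> and its sampled version beyond), then the mollification radius \<open>d\<close>, which depends on
  the oscillation of \<open>w\<close> on a slightly larger strip, and last the mesh of the grid, which depends on the modulus of continuity of
  the mollified function.
\<close>

lemma level_approximation:
  fixes v :: "'a::euclidean_space \<times> real \<Rightarrow> real" and \<Phi> :: "'a \<times> real \<Rightarrow> 'a \<times> real" and \<theta> :: "real \<Rightarrow> real"
  assumes Om: "open \<Omega>'"
    and C: "\<And>\<phi>. \<phi> \<in> C1_compact_support (\<Omega>' \<times> I1) \<Longrightarrow> (\<And>p. p \<in> \<Omega>' \<times> I1 \<Longrightarrow> norm (\<phi> p) \<le> w (snd p)) \<Longrightarrow>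
       (\<integral>p. v p * divergence \<phi> p \<partial>lborel) \<le> C"
    and v[measurable]: "v \<in> borel_measurable borel" and nn: "\<And>p. 0 \<le> v p"
    and int: "integrable lborel (\<lambda>p. v p * wbar (snd p))"
    and tail: "\<alpha> = \<infinity> \<Longrightarrow> \<exists>\<rho>. \<forall>x t. t \<ge> \<rho> \<longrightarrow> v (x, t) = 0"
    and \<Phi>: "\<Phi> \<in> C1_compact_support (\<Omega>' \<times> {0<..})" "\<And>p. norm (\<Phi> p) \<le> 1" "\<And>p. 0 \<le> snd (\<Phi> p)"
    and K: "compact K" "\<And>p. fst p \<notin> K \<Longrightarrow> \<Phi> p = 0" "K \<subseteq> \<Omega>'"
    and \<theta>0: "\<theta> 0 = 0" and \<theta>\<alpha>: "\<alpha> < \<infinity> \<Longrightarrow> \<theta> (real_of_ereal \<alpha>) = 0"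
    and \<theta>f: "\<And>s. 0 < s \<Longrightarrow> ereal s < \<alpha> \<Longrightarrow> \<theta> s \<le> f s"
    and \<theta>c: "continuous_on UNIV \<theta>" "\<And>s. \<bar>\<theta> s\<bar> \<le> \<Theta>"
    and C0: "0 \<le> C0" and \<epsilon>: "0 < \<epsilon>" "\<epsilon> < 1"
  obtains u1 u2 :: "'a \<times> real \<Rightarrow> real" where "u1 \<in> borel_measurable borel" "u2 \<in> borel_measurable borel"
    "(\<integral>p. lev u1 p * hdivergence \<Phi> p \<partial>lborel) + (1 - \<epsilon>) * (\<integral>p. snd (\<Phi> p) * \<theta> (lev u2 p) \<partial>lborel) \<le> (1 + \<epsilon>) * C"
    "(\<integral>\<^sup>+p. indicator (K \<times> {0<..<C0}) p * ennreal \<bar>lev u1 p - lev v p\<bar> \<partial>lborel) \<le> ennreal \<epsilon>"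
    "(\<integral>\<^sup>+p. indicator (K \<times> {0<..<C0}) p * ennreal \<bar>lev u2 p - lev v p\<bar> \<partial>lborel) \<le> ennreal \<epsilon>"
proof -
  define \<mu> where "\<mu> = measure lborel K"
  have \<mu>0: "0 \<le> \<mu>" by (simp add: \<mu>_def)
  \<comment> \<open>small enough for the part of \<open>K \<times> {0<..<C0}\<close> that lies over the two ends of \<open>I1\<close>\<close>
  define e1 where "e1 = \<epsilon> / (4 * (\<mu> * C0 + 1))"
  have den: "0 < \<mu> * C0 + 1" using \<mu>0 C0 by (simp add: add_nonneg_pos)
  have e1: "e1 > 0" using den \<epsilon> by (simp add: e1_def)
  have e1C: "\<mu> * (C0 * s) \<le> \<epsilon> / 4" if "0 \<le> s" "s \<le> e1" for s
  proof -
    have "\<mu> * (C0 * s) \<le> \<mu> * (C0 * e1)" using that \<mu>0 C0 by (intro mult_left_mono) auto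
    also have "\<dots> = \<epsilon> / 4 * ((\<mu> * C0) / (\<mu> * C0 + 1))" by (simp add: e1_def)
    also have "\<dots> \<le> \<epsilon> / 4 * 1" using \<epsilon> \<mu>0 C0 den by (intro mult_left_mono) auto
    finally show ?thesis by simp
  qed
  obtain r where r: "r \<in> I1" "W r < e1" by (rule W_small[OF e1]) (rule that)
  obtain R \<tau> where R: "R \<in> I1" "r < R" "0 \<le> \<tau>" "\<tau> \<le> e1" "\<alpha> < \<infinity> \<Longrightarrow> real_of_ereal \<alpha> - W R \<le> \<tau>"
    and Rtail: "\<And>x t. \<alpha> = \<infinity> \<Longrightarrow> t \<ge> R - 1 \<Longrightarrow> v (x, t) = 0"
  proof (cases "\<alpha> = \<infinity>")
    case True
    obtain \<rho> where \<rho>: "\<And>x t. t \<ge> \<rho> \<Longrightarrow> v (x, t) = 0" using tail[OF True] by blast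
    have "0 < r" using r(1) unfolding mem_I1 by blast
    then have "max (r + 1) \<rho> + 1 \<in> I1" unfolding mem_I1 unfolding alpha1_infinite[OF True] by simp
    then show ?thesis using that[of "max (r + 1) \<rho> + 1" 0] \<rho> True e1 by auto
  next
    case False
    then obtain A where A: "\<alpha> = ereal A" using alpha_pos by (cases \<alpha>) auto
    obtain R where "R \<in> I1" "A - e1 < W R" "r < R"
      by (rule W_approaches_alpha[of "A - e1" r]) (use A e1 r in auto)
    then show ?thesis using that[of R e1] A e1 by auto
  qed
  have r0: "0 < r" using r(1) by (simp add: mem_I1)
  define r' where "r' = r / 2"
  have r': "r' \<in> I1" "r' < r" using I1_downward[OF r(1), of "r / 2"] r0 by (auto simp: r'_def)
  obtain R' where R': "R < R'" "R' \<in> I1" by (rule I1_above[OF R(1)]) (rule that)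
  obtain Bw where Bw: "Bw > 0" "\<And>t. t \<in> {r..R} \<Longrightarrow> w t \<le> Bw" by (rule w_bounded_Icc[OF r(1) R(1)]) (rule that)
  have sub: "{r'..R'} \<subseteq> I1" by (rule Icc_subset_I1[OF r'(1) R'(2)])
  have wc: "continuous_on {r'..R'} w" by (rule continuous_on_subset[OF w_continuous_I1 sub])
  obtain m where m: "m > 0" "\<And>t. t \<in> {r'..R'} \<Longrightarrow> m \<le> w t"
  proof -
    have "{r'..R'} \<noteq> {}" using r' R R' by auto
    then obtain t0 where "t0 \<in> {r'..R'}" "\<And>t. t \<in> {r'..R'} \<Longrightarrow> w t0 \<le> w t"
      using continuous_attains_inf[OF compact_Icc _ wc] by blast
    moreover have "0 < w t0" using w_pos[of t0] sub \<open>t0 \<in> {r'..R'}\<close> by blast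
    ultimately show ?thesis using that by blast
  qed
  define v1 where "v1 = (\<lambda>p. if snd p \<in> {r'..R'} then v p else 0)"
  have v1m[measurable]: "v1 \<in> borel_measurable borel" unfolding v1_def by measurable
  have intv1: "integrable lborel v1"
  proof (rule Bochner_Integration.integrable_bound[where f="\<lambda>p. (1 / m) * (v p * wbar (snd p))"])
    show "integrable lborel (\<lambda>p. (1 / m) * (v p * wbar (snd p)))" using int by simp
    show "AE p in lborel. norm (v1 p) \<le> norm ((1 / m) * (v p * wbar (snd p)))"
    proof (intro AE_I2)
      fix p
      show "norm (v1 p) \<le> norm ((1 / m) * (v p * wbar (snd p)))"
      proof (cases "snd p \<in> {r'..R'}")
        case True
        then have "m \<le> wbar (snd p)" using m(2)[OF True] sub by (auto simp: wbar_def)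
        then have "v p * m \<le> v p * wbar (snd p)" by (intro mult_left_mono nn)
        then show ?thesis using True m(1) nn[of p] wbar_nonneg[of "snd p"] by (simp add: v1_def field_simps)
      qed (auto simp: v1_def)
    qed
  qed simp
  obtain dw where dw: "dw > 0" "\<And>s t. s \<in> {r'..R'} \<Longrightarrow> t \<in> {r'..R'} \<Longrightarrow> \<bar>s - t\<bar> < dw \<Longrightarrow> \<bar>w s - w t\<bar> < \<epsilon> * m"
    using compact_uniformly_continuous[OF wc compact_Icc] m(1) \<epsilon>(1)
    unfolding uniformly_continuous_on_def dist_real_def by (metis mult_pos_pos)
  obtain dK where dK0: "dK > 0" "(\<Union>x\<in>K. cball x dK) \<subseteq> \<Omega>'"
    by (rule compact_subset_open_imp_cball_epsilon_subset[OF K(1) Om K(3)]) (rule that)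
  have dK: "dK > 0" "\<And>x x'. x \<in> K \<Longrightarrow> dist x x' \<le> dK \<Longrightarrow> x' \<in> \<Omega>'"
  proof -
    show "dK > 0" by (rule dK0(1))
    fix x x' assume "x \<in> K" "dist x x' \<le> dK"
    then have "x' \<in> (\<Union>x\<in>K. cball x dK)" by (intro UN_I[of x]) auto
    then show "x' \<in> \<Omega>'" using dK0(2) by (rule subsetD[rotated])
  qed
  define d0 where "d0 = Min {r - r', R' - R, 1, dw, dK}"
  have d0: "0 < d0" "d0 \<le> r - r'" "d0 \<le> R' - R" "d0 \<le> 1" "d0 \<le> dw" "d0 \<le> dK"
    unfolding d0_def using r' R' dw dK by auto
  have "\<forall>\<^sub>F d in at_right 0. (\<integral>x. norm (mollify d v1 x - v1 x) \<partial>lborel) < \<epsilon> / (4 * Bw)"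
    by (rule order_tendstoD(2)[OF mollify_tendsto_L1[OF intv1]]) (use \<epsilon> Bw in auto)
  then have "\<forall>\<^sub>F d in at_right 0. d \<in> {0<..<d0} \<and> (\<integral>x. norm (mollify d v1 x - v1 x) \<partial>lborel) < \<epsilon> / (4 * Bw)"
    by (intro eventually_conj eventually_at_right_real[OF d0(1)])
  then obtain d where d: "0 < d" "d < d0" "(\<integral>x. norm (mollify d v1 x - v1 x) \<partial>lborel) < \<epsilon> / (4 * Bw)"
    using eventually_happens[of _ "at_right (0::real)"] by (auto simp: trivial_limit_at_right_real)
  define V where "V = mollify d v1"
  define D where "D = (\<integral>x. norm (V x - v1 x) \<partial>lborel)"
  have D0: "0 \<le> D" by (simp add: D_def)
  have BD: "Bw * D \<le> \<epsilon> / 4" using d(3) Bw(1) by (simp add: D_def V_def field_simps)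
  have contV: "continuous_on UNIV V" unfolding V_def by (rule continuous_mollify[OF d(1) intv1])
  have Vm[measurable]: "V \<in> borel_measurable borel" by (rule borel_measurable_continuous_onI[OF contV])
  have L1: "(\<integral>\<^sup>+p. ennreal \<bar>V p - v1 p\<bar> \<partial>lborel) \<le> ennreal D"
    using nn_integral_eq_integral[of lborel "\<lambda>p. norm (V p - v1 p)"] integrable_mollify[OF d(1) intv1] intv1
    by (simp add: D_def V_def)
  have wle: "w t \<le> (1 + \<epsilon>) * w s" if "t \<in> {r..R}" "\<bar>s - t\<bar> \<le> d" for s t
  proof -
    have t: "t \<in> {r'..R'}" using that r' R' by auto
    have s: "s \<in> {r'..R'}" using that d d0 by auto
    have "\<bar>t - s\<bar> < dw" using that d d0 by auto
    then have "w t < w s + \<epsilon> * m" using dw(2)[OF t s] by linarith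
    also have "\<dots> \<le> w s + \<epsilon> * w s" using m(2)[OF s] \<epsilon> by (intro add_left_mono mult_left_mono) auto
    finally show ?thesis by (simp add: algebra_simps)
  qed
  define \<eta> where "\<eta> = \<epsilon> / (4 * (\<mu> * Bw * (R - r) + 1))"
  have den2: "0 < \<mu> * Bw * (R - r) + 1" using \<mu>0 Bw R by (simp add: add_nonneg_pos)
  have \<eta>: "0 < \<eta>" using den2 \<epsilon> by (simp add: \<eta>_def)
  have \<eta>C: "\<mu> * (Bw * \<eta> * (R - r)) \<le> \<epsilon> / 4"
  proof -
    have "\<mu> * (Bw * \<eta> * (R - r)) = \<epsilon> / 4 * ((\<mu> * Bw * (R - r)) / (\<mu> * Bw * (R - r) + 1))" by (simp add: \<eta>_def)
    also have "\<dots> \<le> \<epsilon> / 4 * 1" using \<epsilon> den2 by (intro mult_left_mono) auto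
    finally show ?thesis by simp
  qed
  have "uniformly_continuous_on (K \<times> {r..R}) V"
    using K(1) by (intro compact_uniformly_continuous continuous_on_subset[OF contV] compact_Times) auto
  then obtain dV where dV: "dV > 0" "\<And>p q. p \<in> K \<times> {r..R} \<Longrightarrow> q \<in> K \<times> {r..R} \<Longrightarrow> dist p q < dV \<Longrightarrow> \<bar>V p - V q\<bar> < \<eta>"
    using \<eta> unfolding uniformly_continuous_on_def dist_real_def by metis
  obtain n0 :: nat where n0: "(R - r) / min dV d < real n0" using reals_Archimedean2 by blast
  define n where "n = Suc n0"
  define h where "h = (R - r) / real n"
  have n: "n \<ge> 1" by (simp add: n_def)
  have h: "0 < h" using R by (simp add: h_def n_def)
  have "(R - r) < min dV d * real n"
    using n0 dV(1) d(1) by (simp add: n_def divide_less_eq algebra_simps)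
  moreover have "min dV d * real n \<le> dV * real n" "min dV d * real n \<le> d * real n"
    by (intro mult_right_mono; simp)+
  ultimately have "R - r < dV * real n" "R - r < d * real n" by linarith+
  then have hd: "h < dV" "h < d" using n by (auto simp: h_def divide_less_eq)
  define y where "y = (\<lambda>i::nat. r + real i * h)"
  have y0: "y 0 = r" by (simp add: y_def)
  have yn: "y n = R" using n by (simp add: y_def h_def)
  have yrange: "y i \<in> {r..R}" if "i \<le> n" for i
  proof -
    have "real i * h \<le> real n * h" using that h by (intro mult_right_mono) auto
    then have "y i \<le> y n" unfolding y_def by linarith
    moreover have "r \<le> y i" using h by (simp add: y_def)
    ultimately show ?thesis using yn by simp
  qed
  have subrR: "{r..R} \<subseteq> I1" by (rule Icc_subset_I1[OF r(1) R(1)])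
  have yI: "y i \<in> I1" if "i \<le> n" for i using yrange[OF that] subrR by blast
  have ym: "y i < y (Suc i)" for i using h by (simp add: y_def algebra_simps)
  have grid: "R \<le> t \<Longrightarrow> grid_index y n t = n" "t \<in> {r..R} \<Longrightarrow> \<bar>t - y (grid_index y n t)\<bar> \<le> h"
    "y (grid_index y n t) \<in> {r..R}" for t
  proof -
    show "R \<le> t \<Longrightarrow> grid_index y n t = n"
      using uniform_grid(1)[OF h n, of r t] yn by (simp add: y_def)
    show "t \<in> {r..R} \<Longrightarrow> \<bar>t - y (grid_index y n t)\<bar> \<le> h"
      using uniform_grid(2)[OF h n, of r t] yn by (auto simp: y_def)
    show "y (grid_index y n t) \<in> {r..R}" by (rule yrange[OF grid_index_le])
  qed
  define u1 where "u1 = (\<lambda>p. if snd p \<in> {y 0..y n} then V p else 0)"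
  define u2 where "u2 = (\<lambda>p. V (fst p, y (grid_index y n (snd p))))"
  have u1m: "u1 \<in> borel_measurable borel" unfolding u1_def by measurable
  have u2m: "u2 \<in> borel_measurable borel" unfolding u2_def by measurable
  have VR: "V (x, R) = 0" if "\<alpha> = \<infinity>" for x
    unfolding V_def
  proof (rule mollify_eq_0[OF d(1)])
    fix t :: "'a \<times> real" assume t: "dist (x, R) t < d"
    have "\<bar>R - snd t\<bar> < d" using abs_snd_diff_le_dist[of "(x, R)" t] t by simp
    then have "snd t \<ge> R - 1" using d d0 by linarith
    then show "v1 t = 0" using Rtail[OF that, of "snd t" "fst t"] by (simp add: v1_def)
  qed
  have main: "(\<integral>p. lev u1 p * hdivergence \<Phi> p \<partial>lborel) + (1 - \<epsilon>) * (\<integral>p. snd (\<Phi> p) * \<theta> (lev u2 p) \<partial>lborel) \<le> (1 + \<epsilon>) * C"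
    unfolding u1_def u2_def
  proof (rule level_lower_bound[where V=V and DV="mollify_gradient d v1" and \<Phi>=\<Phi> and \<Omega>'=\<Omega>' and K=K
      and y=y and n=n and \<theta>=\<theta> and \<Theta>=\<Theta> and \<kappa>="1 - \<epsilon>" and C'="(1 + \<epsilon>) * C", OF _ _ \<Phi> K(1,2) _ n yI ym \<theta>0 \<theta>\<alpha> \<theta>f \<theta>c])
    show "(V has_derivative (\<lambda>h. mollify_gradient d v1 p \<bullet> h)) (at p)" for p
      unfolding V_def by (rule has_derivative_mollify_real[OF d(1) intv1])
    show "continuous_on UNIV (mollify_gradient d v1)" by (rule continuous_mollify_gradient[OF d(1) intv1])
    show "0 \<le> 1 - \<epsilon>" using \<epsilon> by simp
    show "V (x, y n) \<le> 0" if "\<alpha> = \<infinity>" for x using VR[OF that] yn by simp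
    show "(1 - \<epsilon>) * w (y (Suc i)) \<le> w t" if "i < n" "t \<in> {y i..y (Suc i)}" for i t
    proof -
      have yS: "y (Suc i) \<in> {r..R}" using yrange[of "Suc i"] that by simp
      have tr: "t \<in> {r..R}" using that(2) yS yrange[of i] that(1) by auto
      have "\<bar>t - y (Suc i)\<bar> \<le> d" using that(2) hd by (simp add: y_def algebra_simps)
      from wle[OF yS this] have "(1 - \<epsilon>) * w (y (Suc i)) \<le> (1 - \<epsilon>) * ((1 + \<epsilon>) * w t)"
        using \<epsilon> by (intro mult_left_mono) auto
      also have "\<dots> = w t - \<epsilon>\<^sup>2 * w t" by (simp add: algebra_simps power2_eq_square)
      also have "\<dots> \<le> w t" using w_pos[of t] tr subrR by (auto simp: less_imp_le)
      finally show ?thesis .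
    qed
    fix g :: "'a \<times> real \<Rightarrow> 'a \<times> real"
    assume g: "g \<in> borel_measurable borel" "\<And>p. p \<notin> K \<times> {y 0..y n} \<Longrightarrow> g p = 0"
      "\<And>p. p \<in> K \<times> {y 0..y n} \<Longrightarrow> norm (g p) \<le> w (snd p)"
    have dK': "x' \<in> \<Omega>'" if "x \<in> K" "dist x x' \<le> d" for x x' using dK(2)[of x x'] that d d0 by auto
    show "- (\<integral>p. mollify_gradient d v1 p \<bullet> g p \<partial>lborel) \<le> (1 + \<epsilon>) * C"
      unfolding v1_def
      by (rule mollified_test_bound[OF C d(1) _ r'(1) R'(2) _ _ intv1[unfolded v1_def] K(1) dK' wle g(1) g(2,3)[unfolded y0 yn]])
        (use \<epsilon> d d0 in auto)
  qed
  define g where "g = (\<lambda>p::'a \<times> real. (ennreal C0 * indicator {..<r} (snd p) + (if \<alpha> = \<infinity> then 0 else ennreal C0 * indicator {R..} (snd p)))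
       + indicator {r..R} (snd p) * (ennreal \<bar>V p - v1 p\<bar> + ennreal \<eta>))"
  have gm: "g \<in> borel_measurable borel" unfolding g_def by measurable
  have total: "(\<integral>\<^sup>+x. indicator K x * (\<integral>\<^sup>+t. g (x, t) * ennreal (wbar t) \<partial>lborel) \<partial>lborel) \<le> ennreal \<epsilon>"
  proof -
    have "(\<integral>\<^sup>+x. indicator K x * (\<integral>\<^sup>+t. g (x, t) * ennreal (wbar t) \<partial>lborel) \<partial>lborel)
        \<le> ennreal (\<mu> * (C0 * W r + C0 * \<tau> + Bw * \<eta> * (R - r)) + Bw * D)"
      unfolding g_def \<mu>_def
      by (rule level_approximation_bound[OF Vm v1m K(1) r(1) R(1) _ Bw C0 _ R(5,3) L1 D0]) (use R \<eta> in auto)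
    also have "\<dots> \<le> ennreal \<epsilon>"
    proof (rule ennreal_leI)
      have "\<mu> * (C0 * W r + C0 * \<tau> + Bw * \<eta> * (R - r)) = \<mu> * (C0 * W r) + \<mu> * (C0 * \<tau>) + \<mu> * (Bw * \<eta> * (R - r))"
        by (simp add: distrib_left)
      then show "\<mu> * (C0 * W r + C0 * \<tau> + Bw * \<eta> * (R - r)) + Bw * D \<le> \<epsilon>"
        using e1C[of "W r"] e1C[of \<tau>] \<eta>C BD W_pos[OF r(1)] r(2) R(3,4) by linarith
    qed
    finally show ?thesis .
  qed
  have close: "(\<integral>\<^sup>+p. indicator (K \<times> {0<..<C0}) p * ennreal \<bar>lev u p - lev v p\<bar> \<partial>lborel) \<le> ennreal \<epsilon>"
    if u: "u \<in> borel_measurable borel" "\<And>x t. x \<in> K \<Longrightarrow> t \<in> {r..R} \<Longrightarrow> \<bar>u (x, t) - V (x, t)\<bar> \<le> \<eta>"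
      "\<And>x t. \<alpha> = \<infinity> \<Longrightarrow> t > R \<Longrightarrow> u (x, t) = 0" for u
  proof -
    have Km: "K \<in> sets borel" using K(1) by (simp add: borel_closed compact_imp_closed)
    have "(\<integral>\<^sup>+p. indicator (K \<times> {0<..<C0}) p * ennreal \<bar>lev u p - lev v p\<bar> \<partial>lborel)
      \<le> (\<integral>\<^sup>+x. indicator K x * (\<integral>\<^sup>+t. g (x, t) * ennreal (wbar t) \<partial>lborel) \<partial>lborel)"
    proof (rule nn_integral_lev_diff_le[OF u(1) v Km gm])
      fix x t assume x: "x \<in> K"
      let ?X = "\<integral>\<^sup>+c. indicator {0<..<C0} c * (if (c < u (x, t)) \<noteq> (c < v (x, t)) then 1 else 0) \<partial>lborel"
      consider "t < r" | "t \<in> {r..R}" | "t > R" "\<alpha> \<noteq> \<infinity>" | "t > R" "\<alpha> = \<infinity>" by fastforce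
      then show "?X \<le> g (x, t)"
      proof cases
        case 1
        have "?X \<le> ennreal C0" by (rule nn_integral_crossing_le(2))
        then show ?thesis using 1 by (auto simp: g_def intro: order_trans)
      next
        case 3
        have "?X \<le> ennreal C0" by (rule nn_integral_crossing_le(2))
        then show ?thesis using 3 R by (auto simp: g_def intro: order_trans)
      next
        case 4
        then have "u (x, t) = 0" "v (x, t) = 0" using u(3) Rtail[of t x] by auto
        then show ?thesis by simp
      next
        case 2
        have "t \<in> {r'..R'}" using 2 r' R' by auto
        then have "v1 (x, t) = v (x, t)" by (simp add: v1_def)
        then have "\<bar>u (x, t) - v (x, t)\<bar> \<le> \<bar>V (x, t) - v1 (x, t)\<bar> + \<eta>" using u(2)[OF x 2] by linarith
        then have "ennreal \<bar>u (x, t) - v (x, t)\<bar> \<le> ennreal \<bar>V (x, t) - v1 (x, t)\<bar> + ennreal \<eta>"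
          using \<eta> by (simp add: ennreal_plus[symmetric] ennreal_leI del: ennreal_plus)
        also have "\<dots> \<le> g (x, t)" using 2 by (simp add: g_def)
        finally show ?thesis using nn_integral_crossing_le(1) order_trans by blast
      qed
    qed
    then show ?thesis using total by (rule order_trans)
  qed
  have close1: "(\<integral>\<^sup>+p. indicator (K \<times> {0<..<C0}) p * ennreal \<bar>lev u1 p - lev v p\<bar> \<partial>lborel) \<le> ennreal \<epsilon>"
    by (rule close[OF u1m]) (use \<eta> y0 yn in \<open>auto simp: u1_def\<close>)
  have close2: "(\<integral>\<^sup>+p. indicator (K \<times> {0<..<C0}) p * ennreal \<bar>lev u2 p - lev v p\<bar> \<partial>lborel) \<le> ennreal \<epsilon>"
  proof (rule close[OF u2m])
    fix x t assume x: "x \<in> K" and t: "t \<in> {r..R}"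
    let ?y = "y (grid_index y n t)"
    have "?y \<in> {r..R}" by (rule grid(3))
    moreover have "dist (x, ?y) (x, t) < dV"
      using grid(2)[OF t] hd by (simp add: dist_Pair_Pair dist_real_def abs_minus_commute)
    ultimately show "\<bar>u2 (x, t) - V (x, t)\<bar> \<le> \<eta>" using dV(2)[of "(x, ?y)" "(x, t)"] x t by (simp add: u2_def)
  next
    fix x t assume "\<alpha> = \<infinity>" "t > R"
    then show "u2 (x, t) = 0" using grid(1)[of t] yn VR by (simp add: u2_def)
  qed
  show ?thesis by (rule that[OF u1m u2m main close1 close2])
qed


text \<open>
  Both terms of the level functional are continuous along \<open>L1\<close> convergence of the levels on the support of \<open>\<Phi>\<close>.
\<close>

lemma level_functional_tendsto:
  fixes v :: "'a::euclidean_space \<times> real \<Rightarrow> real" and \<Phi> :: "'a \<times> real \<Rightarrow> 'a \<times> real" and \<theta> :: "real \<Rightarrow> real"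
    and u :: "nat \<Rightarrow> 'a \<times> real \<Rightarrow> real"
  assumes v[measurable]: "v \<in> borel_measurable borel" and lv: "integrable lborel (lev v)"
    and u[measurable]: "\<And>k. u k \<in> borel_measurable borel"
    and \<Phi>: "\<Phi> \<in> C1_compact_support S" "\<And>p. norm (\<Phi> p) \<le> 1"
    and K: "compact K" "\<And>p. p \<notin> K \<times> {0<..<C0} \<Longrightarrow> \<Phi> p = 0" "\<And>p. p \<notin> K \<times> {0<..<C0} \<Longrightarrow> hdivergence \<Phi> p = 0"
    and \<theta>: "uniformly_continuous_on UNIV \<theta>" "\<And>s. \<bar>\<theta> s\<bar> \<le> \<Theta>"
    and lim: "(\<lambda>k. \<integral>\<^sup>+p. indicator (K \<times> {0<..<C0}) p * ennreal \<bar>lev (u k) p - lev v p\<bar> \<partial>lborel) \<longlonglongrightarrow> 0"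
  shows "(\<lambda>k. \<integral>p. lev (u k) p * hdivergence \<Phi> p \<partial>lborel) \<longlonglongrightarrow> (\<integral>p. lev v p * hdivergence \<Phi> p \<partial>lborel)"
    and "(\<lambda>k. \<integral>p. snd (\<Phi> p) * \<theta> (lev (u k) p) \<partial>lborel) \<longlonglongrightarrow> (\<integral>p. snd (\<Phi> p) * \<theta> (lev v p) \<partial>lborel)"
proof -
  let ?D = "K \<times> {0<..<C0}"
  have Dm[measurable]: "?D \<in> sets borel"
    using K(1) by (intro borel_Times) (auto intro: borel_closed compact_imp_closed)
  have Db: "bounded ?D" using compact_imp_bounded[OF K(1)] by (intro bounded_Times) auto
  have cont\<Phi>: "continuous_on UNIV \<Phi>" by (rule C1_compact_support_continuous[OF \<Phi>(1)])
  have conthd: "continuous_on UNIV (hdivergence \<Phi>)" by (rule continuous_hdivergence[OF \<Phi>(1)])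
  have \<theta>c: "continuous_on UNIV \<theta>" by (rule uniformly_continuous_imp_continuous[OF \<theta>(1)])
  have [measurable]: "\<Phi> \<in> borel_measurable borel" "hdivergence \<Phi> \<in> borel_measurable borel" "\<theta> \<in> borel_measurable borel"
    using cont\<Phi> conthd \<theta>c by (auto intro: borel_measurable_continuous_onI)
  have n\<Phi>: "\<bar>snd (\<Phi> p)\<bar> \<le> 1" for p
    using \<Phi>(2)[of p] norm_snd_le[of "snd (\<Phi> p)" "fst (\<Phi> p)"] by auto
  obtain Bh where Bh: "Bh \<ge> 0" "\<And>p. norm (hdivergence \<Phi> p) \<le> Bh"
  proof -
    obtain K0 where K0: "compact K0" "\<And>x h. x \<notin> K0 \<Longrightarrow> frechet_derivative \<Phi> (at x) h = 0"
      by (rule C1_compact_support_obtain[OF \<Phi>(1)]) (rule that)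
    have "hdivergence \<Phi> p = 0" if "p \<notin> K0" for p using K0(2)[OF that] by (simp add: hdivergence_def)
    from bounded_compact_support[OF conthd K0(1) this] show ?thesis using that by metis
  qed
  show "(\<lambda>k. \<integral>p. snd (\<Phi> p) * \<theta> (lev (u k) p) \<partial>lborel) \<longlonglongrightarrow> (\<integral>p. snd (\<Phi> p) * \<theta> (lev v p) \<partial>lborel)"
  proof (rule tendsto_integral_compose_L1[OF Dm Db _ _ _ _ _ _ _ lim, where G="\<lambda>p s. snd (\<Phi> p) * \<theta> s" and B="1 * \<Theta>"])
    fix e :: real assume "e > 0"
    then obtain d where d: "d > 0" "\<And>s s'. dist s' s < d \<Longrightarrow> dist (\<theta> s') (\<theta> s) < e"
      using \<theta>(1) unfolding uniformly_continuous_on_def by blast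
    show "\<exists>d>0. \<forall>p\<in>?D. \<forall>s s'. \<bar>s - s'\<bar> < d \<longrightarrow> \<bar>snd (\<Phi> p) * \<theta> s - snd (\<Phi> p) * \<theta> s'\<bar> \<le> e"
    proof (intro exI[of _ d] conjI ballI allI impI d(1))
      fix p s s' assume "\<bar>s - s'\<bar> < d"
      then have A: "\<bar>\<theta> s - \<theta> s'\<bar> \<le> e" using d(2)[of s s'] by (simp add: dist_real_def)
      have "\<bar>snd (\<Phi> p)\<bar> * \<bar>\<theta> s - \<theta> s'\<bar> \<le> 1 * e" by (rule mult_mono[OF n\<Phi> A]) auto
      then show "\<bar>snd (\<Phi> p) * \<theta> s - snd (\<Phi> p) * \<theta> s'\<bar> \<le> e" by (simp add: abs_mult flip: right_diff_distrib)
    qed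
  next
    show "\<bar>snd (\<Phi> p) * \<theta> s\<bar> \<le> 1 * \<Theta>" for p s unfolding abs_mult by (intro mult_mono n\<Phi> \<theta>(2)) auto
  qed (use K(2) in auto)
  have dom: "ennreal (norm (lev (u k) p * hdivergence \<Phi> p - lev v p * hdivergence \<Phi> p)) \<le> ennreal Bh * (indicator ?D p * ennreal \<bar>lev (u k) p - lev v p\<bar>)" for k p
  proof (cases "p \<in> ?D")
    case True
    have "\<bar>hdivergence \<Phi> p\<bar> * \<bar>lev (u k) p - lev v p\<bar> \<le> Bh * \<bar>lev (u k) p - lev v p\<bar>"
      using Bh(2)[of p] by (intro mult_right_mono) auto
    then have "norm (lev (u k) p * hdivergence \<Phi> p - lev v p * hdivergence \<Phi> p) \<le> Bh * \<bar>lev (u k) p - lev v p\<bar>"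
      unfolding left_diff_distrib[symmetric] real_norm_def abs_mult by (simp only: mult.commute)
    then have "ennreal (norm (lev (u k) p * hdivergence \<Phi> p - lev v p * hdivergence \<Phi> p)) \<le> ennreal (Bh * \<bar>lev (u k) p - lev v p\<bar>)"
      by (rule ennreal_leI)
    then show ?thesis using True Bh(1) by (simp add: ennreal_mult)
  next
    case False then show ?thesis using K(3)[OF False] by simp
  qed
  let ?J = "\<lambda>k. \<integral>\<^sup>+p. indicator ?D p * ennreal \<bar>lev (u k) p - lev v p\<bar> \<partial>lborel"
  have le: "(\<integral>\<^sup>+p. ennreal (norm (lev (u k) p * hdivergence \<Phi> p - lev v p * hdivergence \<Phi> p)) \<partial>lborel) \<le> ennreal Bh * ?J k" for k
  proof -
    have "(\<integral>\<^sup>+p. ennreal (norm (lev (u k) p * hdivergence \<Phi> p - lev v p * hdivergence \<Phi> p)) \<partial>lborel)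
       \<le> (\<integral>\<^sup>+p. ennreal Bh * (indicator ?D p * ennreal \<bar>lev (u k) p - lev v p\<bar>) \<partial>lborel)"
      by (rule nn_integral_mono) (rule dom)
    also have "\<dots> = ennreal Bh * ?J k" by (rule nn_integral_cmult) measurable
    finally show ?thesis .
  qed
  have lim0: "(\<lambda>k. \<integral>\<^sup>+p. ennreal (norm (lev (u k) p * hdivergence \<Phi> p - lev v p * hdivergence \<Phi> p)) \<partial>lborel) \<longlonglongrightarrow> 0"
  proof (rule tendsto_sandwich[OF _ _ tendsto_const])
    show "(\<lambda>k. ennreal Bh * ?J k) \<longlonglongrightarrow> 0"
      using ennreal_tendsto_cmult[OF _ lim, of "ennreal Bh"] by simp
  qed (use le in \<open>auto intro!: always_eventually\<close>)
  have intv: "integrable lborel (\<lambda>p. lev v p * hdivergence \<Phi> p)"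
  proof (rule Bochner_Integration.integrable_bound[where f="\<lambda>p. Bh * lev v p"])
    show "AE p in lborel. norm (lev v p * hdivergence \<Phi> p) \<le> norm (Bh * lev v p)"
    proof (intro AE_I2)
      fix p
      have "\<bar>lev v p\<bar> * \<bar>hdivergence \<Phi> p\<bar> \<le> \<bar>lev v p\<bar> * Bh" using Bh(2)[of p] by (intro mult_left_mono) auto
      then show "norm (lev v p * hdivergence \<Phi> p) \<le> norm (Bh * lev v p)" using Bh(1) by (simp add: abs_mult mult.commute)
    qed
  qed (use lv in auto)
  have "eventually (\<lambda>k. (\<integral>\<^sup>+p. ennreal (norm (lev (u k) p * hdivergence \<Phi> p - lev v p * hdivergence \<Phi> p)) \<partial>lborel) < \<infinity>) sequentially"
    using order_tendstoD(2)[OF lim0, of \<infinity>] by simp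
  then obtain N where N: "\<And>k. k \<ge> N \<Longrightarrow> (\<integral>\<^sup>+p. ennreal (norm (lev (u k) p * hdivergence \<Phi> p - lev v p * hdivergence \<Phi> p)) \<partial>lborel) < \<infinity>"
    by (auto simp: eventually_sequentially)
  have intu: "integrable lborel (\<lambda>p. lev (u (k + N)) p * hdivergence \<Phi> p)" for k
  proof -
    have "integrable lborel (\<lambda>p. lev (u (k + N)) p * hdivergence \<Phi> p - lev v p * hdivergence \<Phi> p)"
      by (intro integrableI_bounded N) auto
    from Bochner_Integration.integrable_add[OF this intv] show ?thesis by simp
  qed
  have "(\<lambda>k. \<integral>p. lev (u (k + N)) p * hdivergence \<Phi> p \<partial>lborel) \<longlonglongrightarrow> (\<integral>p. lev v p * hdivergence \<Phi> p \<partial>lborel)"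
    by (rule tendsto_L1_int[OF intu intv LIMSEQ_ignore_initial_segment[OF lim0]])
  then show "(\<lambda>k. \<integral>p. lev (u k) p * hdivergence \<Phi> p \<partial>lborel) \<longlonglongrightarrow> (\<integral>p. lev v p * hdivergence \<Phi> p \<partial>lborel)"
    by (rule LIMSEQ_offset)
qed

lemma support_in_box:
  fixes \<Phi> :: "'a::euclidean_space \<times> real \<Rightarrow> 'a \<times> real"
  assumes \<Phi>: "\<Phi> \<in> C1_compact_support (\<Omega>' \<times> {0<..})"
  obtains K C0 where "compact K" "K \<subseteq> \<Omega>'" "0 \<le> C0" "\<And>p. p \<notin> K \<times> {0<..<C0} \<Longrightarrow> \<Phi> p = 0"
    "\<And>p. p \<notin> K \<times> {0<..<C0} \<Longrightarrow> hdivergence \<Phi> p = 0" "\<And>p. fst p \<notin> K \<Longrightarrow> \<Phi> p = 0"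
proof -
  obtain K0 where K0: "compact K0" "K0 \<subseteq> \<Omega>' \<times> {0<..}" "\<And>x. x \<notin> K0 \<Longrightarrow> \<Phi> x = 0"
    "\<And>x h. x \<notin> K0 \<Longrightarrow> frechet_derivative \<Phi> (at x) h = 0"
    by (rule C1_compact_support_obtain[OF \<Phi>]) (rule that)
  have "compact (snd ` K0)" "compact (fst ` K0)"
    using K0(1) by (auto intro!: compact_continuous_image continuous_intros)
  then obtain b where b: "\<And>c. c \<in> snd ` K0 \<Longrightarrow> \<bar>c\<bar> \<le> b" "b > 0"
    using compact_imp_bounded[of "snd ` K0"] unfolding bounded_pos by auto
  have out: "p \<notin> K0" if "p \<notin> fst ` K0 \<times> {0<..<b + 1}" for p
  proof
    assume p: "p \<in> K0"
    then have "0 < snd p" "\<bar>snd p\<bar> \<le> b" using K0(2) b(1) by auto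
    moreover have "fst p \<in> fst ` K0" using p by simp
    ultimately show False using that by (cases p) auto
  qed
  show ?thesis
  proof (rule that[of "fst ` K0" "b + 1"])
    show "fst ` K0 \<subseteq> \<Omega>'" using K0(2) by auto
    show "\<Phi> p = 0" if "p \<notin> fst ` K0 \<times> {0<..<b + 1}" for p using K0(3)[OF out[OF that]] .
    show "hdivergence \<Phi> p = 0" if "p \<notin> fst ` K0 \<times> {0<..<b + 1}" for p using K0(4)[OF out[OF that]] by (simp add: hdivergence_def)
    show "\<Phi> p = 0" if "fst p \<notin> fst ` K0" for p using K0(3)[of p] that by blast
  qed (use \<open>compact (fst ` K0)\<close> b in auto)
qed

text \<open>
  The limit of \<open>level_approximation\<close>. In the case \<open>\<alpha> = \<infinity>\<close> the function is required to vanish for large \<open>y\<close>, since otherwise the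
  sampled function could have superlevel sets of infinite measure.
\<close>

lemma level_inequality_vanishing:
  fixes v :: "'a::euclidean_space \<times> real \<Rightarrow> real" and \<Phi> :: "'a \<times> real \<Rightarrow> 'a \<times> real" and \<theta> :: "real \<Rightarrow> real"
  assumes Om: "open \<Omega>'"
    and C: "\<And>\<phi>. \<phi> \<in> C1_compact_support (\<Omega>' \<times> I1) \<Longrightarrow> (\<And>p. p \<in> \<Omega>' \<times> I1 \<Longrightarrow> norm (\<phi> p) \<le> w (snd p)) \<Longrightarrow>
       (\<integral>p. v p * divergence \<phi> p \<partial>lborel) \<le> C"
    and v: "v \<in> borel_measurable borel" and nn: "\<And>p. 0 \<le> v p"
    and int: "integrable lborel (\<lambda>p. v p * wbar (snd p))"
    and tail: "\<alpha> = \<infinity> \<Longrightarrow> \<exists>\<rho>. \<forall>x t. t \<ge> \<rho> \<longrightarrow> v (x, t) = 0"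
    and \<Phi>: "\<Phi> \<in> C1_compact_support (\<Omega>' \<times> {0<..})" "\<And>p. norm (\<Phi> p) \<le> 1" "\<And>p. 0 \<le> snd (\<Phi> p)"
    and \<theta>0: "\<theta> 0 = 0" and \<theta>\<alpha>: "\<alpha> < \<infinity> \<Longrightarrow> \<theta> (real_of_ereal \<alpha>) = 0"
    and \<theta>f: "\<And>s. 0 < s \<Longrightarrow> ereal s < \<alpha> \<Longrightarrow> \<theta> s \<le> f s"
    and \<theta>c: "uniformly_continuous_on UNIV \<theta>" "\<And>s. \<bar>\<theta> s\<bar> \<le> \<Theta>"
  shows "(\<integral>p. lev v p * hdivergence \<Phi> p \<partial>lborel) + (\<integral>p. snd (\<Phi> p) * \<theta> (lev v p) \<partial>lborel) \<le> C"
proof -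
  obtain K C0 where K: "compact K" "K \<subseteq> \<Omega>'" "0 \<le> C0" "\<And>p. p \<notin> K \<times> {0<..<C0} \<Longrightarrow> \<Phi> p = 0"
    "\<And>p. p \<notin> K \<times> {0<..<C0} \<Longrightarrow> hdivergence \<Phi> p = 0" "\<And>p. fst p \<notin> K \<Longrightarrow> \<Phi> p = 0"
    by (rule support_in_box[OF \<Phi>(1)]) (rule that)
  define \<epsilon> where "\<epsilon> k = 1 / real (Suc (Suc k))" for k
  have \<epsilon>: "0 < \<epsilon> k" "\<epsilon> k < 1" for k by (auto simp: \<epsilon>_def)
  have \<epsilon>lim: "\<epsilon> \<longlonglongrightarrow> 0"
    unfolding \<epsilon>_def using LIMSEQ_Suc[OF LIMSEQ_inverse_real_of_nat] by (simp add: inverse_eq_divide)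
  have \<theta>c': "continuous_on UNIV \<theta>" by (rule uniformly_continuous_imp_continuous[OF \<theta>c(1)])
  define Q where "Q k u1 u2 \<longleftrightarrow> u1 \<in> borel_measurable borel \<and> u2 \<in> borel_measurable borel \<and>
    (\<integral>p. lev u1 p * hdivergence \<Phi> p \<partial>lborel) + (1 - \<epsilon> k) * (\<integral>p. snd (\<Phi> p) * \<theta> (lev u2 p) \<partial>lborel) \<le> (1 + \<epsilon> k) * C \<and>
    (\<integral>\<^sup>+p. indicator (K \<times> {0<..<C0}) p * ennreal \<bar>lev u1 p - lev v p\<bar> \<partial>lborel) \<le> ennreal (\<epsilon> k) \<and>
    (\<integral>\<^sup>+p. indicator (K \<times> {0<..<C0}) p * ennreal \<bar>lev u2 p - lev v p\<bar> \<partial>lborel) \<le> ennreal (\<epsilon> k)"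
    for k and u1 u2 :: "'a \<times> real \<Rightarrow> real"
  have "\<exists>u1 u2. Q k u1 u2" for k
  proof (rule level_approximation[OF Om C v nn int tail \<Phi> K(1,6,2) \<theta>0 \<theta>\<alpha> \<theta>f \<theta>c' \<theta>c(2) K(3) \<epsilon>(1)[of k] \<epsilon>(2)[of k]])
    fix u1 u2 :: "'a \<times> real \<Rightarrow> real"
    assume "u1 \<in> borel_measurable borel" "u2 \<in> borel_measurable borel"
      "(\<integral>p. lev u1 p * hdivergence \<Phi> p \<partial>lborel) + (1 - \<epsilon> k) * (\<integral>p. snd (\<Phi> p) * \<theta> (lev u2 p) \<partial>lborel) \<le> (1 + \<epsilon> k) * C"
      "(\<integral>\<^sup>+p. indicator (K \<times> {0<..<C0}) p * ennreal \<bar>lev u1 p - lev v p\<bar> \<partial>lborel) \<le> ennreal (\<epsilon> k)"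
      "(\<integral>\<^sup>+p. indicator (K \<times> {0<..<C0}) p * ennreal \<bar>lev u2 p - lev v p\<bar> \<partial>lborel) \<le> ennreal (\<epsilon> k)"
    then show ?thesis unfolding Q_def by blast
  qed
  then obtain u1 u2 where "\<And>k. Q k (u1 k) (u2 k)" by metis
  then have u: "\<And>k. u1 k \<in> borel_measurable borel" "\<And>k. u2 k \<in> borel_measurable borel"
    and main: "\<And>k. (\<integral>p. lev (u1 k) p * hdivergence \<Phi> p \<partial>lborel) + (1 - \<epsilon> k) * (\<integral>p. snd (\<Phi> p) * \<theta> (lev (u2 k) p) \<partial>lborel) \<le> (1 + \<epsilon> k) * C"
    and l1: "\<And>k. (\<integral>\<^sup>+p. indicator (K \<times> {0<..<C0}) p * ennreal \<bar>lev (u1 k) p - lev v p\<bar> \<partial>lborel) \<le> ennreal (\<epsilon> k)"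
    and l2: "\<And>k. (\<integral>\<^sup>+p. indicator (K \<times> {0<..<C0}) p * ennreal \<bar>lev (u2 k) p - lev v p\<bar> \<partial>lborel) \<le> ennreal (\<epsilon> k)"
    unfolding Q_def by blast+
  have elim: "(\<lambda>k. ennreal (\<epsilon> k)) \<longlonglongrightarrow> 0" using tendsto_ennrealI[OF \<epsilon>lim] by simp
  have L1: "(\<lambda>k. \<integral>\<^sup>+p. indicator (K \<times> {0<..<C0}) p * ennreal \<bar>lev (u1 k) p - lev v p\<bar> \<partial>lborel) \<longlonglongrightarrow> 0"
    by (rule tendsto_sandwich[OF _ _ tendsto_const elim]) (use l1 in \<open>auto intro!: always_eventually\<close>)
  have L2: "(\<lambda>k. \<integral>\<^sup>+p. indicator (K \<times> {0<..<C0}) p * ennreal \<bar>lev (u2 k) p - lev v p\<bar> \<partial>lborel) \<longlonglongrightarrow> 0"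
    by (rule tendsto_sandwich[OF _ _ tendsto_const elim]) (use l2 in \<open>auto intro!: always_eventually\<close>)
  note lv = integrable_lev(1)[OF v nn int]
  have T1: "(\<lambda>k. \<integral>p. lev (u1 k) p * hdivergence \<Phi> p \<partial>lborel) \<longlonglongrightarrow> (\<integral>p. lev v p * hdivergence \<Phi> p \<partial>lborel)"
    by (rule level_functional_tendsto(1)[OF v lv u(1) \<Phi>(1,2) K(1,4,5) \<theta>c L1])
  have T2: "(\<lambda>k. \<integral>p. snd (\<Phi> p) * \<theta> (lev (u2 k) p) \<partial>lborel) \<longlonglongrightarrow> (\<integral>p. snd (\<Phi> p) * \<theta> (lev v p) \<partial>lborel)"
    by (rule level_functional_tendsto(2)[OF v lv u(2) \<Phi>(1,2) K(1,4,5) \<theta>c L2])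
  have "(\<integral>p. lev v p * hdivergence \<Phi> p \<partial>lborel) + (1 - 0) * (\<integral>p. snd (\<Phi> p) * \<theta> (lev v p) \<partial>lborel) \<le> (1 + 0) * C"
  proof (rule LIMSEQ_le)
    show "(\<lambda>k. (\<integral>p. lev (u1 k) p * hdivergence \<Phi> p \<partial>lborel) + (1 - \<epsilon> k) * (\<integral>p. snd (\<Phi> p) * \<theta> (lev (u2 k) p) \<partial>lborel))
      \<longlonglongrightarrow> (\<integral>p. lev v p * hdivergence \<Phi> p \<partial>lborel) + (1 - 0) * (\<integral>p. snd (\<Phi> p) * \<theta> (lev v p) \<partial>lborel)"
      by (intro tendsto_intros T1 T2 \<epsilon>lim)
    show "(\<lambda>k. (1 + \<epsilon> k) * C) \<longlonglongrightarrow> (1 + 0) * C" by (intro tendsto_intros \<epsilon>lim)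
  qed (use main in auto)
  then show ?thesis by simp
qed

end

text \<open>
  A \<open>C1\<close> function that decreases from \<open>1\<close> at \<open>n\<close> to \<open>0\<close> at \<open>2 n\<close>.
\<close>

definition cutoff :: "real \<Rightarrow> real \<Rightarrow> real" where
  "cutoff n y = (max 0 (1 - (max 0 (y / n - 1))\<^sup>2))\<^sup>2"

definition cutoff_deriv :: "real \<Rightarrow> real \<Rightarrow> real" where
  "cutoff_deriv n y = 2 * max 0 (1 - (max 0 (y / n - 1))\<^sup>2) * (- (2 * max 0 (y / n - 1) * (1 / n)))"

lemma DERIV_cutoff: "(cutoff n has_real_derivative cutoff_deriv n y) (at y)"
proof -
  have "((\<lambda>y. y / n - 1) has_real_derivative 1 / n) (at y)"
    using DERIV_diff[OF DERIV_cdivide[OF DERIV_ident, of n] DERIV_const[of 1]] by simp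
  from DERIV_chain2[OF DERIV_max_square this]
  have "((\<lambda>y. (max 0 (y / n - 1))\<^sup>2) has_real_derivative 2 * max 0 (y / n - 1) * (1 / n)) (at y)" .
  from DERIV_diff[OF DERIV_const[of 1] this]
  have "((\<lambda>y. 1 - (max 0 (y / n - 1))\<^sup>2) has_real_derivative - (2 * max 0 (y / n - 1) * (1 / n))) (at y)" by simp
  from DERIV_chain2[OF DERIV_max_square this]
  show ?thesis unfolding cutoff_def[abs_def] cutoff_deriv_def .
qed

lemma continuous_cutoff: "continuous_on UNIV (cutoff n)"
  using DERIV_cutoff by (auto intro!: continuous_at_imp_continuous_on DERIV_isCont)

lemma continuous_cutoff_deriv: "continuous_on UNIV (cutoff_deriv n)"
  unfolding cutoff_deriv_def divide_inverse by (intro continuous_intros)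

lemma cutoff_bounds: "0 \<le> cutoff n y" "cutoff n y \<le> 1"
proof -
  show "0 \<le> cutoff n y" by (simp add: cutoff_def)
  show "cutoff n y \<le> 1" unfolding cutoff_def by (rule power_le_one) auto
qed

lemma cutoff_eq_1: "n > 0 \<Longrightarrow> y \<le> n \<Longrightarrow> cutoff n y = 1"
  by (simp add: cutoff_def max_def)

lemma cutoff_eq_0: "n > 0 \<Longrightarrow> y \<ge> 2 * n \<Longrightarrow> cutoff n y = 0"
proof -
  assume n: "n > 0" "y \<ge> 2 * n"
  then have "1 \<le> max 0 (y / n - 1)" by (auto simp: field_simps)
  then have "1 \<le> (max 0 (y / n - 1))\<^sup>2" by (rule one_le_power)
  then show ?thesis by (simp add: cutoff_def)
qed

lemma cutoff_deriv_bound: assumes n: "n > 0" shows "\<bar>cutoff_deriv n y\<bar> \<le> 4 / n"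
proof -
  define m where "m = max 0 (y / n - 1)"
  define s where "s = max 0 (1 - m\<^sup>2)"
  have m: "0 \<le> m" by (simp add: m_def)
  have s: "0 \<le> s" "s \<le> 1" by (auto simp: s_def)
  have "s * m \<le> 1"
  proof (cases "m \<le> 1")
    case True then show ?thesis using m s by (simp add: mult_le_one)
  next
    case False
    then have "1 \<le> m\<^sup>2" by (simp add: one_le_power)
    then show ?thesis by (simp add: s_def)
  qed
  then have "4 * (s * m) / n \<le> 4 * 1 / n" using n by (intro divide_right_mono) auto
  moreover have "\<bar>cutoff_deriv n y\<bar> = 4 * (s * m) / n"
    using n m s by (simp add: cutoff_deriv_def abs_mult flip: m_def s_def)
  ultimately show ?thesis by simp
qed

lemma cutoff_field:
  fixes \<phi> :: "'a::euclidean_space \<times> real \<Rightarrow> 'a \<times> real"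
  assumes \<phi>: "\<phi> \<in> C1_compact_support S"
  shows "(\<lambda>p. cutoff n (snd p) *\<^sub>R \<phi> p) \<in> C1_compact_support S"
    and "divergence (\<lambda>p. cutoff n (snd p) *\<^sub>R \<phi> p) p = cutoff n (snd p) * divergence \<phi> p + cutoff_deriv n (snd p) * snd (\<phi> p)"
proof -
  let ?D = "\<lambda>p. frechet_derivative \<phi> (at p)"
  let ?E = "\<lambda>p h. cutoff n (snd p) *\<^sub>R ?D p h + (cutoff_deriv n (snd p) * snd h) *\<^sub>R \<phi> p"
  have E: "((\<lambda>p. cutoff n (snd p) *\<^sub>R \<phi> p) has_derivative ?E p) (at p)" for p
  proof -
    have "((\<lambda>p. cutoff n (snd p)) has_derivative (\<lambda>h. cutoff_deriv n (snd p) * snd h)) (at p)"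
      using has_derivative_compose[OF has_derivative_snd[OF has_derivative_ident] DERIV_cutoff[unfolded has_field_derivative_def]] .
    from has_derivative_scaleR[OF this C1_compact_support_has_derivative[OF \<phi>]] show ?thesis .
  qed
  obtain K where K: "compact K" "K \<subseteq> S" "\<And>x. x \<notin> K \<Longrightarrow> \<phi> x = 0"
    by (rule C1_compact_support_obtain[OF \<phi>]) (rule that)
  show "(\<lambda>p. cutoff n (snd p) *\<^sub>R \<phi> p) \<in> C1_compact_support S"
  proof (rule C1_compact_supportI[OF E _ K(1,2)])
    show "continuous_on UNIV (\<lambda>p. ?E p b)" for b
      by (intro continuous_on_add continuous_on_scaleR continuous_on_mult continuous_on_const
        continuous_on_compose2[OF continuous_cutoff] continuous_on_compose2[OF continuous_cutoff_deriv]
        continuous_on_snd continuous_on_id C1_compact_support_continuous_derivative[OF \<phi>]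
        C1_compact_support_continuous[OF \<phi>]) auto
  qed (use K(3) in auto)
  have "(\<Sum>b\<in>Basis. snd b * (\<phi> p \<bullet> b)) = snd (\<phi> p)"
  proof -
    have "(\<Sum>b\<in>Basis. snd b * (\<phi> p \<bullet> b)) = (\<Sum>b\<in>Basis. (\<phi> p \<bullet> b) * ((0, 1) \<bullet> b))"
      by (intro sum.cong) (auto simp: inner_prod_def[of "(0, 1)"])
    also have "\<dots> = \<phi> p \<bullet> (0, 1)" by (rule euclidean_inner[symmetric])
    finally show ?thesis by (simp add: inner_prod_def)
  qed
  moreover have "divergence (\<lambda>p. cutoff n (snd p) *\<^sub>R \<phi> p) p = cutoff n (snd p) * divergence \<phi> p
      + cutoff_deriv n (snd p) * (\<Sum>b\<in>Basis. snd b * (\<phi> p \<bullet> b))"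
    unfolding divergence_def frechet_derivative_at[OF E, symmetric]
    by (simp add: inner_add_left sum.distrib sum_distrib_left mult.assoc)
  ultimately show "divergence (\<lambda>p. cutoff n (snd p) *\<^sub>R \<phi> p) p = cutoff n (snd p) * divergence \<phi> p + cutoff_deriv n (snd p) * snd (\<phi> p)"
    by simp
qed

lemma continuous_divergence:
  assumes "\<phi> \<in> C1_compact_support S"
  shows "continuous_on UNIV (divergence \<phi>)"
  unfolding divergence_def
  by (intro continuous_on_sum continuous_on_inner[OF C1_compact_support_continuous_derivative[OF assms] continuous_on_const])

context weight begin

text \<open>
  The weight is bounded below on compact subsets of \<open>I1\<close>, so \<open>v\<close> is integrable there.
\<close>

lemma integrable_times_compact_support:
  fixes v h :: "'a::euclidean_space \<times> real \<Rightarrow> real"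
  assumes v: "v \<in> borel_measurable borel" and int: "integrable lborel (\<lambda>p. v p * wbar (snd p))"
    and K: "compact K" "K \<subseteq> S \<times> I1" and h: "continuous_on UNIV h" "\<And>p. p \<notin> K \<Longrightarrow> h p = 0"
  shows "integrable lborel (\<lambda>p. v p * h p)"
proof (cases "K = {}")
  case True then show ?thesis using h by simp
next
  case False
  have "compact (snd ` K)" using K(1) by (auto intro!: compact_continuous_image continuous_intros)
  moreover have sub: "snd ` K \<subseteq> I1" using K(2) by auto
  ultimately obtain t0 where "t0 \<in> snd ` K" "\<And>t. t \<in> snd ` K \<Longrightarrow> w t0 \<le> w t"
    using continuous_attains_inf[of "snd ` K" w] False continuous_on_subset[OF w_continuous_I1 sub] by auto
  moreover define m where "m = w t0"
  ultimately have m: "0 < m" "\<And>t. t \<in> snd ` K \<Longrightarrow> m \<le> w t" using w_pos[of t0] sub by auto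
  obtain B where B: "B \<ge> 0" "\<And>p. norm (h p) \<le> B" using bounded_compact_support[OF h(1) K(1) h(2)] by metis
  have [measurable]: "h \<in> borel_measurable borel" "v \<in> borel_measurable borel"
    using v h(1) by (auto intro: borel_measurable_continuous_onI)
  show ?thesis
  proof (rule Bochner_Integration.integrable_bound[where f="\<lambda>p. (B / m) * (v p * wbar (snd p))"])
    show "AE p in lborel. norm (v p * h p) \<le> norm ((B / m) * (v p * wbar (snd p)))"
    proof (intro AE_I2)
      fix p
      show "norm (v p * h p) \<le> norm ((B / m) * (v p * wbar (snd p)))"
      proof (cases "p \<in> K")
        case True
        then have "m \<le> wbar (snd p)" using m(2)[of "snd p"] sub by (auto simp: wbar_def)
        then have "B * m \<le> B * wbar (snd p)" using B(1) by (intro mult_left_mono)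
        then have "B \<le> B / m * wbar (snd p)" using m(1) by (simp add: field_simps)
        then have "\<bar>h p\<bar> \<le> B / m * wbar (snd p)" using B(2)[of p] by simp
        then have "\<bar>v p\<bar> * \<bar>h p\<bar> \<le> \<bar>v p\<bar> * (B / m * wbar (snd p))" by (intro mult_left_mono) auto
        then show ?thesis using B(1) m(1) wbar_nonneg[of "snd p"] by (simp add: abs_mult mult_ac)
      next
        case False then show ?thesis using h(2) by simp
      qed
    qed
  qed (use int in auto)
qed

text \<open>
  It remains to remove the condition at infinity when \<open>\<alpha> = \<infinity>\<close>. The product of \<open>v\<close> with a cutoff at height \<open>n\<close> satisfies the
  hypotheses with \<open>C\<close> enlarged by \<open>4/n\<close> times the weighted integral of \<open>v\<close>, since the cutoff may be moved to the test field,
  where its derivative produces one additional term. The levels of the products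
  converge in \<open>L1\<close> to those of \<open>v\<close>.
\<close>

theorem level_inequality:
  fixes v :: "'a::euclidean_space \<times> real \<Rightarrow> real" and \<Phi> :: "'a \<times> real \<Rightarrow> 'a \<times> real" and \<theta> :: "real \<Rightarrow> real"
  assumes Om: "open \<Omega>'"
    and C: "\<And>\<phi>. \<phi> \<in> C1_compact_support (\<Omega>' \<times> I1) \<Longrightarrow> (\<And>p. p \<in> \<Omega>' \<times> I1 \<Longrightarrow> norm (\<phi> p) \<le> w (snd p)) \<Longrightarrow>
       (\<integral>p. v p * divergence \<phi> p \<partial>lborel) \<le> C"
    and v: "v \<in> borel_measurable borel" and nn: "\<And>p. 0 \<le> v p" and v0: "\<And>p. p \<notin> \<Omega>' \<times> I1 \<Longrightarrow> v p = 0"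
    and int: "integrable lborel (\<lambda>p. v p * wbar (snd p))"
    and \<Phi>: "\<Phi> \<in> C1_compact_support (\<Omega>' \<times> {0<..})" "\<And>p. norm (\<Phi> p) \<le> 1" "\<And>p. 0 \<le> snd (\<Phi> p)"
    and \<theta>0: "\<theta> 0 = 0" and \<theta>\<alpha>: "\<alpha> < \<infinity> \<Longrightarrow> \<theta> (real_of_ereal \<alpha>) = 0"
    and \<theta>f: "\<And>s. 0 < s \<Longrightarrow> ereal s < \<alpha> \<Longrightarrow> \<theta> s \<le> f s"
    and \<theta>c: "uniformly_continuous_on UNIV \<theta>" "\<And>s. \<bar>\<theta> s\<bar> \<le> \<Theta>"
  shows "(\<integral>p. lev v p * hdivergence \<Phi> p \<partial>lborel) + (\<integral>p. snd (\<Phi> p) * \<theta> (lev v p) \<partial>lborel) \<le> C"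
proof (cases "\<alpha> = \<infinity>")
  case False
  then show ?thesis
    by (intro level_inequality_vanishing[OF Om C v nn int _ \<Phi> \<theta>0 \<theta>\<alpha> \<theta>f \<theta>c]) auto
next
  case True
  define u where "u k p = cutoff (real (Suc k)) (snd p) * v p" for k p
  define J where "J = (\<integral>p. v p * wbar (snd p) \<partial>lborel)"
  have [measurable]: "v \<in> borel_measurable borel" by (rule v)
  have [measurable]: "cutoff n \<in> borel_measurable borel" for n by (rule borel_measurable_continuous_onI[OF continuous_cutoff])
  have um[measurable]: "u k \<in> borel_measurable borel" for k unfolding u_def by measurable
  have unn: "0 \<le> u k p" for k p using cutoff_bounds nn by (simp add: u_def)
  have ule: "u k p \<le> v p" for k p using cutoff_bounds nn[of p] by (simp add: u_def mult_left_le_one_le)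
  have uint: "integrable lborel (\<lambda>p. u k p * wbar (snd p))" for k
  proof (rule Bochner_Integration.integrable_bound[OF int])
    show "AE p in lborel. norm (u k p * wbar (snd p)) \<le> norm (v p * wbar (snd p))"
      by (intro AE_I2) (use ule unn nn wbar_nonneg in \<open>auto simp: abs_mult intro!: mult_right_mono\<close>)
  qed measurable
  have uC: "(\<integral>p. u k p * divergence \<phi> p \<partial>lborel) \<le> C + 4 / real (Suc k) * J"
    if \<phi>: "\<phi> \<in> C1_compact_support (\<Omega>' \<times> I1)" "\<And>p. p \<in> \<Omega>' \<times> I1 \<Longrightarrow> norm (\<phi> p) \<le> w (snd p)" for k \<phi>
  proof -
    let ?n = "real (Suc k)"
    let ?\<psi> = "\<lambda>p. cutoff ?n (snd p) *\<^sub>R \<phi> p"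
    have \<psi>: "?\<psi> \<in> C1_compact_support (\<Omega>' \<times> I1)" by (rule cutoff_field(1)[OF \<phi>(1)])
    have "norm (?\<psi> p) \<le> w (snd p)" if "p \<in> \<Omega>' \<times> I1" for p
    proof -
      have "\<bar>cutoff ?n (snd p)\<bar> * norm (\<phi> p) \<le> 1 * w (snd p)"
        using cutoff_bounds[of ?n "snd p"] by (intro mult_mono \<phi>(2) that) auto
      then show ?thesis by simp
    qed
    then have 1: "(\<integral>p. v p * divergence ?\<psi> p \<partial>lborel) \<le> C" by (rule C[OF \<psi>])
    obtain K where K: "compact K" "K \<subseteq> \<Omega>' \<times> I1" "\<And>x. x \<notin> K \<Longrightarrow> \<phi> x = 0"
        "\<And>x h. x \<notin> K \<Longrightarrow> frechet_derivative \<phi> (at x) h = 0"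
      by (rule C1_compact_support_obtain[OF \<phi>(1)]) (rule that)
    have cont: "continuous_on UNIV (\<lambda>p. cutoff_deriv ?n (snd p) * snd (\<phi> p))"
      by (intro continuous_on_mult continuous_on_compose2[OF continuous_cutoff_deriv] continuous_on_snd continuous_on_id
        C1_compact_support_continuous[OF \<phi>(1)]) auto
    have i2: "integrable lborel (\<lambda>p. v p * (cutoff_deriv ?n (snd p) * snd (\<phi> p)))"
      by (rule integrable_times_compact_support[OF v int K(1,2) cont]) (use K(3) in simp)
    have i1: "integrable lborel (\<lambda>p. v p * divergence ?\<psi> p)"
    proof (rule integrable_times_compact_support[OF v int K(1,2) continuous_divergence[OF \<psi>]])
      show "divergence ?\<psi> p = 0" if "p \<notin> K" for p
        unfolding cutoff_field(2)[OF \<phi>(1)] using K(3,4)[OF that] by (simp add: divergence_def)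
    qed
    have "u k p * divergence \<phi> p = v p * divergence ?\<psi> p - v p * (cutoff_deriv ?n (snd p) * snd (\<phi> p))" for p
      unfolding cutoff_field(2)[OF \<phi>(1)] by (simp add: u_def algebra_simps)
    then have eq: "(\<integral>p. u k p * divergence \<phi> p \<partial>lborel) = (\<integral>p. v p * divergence ?\<psi> p \<partial>lborel) - (\<integral>p. v p * (cutoff_deriv ?n (snd p) * snd (\<phi> p)) \<partial>lborel)"
      using i1 i2 by simp
    have le: "- (\<integral>p. v p * (cutoff_deriv ?n (snd p) * snd (\<phi> p)) \<partial>lborel) \<le> (\<integral>p. 4 / ?n * (v p * wbar (snd p)) \<partial>lborel)"
    proof -
      have "- (\<integral>p. v p * (cutoff_deriv ?n (snd p) * snd (\<phi> p)) \<partial>lborel) = (\<integral>p. - (v p * (cutoff_deriv ?n (snd p) * snd (\<phi> p))) \<partial>lborel)"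
        by simp
      also have "\<dots> \<le> (\<integral>p. 4 / ?n * (v p * wbar (snd p)) \<partial>lborel)"
      proof (rule integral_mono)
        show "integrable lborel (\<lambda>p. - (v p * (cutoff_deriv ?n (snd p) * snd (\<phi> p))))" using i2 by simp
        show "integrable lborel (\<lambda>p. 4 / ?n * (v p * wbar (snd p)))" using int by simp
        fix p
        show "- (v p * (cutoff_deriv ?n (snd p) * snd (\<phi> p))) \<le> 4 / ?n * (v p * wbar (snd p))"
        proof (cases "p \<in> \<Omega>' \<times> I1")
          case False then show ?thesis using v0 by simp
        next
          case True
          then have wb: "wbar (snd p) = w (snd p)" by (auto simp: wbar_def)
          have "\<bar>snd (\<phi> p)\<bar> \<le> norm (\<phi> p)" using norm_snd_le[of "snd (\<phi> p)" "fst (\<phi> p)"] by simp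
          also have "\<dots> \<le> w (snd p)" by (rule \<phi>(2)[OF True])
          finally have "\<bar>cutoff_deriv ?n (snd p)\<bar> * \<bar>snd (\<phi> p)\<bar> \<le> 4 / ?n * w (snd p)"
            by (intro mult_mono cutoff_deriv_bound) auto
          then have "- (cutoff_deriv ?n (snd p) * snd (\<phi> p)) \<le> 4 / ?n * w (snd p)"
            using abs_ge_minus_self[of "cutoff_deriv ?n (snd p) * snd (\<phi> p)"] by (simp add: abs_mult)
          then have "v p * (- (cutoff_deriv ?n (snd p) * snd (\<phi> p))) \<le> v p * (4 / ?n * w (snd p))"
            by (intro mult_left_mono nn)
          then show ?thesis using wb by (simp add: mult_ac)
        qed
      qed
      finally show ?thesis .
    qed
    have "(\<integral>p. 4 / ?n * (v p * wbar (snd p)) \<partial>lborel) = 4 / ?n * J" unfolding J_def by (rule integral_mult_right_zero)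
    then show ?thesis using 1 eq le by linarith
  qed
  have ineq: "(\<integral>p. lev (u k) p * hdivergence \<Phi> p \<partial>lborel) + (\<integral>p. snd (\<Phi> p) * \<theta> (lev (u k) p) \<partial>lborel) \<le> C + 4 / real (Suc k) * J" for k
  proof (rule level_inequality_vanishing[OF Om uC um unn uint _ \<Phi> \<theta>0 \<theta>\<alpha> \<theta>f \<theta>c])
    show "\<exists>\<rho>. \<forall>x t. t \<ge> \<rho> \<longrightarrow> u k (x, t) = 0"
      by (intro exI[of _ "2 * real (Suc k)"]) (simp add: u_def cutoff_eq_0)
  qed
  obtain K C0 where K: "compact K" "K \<subseteq> \<Omega>'" "0 \<le> C0" "\<And>p. p \<notin> K \<times> {0<..<C0} \<Longrightarrow> \<Phi> p = 0"
    "\<And>p. p \<notin> K \<times> {0<..<C0} \<Longrightarrow> hdivergence \<Phi> p = 0" "\<And>p. fst p \<notin> K \<Longrightarrow> \<Phi> p = 0"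
    by (rule support_in_box[OF \<Phi>(1)]) (rule that)
  have diffint: "integrable lborel (\<lambda>p. \<bar>u k p - v p\<bar> * wbar (snd p))" for k
  proof (rule Bochner_Integration.integrable_bound[OF int])
    show "AE p in lborel. norm (\<bar>u k p - v p\<bar> * wbar (snd p)) \<le> norm (v p * wbar (snd p))"
    proof (intro AE_I2)
      fix p
      have "\<bar>u k p - v p\<bar> \<le> v p" using ule[of k p] unn[of k p] by simp
      then show "norm (\<bar>u k p - v p\<bar> * wbar (snd p)) \<le> norm (v p * wbar (snd p))"
        using wbar_nonneg[of "snd p"] nn[of p] by (auto simp: abs_mult intro!: mult_right_mono)
    qed
  qed measurable
  have "(\<lambda>k. \<integral>p. \<bar>u k p - v p\<bar> * wbar (snd p) \<partial>lborel) \<longlonglongrightarrow> (\<integral>p. 0 \<partial>(lborel :: ('a \<times> real) measure))"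
  proof (rule integral_dominated_convergence[OF _ _ int])
    show "AE p in lborel. (\<lambda>k. \<bar>u k p - v p\<bar> * wbar (snd p)) \<longlonglongrightarrow> 0"
    proof (intro AE_I2)
      fix p :: "'a \<times> real"
      obtain N :: nat where N: "snd p < real N" using reals_Archimedean2 by blast
      have "eventually (\<lambda>k. \<bar>u k p - v p\<bar> * wbar (snd p) = 0) sequentially"
        unfolding eventually_sequentially
        by (intro exI[of _ N] allI impI) (use N in \<open>simp add: u_def cutoff_eq_1\<close>)
      then show "(\<lambda>k. \<bar>u k p - v p\<bar> * wbar (snd p)) \<longlonglongrightarrow> 0" by (rule tendsto_eventually)
    qed
    show "AE p in lborel. norm (\<bar>u k p - v p\<bar> * wbar (snd p)) \<le> v p * wbar (snd p)" for k
    proof (intro AE_I2)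
      fix p
      have "\<bar>u k p - v p\<bar> \<le> v p" using ule[of k p] unn[of k p] by simp
      then show "norm (\<bar>u k p - v p\<bar> * wbar (snd p)) \<le> v p * wbar (snd p)"
        using wbar_nonneg[of "snd p"] by (auto simp: abs_mult intro!: mult_right_mono)
    qed
  qed measurable
  then have "(\<lambda>k. \<integral>p. \<bar>u k p - v p\<bar> * wbar (snd p) \<partial>lborel) \<longlonglongrightarrow> 0" by simp
  from tendsto_ennrealI[OF this]
  have lim0: "(\<lambda>k. ennreal (\<integral>p. \<bar>u k p - v p\<bar> * wbar (snd p) \<partial>lborel)) \<longlonglongrightarrow> 0" by simp
  have L: "(\<lambda>k. \<integral>\<^sup>+p. indicator (K \<times> {0<..<C0}) p * ennreal \<bar>lev (u k) p - lev v p\<bar> \<partial>lborel) \<longlonglongrightarrow> 0"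
  proof (rule tendsto_sandwich[OF _ _ tendsto_const lim0])
    have Km[measurable]: "K \<in> sets borel" using K(1) by (simp add: borel_closed compact_imp_closed)
    have "(\<integral>\<^sup>+p. indicator (K \<times> {0<..<C0}) p * ennreal \<bar>lev (u k) p - lev v p\<bar> \<partial>lborel)
        \<le> ennreal (\<integral>p. \<bar>u k p - v p\<bar> * wbar (snd p) \<partial>lborel)" for k
    proof -
      have "(\<integral>\<^sup>+p. indicator (K \<times> {0<..<C0}) p * ennreal \<bar>lev (u k) p - lev v p\<bar> \<partial>lborel)
        \<le> (\<integral>\<^sup>+x. indicator K x * (\<integral>\<^sup>+t. ennreal \<bar>u k (x, t) - v (x, t)\<bar> * ennreal (wbar t) \<partial>lborel) \<partial>lborel)"
        by (rule nn_integral_lev_diff_le[where g="\<lambda>p. ennreal \<bar>u k p - v p\<bar>", OF um v Km _ nn_integral_crossing_le(1)]) measurable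
      also have "\<dots> \<le> (\<integral>\<^sup>+x. (\<integral>\<^sup>+t. ennreal (\<bar>u k (x, t) - v (x, t)\<bar> * wbar t) \<partial>lborel) \<partial>lborel)"
        by (intro nn_integral_mono) (auto simp: indicator_def ennreal_mult wbar_nonneg)
      also have "\<dots> = (\<integral>\<^sup>+p. ennreal (\<bar>u k p - v p\<bar> * wbar (snd p)) \<partial>lborel)"
        using lborel.nn_integral_fst[of "\<lambda>p. ennreal (\<bar>u k p - v p\<bar> * wbar (snd p))" lborel] by (simp add: lborel_prod)
      also have "\<dots> = ennreal (\<integral>p. \<bar>u k p - v p\<bar> * wbar (snd p) \<partial>lborel)"
        by (rule nn_integral_eq_integral[OF diffint]) (simp add: wbar_nonneg)
      finally show ?thesis .
    qed
    then show "\<forall>\<^sub>F k in sequentially. (\<integral>\<^sup>+p. indicator (K \<times> {0<..<C0}) p * ennreal \<bar>lev (u k) p - lev v p\<bar> \<partial>lborel)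
        \<le> ennreal (\<integral>p. \<bar>u k p - v p\<bar> * wbar (snd p) \<partial>lborel)" by (intro always_eventually allI)
  qed auto
  note lv = integrable_lev(1)[OF v nn int]
  note T = level_functional_tendsto[OF v lv um \<Phi>(1,2) K(1,4,5) \<theta>c L]
  have nlim: "(\<lambda>k. C + 4 * inverse (real (Suc k)) * J) \<longlonglongrightarrow> C + 4 * 0 * J"
    by (intro tendsto_intros LIMSEQ_inverse_real_of_nat)
  have "(\<integral>p. lev v p * hdivergence \<Phi> p \<partial>lborel) + (\<integral>p. snd (\<Phi> p) * \<theta> (lev v p) \<partial>lborel) \<le> C + 4 * 0 * J"
    by (rule LIMSEQ_le[OF tendsto_add[OF T] nlim]) (use ineq in \<open>auto simp: divide_inverse\<close>)
  then show ?thesis by simp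
qed

end

section \<open>Testing the rearranged function\<close>

text \<open>
  A chart in the vertical variable: \<open>F\<close> is a primitive of \<open>\<omega>\<close>, and the lower bound \<open>b\<close> makes it a bijection of the
  real line whose inverse \<open>Y\<close> is Lipschitz.
\<close>

lemma increasing_inverse:
  fixes \<omega> :: "real \<Rightarrow> real"
  assumes \<omega>: "continuous_on UNIV \<omega>" "0 < b" "\<And>y. b \<le> \<omega> y"
  obtains F Y where "\<And>y. (F has_real_derivative \<omega> y) (at y)" "\<And>s. F (Y s) = s" "\<And>y s. F y < s \<longleftrightarrow> y < Y s"
    "\<And>s s'. \<bar>Y s - Y s'\<bar> \<le> \<bar>s - s'\<bar> / b" "\<And>s. (Y has_real_derivative inverse (\<omega> (Y s))) (at s)" "F a = z"
proof -
  obtain F0 where F0: "\<And>s. (F0 has_real_derivative \<omega> s) (at s)"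
    using einterval_antiderivative[of "-\<infinity>" \<infinity> \<omega>] \<omega>(1)
    by (auto simp: continuous_on_eq_continuous_at has_real_derivative_iff_has_vector_derivative)
  define F where "F y = F0 y + (z - F0 a)" for y
  have F: "(F has_real_derivative \<omega> y) (at y)" for y
    unfolding F_def using DERIV_add[OF F0 DERIV_const] by simp
  have slope: "b * (y' - y) \<le> F y' - F y" if "y \<le> y'" for y y'
  proof (cases "y = y'")
    case False
    then have lt: "y < y'" using that by simp
    obtain c where "F y' - F y = (y' - y) * \<omega> c" using MVT2[OF lt F] by blast
    then show ?thesis using mult_left_mono[OF \<omega>(3)[of c], of "y' - y"] that by (simp add: mult.commute)
  qed simp
  have contF: "continuous_on S F" for S using F by (auto intro!: continuous_at_imp_continuous_on DERIV_isCont)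
  have mono: "F y < F y' \<longleftrightarrow> y < y'" for y y'
  proof
    show "F y < F y'" if "y < y'"
      using slope[of y y'] that mult_pos_pos[OF \<omega>(2), of "y' - y"] by simp
    show "y < y'" if "F y < F y'"
    proof (rule ccontr)
      assume "\<not> y < y'"
      then have "b * (y - y') \<le> F y - F y'" using slope[of y' y] by simp
      moreover have "0 \<le> b * (y - y')" using \<open>\<not> y < y'\<close> \<omega>(2) by (intro mult_nonneg_nonneg) auto
      ultimately show False using that by simp
    qed
  qed
  have "\<exists>y. F y = s" for s
  proof -
    define d where "d = \<bar>s - F 0\<bar> / b"
    have d: "0 \<le> d" "b * d = \<bar>s - F 0\<bar>" using \<omega>(2) by (auto simp: d_def)
    have "F (- d) \<le> s" "s \<le> F d" using slope[of "- d" 0] slope[of 0 d] d by auto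
    then show ?thesis using IVT'[of F "- d" s d] contF d by auto
  qed
  then obtain Y where Y: "\<And>s. F (Y s) = s" by metis
  have iff: "F y < s \<longleftrightarrow> y < Y s" for y s using mono[of y "Y s"] Y by simp
  have lip: "\<bar>Y s - Y s'\<bar> \<le> \<bar>s - s'\<bar> / b" for s s'
  proof -
    have *: "Y t' - Y t \<le> (t' - t) / b" if "t \<le> t'" for t t'
    proof -
      have "Y t \<le> Y t'" using mono[of "Y t'" "Y t"] Y that by (metis linorder_not_less)
      from slope[OF this] show ?thesis using Y \<omega>(2) by (simp add: field_simps)
    qed
    have m: "Y t \<le> Y t'" if "t \<le> t'" for t t' using mono[of "Y t'" "Y t"] Y that by (metis linorder_not_less)
    show ?thesis
    proof (cases "s \<le> s'")
      case True then show ?thesis using *[OF True] m[OF True] by (simp add: abs_if)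
    next
      case False
      then have le: "s' \<le> s" by simp
      show ?thesis using *[OF le] m[OF le] le by (simp add: abs_if)
    qed
  qed
  have contY: "isCont Y s" for s
    unfolding isCont_def LIM_def dist_real_def
  proof (intro allI impI)
    fix r :: real assume r: "0 < r"
    show "\<exists>d>0. \<forall>x. x \<noteq> s \<and> \<bar>x - s\<bar> < d \<longrightarrow> \<bar>Y x - Y s\<bar> < r"
    proof (intro exI[of _ "r * b"] conjI allI impI)
      show "0 < r * b" using r \<omega>(2) by simp
      fix x assume "x \<noteq> s \<and> \<bar>x - s\<bar> < r * b"
      then have "\<bar>x - s\<bar> / b < r" using \<omega>(2) by (simp add: field_simps)
      then show "\<bar>Y x - Y s\<bar> < r" using lip[of x s] by linarith
    qed
  qed
  have derY: "(Y has_real_derivative inverse (\<omega> (Y s))) (at s)" for s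
  proof (rule DERIV_inverse_function[where f=F and a="s - 1" and b="s + 1"])
    show "\<omega> (Y s) \<noteq> 0" using \<omega>(2) \<omega>(3)[of "Y s"] by linarith
  qed (use F Y contY in auto)
  show ?thesis using that[OF F Y iff lip derY] by (simp add: F_def)
qed

lemma snd_mollify:
  fixes g :: "'a::euclidean_space \<Rightarrow> 'b::euclidean_space \<times> real"
  assumes d: "d > 0" and g: "integrable lborel g"
  shows "snd (mollify d g x) = mollify d (\<lambda>p. snd (g p)) x"
proof -
  have "snd (mollify d g x) = mollify d g x \<bullet> (0, 1)" by (simp add: inner_prod_def)
  also have "\<dots> = (\<integral>t. (mollifier d (x - t) *\<^sub>R g t) \<bullet> (0, 1) \<partial>lborel)"
    unfolding mollify_def using integral_inner_left[OF integrable_mollify_integrand[OF d g, of x], of "(0, 1)"] by simp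
  also have "\<dots> = mollify d (\<lambda>p. snd (g p)) x" unfolding mollify_def by (simp add: inner_prod_def)
  finally show ?thesis .
qed

lemma integrable_snd_field:
  fixes g :: "'a::euclidean_space \<Rightarrow> 'b::euclidean_space \<times> real"
  assumes g: "integrable lborel g"
  shows "integrable lborel (\<lambda>p. snd (g p))"
proof -
  have "integrable lborel (\<lambda>p. g p \<bullet> (0, 1))" using g by (rule integrable_inner_left)
  then show ?thesis by (simp add: inner_prod_def)
qed

lemma mollify_nonneg:
  fixes g :: "'a::euclidean_space \<Rightarrow> real"
  assumes d: "d > 0" and g: "\<And>p. 0 \<le> g p"
  shows "0 \<le> mollify d g x"
  unfolding mollify_def by (intro integral_nonneg_AE AE_I2) (simp add: g mollifier_nonneg[OF d])

lemma integral_lessThan_lipschitz: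
  fixes G :: "real \<Rightarrow> real"
  assumes G: "integrable lborel G" "\<And>t. \<bar>G t\<bar> \<le> B"
  shows "\<bar>(\<integral>t. indicator {..<a} t * G t \<partial>lborel) - (\<integral>t. indicator {..<b} t * G t \<partial>lborel)\<bar> \<le> B * \<bar>a - b\<bar>"
proof -
  have i: "integrable lborel (\<lambda>t. indicator {..<a} t * G t)" for a
    using integrable_real_mult_indicator[of "{..<a}", OF _ G(1)] by (simp add: mult.commute)
  have *: "\<bar>(\<integral>t. indicator {..<a} t * G t \<partial>lborel) - (\<integral>t. indicator {..<b} t * G t \<partial>lborel)\<bar> \<le> B * (b - a)" if "a \<le> b" for a b
  proof -
    have "(\<integral>t. indicator {..<a} t * G t \<partial>lborel) - (\<integral>t. indicator {..<b} t * G t \<partial>lborel)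
       = (\<integral>t. indicator {..<a} t * G t - indicator {..<b} t * G t \<partial>lborel)" using i by simp
    also have "norm \<dots> \<le> (\<integral>t. B * indicator {a..b} t \<partial>lborel)"
    proof (rule norm_integral_bound)
      show "integrable lborel (\<lambda>t. indicator {..<a} t * G t - indicator {..<b} t * G t)" using i by simp
      show "integrable lborel (\<lambda>t. B * indicator {a..b} t)"
        by (intro integrable_mult_right impI integrable_real_indicator) (use that in auto)
      fix t
      have "0 \<le> B" using G(2)[of 0] by linarith
      then show "norm (indicator {..<a} t * G t - indicator {..<b} t * G t) \<le> B * indicator {a..b} t"
        using G(2)[of t] that by (auto simp: indicator_def)
    qed
    also have "\<dots> = B * (b - a)" using that by simp
    finally show ?thesis by simp
  qed
  show ?thesis
  proof (cases "a \<le> b")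
    case True then show ?thesis using *[OF True] by simp
  next
    case False
    then have "b \<le> a" by simp
    from *[OF this] show ?thesis using \<open>b \<le> a\<close> by (simp add: abs_minus_commute)
  qed
qed

context weight begin

text \<open>
  The support of a test field lies over a compact part \<open>{r..R}\<close> of \<open>I1\<close>. There the weight is kept; outside it is continued
  to a positive function \<open>\<omega>\<close> on the real line, so that the primitive \<open>F\<close> of \<open>\<omega>\<close>, which agrees with \<open>W\<close> on \<open>{r..R}\<close>, has a
  globally defined inverse \<open>Y\<close>. The minorant \<open>\<theta>\<close> of \<open>f\<close> equals \<open>f\<close> where \<open>Y\<close> takes values in \<open>{r..R}\<close> and is
  cut off to \<open>0\<close> continuously in a neighbourhood.
\<close>

lemma clamped_chart:
  fixes \<phi> :: "'a::euclidean_space \<times> real \<Rightarrow> 'a \<times> real"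
  assumes \<phi>: "\<phi> \<in> C1_compact_support (\<Omega>' \<times> I1)"
  obtains K r R b \<omega> F Y \<theta> \<Theta> where "compact K" "K \<subseteq> \<Omega>' \<times> I1" "\<And>p. p \<notin> K \<Longrightarrow> \<phi> p = 0"
    "\<And>p. p \<notin> K \<Longrightarrow> divergence \<phi> p = 0" "\<And>p. p \<notin> K \<Longrightarrow> hdivergence \<phi> p = 0"
    "r \<in> I1" "\<And>p. p \<in> K \<Longrightarrow> snd p \<in> {r..R}"
    "continuous_on UNIV \<omega>" "0 < (b::real)" "\<And>y. b \<le> \<omega> y" "\<And>y. y \<in> {r..R} \<Longrightarrow> \<omega> y = w y"
    "\<And>y. y \<in> {r..R} \<Longrightarrow> F y = W y"
    "\<And>y s. F y < s \<longleftrightarrow> y < Y s"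
    "\<And>s s'. \<bar>Y s - Y s'\<bar> \<le> \<bar>s - s'\<bar> / b" "\<And>s. (Y has_real_derivative inverse (\<omega> (Y s))) (at s)"
    "\<theta> 0 = 0" "\<alpha> < \<infinity> \<Longrightarrow> \<theta> (real_of_ereal \<alpha>) = 0" "\<And>s. 0 < s \<Longrightarrow> ereal s < \<alpha> \<Longrightarrow> \<theta> s \<le> f s"
    "uniformly_continuous_on UNIV \<theta>" "\<And>s. 0 \<le> \<theta> s" "\<And>s. Y s \<in> {r..R} \<Longrightarrow> \<theta> s = \<omega> (Y s)"
    "\<And>s. s < W (r / 2) \<Longrightarrow> \<theta> s = 0" "\<And>s. \<bar>\<theta> s\<bar> \<le> \<Theta>"
proof -
  obtain K where K: "compact K" "K \<subseteq> \<Omega>' \<times> I1" "\<And>x. x \<notin> K \<Longrightarrow> \<phi> x = 0"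
      "\<And>x h. x \<notin> K \<Longrightarrow> frechet_derivative \<phi> (at x) h = 0"
    by (rule C1_compact_support_obtain[OF \<phi>]) (rule that)
  have Kd: "divergence \<phi> p = 0" "hdivergence \<phi> p = 0" if "p \<notin> K" for p
    using K(4)[OF that] by (simp_all add: divergence_def hdivergence_def)
  obtain r R where rR: "r \<in> I1" "R \<in> I1" "r \<le> R" "\<And>p. p \<in> K \<Longrightarrow> snd p \<in> {r..R}"
  proof (cases "K = {}")
    case True
    obtain y where "y \<in> I1" by (rule I1_nonempty) (rule that)
    then show ?thesis using that[of y y] True by simp
  next
    case False
    have c: "compact (snd ` K)" "snd ` K \<noteq> {}" using K(1) False by (auto intro!: compact_continuous_image continuous_intros)
    obtain a where a: "a \<in> snd ` K" "\<And>t. t \<in> snd ` K \<Longrightarrow> a \<le> t" using compact_attains_inf[OF c] by blast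
    obtain b where b: "b \<in> snd ` K" "\<And>t. t \<in> snd ` K \<Longrightarrow> t \<le> b" using compact_attains_sup[OF c] by blast
    have "snd ` K \<subseteq> I1" using K(2) by auto
    then show ?thesis using that[of a b] a b by auto
  qed
  define r0 where "r0 = r / 2"
  have r0: "r0 \<in> I1" "r0 < r" "0 < r0" using I1_downward[OF rR(1), of "r / 2"] rR(1) mem_I1[of r] by (auto simp: r0_def)
  obtain R0 where R0: "R < R0" "R0 \<in> I1" by (rule I1_above[OF rR(2)]) (rule that)
  define cl where "cl y = max r0 (min R0 y)" for y :: real
  define \<omega> where "\<omega> y = w (cl y)" for y
  have clr: "cl y \<in> {r0..R0}" for y using r0 rR R0 by (auto simp: cl_def)
  have cleq: "cl y = y" if "y \<in> {r0..R0}" for y using that by (auto simp: cl_def)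
  have sub: "{r0..R0} \<subseteq> I1" by (rule Icc_subset_I1[OF r0(1) R0(2)])
  have wc: "continuous_on {r0..R0} w" by (rule continuous_on_subset[OF w_continuous_I1 sub])
  have \<omega>c: "continuous_on UNIV \<omega>"
    unfolding \<omega>_def using clr by (intro continuous_on_compose2[OF wc]) (auto simp: cl_def intro!: continuous_intros)
  obtain b where b: "0 < b" "\<And>y. b \<le> \<omega> y"
  proof -
    have "{r0..R0} \<noteq> {}" using clr[of 0] by auto
    then obtain t0 where t0: "t0 \<in> {r0..R0}" "\<And>t. t \<in> {r0..R0} \<Longrightarrow> w t0 \<le> w t"
      using continuous_attains_inf[OF compact_Icc _ wc] by blast
    then show ?thesis using that[of "w t0"] w_pos[of t0] sub clr by (auto simp: \<omega>_def)
  qed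
  obtain F Y where F: "\<And>y. (F has_real_derivative \<omega> y) (at y)" "\<And>s. F (Y s) = s" "\<And>y s. F y < s \<longleftrightarrow> y < Y s"
    "\<And>s s'. \<bar>Y s - Y s'\<bar> \<le> \<bar>s - s'\<bar> / b" "\<And>s. (Y has_real_derivative inverse (\<omega> (Y s))) (at s)" "F r0 = W r0"
    by (rule increasing_inverse[OF \<omega>c b, of r0 "W r0"]) (rule that)
  have FW: "F y = W y" if y: "y \<in> {r0..R0}" for y
  proof -
    have d: "((\<lambda>y. F y - W y) has_real_derivative 0) (at y)" if "y \<in> {r0..R0}" for y
    proof -
      have "y \<in> I1" using that sub by blast
      from DERIV_diff[OF F(1)[of y] DERIV_W[OF this]] show ?thesis using cleq[OF that] by (simp add: \<omega>_def)
    qed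
    have "F y - W y = F r0 - W r0"
    proof (rule DERIV_isconst2[where a=r0 and b=R0 and f="\<lambda>y. F y - W y"])
      show "r0 < R0" using r0 rR R0 by linarith
      show "continuous_on {r0..R0} (\<lambda>y. F y - W y)"
        by (intro continuous_at_imp_continuous_on ballI DERIV_isCont[OF d])
    qed (use d y in auto)
    then show ?thesis using F(6) by simp
  qed
  \<comment> \<open>equals \<open>1\<close> on \<open>{r..R}\<close> and vanishes outside \<open>{r0..R0}\<close>\<close>
  define ze where "ze y = max 0 (min 1 (min ((y - r0) / (r - r0)) ((R0 - y) / (R0 - R))))" for y :: real
  have ze1: "ze y = 1" if "y \<in> {r..R}" for y
  proof -
    have "1 \<le> (y - r0) / (r - r0)" "1 \<le> (R0 - y) / (R0 - R)" using that r0 R0 by (auto simp: field_simps)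
    then show ?thesis by (simp add: ze_def)
  qed
  have ze0: "ze y = 0" if "y \<notin> {r0..R0}" for y
  proof -
    have "(y - r0) / (r - r0) \<le> 0 \<or> (R0 - y) / (R0 - R) \<le> 0" using that r0 R0 by (auto simp: divide_le_0_iff)
    then show ?thesis by (auto simp: ze_def)
  qed
  have zeb: "0 \<le> ze y" "ze y \<le> 1" for y by (auto simp: ze_def)
  have zec: "continuous_on UNIV ze" unfolding ze_def using r0 R0 by (intro continuous_intros) auto
  define \<theta> where "\<theta> s = \<omega> (Y s) * ze (Y s)" for s
  have uc0: "uniformly_continuous_on UNIV (\<lambda>y. \<omega> y * ze y)"
    by (rule uniformly_continuous_compact_support[where K="{r0..R0}"]) (use ze0 in \<open>auto intro!: continuous_on_mult \<omega>c zec\<close>)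
  obtain \<Theta> where \<Theta>: "\<And>y. norm (\<omega> y * ze y) \<le> \<Theta>"
  proof (rule bounded_compact_support[of "\<lambda>y. \<omega> y * ze y" "{r0..R0}"])
    show "continuous_on UNIV (\<lambda>y. \<omega> y * ze y)" by (intro continuous_on_mult \<omega>c zec)
  qed (use ze0 that in auto)
  have ucY: "uniformly_continuous_on UNIV Y"
    unfolding uniformly_continuous_on_def dist_real_def
  proof (intro allI impI)
    fix e :: real assume e: "0 < e"
    show "\<exists>d>0. \<forall>x\<in>UNIV. \<forall>x'\<in>UNIV. \<bar>x' - x\<bar> < d \<longrightarrow> \<bar>Y x' - Y x\<bar> < e"
    proof (intro exI[of _ "e * b"] conjI ballI impI)
      show "0 < e * b" using e b by simp
      fix x x' assume "\<bar>x' - x\<bar> < e * b"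
      then have "\<bar>x' - x\<bar> / b < e" using b by (simp add: field_simps)
      then show "\<bar>Y x' - Y x\<bar> < e" using F(4)[of x' x] by linarith
    qed
  qed
  have uc: "uniformly_continuous_on UNIV \<theta>"
    unfolding uniformly_continuous_on_def
  proof (intro allI impI)
    fix e :: real assume "0 < e"
    from uc0[unfolded uniformly_continuous_on_def, THEN spec, THEN mp, OF this]
    obtain d where d: "d > 0" "\<And>y y'. dist y' y < d \<Longrightarrow> dist (\<omega> y' * ze y') (\<omega> y * ze y) < e"
      by (elim exE conjE) (rule that, assumption, blast)
    from ucY[unfolded uniformly_continuous_on_def, THEN spec, THEN mp, OF d(1)]
    obtain d' where d': "d' > 0" "\<And>s s'. dist s' s < d' \<Longrightarrow> dist (Y s') (Y s) < d"
      by (elim exE conjE) (rule that, assumption, blast)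
    have "\<forall>s\<in>UNIV. \<forall>s'\<in>UNIV. dist s' s < d' \<longrightarrow> dist (\<theta> s') (\<theta> s) < e"
      unfolding \<theta>_def by (intro ballI impI d(2) d'(2))
    then show "\<exists>d>0. \<forall>s\<in>UNIV. \<forall>s'\<in>UNIV. dist s' s < d \<longrightarrow> dist (\<theta> s') (\<theta> s) < e" using d'(1) by blast
  qed
  have Ysmall: "Y s < r0" if "s < W r0" for s
  proof (rule ccontr)
    assume "\<not> Y s < r0"
    moreover have "\<not> r0 < Y s" using F(3)[of r0 s] F(6) that by simp
    ultimately have "Y s = r0" by simp
    then show False using F(2)[of s] F(6) that by simp
  qed
  have \<theta>small: "\<theta> s = 0" if "s < W r0" for s
    using Ysmall[OF that] ze0[of "Y s"] by (simp add: \<theta>_def)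
  show ?thesis
  proof (rule that[of K r R \<omega> b F Y \<theta> \<Theta>])
    show "\<theta> 0 = 0" using \<theta>small[of 0] W_pos[OF r0(1)] by simp
    show "\<theta> (real_of_ereal \<alpha>) = 0" if "\<alpha> < \<infinity>"
    proof -
      obtain A where A: "\<alpha> = ereal A" using \<open>\<alpha> < \<infinity>\<close> alpha_pos by (cases \<alpha>) auto
      have "F R0 < A" using FW[of R0] W_less_alpha[OF R0(2)] A clr[of R0] cleq r0 rR R0 by auto
      then have "R0 < Y A" using F(3) by simp
      then show ?thesis using ze0[of "Y A"] A by (simp add: \<theta>_def)
    qed
    show "\<theta> s \<le> f s" if "0 < s" "ereal s < \<alpha>" for s
    proof (cases "Y s \<in> {r0..R0}")
      case True
      have "f s = f (W (Y s))" using FW[OF True] F(2)[of s] by simp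
      also have "\<dots> = w (Y s)" by (rule f_W) (use True sub in blast)
      finally have "f s = \<omega> (Y s)" using cleq[OF True] by (simp add: \<omega>_def)
      moreover have "\<omega> (Y s) * ze (Y s) \<le> \<omega> (Y s) * 1" using b zeb by (intro mult_left_mono) (auto intro: order_trans[OF less_imp_le])
      ultimately show ?thesis by (simp add: \<theta>_def)
    next
      case False then show ?thesis using ze0[OF False] f_pos[OF that] by (simp add: \<theta>_def)
    qed
    show "\<omega> y = w y" "F y = W y" if "y \<in> {r..R}" for y
      using that cleq[of y] FW[of y] r0 R0 by (auto simp: \<omega>_def)
    show "0 \<le> \<theta> s" for s using b(1) b(2)[of "Y s"] zeb[of "Y s"] by (simp add: \<theta>_def)
    show "\<theta> s = \<omega> (Y s)" if "Y s \<in> {r..R}" for s using ze1[OF that] by (simp add: \<theta>_def)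
    show "\<theta> s = 0" if "s < W (r / 2)" for s using \<theta>small that by (simp add: r0_def)
    show "\<bar>\<theta> s\<bar> \<le> \<Theta>" for s using \<Theta>[of "Y s"] by (simp add: \<theta>_def)
  qed (use K Kd rR \<omega>c b F uc in auto)
qed


text \<open>
  The left side is \<open>\<integral> T v div \<phi>\<close> written by levels. With \<open>Q\<close> and \<open>\<Gamma>\<close> the integrals of the horizontal and of the full
  divergence of \<open>\<phi>\<close> below \<open>Y s\<close>, it equals \<open>\<integral> \<Gamma>(x, m)\<close>, and \<open>\<Gamma>(x, s) = Q(x, s) + \<phi>_N(x, Y s)\<close>. To apply the level
  inequality \<open>L\<close> although \<open>m\<close> is not smooth, take the field \<open>g\<close> built from the mollified function \<open>M = \<eta> * m\<close>
  and test with \<open>\<eta> * g\<close>: by duality the term \<open>\<integral> m hdiv(\<eta> * g)\<close> is \<open>- \<integral> \<nabla>M \<cdot> g\<close>, which is \<open>\<integral> Q(x, M)\<close>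
  by the divergence theorem on the subgraph of \<open>Y M\<close>; then the radius tends to \<open>0\<close>. The levels are first restricted
  to \<open>{c0..c1}\<close>, so that \<open>g\<close> has compact support.
\<close>

theorem rearranged_test_bound:
  fixes m :: "'a::euclidean_space \<times> real \<Rightarrow> real" and \<phi> :: "'a \<times> real \<Rightarrow> 'a \<times> real"
  assumes Om: "open \<Omega>'"
    and m: "integrable lborel m" "m \<in> borel_measurable borel" "\<And>p. 0 \<le> m p" "\<And>p. snd p \<le> 0 \<Longrightarrow> m p = 0"
    and L: "\<And>\<Phi> \<theta> \<Theta>. \<Phi> \<in> C1_compact_support (\<Omega>' \<times> {0<..}) \<Longrightarrow> (\<And>p. norm (\<Phi> p) \<le> 1) \<Longrightarrow> (\<And>p. 0 \<le> snd (\<Phi> p)) \<Longrightarrow>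
       \<theta> 0 = 0 \<Longrightarrow> (\<alpha> < \<infinity> \<Longrightarrow> \<theta> (real_of_ereal \<alpha>) = 0) \<Longrightarrow> (\<And>s. 0 < s \<Longrightarrow> ereal s < \<alpha> \<Longrightarrow> \<theta> s \<le> f s) \<Longrightarrow>
       uniformly_continuous_on UNIV \<theta> \<Longrightarrow> (\<And>s. \<bar>\<theta> s\<bar> \<le> (\<Theta>::real)) \<Longrightarrow>
       (\<integral>p. m p * hdivergence \<Phi> p \<partial>lborel) + (\<integral>p. snd (\<Phi> p) * \<theta> (m p) \<partial>lborel) \<le> C"
    and \<phi>: "\<phi> \<in> C1_compact_support (\<Omega>' \<times> I1)" "\<And>p. p \<in> \<Omega>' \<times> I1 \<Longrightarrow> norm (\<phi> p) \<le> w (snd p)"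
  shows "(\<integral>p. (\<integral>t. (if t \<in> I1 \<and> W t < m p then divergence \<phi> (fst p, t) else 0) \<partial>lborel) \<partial>lborel) \<le> C"
proof -
  obtain K r R b \<omega> F Y \<theta> \<Theta> where K: "compact K" "K \<subseteq> \<Omega>' \<times> I1" "\<And>p. p \<notin> K \<Longrightarrow> \<phi> p = 0"
    "\<And>p. p \<notin> K \<Longrightarrow> divergence \<phi> p = 0" "\<And>p. p \<notin> K \<Longrightarrow> hdivergence \<phi> p = 0"
    and r: "r \<in> I1" "\<And>p. p \<in> K \<Longrightarrow> snd p \<in> {r..R}"
    and \<omega>: "continuous_on UNIV \<omega>" "0 < (b::real)" "\<And>y. b \<le> \<omega> y" "\<And>y. y \<in> {r..R} \<Longrightarrow> \<omega> y = w y"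
    and FW: "\<And>y. y \<in> {r..R} \<Longrightarrow> F y = W y"
    and Y: "\<And>y s. F y < s \<longleftrightarrow> y < Y s"
    "\<And>s s'. \<bar>Y s - Y s'\<bar> \<le> \<bar>s - s'\<bar> / b" "\<And>s. (Y has_real_derivative inverse (\<omega> (Y s))) (at s)"
    and \<theta>: "\<theta> 0 = 0" "\<alpha> < \<infinity> \<Longrightarrow> \<theta> (real_of_ereal \<alpha>) = 0" "\<And>s. 0 < s \<Longrightarrow> ereal s < \<alpha> \<Longrightarrow> \<theta> s \<le> f s"
    "uniformly_continuous_on UNIV \<theta>" "\<And>s. 0 \<le> \<theta> s" "\<And>s. Y s \<in> {r..R} \<Longrightarrow> \<theta> s = \<omega> (Y s)"
    "\<And>s. s < W (r / 2) \<Longrightarrow> \<theta> s = 0" "\<And>s. \<bar>\<theta> s\<bar> \<le> \<Theta>"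
    by (rule clamped_chart[OF \<phi>(1)]) (rule that)
  have \<omega>pos: "0 < \<omega> y" for y using \<omega>(2) \<omega>(3)[of y] by linarith
  have contY: "continuous_on UNIV Y" by (intro continuous_at_imp_continuous_on ballI DERIV_isCont[OF Y(3)])
  have cont\<phi>: "continuous_on UNIV \<phi>" by (rule C1_compact_support_continuous[OF \<phi>(1)])
  have conthd: "continuous_on UNIV (hdivergence \<phi>)" by (rule continuous_hdivergence[OF \<phi>(1)])
  have contd: "continuous_on UNIV (divergence \<phi>)" by (rule continuous_divergence[OF \<phi>(1)])
  have cont\<theta>: "continuous_on UNIV \<theta>" by (rule uniformly_continuous_imp_continuous[OF \<theta>(4)])
  have [measurable]: "Y \<in> borel_measurable borel" "\<phi> \<in> borel_measurable borel" "hdivergence \<phi> \<in> borel_measurable borel"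
    "divergence \<phi> \<in> borel_measurable borel" "\<theta> \<in> borel_measurable borel" "\<omega> \<in> borel_measurable borel" "m \<in> borel_measurable borel"
    using contY cont\<phi> conthd contd cont\<theta> \<omega>(1) m(2) by (auto intro: borel_measurable_continuous_onI)
  define Kx where "Kx = fst ` K"
  have Kxc: "compact Kx" and K2c: "compact (snd ` K)"
    unfolding Kx_def using K(1) by (auto intro!: compact_continuous_image continuous_intros)
  have Kx\<Omega>: "Kx \<subseteq> \<Omega>'" using K(2) by (auto simp: Kx_def)
  have inK: "fst p \<in> Kx" if "p \<in> K" for p using that by (auto simp: Kx_def)
  obtain Bh where Bh: "Bh \<ge> 0" "\<And>p. norm (hdivergence \<phi> p) \<le> Bh" using bounded_compact_support[OF conthd K(1,5)] by metis
  obtain Bd where Bd: "Bd \<ge> 0" "\<And>p. norm (divergence \<phi> p) \<le> Bd" using bounded_compact_support[OF contd K(1,4)] by metis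
  have slice: "integrable lborel (\<lambda>t. q (x, t))"
    if q: "continuous_on UNIV q" "\<And>p. p \<notin> K \<Longrightarrow> q p = 0" for q :: "'a \<times> real \<Rightarrow> real" and x
  proof -
    have c: "continuous_on UNIV (\<lambda>t. q (x, t))"
      by (intro continuous_on_compose2[OF q(1)] continuous_on_Pair continuous_on_const continuous_on_id) auto
    have z: "q (x, t) = 0" if "t \<notin> snd ` K" for t using q(2)[of "(x, t)"] that by force
    obtain B where "\<And>t. norm (q (x, t)) \<le> B" using bounded_compact_support[OF c K2c z] by metis
    then show ?thesis
      by (intro integrable_compact_support[OF borel_measurable_continuous_onI[OF c] compact_imp_bounded[OF K2c] z])
  qed
  define Q where "Q x s = (\<integral>t. indicator {..<Y s} t * hdivergence \<phi> (x, t) \<partial>lborel)" for x s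
  define \<Gamma> where "\<Gamma> x s = (\<integral>t. indicator {..<Y s} t * divergence \<phi> (x, t) \<partial>lborel)" for x s
  have ind: "integrable lborel (\<lambda>t. indicator {..<a} t * q t)" if "integrable lborel q" for a and q :: "real \<Rightarrow> real"
    using integrable_real_mult_indicator[of "{..<a}", OF _ that] by (simp add: mult.commute)
  have \<Gamma>Q: "\<Gamma> x s = Q x s + snd (\<phi> (x, Y s))" for x s
  proof -
    have i1: "integrable lborel (\<lambda>t. indicator {..<Y s} t * hdivergence \<phi> (x, t))"
      by (rule ind[OF slice[OF conthd K(5)]])
    have i2: "integrable lborel (\<lambda>t. indicator {..<Y s} t * divergence \<phi> (x, t))"
      by (rule ind[OF slice[OF contd K(4)]])
    have "\<Gamma> x s - Q x s = (\<integral>t. indicator {..<Y s} t * divergence \<phi> (x, t) - indicator {..<Y s} t * hdivergence \<phi> (x, t) \<partial>lborel)"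
      unfolding \<Gamma>_def Q_def using i1 i2 by simp
    also have "\<dots> = (\<integral>t. indicator {..<Y s} t * (frechet_derivative \<phi> (at (x, t)) (0, 1) \<bullet> (0, 1)) \<partial>lborel)"
      by (intro Bochner_Integration.integral_cong refl) (simp add: divergence_eq_hdivergence algebra_simps)
    also have "\<dots> = \<phi> (x, Y s) \<bullet> (0, 1)" by (rule integral_vertical_derivative[OF \<phi>(1)])
    finally show ?thesis by (simp add: inner_prod_def)
  qed
  have Qlip: "\<bar>Q x s - Q x s'\<bar> \<le> (Bh / b) * \<bar>s - s'\<bar>" for x s s'
  proof -
    have "\<bar>Q x s - Q x s'\<bar> \<le> Bh * \<bar>Y s - Y s'\<bar>"
      unfolding Q_def by (rule integral_lessThan_lipschitz[OF slice[OF conthd K(5)]]) (use Bh in auto)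
    also have "\<dots> \<le> Bh * (\<bar>s - s'\<bar> / b)" by (intro mult_left_mono Y(2) Bh(1))
    finally show ?thesis by simp
  qed
  have \<Gamma>lip: "\<bar>\<Gamma> x s - \<Gamma> x s'\<bar> \<le> (Bd / b) * \<bar>s - s'\<bar>" for x s s'
  proof -
    have "\<bar>\<Gamma> x s - \<Gamma> x s'\<bar> \<le> Bd * \<bar>Y s - Y s'\<bar>"
      unfolding \<Gamma>_def by (rule integral_lessThan_lipschitz[OF slice[OF contd K(4)]]) (use Bd in auto)
    also have "\<dots> \<le> Bd * (\<bar>s - s'\<bar> / b)" by (intro mult_left_mono Y(2) Bd(1))
    finally show ?thesis by simp
  qed
  have FK: "t < Y s \<longleftrightarrow> W t < s" if "(x, t) \<in> K" for x t s
    using Y(1)[of t s] FW[of t] r(2)[OF that] by simp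
  have \<Gamma>0: "\<Gamma> x 0 = 0" for x
  proof -
    have "indicator {..<Y 0} t * divergence \<phi> (x, t) = 0" for t
    proof (cases "(x, t) \<in> K")
      case True
      then have "t \<in> I1" using K(2) by auto
      then have "\<not> W t < 0" using W_pos[of t] by linarith
      then show ?thesis using FK[OF True, of 0] by simp
    qed (simp add: K(4))
    then show ?thesis unfolding \<Gamma>_def by (simp only: Bochner_Integration.integral_zero)
  qed
  have \<Gamma>out: "\<Gamma> x s = 0" "Q x s = 0" if "x \<notin> Kx" for x s
  proof -
    have "(x, t) \<notin> K" for t using that inK[of "(x, t)"] by auto
    then show "\<Gamma> x s = 0" "Q x s = 0" using K(4,5) by (simp_all add: \<Gamma>_def Q_def)
  qed
  have Qm: "(\<lambda>p. Q (fst p) (h p)) \<in> borel_measurable borel" "(\<lambda>p. \<Gamma> (fst p) (h p)) \<in> borel_measurable borel"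
    if [measurable]: "h \<in> borel_measurable borel" for h :: "'a \<times> real \<Rightarrow> real"
  proof -
    have Z: "(\<lambda>z. indicator {..<Y (h (fst z))} (snd z) * q (fst (fst z), snd z)) \<in> borel_measurable (borel \<Otimes>\<^sub>M lborel)"
      if [measurable]: "q \<in> borel_measurable borel" for q :: "'a \<times> real \<Rightarrow> real"
      unfolding indicator_def lessThan_iff by measurable
    have Z': "(\<lambda>p. \<integral>t. indicator {..<Y (h p)} t * q (fst p, t) \<partial>lborel) \<in> borel_measurable borel"
      if "q \<in> borel_measurable borel" for q :: "'a \<times> real \<Rightarrow> real"
      by (rule lborel.borel_measurable_lebesgue_integral) (simp only: split_def, rule Z[OF that])
    show "(\<lambda>p. Q (fst p) (h p)) \<in> borel_measurable borel" unfolding Q_def by (rule Z') simp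
    show "(\<lambda>p. \<Gamma> (fst p) (h p)) \<in> borel_measurable borel" unfolding \<Gamma>_def by (rule Z') simp
  qed
  have X: "(\<integral>t. (if t \<in> I1 \<and> W t < m p then divergence \<phi> (fst p, t) else 0) \<partial>lborel) = \<Gamma> (fst p) (m p)" for p
    unfolding \<Gamma>_def
  proof (intro Bochner_Integration.integral_cong refl)
    fix t
    show "(if t \<in> I1 \<and> W t < m p then divergence \<phi> (fst p, t) else 0) = indicator {..<Y (m p)} t * divergence \<phi> (fst p, t)"
    proof (cases "(fst p, t) \<in> K")
      case True
      then have "t \<in> I1" using K(2) by auto
      then show ?thesis using FK[OF True] by simp
    qed (simp add: K(4))
  qed
  have \<theta>m: "integrable lborel (\<lambda>p. \<theta> (m p))"
  proof (rule Bochner_Integration.integrable_bound[where f="\<lambda>p. (\<Theta> / W (r / 2)) * m p"])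
    have r2: "r / 2 \<in> I1" using I1_downward[OF r(1), of "r / 2"] mem_I1[of r] r(1) by auto
    have \<Theta>0: "0 \<le> \<Theta>" using \<theta>(8)[of 0] by linarith
    show "AE p in lborel. norm (\<theta> (m p)) \<le> norm ((\<Theta> / W (r / 2)) * m p)"
    proof (intro AE_I2)
      fix p
      show "norm (\<theta> (m p)) \<le> norm ((\<Theta> / W (r / 2)) * m p)"
      proof (cases "m p < W (r / 2)")
        case True then show ?thesis using \<theta>(7) by simp
      next
        case False
        have "\<Theta> * 1 \<le> \<Theta> * (m p / W (r / 2))" using False W_pos[OF r2] \<Theta>0 by (intro mult_left_mono) auto
        then show ?thesis using \<theta>(8)[of "m p"] \<Theta>0 m(3)[of p] W_pos[OF r2] by (simp add: abs_mult)
      qed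
    qed
  qed (use m(1) in auto)
  \<comment> \<open>the last component of the field \<open>g\<close> below is \<open>\<beta> p (M p)\<close>\<close>
  define \<beta> where "\<beta> p s = \<bar>snd (\<phi> (fst p, Y s))\<bar> / \<omega> (Y s)" for p :: "'a \<times> real" and s
  have norm\<phi>: "norm (\<phi> (x, y)) \<le> \<omega> y" for x y
  proof (cases "(x, y) \<in> K")
    case True
    then have "norm (\<phi> (x, y)) \<le> w y" using \<phi>(2)[of "(x, y)"] K(2) by auto
    then show ?thesis using \<omega>(4)[of y] r(2)[OF True] by simp
  next
    case False then show ?thesis using K(3) \<omega>pos[of y] by simp
  qed
  have \<beta>le: "0 \<le> \<beta> p s" "\<beta> p s \<le> 1" for p s
  proof -
    show "0 \<le> \<beta> p s" using \<omega>pos[of "Y s"] by (simp add: \<beta>_def)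
    have "\<bar>snd (\<phi> (fst p, Y s))\<bar> \<le> norm (\<phi> (fst p, Y s))"
      using norm_snd_le[of "snd (\<phi> (fst p, Y s))" "fst (\<phi> (fst p, Y s))"] by simp
    then show "\<beta> p s \<le> 1" using norm\<phi>[of "fst p" "Y s"] \<omega>pos[of "Y s"] by (simp add: \<beta>_def)
  qed
  have \<beta>m: "(\<lambda>p. \<beta> p (h p)) \<in> borel_measurable borel" if [measurable]: "h \<in> borel_measurable borel" for h :: "'a \<times> real \<Rightarrow> real"
    unfolding \<beta>_def by measurable
  have \<beta>uc: "\<exists>d>0. \<forall>p s s'. \<bar>s - s'\<bar> < d \<longrightarrow> \<bar>\<beta> p s - \<beta> p s'\<bar> < e" if e: "0 < e" for e
  proof -
    have "uniformly_continuous_on UNIV (\<lambda>q. \<bar>snd (\<phi> q)\<bar> / \<omega> (snd q))"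
    proof (rule uniformly_continuous_compact_support[OF _ K(1)])
      show "continuous_on UNIV (\<lambda>q. \<bar>snd (\<phi> q)\<bar> / \<omega> (snd q))"
        by (intro continuous_on_divide continuous_on_rabs continuous_on_snd cont\<phi> continuous_on_compose2[OF \<omega>(1)] continuous_on_id)
          (use \<omega>pos in \<open>auto simp: less_imp_neq[symmetric]\<close>)
    qed (simp add: K(3))
    from this[unfolded uniformly_continuous_on_def, THEN spec, THEN mp, OF e]
    obtain d where d: "d > 0" "\<And>q q'. dist q' q < d \<Longrightarrow> dist (\<bar>snd (\<phi> q')\<bar> / \<omega> (snd q')) (\<bar>snd (\<phi> q)\<bar> / \<omega> (snd q)) < e"
      by (elim exE conjE) (rule that, assumption, blast)
    show ?thesis
    proof (intro exI[of _ "d * b"] conjI allI impI)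
      show "0 < d * b" using d(1) \<omega>(2) by simp
      fix p :: "'a \<times> real" and s s' assume "\<bar>s - s'\<bar> < d * b"
      then have "\<bar>s - s'\<bar> / b < d" using \<omega>(2) by (simp add: field_simps)
      then have "\<bar>Y s - Y s'\<bar> < d" using Y(2)[of s s'] by linarith
      then have "dist (fst p, Y s) (fst p, Y s') < d" by (simp add: dist_Pair_Pair dist_real_def)
      from d(2)[OF this] show "\<bar>\<beta> p s - \<beta> p s'\<bar> < e" by (simp add: \<beta>_def dist_real_def)
    qed
  qed
  have box: "(\<integral>p. indicator (Kx \<times> {c0..c1}) p * \<Gamma> (fst p) (m p) \<partial>lborel) \<le> C" if c0: "0 < c0" for c0 c1 :: real
  proof -
    let ?D = "Kx \<times> {c0..c1}"
    have Dc: "compact ?D" using Kxc by (intro compact_Times) auto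
    have Db: "bounded ?D" by (rule compact_imp_bounded[OF Dc])
    have Dm[measurable]: "?D \<in> sets borel" using Dc by (simp add: borel_closed compact_imp_closed)
    have "?D \<subseteq> \<Omega>' \<times> {0<..}" using Kx\<Omega> c0 by auto
    then obtain e0 where e0: "e0 > 0" "(\<Union>x\<in>?D. cball x e0) \<subseteq> \<Omega>' \<times> {0<..}"
      by (rule compact_subset_open_imp_cball_epsilon_subset[OF Dc open_Times[OF Om open_greaterThan]]) (rule that)
    have near: "q \<in> \<Omega>' \<times> {0<..}" if "p \<in> ?D" "dist p q \<le> e0" for p q
    proof -
      have "q \<in> (\<Union>x\<in>?D. cball x e0)" using that by (intro UN_I[of p]) auto
      then show ?thesis using e0(2) by (rule subsetD[rotated])
    qed
    \<comment> \<open>the level inequality with the field \<open>\<eta> * g\<close>, the mollification being moved to \<open>m\<close> and to \<open>\<theta> \<circ> m\<close>\<close>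
    have ineq: "(\<integral>p. indicator ?D p * Q (fst p) (mollify d m p) \<partial>lborel) + (\<integral>p. indicator ?D p * \<beta> p (mollify d m p) * \<theta> (m p) \<partial>lborel)
        \<le> C + (\<integral>p. norm (mollify d (\<lambda>p. \<theta> (m p)) p - \<theta> (m p)) \<partial>lborel)" if d: "0 < d" "d \<le> e0" for d
    proof -
      define M where "M = mollify d m"
      define DM where "DM = mollify_gradient d m"
      have MD: "(M has_derivative (\<lambda>h. DM p \<bullet> h)) (at p)" for p
        unfolding M_def DM_def by (rule has_derivative_mollify_real[OF d(1) m(1)])
      have contDM: "continuous_on UNIV DM" unfolding DM_def by (rule continuous_mollify_gradient[OF d(1) m(1)])
      have contM: "continuous_on UNIV M" unfolding M_def by (rule continuous_mollify[OF d(1) m(1)])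
      have [measurable]: "M \<in> borel_measurable borel" "DM \<in> borel_measurable borel"
        using contM contDM by (auto intro: borel_measurable_continuous_onI)
      define g where "g p = (indicator ?D p / \<omega> (Y (M p))) *\<^sub>R (fst (\<phi> (fst p, Y (M p))), \<bar>snd (\<phi> (fst p, Y (M p)))\<bar>)" for p
      have gm: "g \<in> borel_measurable borel" unfolding g_def by measurable
      have g0: "g p = 0" if "p \<notin> ?D" for p using that by (simp add: g_def zero_prod_def)
      have gle: "norm (g p) \<le> 1" for p
      proof (cases "p \<in> ?D")
        case True
        have "norm (fst (\<phi> (fst p, Y (M p))), \<bar>snd (\<phi> (fst p, Y (M p)))\<bar>) = norm (\<phi> (fst p, Y (M p)))"
          by (simp add: norm_Pair norm_prod_def)
        also have "\<dots> \<le> \<omega> (Y (M p))" by (rule norm\<phi>)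
        finally show ?thesis unfolding g_def norm_scaleR using True \<omega>pos[of "Y (M p)"] by simp
      next
        case False then show ?thesis by (simp add: g0)
      qed
      have gint: "integrable lborel g" by (rule integrable_compact_support[OF gm Db g0 gle])
      have sg: "snd (g p) = indicator ?D p * \<beta> p (M p)" for p by (simp add: g_def \<beta>_def)
      let ?\<Phi> = "mollify d g"
      have \<Phi>: "?\<Phi> \<in> C1_compact_support (\<Omega>' \<times> {0<..})"
        by (rule mollify_C1_compact_support[OF d(1) gint Dc g0]) (use near d in auto)
      have \<Phi>1: "norm (?\<Phi> p) \<le> 1" for p by (rule norm_mollify_le[OF d(1)]) (use gle in auto)
      have s\<Phi>: "snd (?\<Phi> p) = mollify d (\<lambda>p. snd (g p)) p" for p by (rule snd_mollify[OF d(1) gint])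
      have \<Phi>0: "0 \<le> snd (?\<Phi> p)" for p
        unfolding s\<Phi> by (rule mollify_nonneg[OF d(1)]) (simp add: sg \<beta>le)
      have main: "(\<integral>p. m p * hdivergence ?\<Phi> p \<partial>lborel) + (\<integral>p. snd (?\<Phi> p) * \<theta> (m p) \<partial>lborel) \<le> C"
        by (rule L[OF \<Phi> \<Phi>1 \<Phi>0 \<theta>(1,2,3,4,8)])
      have gf: "integrable lborel (\<lambda>p. (fst (g p), 0::real))"
      proof (rule integrable_compact_support[OF _ Db, where B=1])
        show "(\<lambda>p. (fst (g p), 0::real)) \<in> borel_measurable borel" using gm by measurable
        show "norm (fst (g p), 0::real) \<le> 1" for p
          using gle[of p] norm_fst_le[of "fst (g p)" "snd (g p)"] by (simp add: norm_Pair)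
      qed (simp add: g0 zero_prod_def)
      define H where "H p = inverse (\<omega> (Y (M p))) *\<^sub>R fst (DM p)" for p
      have contH: "continuous_on UNIV H"
        unfolding H_def using \<omega>pos
        by (intro continuous_on_scaleR continuous_on_inverse continuous_on_compose2[OF \<omega>(1)] continuous_on_compose2[OF contY]
           contM continuous_on_fst contDM) (auto simp: less_imp_neq[symmetric])
      have [measurable]: "H \<in> borel_measurable borel" by (rule borel_measurable_continuous_onI[OF contH])
      define T where "T p = indicator ?D p * (fst (\<phi> (fst p, Y (M p))) \<bullet> H p)" for p
      have Teq: "DM p \<bullet> (fst (g p), 0) = T p" for p
        by (simp add: inner_prod_def g_def T_def H_def inner_commute divide_inverse)
      have "(\<integral>p. m p * hdivergence ?\<Phi> p \<partial>lborel) = (\<integral>p. m p * (\<integral>t. mollifier_grad d (p - t) \<bullet> (fst (g t), 0) \<partial>lborel) \<partial>lborel)"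
        by (simp add: hdivergence_mollify[OF d(1) gint])
      also have "\<dots> = - (\<integral>t. DM t \<bullet> (fst (g t), 0) \<partial>lborel)"
        unfolding DM_def mollify_gradient_def by (rule mollify_grad_duality[OF d(1) m(1) gf])
      also have "\<dots> = - (\<integral>p. T p \<partial>lborel)" unfolding Teq ..
      also have "\<dots> = (\<integral>p. indicator ?D p * Q (fst p) (M p) \<partial>lborel)"
      proof -
        have intT: "integrable lborel T"
        proof -
          have "integrable lborel (\<lambda>p. DM p \<bullet> (fst (g p), 0))"
          proof -
            have "bounded (DM ` ?D)" using Dc by (intro compact_imp_bounded compact_continuous_image continuous_on_subset[OF contDM]) auto
            then obtain B where B: "B > 0" "\<And>p. p \<in> ?D \<Longrightarrow> norm (DM p) \<le> B" unfolding bounded_pos by auto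
            show ?thesis
            proof (rule integrable_compact_support[OF _ Db, where B="B * 1"])
              show "(\<lambda>p. DM p \<bullet> (fst (g p), 0)) \<in> borel_measurable borel" using gm by measurable
              show "DM p \<bullet> (fst (g p), 0) = 0" if "p \<notin> ?D" for p
                using g0[OF that] by (simp add: inner_prod_def)
              show "norm (DM p \<bullet> (fst (g p), 0)) \<le> B * 1" for p
              proof (cases "p \<in> ?D")
                case True
                have "norm (fst (g p), 0::real) \<le> 1"
                  using gle[of p] norm_fst_le[of "fst (g p)" "snd (g p)"] by (simp add: norm_Pair)
                then have "norm (DM p) * norm (fst (g p), 0::real) \<le> B * 1" using B(2)[OF True] B(1) by (intro mult_mono) auto
                then show ?thesis using Cauchy_Schwarz_ineq2[of "DM p" "(fst (g p), 0)"] by simp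
              next
                case False then show ?thesis using g0[OF False] B(1) by (simp add: inner_prod_def)
              qed
            qed
          qed
          then show ?thesis unfolding Teq .
        qed
        have intQ: "integrable lborel (\<lambda>p. indicator ?D p * Q (fst p) (M p))"
        proof -
          have "bounded (M ` ?D)" using Dc by (intro compact_imp_bounded compact_continuous_image continuous_on_subset[OF contM]) auto
          then obtain B where B: "B > 0" "\<And>p. p \<in> ?D \<Longrightarrow> \<bar>M p\<bar> \<le> B" unfolding bounded_pos by auto
          have Q0: "\<bar>Q x 0\<bar> \<le> Bh / b * 0 + \<bar>Q x 0\<bar>" for x by simp
          have Q00: "Q x 0 = - snd (\<phi> (x, Y 0))" for x using \<Gamma>Q[of x 0] \<Gamma>0[of x] by simp
          have Qb: "\<bar>Q x s\<bar> \<le> Bh / b * \<bar>s\<bar> + \<omega> (Y 0)" for x s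
          proof -
            have "\<bar>snd (\<phi> (x, Y 0))\<bar> \<le> norm (\<phi> (x, Y 0))" using norm_snd_le[of "snd (\<phi> (x, Y 0))" "fst (\<phi> (x, Y 0))"] by simp
            also have "\<dots> \<le> \<omega> (Y 0)" by (rule norm\<phi>)
            finally show ?thesis using Qlip[of x s 0] Q00[of x] by simp
          qed
          show ?thesis
          proof (rule integrable_compact_support[OF _ Db, where B="Bh / b * B + \<omega> (Y 0)"])
            show "(\<lambda>p. indicator ?D p * Q (fst p) (M p)) \<in> borel_measurable borel" using Qm(1)[of M] by measurable
            show "norm (indicator ?D p * Q (fst p) (M p)) \<le> Bh / b * B + \<omega> (Y 0)" for p
            proof (cases "p \<in> ?D")
              case True
              have "Bh / b * \<bar>M p\<bar> \<le> Bh / b * B" using B(2)[OF True] Bh(1) \<omega>(2) by (intro mult_left_mono) auto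
              then have "\<bar>Q (fst p) (M p)\<bar> \<le> Bh / b * B + \<omega> (Y 0)" using Qb[of "fst p" "M p"] by linarith
              then show ?thesis using True by simp
            next
              case False
              have "0 \<le> Bh / b * B" using B(1) Bh(1) \<omega>(2) by simp
              then show ?thesis using False \<omega>pos[of "Y 0"] by simp
            qed
          qed simp
        qed
        have sl: "(\<integral>x. T (x, c) \<partial>lborel) = - (\<integral>x. indicator ?D (x, c) * Q (fst (x, c)) (M (x, c)) \<partial>lborel)" for c
        proof -
          let ?h = "\<lambda>x. Y (M (x, c))"
          have "(\<integral>x. T (x, c) \<partial>lborel) = (\<integral>x. indicator {c0..c1} c * (fst (\<phi> (x, ?h x)) \<bullet> H (x, c)) \<partial>lborel)"
          proof (intro Bochner_Integration.integral_cong refl)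
            fix x
            show "T (x, c) = indicator {c0..c1} c * (fst (\<phi> (x, ?h x)) \<bullet> H (x, c))"
            proof (cases "x \<in> Kx")
              case True then show ?thesis by (simp add: T_def indicator_def)
            next
              case False
              then have "(x, ?h x) \<notin> K" using inK[of "(x, ?h x)"] by auto
              then show ?thesis using K(3) False by (simp add: T_def)
            qed
          qed
          also have "\<dots> = indicator {c0..c1} c * (\<integral>x. fst (\<phi> (x, ?h x)) \<bullet> H (x, c) \<partial>lborel)" by simp
          also have "(\<integral>x. fst (\<phi> (x, ?h x)) \<bullet> H (x, c) \<partial>lborel) = - (\<integral>x. (\<integral>t. indicator {..<?h x} t * hdivergence \<phi> (x, t) \<partial>lborel) \<partial>lborel)"
          proof (rule subgraph_divergence(1)[OF \<phi>(1)])
            show "continuous_on UNIV (\<lambda>x. H (x, c))"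
              by (intro continuous_on_compose2[OF contH] continuous_on_Pair continuous_on_id continuous_on_const) auto
            fix x :: 'a
            have "((\<lambda>x. (x, c)) has_derivative (\<lambda>d. (d, 0))) (at x)" by (auto intro!: derivative_eq_intros)
            from has_derivative_compose[OF this, of M "\<lambda>h. DM (x, c) \<bullet> h"]
            have "((\<lambda>x. M (x, c)) has_derivative (\<lambda>d. fst (DM (x, c)) \<bullet> d)) (at x)"
              using MD[of "(x, c)"] by (simp add: inner_prod_def)
            from has_derivative_compose[OF this Y(3)[of "M (x, c)", unfolded has_field_derivative_def]]
            show "((\<lambda>x. Y (M (x, c))) has_derivative (\<lambda>d. H (x, c) \<bullet> d)) (at x)" by (simp add: H_def)
          qed
          also have "indicator {c0..c1} c * - (\<integral>x. (\<integral>t. indicator {..<?h x} t * hdivergence \<phi> (x, t) \<partial>lborel) \<partial>lborel)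
             = - (\<integral>x. indicator {c0..c1} c * Q x (M (x, c)) \<partial>lborel)" by (simp add: Q_def)
          also have "(\<integral>x. indicator {c0..c1} c * Q x (M (x, c)) \<partial>lborel) = (\<integral>x. indicator ?D (x, c) * Q (fst (x, c)) (M (x, c)) \<partial>lborel)"
            by (intro Bochner_Integration.integral_cong refl) (use \<Gamma>out(2) in \<open>auto simp: indicator_def\<close>)
          finally show ?thesis .
        qed
        have "(\<integral>p. T p \<partial>lborel) = (\<integral>c. (\<integral>x. T (x, c) \<partial>lborel) \<partial>lborel)"
          using lborel_pair.integral_snd[of "\<lambda>x c. T (x, c)"] intT by (simp add: lborel_prod)
        also have "\<dots> = - (\<integral>c. (\<integral>x. indicator ?D (x, c) * Q (fst (x, c)) (M (x, c)) \<partial>lborel) \<partial>lborel)" unfolding sl by simp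
        also have "(\<integral>c. (\<integral>x. indicator ?D (x, c) * Q (fst (x, c)) (M (x, c)) \<partial>lborel) \<partial>lborel) = (\<integral>p. indicator ?D p * Q (fst p) (M p) \<partial>lborel)"
          using lborel_pair.integral_snd[of "\<lambda>x c. indicator ?D (x, c) * Q (fst (x, c)) (M (x, c))"] intQ by (simp add: lborel_prod split_def)
        finally show ?thesis by simp
      qed
      finally have part1: "(\<integral>p. m p * hdivergence ?\<Phi> p \<partial>lborel) = (\<integral>p. indicator ?D p * Q (fst p) (M p) \<partial>lborel)" .
      let ?\<theta>m = "\<lambda>p. \<theta> (m p)"
      have sgint: "integrable lborel (\<lambda>p. snd (g p))" by (rule integrable_snd_field[OF gint])
      have [measurable]: "(\<lambda>p. snd (g p)) \<in> borel_measurable borel" using gm by measurable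
      have mol: "integrable lborel (mollify d ?\<theta>m)" by (rule integrable_mollify[OF d(1) \<theta>m])
      have molm: "mollify d ?\<theta>m \<in> borel_measurable borel" using borel_measurable_integrable[OF mol] by simp
      have sgb: "\<bar>snd (g p)\<bar> \<le> 1" for p using sg \<beta>le by (auto simp: indicator_def)
      have times: "integrable lborel (\<lambda>p. q p * snd (g p))" if "integrable lborel q" for q
      proof (rule Bochner_Integration.integrable_bound[OF that])
        show "(\<lambda>p. q p * snd (g p)) \<in> borel_measurable lborel" using borel_measurable_integrable[OF that] by simp
        show "AE p in lborel. norm (q p * snd (g p)) \<le> norm (q p)"
        proof (intro AE_I2)
          fix p
          have "\<bar>q p\<bar> * \<bar>snd (g p)\<bar> \<le> \<bar>q p\<bar> * 1" by (intro mult_left_mono sgb) auto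
          then show "norm (q p * snd (g p)) \<le> norm (q p)" by (simp add: abs_mult)
        qed
      qed
      have "(\<integral>p. snd (?\<Phi> p) * \<theta> (m p) \<partial>lborel) = (\<integral>p. ?\<theta>m p * mollify d (\<lambda>p. snd (g p)) p \<partial>lborel)"
        unfolding s\<Phi> by (simp add: mult.commute)
      also have "\<dots> = (\<integral>p. mollify d ?\<theta>m p * snd (g p) \<partial>lborel)"
        by (rule mollify_symmetric[OF d(1) \<theta>m sgint])
      also have "\<dots> = (\<integral>p. ?\<theta>m p * snd (g p) \<partial>lborel) + (\<integral>p. (mollify d ?\<theta>m p - ?\<theta>m p) * snd (g p) \<partial>lborel)"
        using times[OF mol] times[OF \<theta>m] by (simp add: left_diff_distrib)
      finally have part2: "(\<integral>p. snd (?\<Phi> p) * \<theta> (m p) \<partial>lborel) = (\<integral>p. ?\<theta>m p * snd (g p) \<partial>lborel) + (\<integral>p. (mollify d ?\<theta>m p - ?\<theta>m p) * snd (g p) \<partial>lborel)" .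
      have "norm (\<integral>p. (mollify d ?\<theta>m p - ?\<theta>m p) * snd (g p) \<partial>lborel) \<le> (\<integral>p. norm (mollify d ?\<theta>m p - ?\<theta>m p) \<partial>lborel)"
      proof (rule norm_integral_bound)
        show "integrable lborel (\<lambda>p. (mollify d ?\<theta>m p - ?\<theta>m p) * snd (g p))" using mol \<theta>m by (intro times) simp
        show "integrable lborel (\<lambda>p. norm (mollify d ?\<theta>m p - ?\<theta>m p))" using mol \<theta>m by simp
        fix p
        have "\<bar>mollify d ?\<theta>m p - ?\<theta>m p\<bar> * \<bar>snd (g p)\<bar> \<le> \<bar>mollify d ?\<theta>m p - ?\<theta>m p\<bar> * 1" by (intro mult_left_mono sgb) auto
        then show "norm ((mollify d ?\<theta>m p - ?\<theta>m p) * snd (g p)) \<le> norm (mollify d ?\<theta>m p - ?\<theta>m p)" by (simp add: abs_mult)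
      qed
      moreover have "(\<integral>p. ?\<theta>m p * snd (g p) \<partial>lborel) = (\<integral>p. indicator ?D p * \<beta> p (M p) * \<theta> (m p) \<partial>lborel)"
        by (simp add: sg mult_ac)
      ultimately show ?thesis using main part1 part2 unfolding M_def real_norm_def by linarith
    qed
    define \<delta> where "\<delta> k = e0 * inverse (real (Suc k))" for k
    have \<delta>: "0 < \<delta> k" "\<delta> k \<le> e0" for k using e0(1) by (auto simp: \<delta>_def field_simps)
    have "(\<lambda>k. e0 * inverse (real (Suc k))) \<longlonglongrightarrow> e0 * 0" by (intro tendsto_intros LIMSEQ_inverse_real_of_nat)
    then have \<delta>lim: "filterlim \<delta> (at_right 0) sequentially"
      unfolding filterlim_at using \<delta>(1) e0(1) by (auto simp: \<delta>_def[abs_def] intro!: always_eventually less_imp_neq[symmetric])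
    have Llim: "(\<lambda>k. \<integral>p. norm (mollify (\<delta> k) q p - q p) \<partial>lborel) \<longlonglongrightarrow> 0" if "integrable lborel q" for q :: "'a \<times> real \<Rightarrow> real"
      using filterlim_compose[OF mollify_tendsto_L1[OF that] \<delta>lim] .
    have molm: "mollify (\<delta> k) m \<in> borel_measurable borel" for k
      by (rule borel_measurable_continuous_onI[OF continuous_mollify[OF \<delta>(1) m(1)]])
    have L1: "(\<lambda>k. \<integral>\<^sup>+p. indicator ?D p * ennreal \<bar>mollify (\<delta> k) m p - m p\<bar> \<partial>lborel) \<longlonglongrightarrow> 0"
    proof (rule tendsto_sandwich[OF _ _ tendsto_const])
      show "(\<lambda>k. ennreal (\<integral>p. norm (mollify (\<delta> k) m p - m p) \<partial>lborel)) \<longlonglongrightarrow> 0"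
        using tendsto_ennrealI[OF Llim[OF m(1)]] by simp
      have "(\<integral>\<^sup>+p. indicator ?D p * ennreal \<bar>mollify (\<delta> k) m p - m p\<bar> \<partial>lborel) \<le> ennreal (\<integral>p. norm (mollify (\<delta> k) m p - m p) \<partial>lborel)" for k
      proof -
        have "(\<integral>\<^sup>+p. indicator ?D p * ennreal \<bar>mollify (\<delta> k) m p - m p\<bar> \<partial>lborel) \<le> (\<integral>\<^sup>+p. ennreal (norm (mollify (\<delta> k) m p - m p)) \<partial>lborel)"
          by (intro nn_integral_mono) (auto simp: indicator_def)
        also have "\<dots> = ennreal (\<integral>p. norm (mollify (\<delta> k) m p - m p) \<partial>lborel)"
          by (rule nn_integral_eq_integral) (use integrable_mollify[OF \<delta>(1) m(1)] m(1) in auto)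
        finally show ?thesis .
      qed
      then show "\<forall>\<^sub>F k in sequentially. (\<integral>\<^sup>+p. indicator ?D p * ennreal \<bar>mollify (\<delta> k) m p - m p\<bar> \<partial>lborel) \<le> ennreal (\<integral>p. norm (mollify (\<delta> k) m p - m p) \<partial>lborel)"
        by (intro always_eventually allI)
    qed auto
    obtain Bq where Bq: "\<And>x s. \<bar>Q x s\<bar> \<le> Bq"
    proof -
      obtain a where a: "\<And>t. t \<in> snd ` K \<Longrightarrow> \<bar>t\<bar> \<le> a" "0 < a"
        using compact_imp_bounded[OF K2c] unfolding bounded_pos by auto
      have "\<bar>Q x s\<bar> \<le> Bh * (2 * a)" for x s
      proof -
        have "norm (Q x s) \<le> (\<integral>t. Bh * indicator {-a..a} t \<partial>lborel)"
          unfolding Q_def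
        proof (rule norm_integral_bound)
          show "integrable lborel (\<lambda>t. indicator {..<Y s} t * hdivergence \<phi> (x, t))" by (rule ind[OF slice[OF conthd K(5)]])
          show "integrable lborel (\<lambda>t. Bh * indicator {-a..a} t)"
            by (intro integrable_mult_right impI integrable_real_indicator) (use a in auto)
          show "norm (indicator {..<Y s} t * hdivergence \<phi> (x, t)) \<le> Bh * indicator {-a..a} t" for t
          proof (cases "(x, t) \<in> K")
            case True
            then have "\<bar>t\<bar> \<le> a" by (intro a(1)) force
            then show ?thesis using Bh(1) Bh(2)[of "(x, t)"] by (auto simp: indicator_def abs_le_iff)
          next
            case False then show ?thesis using K(5) Bh(1) by simp
          qed
        qed
        then show ?thesis using a(2) by simp
      qed
      then show ?thesis using that by blast
    qed
    have T1: "(\<lambda>k. \<integral>p. indicator ?D p * Q (fst p) (mollify (\<delta> k) m p) \<partial>lborel) \<longlonglongrightarrow> (\<integral>p. indicator ?D p * Q (fst p) (m p) \<partial>lborel)"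
    proof (rule tendsto_integral_compose_L1[where G="\<lambda>p s. indicator ?D p * Q (fst p) s", OF Dm Db _ _ _ _ _ molm m(2) L1])
      fix e :: real assume e: "0 < e"
      show "\<exists>d>0. \<forall>p\<in>?D. \<forall>s s'. \<bar>s - s'\<bar> < d \<longrightarrow> \<bar>indicator ?D p * Q (fst p) s - indicator ?D p * Q (fst p) s'\<bar> \<le> e"
      proof (intro exI[of _ "e / (Bh / b + 1)"] conjI ballI allI impI)
        have pos: "0 < Bh / b + 1" using Bh(1) \<omega>(2) by (simp add: add_nonneg_pos)
        show "0 < e / (Bh / b + 1)" using e pos by simp
        fix p s s' assume p: "p \<in> ?D" and s: "\<bar>s - s'\<bar> < e / (Bh / b + 1)"
        have "\<bar>Q (fst p) s - Q (fst p) s'\<bar> \<le> Bh / b * \<bar>s - s'\<bar>" by (rule Qlip)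
        also have "\<dots> \<le> (Bh / b + 1) * \<bar>s - s'\<bar>" by (intro mult_right_mono) auto
        also have "\<dots> \<le> e" using s pos by (simp add: field_simps)
        finally show "\<bar>indicator ?D p * Q (fst p) s - indicator ?D p * Q (fst p) s'\<bar> \<le> e" using p by simp
      qed
    next
      show "\<bar>indicator ?D p * Q (fst p) s\<bar> \<le> \<bar>Bq\<bar>" for p s using Bq[of "fst p" s] by (auto simp: indicator_def)
    qed (use Qm(1)[OF molm] Qm(1)[OF m(2)] in \<open>auto intro!: borel_measurable_times\<close>)
    have T2: "(\<lambda>k. \<integral>p. indicator ?D p * \<beta> p (mollify (\<delta> k) m p) * \<theta> (m p) \<partial>lborel) \<longlonglongrightarrow> (\<integral>p. indicator ?D p * \<beta> p (m p) * \<theta> (m p) \<partial>lborel)"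
    proof (rule tendsto_integral_compose_L1[where G="\<lambda>p s. indicator ?D p * \<beta> p s * \<theta> (m p)" and B=\<Theta>, OF Dm Db _ _ _ _ _ molm m(2) L1])
      have \<Theta>0: "0 \<le> \<Theta>" using \<theta>(8)[of 0] by linarith
      fix e :: real assume e: "0 < e"
      obtain d where d: "d > 0" "\<And>p s s'. \<bar>s - s'\<bar> < d \<Longrightarrow> \<bar>\<beta> p s - \<beta> p s'\<bar> < e / (\<Theta> + 1)"
        using \<beta>uc[of "e / (\<Theta> + 1)"] e \<Theta>0 by auto
      show "\<exists>d>0. \<forall>p\<in>?D. \<forall>s s'. \<bar>s - s'\<bar> < d \<longrightarrow> \<bar>indicator ?D p * \<beta> p s * \<theta> (m p) - indicator ?D p * \<beta> p s' * \<theta> (m p)\<bar> \<le> e"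
      proof (intro exI[of _ d] conjI ballI allI impI d(1))
        fix p s s' assume p: "p \<in> ?D" and s: "\<bar>s - s'\<bar> < d"
        have "\<bar>\<beta> p s - \<beta> p s'\<bar> * \<bar>\<theta> (m p)\<bar> \<le> e / (\<Theta> + 1) * (\<Theta> + 1)"
          using d(2)[OF s, of p] \<theta>(8)[of "m p"] e \<Theta>0 by (intro mult_mono) auto
        also have "\<dots> = e" using \<Theta>0 by simp
        finally show "\<bar>indicator ?D p * \<beta> p s * \<theta> (m p) - indicator ?D p * \<beta> p s' * \<theta> (m p)\<bar> \<le> e"
          using p by (simp add: abs_mult[symmetric] left_diff_distrib)
      qed
    next
      show "\<bar>indicator ?D p * \<beta> p s * \<theta> (m p)\<bar> \<le> \<Theta>" for p s
      proof -
        have "\<bar>indicator ?D p * \<beta> p s\<bar> * \<bar>\<theta> (m p)\<bar> \<le> 1 * \<Theta>"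
          using \<beta>le[of p s] \<theta>(8) by (intro mult_mono) (auto simp: indicator_def)
        then show ?thesis by (simp add: abs_mult)
      qed
    qed (use \<beta>m[OF molm] \<beta>m[OF m(2)] in \<open>auto intro!: borel_measurable_times\<close>)
    have lim: "(\<integral>p. indicator ?D p * Q (fst p) (m p) \<partial>lborel) + (\<integral>p. indicator ?D p * \<beta> p (m p) * \<theta> (m p) \<partial>lborel) \<le> C + 0"
      by (rule LIMSEQ_le[OF tendsto_add[OF T1 T2] tendsto_add[OF tendsto_const Llim[OF \<theta>m]]]) (use ineq \<delta> in auto)
    have iQ: "integrable lborel (\<lambda>p. indicator ?D p * Q (fst p) (m p))"
    proof (rule integrable_compact_support[OF _ Db, where B="\<bar>Bq\<bar>"])
      show "norm (indicator ?D p * Q (fst p) (m p)) \<le> \<bar>Bq\<bar>" for p using Bq[of "fst p" "m p"] by (auto simp: indicator_def)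
    qed (use Qm(1)[OF m(2)] in \<open>auto intro!: borel_measurable_times\<close>)
    have i\<beta>: "integrable lborel (\<lambda>p. indicator ?D p * \<beta> p (m p) * \<theta> (m p))"
    proof (rule integrable_compact_support[OF _ Db, where B="1 * \<Theta>"])
      show "norm (indicator ?D p * \<beta> p (m p) * \<theta> (m p)) \<le> 1 * \<Theta>" for p
        unfolding real_norm_def abs_mult[of _ "\<theta> (m p)"] using \<beta>le[of p "m p"] \<theta>(8) by (intro mult_mono) (auto simp: indicator_def)
    qed (use \<beta>m[OF m(2)] in \<open>auto intro!: borel_measurable_times\<close>)
    have "(\<integral>p. indicator ?D p * \<Gamma> (fst p) (m p) \<partial>lborel) \<le> (\<integral>p. indicator ?D p * Q (fst p) (m p) + indicator ?D p * \<beta> p (m p) * \<theta> (m p) \<partial>lborel)"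
    proof (rule integral_mono)
      show "integrable lborel (\<lambda>p. indicator ?D p * Q (fst p) (m p) + indicator ?D p * \<beta> p (m p) * \<theta> (m p))" using iQ i\<beta> by simp
      fix p
      \<comment> \<open>since \<open>\<theta>(m) = \<omega>(Y m)\<close> wherever \<open>\<phi>(x, Y m) \<noteq> 0\<close>\<close>
      have "snd (\<phi> (fst p, Y (m p))) \<le> \<beta> p (m p) * \<theta> (m p)"
      proof (cases "(fst p, Y (m p)) \<in> K")
        case True
        then have "\<theta> (m p) = \<omega> (Y (m p))" using \<theta>(6) r(2) by force
        then show ?thesis using \<omega>pos[of "Y (m p)"] by (simp add: \<beta>_def)
      next
        case False then show ?thesis using K(3) \<beta>le \<theta>(5) by simp
      qed
      then show "indicator ?D p * \<Gamma> (fst p) (m p) \<le> indicator ?D p * Q (fst p) (m p) + indicator ?D p * \<beta> p (m p) * \<theta> (m p)"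
        by (auto simp: \<Gamma>Q indicator_def)
      next
      have "bounded (\<phi> ` K)"
        by (intro compact_imp_bounded compact_continuous_image K(1) continuous_on_subset[OF cont\<phi>]) simp
      then obtain B where B: "\<And>p. p \<in> K \<Longrightarrow> norm (\<phi> p) \<le> B" unfolding bounded_iff by blast
      have B': "\<bar>snd (\<phi> p)\<bar> \<le> \<bar>B\<bar>" for p
      proof (cases "p \<in> K")
        case True
        then show ?thesis using B[OF True] norm_snd_le[of "snd (\<phi> p)" "fst (\<phi> p)"] by simp
      qed (simp add: K(3))
      show "integrable lborel (\<lambda>p. indicator ?D p * \<Gamma> (fst p) (m p))"
      proof (rule integrable_compact_support[OF _ Db, where B="\<bar>Bq\<bar> + \<bar>B\<bar>"])
        fix p
        have "\<bar>\<Gamma> (fst p) (m p)\<bar> \<le> \<bar>Bq\<bar> + \<bar>B\<bar>"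
          unfolding \<Gamma>Q using Bq[of "fst p" "m p"] B'[of "(fst p, Y (m p))"] by linarith
        then show "norm (indicator ?D p * \<Gamma> (fst p) (m p)) \<le> \<bar>Bq\<bar> + \<bar>B\<bar>" by (simp add: indicator_def)
      qed (use Qm(2)[OF m(2)] in \<open>auto intro!: borel_measurable_times\<close>)
    qed
    then show ?thesis using lim iQ i\<beta> by simp
  qed
  have \<Gamma>int: "integrable lborel (\<lambda>p. \<Gamma> (fst p) (m p))"
  proof (rule Bochner_Integration.integrable_bound[where f="\<lambda>p. (Bd / b) * m p"])
    show "AE p in lborel. norm (\<Gamma> (fst p) (m p)) \<le> norm ((Bd / b) * m p)"
    proof (intro AE_I2)
      fix p
      show "norm (\<Gamma> (fst p) (m p)) \<le> norm ((Bd / b) * m p)"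
        using \<Gamma>lip[of "fst p" "m p" 0] \<Gamma>0[of "fst p"] m(3)[of p] Bd(1) \<omega>(2) by (simp add: abs_mult)
    qed
  qed (use m(1) Qm(2)[OF m(2)] in auto)
  have "(\<lambda>n. \<integral>p. indicator (Kx \<times> {inverse (real (Suc n))..real (Suc n)}) p * \<Gamma> (fst p) (m p) \<partial>lborel) \<longlonglongrightarrow> (\<integral>p. \<Gamma> (fst p) (m p) \<partial>lborel)"
  proof (rule integral_dominated_convergence[where w="\<lambda>p. \<bar>\<Gamma> (fst p) (m p)\<bar>"])
    show "AE p in lborel. (\<lambda>n. indicator (Kx \<times> {inverse (real (Suc n))..real (Suc n)}) p * \<Gamma> (fst p) (m p)) \<longlonglongrightarrow> \<Gamma> (fst p) (m p)"
    proof (intro AE_I2)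
      fix p
      show "(\<lambda>n. indicator (Kx \<times> {inverse (real (Suc n))..real (Suc n)}) p * \<Gamma> (fst p) (m p)) \<longlonglongrightarrow> \<Gamma> (fst p) (m p)"
      proof (cases "fst p \<in> Kx \<and> 0 < snd p")
        case True
        have "eventually (\<lambda>n. inverse (real (Suc n)) < snd p) sequentially"
          using order_tendstoD(2)[OF LIMSEQ_inverse_real_of_nat, of "snd p"] True by simp
        moreover have "eventually (\<lambda>n. snd p \<le> real (Suc n)) sequentially"
        proof -
          obtain N :: nat where "snd p < real N" using reals_Archimedean2 by blast
          then show ?thesis unfolding eventually_sequentially by (intro exI[of _ N]) auto
        qed
        ultimately have "eventually (\<lambda>n. indicator (Kx \<times> {inverse (real (Suc n))..real (Suc n)}) p * \<Gamma> (fst p) (m p) = \<Gamma> (fst p) (m p)) sequentially"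
          by eventually_elim (use True in \<open>cases p; auto simp: indicator_def\<close>)
        then show ?thesis by (rule tendsto_eventually)
      next
        case False
        then have "\<Gamma> (fst p) (m p) = 0" using \<Gamma>out(1)[of "fst p"] m(4)[of p] \<Gamma>0 by (cases "fst p \<in> Kx") auto
        then show ?thesis by simp
      qed
    qed
    show "(\<lambda>p. \<Gamma> (fst p) (m p)) \<in> borel_measurable lborel" using Qm(2)[OF m(2)] by simp
    have "Kx \<in> sets borel" using Kxc by (simp add: borel_closed compact_imp_closed)
    then show "(\<lambda>p. indicator (Kx \<times> {inverse (real (Suc n))..real (Suc n)}) p * \<Gamma> (fst p) (m p)) \<in> borel_measurable lborel" for n
      using Qm(2)[OF m(2)] by (auto intro!: borel_measurable_times borel_measurable_indicator borel_Times)
    show "integrable lborel (\<lambda>p. \<bar>\<Gamma> (fst p) (m p)\<bar>)" using \<Gamma>int by simp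
  qed (auto simp: indicator_def)
  from LIMSEQ_le_const2[OF this] have "(\<integral>p. \<Gamma> (fst p) (m p) \<partial>lborel) \<le> C" using box by auto
  then show ?thesis unfolding X .
qed

end

section \<open>The rearrangement and its levels\<close>

lemma borel_measurable_completion_AE:
  fixes h :: "'a \<Rightarrow> real"
  assumes h0: "h0 \<in> borel_measurable M" and ae: "AE x in M. h x = h0 x"
  shows "h \<in> borel_measurable (completion M)"
proof -
  have [measurable]: "h0 \<in> borel_measurable (completion M)" by (rule measurable_completion[OF h0])
  have N[measurable]: "Measurable.pred (completion M) (\<lambda>x. h x \<noteq> h0 x)"
    by (rule sets_completion_AE) (use ae in auto)
  have "Measurable.pred (completion M) (\<lambda>x. a < h x)" for a
  proof -
    have [measurable]: "Measurable.pred (completion M) (\<lambda>x. a < h0 x)" by measurable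
    have [measurable]: "Measurable.pred (completion M) (\<lambda>x. h x \<noteq> h0 x \<and> a < h x)"
      by (rule sets_completion_AE) (use ae in auto)
    have "(\<lambda>x. a < h x) = (\<lambda>x. (a < h0 x \<and> \<not> h x \<noteq> h0 x) \<or> (h x \<noteq> h0 x \<and> a < h x))" by auto
    then show ?thesis by (simp only:) measurable
  qed
  then show ?thesis unfolding borel_measurable_iff_greater by (simp add: pred_def)
qed

lemma lebesgue_on_AE_borel:
  fixes h h0 :: "'a::euclidean_space \<Rightarrow> real"
  assumes S: "S \<in> sets borel" and h0: "h0 \<in> borel_measurable borel" "\<And>p. p \<notin> S \<Longrightarrow> h0 p = 0"
    and ae: "AE p in lborel. p \<in> S \<longrightarrow> h p = h0 p"
  shows "h \<in> borel_measurable (lebesgue_on S)"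
    and "(\<integral>p. h p \<partial>lebesgue_on S) = (\<integral>p. h0 p \<partial>lborel)"
proof -
  have S': "S \<inter> space lebesgue \<in> sets lebesgue" using S by auto
  have ae': "AE p in lborel. indicator S p *\<^sub>R h p = h0 p"
    using ae by eventually_elim (use h0(2) in \<open>auto simp: indicator_def\<close>)
  have m: "(\<lambda>p. indicator S p *\<^sub>R h p) \<in> borel_measurable lebesgue"
    by (rule borel_measurable_completion_AE[OF _ ae']) (use h0(1) in simp)
  then show "h \<in> borel_measurable (lebesgue_on S)"
    unfolding borel_measurable_restrict_space_iff[OF S'] .
  have "(\<integral>p. h p \<partial>lebesgue_on S) = (\<integral>p. indicator S p *\<^sub>R h p \<partial>lebesgue)"
    by (rule integral_restrict_space[OF S'])
  also have "\<dots> = (\<integral>p. h0 p \<partial>lebesgue)"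
    by (rule integral_cong_AE[OF m measurable_completion AE_completion[OF ae']]) (use h0(1) in simp)
  also have "\<dots> = (\<integral>p. h0 p \<partial>lborel)" by (rule integral_completion) (use h0(1) in simp)
  finally show "(\<integral>p. h p \<partial>lebesgue_on S) = (\<integral>p. h0 p \<partial>lborel)" .
qed

context weight begin

text \<open>
  The superlevel set on \<open>(0, \<alpha>)\<close> in the definition of the rearrangement is the image under \<open>W\<close> of a superlevel set on \<open>I1\<close>,
  and \<open>W' = w\<close>. A slice of a Lebesgue measurable function agrees with a Borel function only almost everywhere, hence the two
  functions \<open>g\<close> and \<open>h\<close>.
\<close>

lemma superlevel_measure:
  fixes g h :: "real \<Rightarrow> real"
  assumes g: "g \<in> borel_measurable borel" and ae: "AE y in lborel. y \<in> I1 \<longrightarrow> h y = g y"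
    and fin: "emeasure mu {y. c < g y} < \<infinity>"
  shows "{s \<in> einterval 0 \<alpha>. c < h (weight_primitive_inv \<alpha>1 w s)} \<in> lmeasurable"
    and "measure lebesgue {s \<in> einterval 0 \<alpha>. c < h (weight_primitive_inv \<alpha>1 w s)} = measure mu {y. c < g y}"
proof -
  note g[measurable]
  let ?A = "{s \<in> einterval 0 \<alpha>. c < h (weight_primitive_inv \<alpha>1 w s)}"
  let ?S = "{y \<in> I1. c < h y}" and ?G = "{y \<in> I1. c < g y}" and ?N = "{y \<in> I1. h y \<noteq> g y}"
  have A: "?A = W ` ?S"
  proof (intro set_eqI iffI)
    fix s assume s: "s \<in> ?A"
    then have "0 < s" "ereal s < \<alpha>" by (simp_all add: einterval_def zero_ereal_def)
    then obtain y where "y \<in> I1" "W y = s" by (rule W_surj) (rule that)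
    then show "s \<in> W ` ?S" using s W_inv[of y] by auto
  next
    fix s assume "s \<in> W ` ?S"
    then obtain y where "y \<in> I1" "c < h y" "s = W y" by auto
    then show "s \<in> ?A" using W_inv[of y] W_pos[of y] W_less_alpha[of y] by (simp add: einterval_def zero_ereal_def)
  qed
  have "?N \<in> null_sets lebesgue"
  proof -
    have "AE y in lborel. y \<notin> ?N" using ae by eventually_elim auto
    then have "AE y in lebesgue. y \<notin> ?N" by (rule AE_completion)
    moreover from ae have "?N \<in> sets lebesgue"
      using sets_completion_AE[where M=lborel and P="\<lambda>y. y \<in> ?N"] \<open>AE y in lborel. y \<notin> ?N\<close> by (simp add: pred_def)
    ultimately show ?thesis by (simp add: AE_iff_null_sets)
  qed
  then have N: "negligible ?N" by (simp add: negligible_iff_null_sets)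
  have S0: "?G \<in> sets borel" by (simp add: Collect_conj_eq)
  have S: "?S \<in> sets lebesgue"
  proof (rule sets_negligible_symdiff)
    show "?G \<in> sets lebesgue" using S0 by simp
    show "negligible ((?G - ?S) \<union> (?S - ?G))" by (rule negligible_subset[OF N]) auto
  qed
  have nn: "(\<integral>\<^sup>+y. ennreal (indicator {y. c < g y} y * wbar y) \<partial>lborel) = emeasure mu {y. c < g y}"
  proof -
    have "{y. c < g y} \<in> sets borel" by measurable
    then show ?thesis
      unfolding emeasure_mu[OF \<open>{y. c < g y} \<in> sets borel\<close>] by (intro nn_integral_cong) (simp add: indicator_def)
  qed
  have i: "integrable lborel (\<lambda>y. indicator {y. c < g y} y * wbar y)"
    by (rule integrableI_nonneg) (use nn fin wbar_nonneg in \<open>auto intro!: AE_I2\<close>)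
  have I: "(\<integral>y. indicator {y. c < g y} y * wbar y \<partial>lborel) = measure mu {y. c < g y}"
    unfolding measure_def nn[symmetric] by (rule integral_eq_nn_integral) (use wbar_nonneg in \<open>auto intro!: AE_I2\<close>)
  have "((\<lambda>y. indicator {y. c < g y} y * wbar y) has_integral measure mu {y. c < g y}) UNIV"
    using has_integral_integral_lborel[OF i] I by simp
  then have "((\<lambda>y. if y \<in> ?S then \<bar>w y\<bar> * 1 else 0) has_integral measure mu {y. c < g y}) UNIV"
    by (rule has_integral_spike[OF N, rotated]) (use w_pos in \<open>auto simp: wbar_def indicator_def abs_of_pos\<close>)
  then have hi: "((\<lambda>y. \<bar>w y\<bar> * 1) has_integral measure mu {y. c < g y}) ?S"
    by (simp only: has_integral_restrict_UNIV)
  then have "(\<lambda>y. \<bar>w y\<bar> * 1) absolutely_integrable_on ?S"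
    by (intro nonnegative_absolutely_integrable_1 has_integral_integrable[OF hi]) auto
  moreover have "integral ?S (\<lambda>y. \<bar>w y\<bar> * 1) = measure mu {y. c < g y}" by (rule integral_unique[OF hi])
  moreover have "inj_on W ?S" by (rule inj_on_subset[OF W_inj]) (use I1_subset_closure in auto)
  moreover have "(W has_field_derivative w y) (at y within ?S)" if "y \<in> ?S" for y
    by (rule has_field_derivative_at_within[OF DERIV_W]) (use that in simp)
  ultimately have "(\<lambda>_. 1::real) absolutely_integrable_on (W ` ?S) \<and> integral (W ` ?S) (\<lambda>_. 1::real) = measure mu {y. c < g y}"
    using has_absolute_integral_change_of_variables_1'[OF S, of W w "\<lambda>_. 1" "measure mu {y. c < g y}"] by blast
  then have "(\<lambda>_. 1::real) integrable_on ?A" "integral ?A (\<lambda>_. 1::real) = measure mu {y. c < g y}"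
    unfolding A by (auto intro: absolutely_integrable_on_def[THEN iffD1, THEN conjunct1] set_lebesgue_integral_eq_integral(1))
  then show m: "?A \<in> lmeasurable" and "measure lebesgue ?A = measure mu {y. c < g y}"
    by (simp_all add: lmeasurable_iff_integrable_on lmeasure_integral)
qed

lemma level_measure_right_continuous:
  fixes g :: "real \<Rightarrow> real" and c s :: real
  assumes g[measurable]: "g \<in> borel_measurable borel" and fin: "emeasure mu {y. c < g y} < \<infinity>"
    and s: "s < measure mu {y. c < g y}"
  obtains c' where "c < c'" "s < measure mu {y. c' < g y}"
proof -
  let ?A = "\<lambda>n. {y. c + inverse (real (Suc n)) < g y}"
  have U: "(\<Union>n. ?A n) = {y. c < g y}"
  proof (intro set_eqI iffI)
    fix y assume "y \<in> {y. c < g y}"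
    then have "0 < g y - c" by simp
    then obtain n where "inverse (real (Suc n)) < g y - c" using reals_Archimedean by blast
    then show "y \<in> (\<Union>n. ?A n)" by (auto intro!: exI[of _ n])
  next
    fix y assume "y \<in> (\<Union>n. ?A n)"
    then obtain n where "c + inverse (real (Suc n)) < g y" by auto
    moreover have "0 < inverse (real (Suc n))" by simp
    ultimately show "y \<in> {y. c < g y}" unfolding mem_Collect_eq by linarith
  qed
  have "(\<lambda>n. measure mu (?A n)) \<longlonglongrightarrow> measure mu (\<Union>n. ?A n)"
  proof (rule Lim_measure_incseq)
    show "range ?A \<subseteq> sets mu" by auto
    show "incseq ?A"
    proof (rule incseq_SucI, rule subsetI)
      fix n y assume "y \<in> ?A n"
      moreover have "inverse (real (Suc (Suc n))) \<le> inverse (real (Suc n))" by (rule le_imp_inverse_le) auto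
      ultimately show "y \<in> ?A (Suc n)" unfolding mem_Collect_eq by linarith
    qed
    show "emeasure mu (\<Union>n. ?A n) \<noteq> \<infinity>" using fin unfolding U by simp
  qed
  then have "eventually (\<lambda>n. s < measure mu (?A n)) sequentially"
    unfolding U by (rule order_tendstoD(1)) (rule s)
  then obtain n where n: "s < measure mu (?A n)" by (auto simp: eventually_sequentially)
  show ?thesis by (rule that[OF _ n]) simp
qed

text \<open>
  The levels \<open>c\<close> with \<open>W y < m c\<close> form an initial interval, because \<open>m\<close> decreases. By the right-continuity of \<open>m\<close> it is
  open on the right, so its supremum exceeds \<open>c\<close> exactly if \<open>c\<close> belongs to it; Chebyshev's inequality bounds it.
\<close>

lemma rearranged_slice:
  fixes v :: "'b \<times> real \<Rightarrow> real" and g :: "real \<Rightarrow> real"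
  assumes g: "g \<in> borel_measurable borel" and ae: "AE y in lborel. y \<in> I1 \<longrightarrow> v (x, y) = g y"
    and fin: "(\<integral>\<^sup>+y. ennreal (g y) \<partial>mu) < \<infinity>" and y: "y \<in> I1"
  shows "0 \<le> w_rearrangement \<alpha> \<alpha>1 w v (x, y)"
    and "0 < c \<Longrightarrow> c < w_rearrangement \<alpha> \<alpha>1 w v (x, y) \<longleftrightarrow> W y < measure mu {t. c < g t}"
proof -
  note g[measurable]
  define m where "m c = measure mu {t. c < g t}" for c
  define J where "J = enn2real (\<integral>\<^sup>+y. ennreal (g y) \<partial>mu)"
  have markov: "emeasure mu {t. c < g t} < \<infinity>" "c * m c \<le> J" if c: "0 < c" for c
  proof -
    have S: "{t. c < g t} \<in> sets mu" by simp
    have "ennreal c * emeasure mu {t. c < g t} = (\<integral>\<^sup>+t. ennreal c * indicator {t. c < g t} t \<partial>mu)"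
      by (rule nn_integral_cmult_indicator[OF S, symmetric])
    also have "\<dots> \<le> (\<integral>\<^sup>+t. ennreal (g t) \<partial>mu)" by (intro nn_integral_mono) (auto simp: indicator_def intro: ennreal_leI)
    also have J: "\<dots> = ennreal J" using fin by (simp add: J_def)
    finally have le: "ennreal c * emeasure mu {t. c < g t} \<le> ennreal J" .
    then show f: "emeasure mu {t. c < g t} < \<infinity>"
      using c by (auto simp: less_top[symmetric] ennreal_mult_top top_unique)
    have "ennreal (c * m c) \<le> ennreal J"
      using le f c by (simp add: m_def emeasure_eq_ennreal_measure ennreal_mult less_top[symmetric])
    then show "c * m c \<le> J" by (subst (asm) ennreal_le_iff) (auto simp: J_def)
  qed
  have lev: "{s \<in> einterval 0 \<alpha>. c < v (x, weight_primitive_inv \<alpha>1 w s)} \<in> lmeasurable"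
    "measure lebesgue {s \<in> einterval 0 \<alpha>. c < v (x, weight_primitive_inv \<alpha>1 w s)} = m c" if "0 < c" for c
    using superlevel_measure[where h="\<lambda>t. v (x, t)", OF g ae markov(1)[OF that]] by (simp_all add: m_def)
  define L where "L = {c. 0 < c \<and> W y < m c}"
  have T: "w_rearrangement \<alpha> \<alpha>1 w v (x, y) = (if L \<noteq> {} then Sup L else 0)"
  proof -
    have E: "{c. c > 0 \<and> W y \<in> set_rearrangement {s \<in> einterval 0 \<alpha>. c < v (x, weight_primitive_inv \<alpha>1 w s)}} = L"
      using W_pos[OF y] lev(2) by (auto simp: L_def set_rearrangement_def)
    show ?thesis
      unfolding w_rearrangement_def rearrangement_def Let_def case_prod_conv E using lev(1) by simp
  qed
  have bdd: "bdd_above L"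
  proof (rule bdd_aboveI)
    fix c assume c: "c \<in> L"
    then have "c * W y \<le> c * m c" by (intro mult_left_mono) (auto simp: L_def)
    also have "\<dots> \<le> J" using c markov(2) by (simp add: L_def)
    finally show "c \<le> J / W y" using W_pos[OF y] by (simp add: field_simps)
  qed
  show "0 \<le> w_rearrangement \<alpha> \<alpha>1 w v (x, y)"
  proof (cases "L = {}")
    case False
    then obtain c where c: "c \<in> L" by blast
    then have "0 \<le> c" by (simp add: L_def)
    also have "c \<le> Sup L" by (rule cSup_upper[OF c bdd])
    finally show ?thesis using T False by simp
  qed (simp add: T)
  assume c: "0 < c"
  show "c < w_rearrangement \<alpha> \<alpha>1 w v (x, y) \<longleftrightarrow> W y < measure mu {t. c < g t}"
  proof
    assume l: "c < w_rearrangement \<alpha> \<alpha>1 w v (x, y)"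
    then have ne: "L \<noteq> {}" using T c by (auto split: if_splits)
    then obtain c' where c': "c' \<in> L" "c < c'" using l less_cSup_iff[OF ne bdd, of c] unfolding T by auto
    have "measure mu {t. c' < g t} \<le> measure mu {t. c < g t}"
      by (rule measure_mono_fmeasurable) (use c' markov(1)[OF c] in \<open>auto simp: fmeasurable_def\<close>)
    then show "W y < measure mu {t. c < g t}" using c' by (simp add: L_def m_def)
  next
    assume "W y < measure mu {t. c < g t}"
    then obtain c' where c': "c < c'" "W y < measure mu {t. c' < g t}"
      by (rule level_measure_right_continuous[OF g markov(1)[OF c]]) (rule that)
    then have L: "c' \<in> L" using c by (simp add: L_def m_def)
    then have "c' \<le> Sup L" by (rule cSup_upper[OF _ bdd])
    then show "c < w_rearrangement \<alpha> \<alpha>1 w v (x, y)" using T L c' by auto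
  qed
qed

end

lemma AE_lborel_fst:
  fixes P :: "'a::euclidean_space \<Rightarrow> bool"
  assumes "AE x in lborel. P x"
  shows "AE p in (lborel :: ('a \<times> 'b::euclidean_space) measure). P (fst p)"
proof -
  from AE_E[OF assms] obtain N where N: "{x \<in> space lborel. \<not> P x} \<subseteq> N" "emeasure lborel N = 0" "N \<in> sets lborel" .
  then have "N \<in> null_sets lborel" by auto
  then have "AE x in lborel. x \<notin> N" by (rule AE_not_in)
  then have "AE x in lborel. AE y in (lborel :: 'b measure). fst (x, y) \<notin> N"
    by eventually_elim simp
  then have "AE p in (lborel \<Otimes>\<^sub>M (lborel :: 'b measure)). fst p \<notin> N"
  proof (rule lborel_pair.AE_pair_measure[rotated])
    note N(3)[measurable]
    show "{p \<in> space (lborel \<Otimes>\<^sub>M (lborel :: 'b measure)). fst p \<notin> N} \<in> sets (lborel \<Otimes>\<^sub>M lborel)" by measurable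
  qed
  then have "AE p in (lborel :: ('a \<times> 'b) measure). fst p \<notin> N"
    by (rule subst[OF lborel_prod, where P="\<lambda>M. AE p in M. fst p \<notin> N"])
  then show ?thesis by eventually_elim (use N(1) in auto)
qed

context weight begin

lemma measurable_W_less:
  assumes [measurable]: "g \<in> M \<rightarrow>\<^sub>M (borel :: real measure)" "h \<in> M \<rightarrow>\<^sub>M (borel :: real measure)"
  shows "Measurable.pred M (\<lambda>x. g x \<in> I1 \<and> W (g x) < h x)"
proof -
  define Wb where "Wb = (\<lambda>t. if t \<in> I1 then W t else 0)"
  have "continuous_on I1 W" by (intro continuous_at_imp_continuous_on ballI DERIV_isCont[OF DERIV_W])
  then have [measurable]: "Wb \<in> borel_measurable borel"
    unfolding Wb_def by (intro borel_measurable_continuous_on_if) (auto intro: continuous_on_const)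
  have "(\<lambda>x. g x \<in> I1 \<and> W (g x) < h x) = (\<lambda>x. g x \<in> I1 \<and> Wb (g x) < h x)" by (auto simp: Wb_def)
  moreover have [measurable]: "I1 \<in> sets borel" by simp
  have "Measurable.pred M (\<lambda>x. g x \<in> I1 \<and> Wb (g x) < h x)" by measurable
  ultimately show ?thesis by simp
qed

text \<open>
  The set \<open>{W < s}\<close> is an initial interval of measure \<open>s\<close>, or all of \<open>I1\<close> if \<open>s \<ge> \<alpha>\<close>.
\<close>

lemma emeasure_W_less:
  assumes s: "0 \<le> s"
  shows "(\<integral>\<^sup>+t. (if t \<in> I1 \<and> W t < s then ennreal (wbar t) else 0) \<partial>lborel) \<le> ennreal s"
proof (cases "ereal s < \<alpha>")
  case True
  show ?thesis
  proof (cases "s = 0")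
    case True
    have "(if t \<in> I1 \<and> W t < s then ennreal (wbar t) else 0) = 0" for t using W_pos[of t] True by auto
    then show ?thesis by (simp only: nn_integral_const mult_zero_left) simp
  next
    case False
    then obtain y where y: "y \<in> I1" "W y = s" using W_surj[of s] s True by auto
    have "(\<integral>\<^sup>+t. (if t \<in> I1 \<and> W t < s then ennreal (wbar t) else 0) \<partial>lborel) \<le> (\<integral>\<^sup>+t. ennreal (wbar t) * indicator {..<y} t \<partial>lborel)"
      by (intro nn_integral_mono) (use W_less_iff y in \<open>auto simp: indicator_def\<close>)
    also have "\<dots> = emeasure mu {..<y}" by (rule emeasure_mu[symmetric]) simp
    also have "\<dots> = ennreal s" using emeasure_mu_lessThan[OF y(1)] y(2) by simp
    finally show ?thesis .
  qed
next
  case False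
  then obtain A where A: "\<alpha> = ereal A" "A \<le> s" using alpha_pos by (cases \<alpha>) auto
  obtain a where a: "a \<in> I1" by (rule I1_nonempty) (rule that)
  have aA: "W a \<le> A" using W_less_alpha[OF a] A(1) by simp
  have "(\<integral>\<^sup>+t. (if t \<in> I1 \<and> W t < s then ennreal (wbar t) else 0) \<partial>lborel) \<le> (\<integral>\<^sup>+t. ennreal (wbar t) * indicator {..<a} t + ennreal (wbar t) * indicator {a..} t \<partial>lborel)"
    by (intro nn_integral_mono) (auto simp: indicator_def)
  also have "\<dots> = emeasure mu {..<a} + emeasure mu {a..}"
    by (subst nn_integral_add) (simp_all add: emeasure_mu)
  also have "\<dots> = ennreal (W a) + ennreal (A - W a)" using emeasure_mu_lessThan[OF a] emeasure_mu_atLeast[OF a A(1)] by simp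
  also have "\<dots> = ennreal A" using aA W_pos[OF a] by (simp add: ennreal_plus[symmetric] del: ennreal_plus)
  also have "\<dots> \<le> ennreal s" using A(2) by (rule ennreal_leI)
  finally show ?thesis .
qed

text \<open>
  The length of the set of levels \<open>c\<close> with \<open>W y < m(x, c)\<close>. For \<open>m = lev v\<close> this is \<open>T v\<close> almost everywhere
  (\<open>layer_lev\<close>), in a form to which Fubini's theorem applies.
\<close>

definition layer :: "('a \<times> real \<Rightarrow> real) \<Rightarrow> 'a \<times> real \<Rightarrow> ennreal" where
  "layer m p = (\<integral>\<^sup>+c. (if snd p \<in> I1 \<and> W (snd p) < m (fst p, c) then 1 else 0) \<partial>lborel)"

lemma measurable_layer:
  fixes m :: "'a::euclidean_space \<times> real \<Rightarrow> real"
  assumes [measurable]: "m \<in> borel_measurable borel"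
  shows "layer m \<in> borel_measurable borel"
proof -
  have [measurable]: "Measurable.pred (borel \<Otimes>\<^sub>M lborel) (\<lambda>z :: ('a \<times> real) \<times> real. snd (fst z) \<in> I1 \<and> W (snd (fst z)) < m (fst (fst z), snd z))"
    by (rule measurable_W_less) measurable
  show ?thesis
    unfolding layer_def by (rule lborel.borel_measurable_nn_integral) (simp only: split_def, measurable)
qed

lemma layer_fubini:
  fixes m :: "'a::euclidean_space \<times> real \<Rightarrow> real" and q :: "'a \<times> real \<Rightarrow> ennreal"
  assumes m[measurable]: "m \<in> borel_measurable borel" and q[measurable]: "q \<in> borel_measurable borel"
  shows "(\<integral>\<^sup>+p. q p * layer m p \<partial>lborel) = (\<integral>\<^sup>+p. (\<integral>\<^sup>+t. (if t \<in> I1 \<and> W t < m p then q (fst p, t) else 0) \<partial>lborel) \<partial>lborel)"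
proof -
  have [measurable]: "layer m \<in> borel_measurable borel" by (rule measurable_layer[OF m])
  have P1[measurable]: "Measurable.pred (borel \<Otimes>\<^sub>M borel) (\<lambda>z :: real \<times> real. fst z \<in> I1 \<and> W (fst z) < m (x, snd z))" for x
    by (rule measurable_W_less) measurable
  have P1'[measurable]: "Measurable.pred borel (\<lambda>c. t \<in> I1 \<and> W t < m (x, c))" for x t by measurable
  have P2[measurable]: "Measurable.pred (borel \<Otimes>\<^sub>M lborel) (\<lambda>z :: ('a \<times> real) \<times> real. snd z \<in> I1 \<and> W (snd z) < m (fst z))"
    by (rule measurable_W_less) measurable
  have R: "(\<lambda>p. \<integral>\<^sup>+t. (if t \<in> I1 \<and> W t < m p then q (fst p, t) else 0) \<partial>lborel) \<in> borel_measurable borel"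
    by (rule lborel.borel_measurable_nn_integral) (simp only: split_def, measurable)
  have "(\<integral>\<^sup>+p. q p * layer m p \<partial>lborel) = (\<integral>\<^sup>+x. \<integral>\<^sup>+t. q (x, t) * layer m (x, t) \<partial>lborel \<partial>lborel)"
    using lborel.nn_integral_fst[of "\<lambda>p. q p * layer m p" lborel] by (simp add: lborel_prod)
  also have "\<dots> = (\<integral>\<^sup>+x. \<integral>\<^sup>+t. \<integral>\<^sup>+c. (if t \<in> I1 \<and> W t < m (x, c) then q (x, t) else 0) \<partial>lborel \<partial>lborel \<partial>lborel)"
  proof (intro nn_integral_cong)
    fix x t
    have "q (x, t) * layer m (x, t) = (\<integral>\<^sup>+c. q (x, t) * (if t \<in> I1 \<and> W t < m (x, c) then 1 else 0) \<partial>lborel)"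
      unfolding layer_def fst_conv snd_conv by (rule nn_integral_cmult[symmetric]) measurable
    also have "\<dots> = (\<integral>\<^sup>+c. (if t \<in> I1 \<and> W t < m (x, c) then q (x, t) else 0) \<partial>lborel)"
      by (intro nn_integral_cong) simp
    finally show "q (x, t) * layer m (x, t) = (\<integral>\<^sup>+c. (if t \<in> I1 \<and> W t < m (x, c) then q (x, t) else 0) \<partial>lborel)" .
  qed
  also have "\<dots> = (\<integral>\<^sup>+x. \<integral>\<^sup>+c. \<integral>\<^sup>+t. (if t \<in> I1 \<and> W t < m (x, c) then q (x, t) else 0) \<partial>lborel \<partial>lborel \<partial>lborel)"
  proof (rule nn_integral_cong)
    fix x
    have "(\<lambda>z. if fst z \<in> I1 \<and> W (fst z) < m (x, snd z) then q (x, fst z) else 0) \<in> borel_measurable (lborel \<Otimes>\<^sub>M lborel)"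
      by measurable
    from lborel_pair.Fubini'[of "\<lambda>t c. if t \<in> I1 \<and> W t < m (x, c) then q (x, t) else 0"] this
    show "(\<integral>\<^sup>+t. \<integral>\<^sup>+c. (if t \<in> I1 \<and> W t < m (x, c) then q (x, t) else 0) \<partial>lborel \<partial>lborel)
      = (\<integral>\<^sup>+c. \<integral>\<^sup>+t. (if t \<in> I1 \<and> W t < m (x, c) then q (x, t) else 0) \<partial>lborel \<partial>lborel)"
      by (simp add: split_def)
  qed
  also have "\<dots> = (\<integral>\<^sup>+p. (\<integral>\<^sup>+t. (if t \<in> I1 \<and> W t < m p then q (fst p, t) else 0) \<partial>lborel) \<partial>lborel)"
    using lborel.nn_integral_fst[of "\<lambda>p. \<integral>\<^sup>+t. (if t \<in> I1 \<and> W t < m p then q (fst p, t) else 0) \<partial>lborel" lborel] R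
    unfolding fst_conv by (simp add: lborel_prod)
  finally show ?thesis .
qed

lemma layer_weight_le:
  fixes m :: "'a::euclidean_space \<times> real \<Rightarrow> real"
  assumes m: "m \<in> borel_measurable borel" "\<And>p. 0 \<le> m p"
  shows "(\<integral>\<^sup>+p. ennreal (wbar (snd p)) * layer m p \<partial>lborel) \<le> (\<integral>\<^sup>+p. ennreal (m p) \<partial>lborel)"
proof -
  have "(\<integral>\<^sup>+p. ennreal (wbar (snd p)) * layer m p \<partial>lborel)
     = (\<integral>\<^sup>+p. (\<integral>\<^sup>+t. (if t \<in> I1 \<and> W t < m p then ennreal (wbar t) else 0) \<partial>lborel) \<partial>(lborel :: ('a \<times> real) measure))"
    using layer_fubini[OF m(1), of "\<lambda>p. ennreal (wbar (snd p))"] unfolding snd_conv by simp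
  also have "\<dots> \<le> (\<integral>\<^sup>+p. ennreal (m p) \<partial>lborel)" by (intro nn_integral_mono emeasure_W_less m(2))
  finally show ?thesis .
qed

lemma layer_integral_nonneg:
  fixes m q :: "'a::euclidean_space \<times> real \<Rightarrow> real"
  assumes m: "integrable lborel m" "m \<in> borel_measurable borel" "\<And>p. 0 \<le> m p"
    and q: "q \<in> borel_measurable borel" "\<And>p. 0 \<le> q p" "\<And>p. q p \<le> k * wbar (snd p)" and k: "0 \<le> k"
  shows "integrable lborel (\<lambda>t. if t \<in> I1 \<and> W t < m p then q (fst p, t) else 0)"
    and "integrable lborel (\<lambda>p. enn2real (layer m p) * q p)"
    and "integrable lborel (\<lambda>p. \<integral>t. (if t \<in> I1 \<and> W t < m p then q (fst p, t) else 0) \<partial>lborel)"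
    and "(\<integral>p. enn2real (layer m p) * q p \<partial>lborel)
       = (\<integral>p. (\<integral>t. (if t \<in> I1 \<and> W t < m p then q (fst p, t) else 0) \<partial>lborel) \<partial>lborel)"
proof -
  note m(2)[measurable] q(1)[measurable]
  have [measurable]: "layer m \<in> borel_measurable borel" by (rule measurable_layer[OF m(2)])
  have P1[measurable]: "Measurable.pred borel (\<lambda>t. t \<in> I1 \<and> W t < m p)" for p
    by (rule measurable_W_less) measurable
  have P2[measurable]: "Measurable.pred (borel \<Otimes>\<^sub>M lborel) (\<lambda>z :: ('a \<times> real) \<times> real. snd z \<in> I1 \<and> W (snd z) < m (fst z))"
    by (rule measurable_W_less) measurable
  let ?h = "\<lambda>p t. if t \<in> I1 \<and> W t < m p then q (fst p, t) else 0"
  let ?J = "\<lambda>p. \<integral>t. ?h p t \<partial>lborel"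
  have sl: "(\<integral>\<^sup>+t. ennreal (?h p t) \<partial>lborel) \<le> ennreal (k * m p)" for p
  proof -
    have "(\<integral>\<^sup>+t. ennreal (?h p t) \<partial>lborel) \<le> (\<integral>\<^sup>+t. ennreal k * (if t \<in> I1 \<and> W t < m p then ennreal (wbar t) else 0) \<partial>lborel)"
    proof (intro nn_integral_mono)
      fix t
      show "ennreal (?h p t) \<le> ennreal k * (if t \<in> I1 \<and> W t < m p then ennreal (wbar t) else 0)"
        using q(3)[of "(fst p, t)"] k wbar_nonneg[of t] by (auto simp: ennreal_mult[symmetric] intro: ennreal_leI)
    qed
    also have "\<dots> = ennreal k * (\<integral>\<^sup>+t. (if t \<in> I1 \<and> W t < m p then ennreal (wbar t) else 0) \<partial>lborel)"
      by (rule nn_integral_cmult) measurable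
    also have "\<dots> \<le> ennreal k * ennreal (m p)" by (intro mult_left_mono emeasure_W_less m(3)) simp
    finally show ?thesis using k m(3) by (simp add: ennreal_mult)
  qed
  show s: "integrable lborel (?h p)" for p
  proof (rule integrableI_nonneg)
    show "?h p \<in> borel_measurable lborel" by measurable
    show "(\<integral>\<^sup>+t. ennreal (?h p t) \<partial>lborel) < \<infinity>" by (rule le_less_trans[OF sl]) simp
  qed (use q(2) in auto)
  have Jm: "?J \<in> borel_measurable borel"
    by (rule lborel.borel_measurable_lebesgue_integral) (simp only: split_def, measurable)
  have J0: "0 \<le> ?J p" for p by (rule Bochner_Integration.integral_nonneg) (use q(2) in auto)
  have EJ: "ennreal (?J p) = (\<integral>\<^sup>+t. (if t \<in> I1 \<and> W t < m p then ennreal (q (fst p, t)) else 0) \<partial>lborel)" for p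
  proof -
    have "ennreal (?J p) = (\<integral>\<^sup>+t. ennreal (?h p t) \<partial>lborel)"
      by (rule nn_integral_eq_integral[symmetric, OF s]) (use q(2) in auto)
    also have "\<dots> = (\<integral>\<^sup>+t. (if t \<in> I1 \<and> W t < m p then ennreal (q (fst p, t)) else 0) \<partial>lborel)"
      by (intro nn_integral_cong) simp
    finally show ?thesis .
  qed
  have intm: "(\<integral>\<^sup>+p. ennreal (m p) \<partial>lborel) < \<infinity>" using m by (simp add: integrable_iff_bounded)
  have JI: "(\<integral>\<^sup>+p. ennreal (?J p) \<partial>lborel) < \<infinity>"
  proof -
    have "(\<integral>\<^sup>+p. ennreal (?J p) \<partial>lborel) \<le> (\<integral>\<^sup>+p. ennreal k * ennreal (m p) \<partial>lborel)"
    proof (intro nn_integral_mono)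
      fix p
      have "ennreal (?J p) = (\<integral>\<^sup>+t. ennreal (?h p t) \<partial>lborel)"
        by (rule nn_integral_eq_integral[symmetric, OF s]) (use q(2) in auto)
      also note sl
      finally show "ennreal (?J p) \<le> ennreal k * ennreal (m p)" using k m(3) by (simp add: ennreal_mult)
    qed
    also have "\<dots> = ennreal k * (\<integral>\<^sup>+p. ennreal (m p) \<partial>lborel)" by (rule nn_integral_cmult) measurable
    also have "\<dots> < \<infinity>" using intm by (simp add: ennreal_mult_less_top)
    finally show ?thesis .
  qed
  show "integrable lborel ?J" by (rule integrableI_nonneg) (use Jm J0 JI in auto)
  have fin: "AE p in lborel. ennreal (wbar (snd p)) * layer m p \<noteq> \<infinity>"
  proof (rule nn_integral_PInf_AE)
    show "(\<lambda>p. ennreal (wbar (snd p)) * layer m p) \<in> borel_measurable lborel" by measurable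
    show "(\<integral>\<^sup>+p. ennreal (wbar (snd p)) * layer m p \<partial>lborel) \<noteq> \<infinity>"
      using le_less_trans[OF layer_weight_le[OF m(2,3)] intm] by simp
  qed
  have E: "(\<integral>\<^sup>+p. ennreal (enn2real (layer m p) * q p) \<partial>lborel) = (\<integral>\<^sup>+p. ennreal (?J p) \<partial>lborel)"
  proof -
    have "(\<integral>\<^sup>+p. ennreal (enn2real (layer m p) * q p) \<partial>lborel) = (\<integral>\<^sup>+p. ennreal (q p) * layer m p \<partial>lborel)"
    proof (rule nn_integral_cong_AE)
      show "AE p in lborel. ennreal (enn2real (layer m p) * q p) = ennreal (q p) * layer m p"
        using fin
      proof eventually_elim
        case (elim p)
        show ?case
        proof (cases "q p = 0")
          case False
          then have "wbar (snd p) \<noteq> 0" using q(2)[of p] q(3)[of p] by auto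
          then have "layer m p \<noteq> \<infinity>" using elim wbar_nonneg[of "snd p"] by (auto simp: ennreal_mult_top)
          then show ?thesis using q(2)[of p] by (simp add: ennreal_mult mult.commute less_top)
        qed simp
      qed
    qed
    also have "\<dots> = (\<integral>\<^sup>+p. ennreal (?J p) \<partial>lborel)"
      unfolding EJ by (rule layer_fubini) (use m(2) q(1) in \<open>auto\<close>)
    finally show ?thesis .
  qed
  show "integrable lborel (\<lambda>p. enn2real (layer m p) * q p)"
  proof (rule integrableI_nonneg)
    show "(\<lambda>p. enn2real (layer m p) * q p) \<in> borel_measurable lborel" by measurable
    show "(\<integral>\<^sup>+p. ennreal (enn2real (layer m p) * q p) \<partial>lborel) < \<infinity>" unfolding E by (rule JI)
  qed (use q(2) in auto)
  have "(\<integral>p. enn2real (layer m p) * q p \<partial>lborel) = enn2real (\<integral>\<^sup>+p. ennreal (enn2real (layer m p) * q p) \<partial>lborel)"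
    by (rule integral_eq_nn_integral) (use q(2) in auto)
  also have "\<dots> = (\<integral>p. ?J p \<partial>lborel)"
    unfolding E by (rule integral_eq_nn_integral[symmetric]) (use Jm J0 in auto)
  finally show "(\<integral>p. enn2real (layer m p) * q p \<partial>lborel) = (\<integral>p. ?J p \<partial>lborel)" .
qed

text \<open>
  Fubini's theorem for integrands of both signs. The bound by \<open>k * wbar\<close> makes every part integrable.
\<close>

lemma layer_integral:
  fixes m q :: "'a::euclidean_space \<times> real \<Rightarrow> real"
  assumes m: "integrable lborel m" "m \<in> borel_measurable borel" "\<And>p. 0 \<le> m p"
    and q: "q \<in> borel_measurable borel" "\<And>p. \<bar>q p\<bar> \<le> k * wbar (snd p)" and k: "0 \<le> k"
  shows "(\<integral>p. enn2real (layer m p) * q p \<partial>lborel)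
       = (\<integral>p. (\<integral>t. (if t \<in> I1 \<and> W t < m p then q (fst p, t) else 0) \<partial>lborel) \<partial>lborel)"
proof -
  let ?u = "\<lambda>p. max 0 (q p)" and ?d = "\<lambda>p. max 0 (- q p)"
  have u: "?u \<in> borel_measurable borel" "0 \<le> ?u p" "?u p \<le> k * wbar (snd p)" for p
    using q(1) q(2)[of p] by auto
  have d: "?d \<in> borel_measurable borel" "0 \<le> ?d p" "?d p \<le> k * wbar (snd p)" for p
    using q(1) q(2)[of p] by auto
  note U = layer_integral_nonneg[OF m u k] and D = layer_integral_nonneg[OF m d k]
  have "(\<integral>p. enn2real (layer m p) * q p \<partial>lborel) = (\<integral>p. enn2real (layer m p) * ?u p - enn2real (layer m p) * ?d p \<partial>lborel)"
    by (intro Bochner_Integration.integral_cong refl) (simp add: max_def)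
  also have "\<dots> = (\<integral>p. (\<integral>t. (if t \<in> I1 \<and> W t < m p then ?u (fst p, t) else 0) \<partial>lborel) - (\<integral>t. (if t \<in> I1 \<and> W t < m p then ?d (fst p, t) else 0) \<partial>lborel) \<partial>lborel)"
    using U(2,3,4) D(2,3,4) by (simp only: Bochner_Integration.integral_diff)
  also have "\<dots> = (\<integral>p. (\<integral>t. (if t \<in> I1 \<and> W t < m p then q (fst p, t) else 0) \<partial>lborel) \<partial>lborel)"
  proof (intro Bochner_Integration.integral_cong refl)
    fix p
    have "(\<integral>t. (if t \<in> I1 \<and> W t < m p then ?u (fst p, t) else 0) \<partial>lborel) - (\<integral>t. (if t \<in> I1 \<and> W t < m p then ?d (fst p, t) else 0) \<partial>lborel)
      = (\<integral>t. (if t \<in> I1 \<and> W t < m p then ?u (fst p, t) else 0) - (if t \<in> I1 \<and> W t < m p then ?d (fst p, t) else 0) \<partial>lborel)"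
      by (rule Bochner_Integration.integral_diff[symmetric, OF U(1) D(1)])
    also have "\<dots> = (\<integral>t. (if t \<in> I1 \<and> W t < m p then q (fst p, t) else 0) \<partial>lborel)"
      by (intro Bochner_Integration.integral_cong refl) (simp add: max_def)
    finally show "(\<integral>t. (if t \<in> I1 \<and> W t < m p then ?u (fst p, t) else 0) \<partial>lborel) - (\<integral>t. (if t \<in> I1 \<and> W t < m p then ?d (fst p, t) else 0) \<partial>lborel)
      = (\<integral>t. (if t \<in> I1 \<and> W t < m p then q (fst p, t) else 0) \<partial>lborel)" .
  qed
  finally show ?thesis .
qed

lemma borel_representative:
  fixes v :: "'a::euclidean_space \<times> real \<Rightarrow> real"
  assumes Om: "open \<Omega>'" and v: "v \<in> L1_w (\<Omega>' \<times> I1) w" and nn: "\<And>p. p \<in> \<Omega>' \<times> I1 \<Longrightarrow> 0 \<le> v p"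
  obtains v0 where "v0 \<in> borel_measurable borel" "\<And>p. 0 \<le> v0 p" "\<And>p. p \<notin> \<Omega>' \<times> I1 \<Longrightarrow> v0 p = 0"
    "AE p in lborel. p \<in> \<Omega>' \<times> I1 \<longrightarrow> v p = v0 p" "integrable lborel (\<lambda>p. v0 p * wbar (snd p))"
proof -
  let ?S = "\<Omega>' \<times> I1"
  have S: "?S \<in> sets borel" using open_Times[OF Om open_I1] by (rule borel_open)
  then have S': "?S \<inter> space lebesgue \<in> sets lebesgue" by simp
  have vm: "v \<in> borel_measurable (lebesgue_on ?S)" and vn: "L1_norm_w ?S w v < \<infinity>" using v by (auto simp: L1_w_def)
  have "(\<lambda>p. indicator ?S p *\<^sub>R v p) \<in> borel_measurable lebesgue"
    using vm borel_measurable_restrict_space_iff[OF S', of v] by blast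
  then obtain g where g: "g \<in> borel_measurable lborel" "AE p in lborel. indicator ?S p *\<^sub>R v p = g p"
    using completion_ex_borel_measurable_real by blast
  define v0 where "v0 p = (if p \<in> ?S then max 0 (g p) else 0)" for p
  have [measurable]: "?S \<in> sets borel" "g \<in> borel_measurable borel" using S g(1) by auto
  have v0m[measurable]: "v0 \<in> borel_measurable borel" unfolding v0_def by measurable
  have v00: "0 \<le> v0 p" for p by (simp add: v0_def)
  have ae: "AE p in lborel. p \<in> ?S \<longrightarrow> v p = v0 p"
    using g(2)
  proof eventually_elim
    case (elim p)
    then show ?case using nn[of p] by (auto simp: v0_def)
  qed
  have "(\<integral>\<^sup>+p. ennreal (v0 p * wbar (snd p)) \<partial>lborel) = (\<integral>\<^sup>+p. ennreal (\<bar>v p\<bar> * w (snd p)) * indicator ?S p \<partial>lborel)"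
  proof (rule nn_integral_cong_AE)
    show "AE p in lborel. ennreal (v0 p * wbar (snd p)) = ennreal (\<bar>v p\<bar> * w (snd p)) * indicator ?S p"
      using ae by eventually_elim (use v00 in \<open>auto simp: v0_def wbar_def indicator_def\<close>)
  qed
  also have "\<dots> = (\<integral>\<^sup>+p. ennreal (\<bar>v p\<bar> * w (snd p)) \<partial>lebesgue_on ?S)"
    by (simp add: nn_integral_restrict_space[OF S'] nn_integral_completion)
  also have "\<dots> < \<infinity>" using vn by (simp add: L1_norm_w_def less_top)
  finally have fin: "(\<integral>\<^sup>+p. ennreal (v0 p * wbar (snd p)) \<partial>lborel) < \<infinity>" .
  show ?thesis
  proof (rule that[OF v0m v00 _ ae])
    show "integrable lborel (\<lambda>p. v0 p * wbar (snd p))"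
      by (rule integrableI_nonneg) (use fin v00 wbar_nonneg in auto)
  qed (simp add: v0_def)
qed

text \<open>
  For almost every \<open>x\<close> the slice of \<open>v\<close> agrees almost everywhere with the slice of its Borel representative \<open>v0\<close> and has a
  finite weighted integral; for all these \<open>x\<close> the slice falls under the main case of the definition of the rearrangement.
\<close>

lemma layer_lev:
  fixes v v0 :: "'a::euclidean_space \<times> real \<Rightarrow> real"
  assumes v0: "v0 \<in> borel_measurable borel" "\<And>p. 0 \<le> v0 p" "\<And>p. p \<notin> \<Omega>' \<times> I1 \<Longrightarrow> v0 p = 0"
    "AE p in lborel. p \<in> \<Omega>' \<times> I1 \<longrightarrow> v p = v0 p" "integrable lborel (\<lambda>p. v0 p * wbar (snd p))"
  shows "AE p in lborel. layer (lev v0) p = ennreal (if p \<in> \<Omega>' \<times> I1 then w_rearrangement \<alpha> \<alpha>1 w v p else 0)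
     \<and> (p \<in> \<Omega>' \<times> I1 \<longrightarrow> 0 \<le> w_rearrangement \<alpha> \<alpha>1 w v p)"
proof -
  note v0(1)[measurable]
  have slm: "(\<lambda>y. v0 (x, y)) \<in> borel_measurable borel" for x by measurable
  have "AE p in lborel \<Otimes>\<^sub>M lborel. p \<in> \<Omega>' \<times> I1 \<longrightarrow> v p = v0 p"
    by (rule ssubst[OF lborel_prod, where P="\<lambda>M. AE p in M. p \<in> \<Omega>' \<times> I1 \<longrightarrow> v p = v0 p"]) (rule v0(4))
  then have a1: "AE x in lborel. AE y in lborel. (x, y) \<in> \<Omega>' \<times> I1 \<longrightarrow> v (x, y) = v0 (x, y)"
    by (rule lborel_pair.AE_pair)
  have a2: "AE x in lborel. (\<integral>\<^sup>+y. ennreal (v0 (x, y)) \<partial>mu) \<noteq> \<infinity>"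
  proof (rule nn_integral_PInf_AE)
    have eq: "(\<integral>\<^sup>+y. ennreal (v0 (x, y)) \<partial>mu) = (\<integral>\<^sup>+y. ennreal (v0 (x, y) * wbar y) \<partial>lborel)" for x
      unfolding mu_def using v0(2) wbar_nonneg by (subst nn_integral_density) (auto simp: ennreal_mult mult.commute)
    show "(\<lambda>x. \<integral>\<^sup>+y. ennreal (v0 (x, y)) \<partial>mu) \<in> borel_measurable lborel"
      unfolding eq by measurable
    have "(\<integral>\<^sup>+x. \<integral>\<^sup>+y. ennreal (v0 (x, y)) \<partial>mu \<partial>lborel) = (\<integral>\<^sup>+p. ennreal (v0 p * wbar (snd p)) \<partial>lborel)"
      unfolding eq using lborel.nn_integral_fst[of "\<lambda>p. ennreal (v0 p * wbar (snd p))" lborel] by (simp add: lborel_prod)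
    also have "\<dots> < \<infinity>" using v0(2,5) wbar_nonneg by (simp add: integrable_iff_bounded)
    finally show "(\<integral>\<^sup>+x. \<integral>\<^sup>+y. ennreal (v0 (x, y)) \<partial>mu \<partial>lborel) \<noteq> \<infinity>" by simp
  qed
  from a1 a2 have "AE x in lborel. (AE y in lborel. (x, y) \<in> \<Omega>' \<times> I1 \<longrightarrow> v (x, y) = v0 (x, y)) \<and> (\<integral>\<^sup>+y. ennreal (v0 (x, y)) \<partial>mu) \<noteq> \<infinity>"
    by eventually_elim blast
  then have "AE p in (lborel :: ('a \<times> real) measure). (AE y in lborel. (fst p, y) \<in> \<Omega>' \<times> I1 \<longrightarrow> v (fst p, y) = v0 (fst p, y)) \<and> (\<integral>\<^sup>+y. ennreal (v0 (fst p, y)) \<partial>mu) \<noteq> \<infinity>"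
    by (rule AE_lborel_fst)
  then show ?thesis
  proof eventually_elim
    case (elim p)
    obtain x y where p: "p = (x, y)" by (cases p)
    show ?case
    proof (cases "p \<in> \<Omega>' \<times> I1")
      case True
      then have xy: "x \<in> \<Omega>'" "y \<in> I1" using p by auto
      have ae: "AE t in lborel. t \<in> I1 \<longrightarrow> v (x, t) = v0 (x, t)"
        using elim p xy(1) by simp
      have fin: "(\<integral>\<^sup>+y. ennreal (v0 (x, y)) \<partial>mu) < \<infinity>" using elim p by (simp add: less_top)
      note R = rearranged_slice[OF slm ae fin xy(2)]
      have "layer (lev v0) p = (\<integral>\<^sup>+c. indicator {0<..<w_rearrangement \<alpha> \<alpha>1 w v p} c \<partial>lborel)"
        unfolding layer_def
      proof (intro nn_integral_cong)
        fix c
        show "(if snd p \<in> I1 \<and> W (snd p) < lev v0 (fst p, c) then 1 else 0) = (indicator {0<..<w_rearrangement \<alpha> \<alpha>1 w v p} c :: ennreal)"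
        proof (cases "0 < c")
          case True
          then show ?thesis using R(2)[of c] xy by (simp add: p lev_def indicator_def)
        next
          case False
          then show ?thesis using W_pos[OF xy(2)] by (simp add: p lev_def)
        qed
      qed
      also have "\<dots> = ennreal (w_rearrangement \<alpha> \<alpha>1 w v p)" using R(1) by (simp add: p)
      finally show ?thesis using True R(1) p by simp
    next
      case False
      have "(if snd p \<in> I1 \<and> W (snd p) < lev v0 (fst p, c) then 1 else 0) = (0::ennreal)" for c
      proof (cases "snd p \<in> I1")
        case True
        then have "x \<notin> \<Omega>'" using False p by auto
        then have "lev v0 (x, c) = 0" by (simp add: lev_def v0(3))
        then show ?thesis using W_pos[OF True] by (simp add: p)
      qed simp
      then have "layer (lev v0) p = 0" unfolding layer_def by (simp only: nn_integral_const mult_zero_left)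
      then show ?thesis using False by simp
    qed
  qed
qed

section \<open>Variation of the rearrangement\<close>

text \<open>
  The variation \<open>C\<close> of \<open>v\<close> is the constant in \<open>level_inequality\<close>, which is the hypothesis \<open>L\<close> of
  \<open>rearranged_test_bound\<close>; the values \<open>lev v0\<close> do not depend on the choice of a representative up to null sets.
\<close>

theorem rearrangement_decreases_variation:
  fixes v :: "'a::euclidean_space \<times> real \<Rightarrow> real"
  assumes Om: "open \<Omega>'" and v: "v \<in> BV_w (\<Omega>' \<times> I1) w" and nn: "\<And>p. p \<in> \<Omega>' \<times> I1 \<Longrightarrow> 0 \<le> v p"
  shows "w_rearrangement \<alpha> \<alpha>1 w v \<in> BV_w (\<Omega>' \<times> I1) w"
    and "BV_seminorm_w (\<Omega>' \<times> I1) w (w_rearrangement \<alpha> \<alpha>1 w v) \<le> BV_seminorm_w (\<Omega>' \<times> I1) w v"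
proof -
  let ?S = "\<Omega>' \<times> I1" and ?T = "w_rearrangement \<alpha> \<alpha>1 w v"
  have S: "?S \<in> sets borel" using open_Times[OF Om open_I1] by (rule borel_open)
  then have S': "?S \<inter> space lebesgue \<in> sets lebesgue" by simp
  have vL: "v \<in> L1_w ?S w" and vB: "L1_norm_w ?S w v + BV_seminorm_w ?S w v < \<infinity>" using v by (auto simp: BV_w_def)
  obtain v0 where v0: "v0 \<in> borel_measurable borel" "\<And>p. 0 \<le> v0 p" "\<And>p. p \<notin> ?S \<Longrightarrow> v0 p = 0"
    "AE p in lborel. p \<in> ?S \<longrightarrow> v p = v0 p" "integrable lborel (\<lambda>p. v0 p * wbar (snd p))"
    by (rule borel_representative[OF Om vL nn]) (simp, rule that)
  define m where "m = lev v0"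
  have m: "integrable lborel m" "m \<in> borel_measurable borel" "\<And>p. 0 \<le> m p" "\<And>p. snd p \<le> 0 \<Longrightarrow> m p = 0"
    unfolding m_def using integrable_lev(1)[OF v0(1,2,5)] measurable_lev[OF v0(1)] by (auto simp: lev_def)
  have lay: "AE p in lborel. layer m p = ennreal (if p \<in> ?S then ?T p else 0) \<and> (p \<in> ?S \<longrightarrow> 0 \<le> ?T p)"
    unfolding m_def by (rule layer_lev[OF v0])
  define T0 where "T0 p = indicator ?S p * enn2real (layer m p)" for p
  have laym[measurable]: "layer m \<in> borel_measurable borel" by (rule measurable_layer[OF m(2)])
  have T0m: "T0 \<in> borel_measurable borel" unfolding T0_def using S by (intro borel_measurable_times borel_measurable_indicator) auto
  have T0: "AE p in lborel. p \<in> ?S \<longrightarrow> ?T p = T0 p"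
    using lay by eventually_elim (simp add: T0_def)
  have ext: "T0 p = 0" if "p \<notin> ?S" for p using that by (simp add: T0_def)
  have Tm: "?T \<in> borel_measurable (lebesgue_on ?S)" by (rule lebesgue_on_AE_borel(1)[OF S T0m ext T0])
  have norm: "L1_norm_w ?S w ?T < \<infinity>"
  proof -
    have "(\<integral>\<^sup>+p. ennreal (\<bar>?T p\<bar> * w (snd p)) \<partial>lebesgue_on ?S) = (\<integral>\<^sup>+p. ennreal (\<bar>?T p\<bar> * w (snd p)) * indicator ?S p \<partial>lborel)"
      by (simp add: nn_integral_restrict_space[OF S'] nn_integral_completion)
    also have "\<dots> \<le> (\<integral>\<^sup>+p. ennreal (wbar (snd p)) * layer m p \<partial>lborel)"
    proof (rule nn_integral_mono_AE)
      show "AE p in lborel. ennreal (\<bar>?T p\<bar> * w (snd p)) * indicator ?S p \<le> ennreal (wbar (snd p)) * layer m p"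
        using lay
      proof eventually_elim
        case (elim p)
        show ?case
        proof (cases "p \<in> ?S")
          case True
          then have "snd p \<in> I1" by auto
          then show ?thesis using True elim w_pos[of "snd p"] by (simp add: wbar_def ennreal_mult[symmetric] mult.commute)
        qed simp
      qed
    qed
    also have "\<dots> \<le> (\<integral>\<^sup>+p. ennreal (m p) \<partial>lborel)" by (rule layer_weight_le[OF m(2,3)])
    also have "\<dots> < \<infinity>" using m by (simp add: integrable_iff_bounded)
    finally show ?thesis by (simp add: L1_norm_w_def less_top[symmetric] enn2ereal_eq_top_iff)
  qed
  have zero: "(\<lambda>p. 0) \<in> C1_compact_support ?S" 
    unfolding C1_compact_support_def by (auto intro!: exI[of _ "\<lambda>_. 0"] simp: zero_blinfun.rep_eq)
  have sem0: "0 \<le> BV_seminorm_w ?S w v"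
  proof -
    have "ereal (\<integral>p. v p * divergence (\<lambda>p. 0) p \<partial>lebesgue_on ?S) \<le> BV_seminorm_w ?S w v"
      unfolding BV_seminorm_w_def by (rule SUP_upper) (use zero w_pos in \<open>auto simp: less_imp_le\<close>)
    then show ?thesis by (simp add: divergence_def frechet_derivative_const zero_ereal_def)
  qed
  have "0 \<le> L1_norm_w ?S w v" by (simp add: L1_norm_w_def)
  then have "BV_seminorm_w ?S w v < \<infinity>" using vB sem0 by (cases "BV_seminorm_w ?S w v"; cases "L1_norm_w ?S w v") auto
  then obtain C where C: "BV_seminorm_w ?S w v = ereal C" using sem0 by (cases "BV_seminorm_w ?S w v") auto
  have test: "(\<integral>p. v0 p * divergence \<phi> p \<partial>lborel) \<le> C"
    if \<phi>: "\<phi> \<in> C1_compact_support ?S" "\<And>p. p \<in> ?S \<Longrightarrow> norm (\<phi> p) \<le> w (snd p)" for \<phi>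
  proof -
    have "divergence \<phi> \<in> borel_measurable borel" by (rule borel_measurable_continuous_onI[OF continuous_divergence[OF \<phi>(1)]])
    then have "(\<integral>p. v p * divergence \<phi> p \<partial>lebesgue_on ?S) = (\<integral>p. v0 p * divergence \<phi> p \<partial>lborel)"
      by (intro lebesgue_on_AE_borel(2)[OF S]) (use v0 in auto)
    moreover have "ereal (\<integral>p. v p * divergence \<phi> p \<partial>lebesgue_on ?S) \<le> BV_seminorm_w ?S w v"
      unfolding BV_seminorm_w_def by (rule SUP_upper) (use \<phi> in auto)
    ultimately show ?thesis using C by simp
  qed
  have bound: "(\<integral>p. ?T p * divergence \<phi> p \<partial>lebesgue_on ?S) \<le> C"
    if \<phi>: "\<phi> \<in> C1_compact_support ?S" "\<And>p. p \<in> ?S \<Longrightarrow> norm (\<phi> p) \<le> w (snd p)" for \<phi>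
  proof -
    obtain K r R b \<omega> where K: "compact K" "K \<subseteq> ?S" "\<And>p. p \<notin> K \<Longrightarrow> divergence \<phi> p = 0"
      and r: "\<And>p. p \<in> K \<Longrightarrow> snd p \<in> {r..R}"
      and \<omega>: "0 < (b::real)" "\<And>y. b \<le> \<omega> y" "\<And>y. y \<in> {r..R} \<Longrightarrow> \<omega> y = w y"
      by (rule clamped_chart[OF \<phi>(1)]) (rule that)
    have cd: "continuous_on UNIV (divergence \<phi>)" by (rule continuous_divergence[OF \<phi>(1)])
    have dm: "divergence \<phi> \<in> borel_measurable borel" by (rule borel_measurable_continuous_onI[OF cd])
    obtain B where B: "0 \<le> B" "\<And>p. norm (divergence \<phi> p) \<le> B" using bounded_compact_support[OF cd K(1,3)] by metis
    have dw: "\<bar>divergence \<phi> p\<bar> \<le> (B / b) * wbar (snd p)" for p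
    proof (cases "p \<in> K")
      case True
      then have "snd p \<in> I1" using K(2) by auto
      then have "b \<le> wbar (snd p)" using \<omega>(2)[of "snd p"] \<omega>(3)[OF r[OF True]] by (simp add: wbar_def)
      then have "(B / b) * b \<le> (B / b) * wbar (snd p)" using B(1) \<omega>(1) by (intro mult_left_mono) auto
      then show ?thesis using B(2)[of p] \<omega>(1) by simp
    next
      case False
      then show ?thesis using K(3) B(1) \<omega>(1) wbar_nonneg[of "snd p"] by simp
    qed
    have "(\<integral>p. ?T p * divergence \<phi> p \<partial>lebesgue_on ?S) = (\<integral>p. T0 p * divergence \<phi> p \<partial>lborel)"
      by (intro lebesgue_on_AE_borel(2)[OF S]) (use T0m dm T0 ext in auto)
    also have "\<dots> = (\<integral>p. enn2real (layer m p) * divergence \<phi> p \<partial>lborel)"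
    proof (intro Bochner_Integration.integral_cong refl)
      fix p
      show "T0 p * divergence \<phi> p = enn2real (layer m p) * divergence \<phi> p"
        using K(2) K(3)[of p] by (cases "p \<in> K") (auto simp: T0_def)
    qed
    also have "\<dots> = (\<integral>p. (\<integral>t. (if t \<in> I1 \<and> W t < m p then divergence \<phi> (fst p, t) else 0) \<partial>lborel) \<partial>lborel)"
      by (rule layer_integral[OF m(1,2,3) dm dw]) (use B \<omega>(1) in simp)
    also have "\<dots> \<le> C"
    proof (rule rearranged_test_bound[OF Om m _ \<phi>])
      fix \<Phi> :: "'a \<times> real \<Rightarrow> 'a \<times> real" and \<theta> :: "real \<Rightarrow> real" and \<Theta> :: real
      assume a: "\<Phi> \<in> C1_compact_support (\<Omega>' \<times> {0<..})" "\<And>p. norm (\<Phi> p) \<le> 1" "\<And>p. 0 \<le> snd (\<Phi> p)" "\<theta> 0 = 0"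
        "\<alpha> < \<infinity> \<Longrightarrow> \<theta> (real_of_ereal \<alpha>) = 0" "\<And>s. 0 < s \<Longrightarrow> ereal s < \<alpha> \<Longrightarrow> \<theta> s \<le> f s"
        "uniformly_continuous_on UNIV \<theta>" "\<And>s. \<bar>\<theta> s\<bar> \<le> \<Theta>"
      show "(\<integral>p. m p * hdivergence \<Phi> p \<partial>lborel) + (\<integral>p. snd (\<Phi> p) * \<theta> (m p) \<partial>lborel) \<le> C"
        unfolding m_def by (rule level_inequality[OF Om test v0(1,2,3,5) a])
    qed
    finally show ?thesis .
  qed
  show le: "BV_seminorm_w ?S w ?T \<le> BV_seminorm_w ?S w v"
    unfolding C unfolding BV_seminorm_w_def by (rule SUP_least) (use bound in auto)
  have "L1_norm_w ?S w ?T + BV_seminorm_w ?S w ?T < \<infinity>"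
    using norm le C by (cases "BV_seminorm_w ?S w ?T"; cases "L1_norm_w ?S w ?T") auto
  then show "?T \<in> BV_w ?S w" using Tm norm by (simp add: BV_w_def L1_w_def)
qed

end

theorem theorem4p7:
  fixes \<Omega>' :: "(real ^ 'n) set"
    and \<alpha> \<alpha>1 :: ereal
    and w f :: "real \<Rightarrow> real"
    and v :: "(real ^ 'n) \<times> real \<Rightarrow> real"
  defines "I \<equiv> einterval 0 \<alpha>"
    and "I1 \<equiv> einterval 0 \<alpha>1"
    and "\<Omega>1 \<equiv> \<Omega>' \<times> einterval 0 \<alpha>1"
  assumes "bounded_lipschitz_domain \<Omega>'"
    and "0 < \<alpha>" and "0 < \<alpha>1"
    and "continuous_on (closure I1) w"
    and "\<And>y. y \<in> I1 \<Longrightarrow> w y > 0"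
    and "((ereal \<circ> weight_primitive w \<circ> real_of_ereal) \<longlongrightarrow> \<alpha>) (at_left \<alpha>1)"
    and "continuous_on (closure I) f"
    and "\<And>z. z \<in> weight_primitive w ` closure I1 \<Longrightarrow> f z = w (weight_primitive_inv \<alpha>1 w z)"
    and "\<And>z1 z2. \<lbrakk>z1 \<in> closure I; z2 \<in> closure I; z1 \<le> z2\<rbrakk> \<Longrightarrow> f (z2 - z1) \<le> f z1 + f z2"
    and "\<And>z. \<lbrakk>\<alpha> < \<infinity>; z \<in> closure I\<rbrakk> \<Longrightarrow> f z = f (real_of_ereal \<alpha> - z)"
    and "v \<in> BV_w \<Omega>1 w"
    and "\<And>x. x \<in> \<Omega>1 \<Longrightarrow> v x \<ge> 0"
  shows "w_rearrangement \<alpha> \<alpha>1 w v \<in> BV_w \<Omega>1 w \<and>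
         BV_seminorm_w \<Omega>1 w v \<ge> BV_seminorm_w \<Omega>1 w (w_rearrangement \<alpha> \<alpha>1 w v)"
proof -
  interpret weight \<alpha> \<alpha>1 w f
    by unfold_locales (use assms(5-13) in \<open>simp_all only: I_def I1_def\<close>)
  have "open \<Omega>'" using assms(4) by (simp add: bounded_lipschitz_domain_def)
  from rearrangement_decreases_variation[OF this, of v] show ?thesis
    using assms(14,15) unfolding \<Omega>1_def by blast
qed

end
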